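(* Let $\mathcal{S}$ be a finitely generated semigroup (under composition) of rational functions in $\mathbb{C}(x)$. Then either $\mathcal{S}$ has polynomially bounded growth or $\mathcal{S}$ contains a nonabelian free semigroup.
   Context: For a semigroup $\mathcal{S}$ with finite generating set $S$, let $d_S(n)$ be the number of distinct elements of $\mathcal{S}$ expressible as a product (here: composition) of at most $n$ elements of $S$. $\mathcal{S}$ has polynomially bounded growth if $d_S(n)=O(n^\kappa)$ for some constant $\kappa>0$; this does not depend on the choice of finite generating set. $\mathcal{S}$ contains a nonabelian free semigroup if it contains a subsemigroup that is free on two generators. *)

theory Defs
  imports
    "HOL-Computational_Algebra.Polynomial_Factorial"
    "HOL-Computational_Algebra.Field_as_Ring"
    "HOL-Library.Landau_Symbols"
begin

section \<open>Generated semigroups, growth and freeness\<close>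

text \<open>
  The semigroup operation is an arbitrary binary function \<open>m\<close>; associativity is only ever needed
  on the carrier sets under consideration.
\<close>

inductive_set semigroup_generated :: "('a \<Rightarrow> 'a \<Rightarrow> 'a) \<Rightarrow> 'a set \<Rightarrow> 'a set"
  for m :: "'a \<Rightarrow> 'a \<Rightarrow> 'a" and S :: "'a set" where
  generator: "s \<in> S \<Longrightarrow> s \<in> semigroup_generated m S"
| mult: "a \<in> semigroup_generated m S \<Longrightarrow> b \<in> semigroup_generated m S
           \<Longrightarrow> m a b \<in> semigroup_generated m S"

text \<open>A semigroup need not have an identity, so only nonempty words have a product.\<close>

definition words :: "'a set \<Rightarrow> 'a list set" where
  "words S = {w. w \<noteq> [] \<and> set w \<subseteq> S}"

fun word_prod :: "('a \<Rightarrow> 'a \<Rightarrow> 'a) \<Rightarrow> 'a list \<Rightarrow> 'a" where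
  "word_prod m [] = undefined"
| "word_prod m [a] = a"
| "word_prod m (a # b # w) = m a (word_prod m (b # w))"

definition growth :: "('a \<Rightarrow> 'a \<Rightarrow> 'a) \<Rightarrow> 'a set \<Rightarrow> nat \<Rightarrow> nat" where
  "growth m S n = card (word_prod m ` {w \<in> words S. length w \<le> n})"

definition polynomially_bounded_growth :: "('a \<Rightarrow> 'a \<Rightarrow> 'a) \<Rightarrow> 'a set \<Rightarrow> bool" where
  "polynomially_bounded_growth m S \<longleftrightarrow>
     (\<exists>\<kappa>::real. \<kappa> > 0 \<and> (\<lambda>n. real (growth m S n)) \<in> O(\<lambda>n. real n powr \<kappa>))"

text \<open>\<open>T\<close> is free on \<open>X\<close>: each element of \<open>T\<close> is the product of exactly one nonempty word in \<open>X\<close>.\<close>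

definition free_semigroup_on :: "('a \<Rightarrow> 'a \<Rightarrow> 'a) \<Rightarrow> 'a set \<Rightarrow> 'a set \<Rightarrow> bool" where
  "free_semigroup_on m X T \<longleftrightarrow> bij_betw (word_prod m) (words X) T"

definition contains_nonabelian_free_semigroup :: "('a \<Rightarrow> 'a \<Rightarrow> 'a) \<Rightarrow> 'a set \<Rightarrow> bool" where
  "contains_nonabelian_free_semigroup m G \<longleftrightarrow>
     (\<exists>T \<subseteq> G. (\<forall>a\<in>T. \<forall>b\<in>T. m a b \<in> T) \<and> (\<exists>a b. a \<noteq> b \<and> free_semigroup_on m {a, b} T))"


section \<open>Rational functions under composition\<close>

type_synonym ratfun = "complex poly fract"

text \<open>\<open>poly_at p g\<close> is the polynomial \<open>p\<close> evaluated at the element \<open>g\<close> of the field \<open>\<complex>(x)\<close>.\<close>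

definition poly_at :: "complex poly \<Rightarrow> ratfun \<Rightarrow> ratfun" where
  "poly_at p g = poly (map_poly (\<lambda>c. to_fract [:c:]) p) g"

text \<open>
  For \<open>f = p / q\<close> in lowest terms, \<open>f \<circ> g = p(g) / q(g)\<close>. This is an element of \<open>\<complex>(x)\<close> unless
  \<open>q(g) = 0\<close>, that is, unless \<open>g\<close> is a constant at which \<open>f\<close> has a pole.
\<close>

definition ratfun_composable :: "ratfun \<Rightarrow> ratfun \<Rightarrow> bool" where
  "ratfun_composable f g \<longleftrightarrow> poly_at (snd (quot_of_fract f)) g \<noteq> 0"

definition ratfun_comp :: "ratfun \<Rightarrow> ratfun \<Rightarrow> ratfun" where
  "ratfun_comp f g = poly_at (fst (quot_of_fract f)) g / poly_at (snd (quot_of_fract f)) g"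

text \<open>Associativity is not part of the definition because it is automatic, see
  \<open>ratfun_comp_assoc\<close> below.\<close>

definition ratfun_semigroup :: "ratfun set \<Rightarrow> bool" where
  "ratfun_semigroup G \<longleftrightarrow> (\<forall>f\<in>G. \<forall>g\<in>G. ratfun_composable f g \<and> ratfun_comp f g \<in> G)"

lemma poly_at_simps [simp]:
  "poly_at 0 g = 0" "poly_at 1 g = 1"
  "poly_at (p + q) g = poly_at p g + poly_at q g"
  "poly_at (p * q) g = poly_at p g * poly_at q g"
  "poly_at (pCons c p) g = to_fract [:c:] + g * poly_at p g"
proof -
  define e :: "complex \<Rightarrow> ratfun" where "e = (\<lambda>c. to_fract [:c:])"
  have e: "e 0 = 0" "\<And>a b. e (a + b) = e a + e b" "\<And>a b. e (a * b) = e a * e b"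
    by (simp_all add: e_def flip: to_fract_add to_fract_mult)
  have P: "poly_at p g = poly (map_poly e p) g" for p
    by (simp add: poly_at_def e_def)
  have add: "poly_at (p + q) g = poly_at p g + poly_at q g" for p q
  proof -
    have "map_poly e (p + q) = map_poly e p + map_poly e q"
      by (rule poly_eqI) (simp add: coeff_map_poly e)
    thus ?thesis by (simp add: P)
  qed
  have pCons: "poly_at (pCons c p) g = e c + g * poly_at p g" for c p
    by (simp add: P map_poly_pCons e)
  have z: "poly_at 0 g = 0" by (simp add: P)
  have smult: "poly_at (smult c p) g = e c * poly_at p g" for c p
    by (induction p) (simp_all add: z pCons e algebra_simps)
  have "poly_at (p * q) g = poly_at p g * poly_at q g"
    by (induction p) (simp_all add: z pCons add smult e algebra_simps)
  moreover have "poly_at 1 g = 1"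
    by (simp add: one_pCons pCons z) (simp add: e_def flip: one_pCons)
  ultimately show "poly_at 0 g = 0" "poly_at 1 g = 1"
    "poly_at (p + q) g = poly_at p g + poly_at q g"
    "poly_at (p * q) g = poly_at p g * poly_at q g"
    "poly_at (pCons c p) g = to_fract [:c:] + g * poly_at p g"
    using z add pCons by (simp_all add: e_def)
qed

lemma ratfun_eq_div:
  "f = to_fract (fst (quot_of_fract f)) / to_fract (snd (quot_of_fract f))"
  by (metis Fract_conv_to_fract Fract_quot_of_fract)

lemma ratfun_comp_div:
  assumes b: "poly_at b h \<noteq> 0" and f: "f = to_fract a / to_fract b"
  shows "ratfun_composable f h" "ratfun_comp f h = poly_at a h / poly_at b h"
proof -
  define p q where "p = fst (quot_of_fract f)" and "q = snd (quot_of_fract f)"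
  have q0: "q \<noteq> 0" by (simp add: q_def)
  have b0: "b \<noteq> 0" using b by auto
  have "to_fract p / to_fract q = to_fract a / to_fract b"
    using ratfun_eq_div[of f] f by (simp add: p_def q_def)
  hence "to_fract (p * b) = to_fract (a * q)"
    using q0 b0 by (simp add: field_simps)
  hence eq: "p * b = a * q" by (simp only: to_fract_eq_iff)
  have "coprime p q" unfolding p_def q_def by (rule coprime_quot_of_fract)
  moreover have "q dvd p * b" using eq by simp
  ultimately have "q dvd b" by (simp add: coprime_commute coprime_dvd_mult_right_iff)
  then obtain r where "b = q * r" by (elim dvdE)
  hence qh: "poly_at q h \<noteq> 0" using b by auto
  thus "ratfun_composable f h" by (simp add: ratfun_composable_def q_def)
  have "poly_at p h * poly_at b h = poly_at a h * poly_at q h"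
    using arg_cong[OF eq, of "\<lambda>p. poly_at p h"] by simp
  thus "ratfun_comp f h = poly_at a h / poly_at b h"
    using qh b by (simp add: ratfun_comp_def flip: p_def q_def) (simp add: field_simps)
qed

lemma ratfun_comp_poly_at:
  assumes "ratfun_composable g h"
  shows "ratfun_composable (poly_at p g) h \<and> ratfun_comp (poly_at p g) h = poly_at p (ratfun_comp g h)"
proof (induction p)
  case 0
  show ?case using ratfun_comp_div[of 1 h 0 0] by simp
next
  case (pCons c p)
  define a b where "a = fst (quot_of_fract g)" and "b = snd (quot_of_fract g)"
  define u v where "u = fst (quot_of_fract (poly_at p g))" and "v = snd (quot_of_fract (poly_at p g))"
  have bh: "poly_at b h \<noteq> 0" using assms by (simp add: ratfun_composable_def b_def)
  have vh: "poly_at v h \<noteq> 0" using pCons.IH by (simp add: ratfun_composable_def v_def)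
  have 0: "b \<noteq> 0" "v \<noteq> 0" by (simp_all add: b_def v_def)
  have g: "g = to_fract a / to_fract b" unfolding a_def b_def by (rule ratfun_eq_div)
  have pg: "poly_at p g = to_fract u / to_fract v" unfolding u_def v_def by (rule ratfun_eq_div)
  have "poly_at (pCons c p) g = to_fract [:c:] + (to_fract a / to_fract b) * (to_fract u / to_fract v)"
    using g pg by simp
  also have "\<dots> = to_fract ([:c:] * (b * v) + a * u) / to_fract (b * v)"
    using 0 by (simp only: to_fract_add to_fract_mult) (simp add: field_simps)
  finally have eq: "poly_at (pCons c p) g = to_fract ([:c:] * (b * v) + a * u) / to_fract (b * v)" .
  have bv: "poly_at (b * v) h \<noteq> 0" using bh vh by simp
  have "poly_at ([:c:] * (b * v) + a * u) h / poly_at (b * v) h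
      = to_fract [:c:] + ratfun_comp g h * ratfun_comp (poly_at p g) h"
    using ratfun_comp_div(2)[OF bh g] ratfun_comp_div(2)[OF vh pg] bh vh
    by (simp only: poly_at_simps) (simp add: field_simps)
  thus ?case using ratfun_comp_div[OF bv eq] pCons.IH by simp
qed

lemma ratfun_comp_assoc:
  assumes "ratfun_composable f g" "ratfun_composable g h" "ratfun_composable f (ratfun_comp g h)"
  shows "ratfun_comp (ratfun_comp f g) h = ratfun_comp f (ratfun_comp g h)"
proof -
  define A B where "A = poly_at (fst (quot_of_fract f)) g" and "B = poly_at (snd (quot_of_fract f)) g"
  define a b where "a = fst (quot_of_fract A)" and "b = snd (quot_of_fract A)"
  define c d where "c = fst (quot_of_fract B)" and "d = snd (quot_of_fract B)"
  have A: "ratfun_composable A h" "ratfun_comp A h = poly_at (fst (quot_of_fract f)) (ratfun_comp g h)"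
    and B: "ratfun_composable B h" "ratfun_comp B h = poly_at (snd (quot_of_fract f)) (ratfun_comp g h)"
    using ratfun_comp_poly_at[OF assms(2)] by (simp_all add: A_def B_def)
  have bh: "poly_at b h \<noteq> 0" and dh: "poly_at d h \<noteq> 0"
    using A(1) B(1) by (simp_all add: ratfun_composable_def b_def d_def)
  have "poly_at c h / poly_at d h \<noteq> 0"
    using B(2) assms(3) by (simp add: ratfun_comp_def c_def d_def ratfun_composable_def)
  hence ch: "poly_at c h \<noteq> 0" by auto
  have Ae: "A = to_fract a / to_fract b" unfolding a_def b_def by (rule ratfun_eq_div)
  have Be: "B = to_fract c / to_fract d" unfolding c_def d_def by (rule ratfun_eq_div)
  have "ratfun_comp f g = to_fract (a * d) / to_fract (b * c)"
    using Ae Be by (simp add: ratfun_comp_def flip: A_def B_def)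
  moreover have "poly_at (b * c) h \<noteq> 0" using bh ch by simp
  ultimately have "ratfun_comp (ratfun_comp f g) h = poly_at (a * d) h / poly_at (b * c) h"
    by (intro ratfun_comp_div(2))
  also have "\<dots> = ratfun_comp A h / ratfun_comp B h"
    using ratfun_comp_div(2)[OF bh Ae] ratfun_comp_div(2)[OF dh Be] by simp
  also have "\<dots> = ratfun_comp f (ratfun_comp g h)"
    using A(2) B(2) by (simp add: ratfun_comp_def[of f])
  finally show ?thesis .
qed

end

theory Submission imports Defs "HOL-Complex_Analysis.Complex_Analysis" "HOL-Computational_Algebra.Fundamental_Theorem_Algebra" begin

text \<open>Composition of rational functions is the action of pairs of binary forms on vectors. If the semigroup contains no
free semigroup on two generators and a map of degree at least two occurs, specialise the coefficients to a number field
(with a formal parameter keeping words apart) and take a repelling periodic point \<open>P\<close>: the relations forced by the absence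
of free semigroups bound the orbit of \<open>P\<close> at every place, so by Northcott it is finite, and in linearising
coordinates at its points two different words of equal degree would give the same digit expansion unless words depend only
on polynomially many data. If all degrees are one, ping-pong at a suitable place excludes eigenvalue quotients that are not
roots of unity unless the semigroup is monomial; otherwise all traces are sums of inverse roots of unity and the
semigroup is affine or finite.\<close>

section \<open>Subrings, ring homomorphisms and minimal polynomials\<close>

definition subring :: "'a :: ring_1 set => bool" where
  "subring A \<longleftrightarrow> 1 : A & (ALL a:A. ALL b:A. a - b : A & a*b : A)"

lemma subring_closed:
 assumes "subring A"
 shows "1:A" "0:A" "a:A ==> - a : A"
  "a:A ==> b:A ==> a - b : A" "a:A ==> b:A ==> a + b : A"
  "a:A ==> b:A ==> a*b : A" "a:A ==> a^n : A" "of_nat n : A" "of_int k : A"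
proof -
 show 1: "1:A" using assms by(simp add: subring_def)
 have d: "!!a b. a:A ==> b:A ==> a - b : A" and m: "!!a b. a:A ==> b:A ==> a*b : A"
  using assms by(simp_all add: subring_def)
 show 0: "0:A" using d[OF 1 1] by simp
 have neg: "- a : A" if "a:A" for a using d[OF 0 that] by simp
 have add: "a + b : A" if "a:A" "b:A" for a b using d[OF that(1) neg[OF that(2)]] by simp
 have nat: "of_nat n : A" for n by(induction n) (auto intro: 0 1 add)
 show "a:A ==> - a : A" "a:A ==> b:A ==> a - b : A"
   "a:A ==> b:A ==> a + b : A" "a:A ==> b:A ==> a*b : A"
    by(rule neg d add m; assumption)+
 show "a:A ==> a^n : A" by(induction n) (auto intro: 1 m)
 show "of_nat n : A" by(rule nat)
 show "of_int k : A" by(cases k) (use nat neg in \<open>auto simp del: of_nat_Suc\<close>)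
qed

lemmas subring_one = subring_closed(1) and subring_zero = subring_closed(2)
 and subring_uminus = subring_closed(3) and subring_diff = subring_closed(4)
 and subring_add = subring_closed(5) and subring_mult = subring_closed(6)
 and subring_power = subring_closed(7) and subring_of_nat = subring_closed(8)
 and subring_of_int = subring_closed(9)

lemma subring_sum: "subring A ==> (!!i. i:I ==> f i : A) ==> sum f I : A"
 by(induction I rule: infinite_finite_induct) (auto intro: subring_closed)

lemma subring_UNIV: "subring UNIV" by(simp add: subring_def)

lemma subring_Ints: "subring (\<int> :: 'a::ring_1 set)" by(auto simp: subring_def)

lemma subring_Rats: "subring (\<rat> :: 'a::field_char_0 set)" by(auto simp: subring_def)

definition polys_over :: "'a::comm_ring_1 set => 'a poly set" where
 "polys_over A = {f. ALL i. coeff f i : A}"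

lemma polys_over_coeff: "f:polys_over A ==> coeff f i : A" by(simp add: polys_over_def)

lemma polys_over_mono: "A <= B ==> polys_over A <= polys_over B" by(auto simp: polys_over_def)

lemma polys_over_UNIV: "polys_over UNIV = UNIV" by(auto simp: polys_over_def)

lemma subring_polys_over:
 assumes "subring A"
 shows "subring (polys_over A)"
 unfolding subring_def polys_over_def
 using assms by(auto simp: coeff_mult intro!: subring_closed subring_sum)

lemma polys_over_intros:
 assumes "subring A"
 shows const_in_polys_over: "c:A ==> [:c:] : polys_over A"
  and X_in_polys_over: "[:0,1:] : polys_over A"
  and monom_in_polys_over: "c:A ==> monom c n : polys_over A"
  and smult_in_polys_over: "c:A ==> f:polys_over A ==> smult c f : polys_over A"
  and pCons_in_polys_over: "c:A ==> f:polys_over A ==> pCons c f : polys_over A"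
 using assms by(auto simp: polys_over_def coeff_pCons split: nat.splits intro: subring_closed)

lemma countable_polys_over:
 assumes "countable A" shows "countable (polys_over A)"
proof -
 have "coeffs ` polys_over A <= lists A" by(auto simp: polys_over_def coeffs_def split: if_splits)
 hence "countable (coeffs ` polys_over A)" by(rule countable_subset) (use assms in simp)
 moreover have "inj_on coeffs (polys_over A)" by(intro inj_onI) (simp add: coeffs_eq_iff)
 ultimately show ?thesis by(rule countable_image_inj_on)
qed

lemma poly_in_subring:
 assumes "subring A" "f:polys_over A" "x:A"
 shows "poly f x : A"
 unfolding poly_altdef using assms by(auto simp: polys_over_def intro!: subring_sum subring_closed)

lemma poly_altdef_le:
 fixes f :: "'a :: comm_ring_1 poly"
 shows "degree f <= n ==> poly f x = (\<Sum>i\<le>n. coeff f i*x^i)"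
 unfolding poly_altdef by(rule sum.mono_neutral_left) (auto simp: coeff_eq_0)

lemma reflect_poly_in_polys_over:
 "subring A ==> f:polys_over A ==> reflect_poly f : polys_over A"
 by(auto simp: polys_over_def coeff_reflect_poly intro: subring_zero)

definition adjoin :: "'a::comm_ring_1 set => 'a => 'a set" where
 "adjoin A x = (%f. poly f x) ` polys_over A"

lemma adjoin_subset: "subring B ==> A <= B ==> x:B ==> adjoin A x <= B"
 using poly_in_subring polys_over_mono unfolding adjoin_def by blast

lemma subring_adjoin:
 assumes "subring A"
 shows "subring (adjoin A x)" and subset_adjoin: "A <= adjoin A x"
  and in_adjoin: "x:adjoin A x"
proof -
 note subring_polys = subring_polys_over[OF assms]
 show "subring (adjoin A x)" unfolding subring_def
 proof(intro conjI ballI)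
  show "1:adjoin A x" unfolding adjoin_def using subring_one[OF subring_polys] by(intro image_eqI[of _ _ 1]) auto
  fix a b assume "a:adjoin A x" "b:adjoin A x"
  then obtain f g where fg: "f:polys_over A" "g:polys_over A" "a = poly f x" "b = poly g x" by(auto simp: adjoin_def)
  show "a - b : adjoin A x" unfolding adjoin_def
   using fg subring_diff[OF subring_polys] by(intro image_eqI[of _ _ "f - g"]) auto
  show "a * b : adjoin A x" unfolding adjoin_def
   using fg subring_mult[OF subring_polys] by(intro image_eqI[of _ _ "f * g"]) auto
 qed
 show "A <= adjoin A x"
 proof
  fix a assume "a:A"
  thus "a:adjoin A x" unfolding adjoin_def using polys_over_intros(1)[OF assms] by(intro image_eqI[of _ _ "[:a:]"]) auto
 qed
 show "x:adjoin A x" unfolding adjoin_def using polys_over_intros(2)[OF assms] by(intro image_eqI[of _ _ "[:0,1:]"]) auto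
qed

definition ring_hom_on :: "'a::comm_ring_1 set => ('a => 'b::comm_ring_1) => bool" where
 "ring_hom_on A phi \<longleftrightarrow> phi 1 = 1 &
  (ALL a:A. ALL b:A. phi (a + b) = phi a + phi b & phi (a * b) = phi a * phi b)"

lemma ring_hom_on_id: "ring_hom_on A (%x. x)" by(simp add: ring_hom_on_def)

lemma ring_hom_on_simps:
 assumes hom: "ring_hom_on A phi" and A: "subring A"
 shows "phi 1 = 1" "phi 0 = 0" "a:A ==> b:A ==> phi (a + b) = phi a + phi b"
  "a:A ==> b:A ==> phi (a * b) = phi a * phi b" "a:A ==> phi (- a) = - phi a"
  "a:A ==> b:A ==> phi (a - b) = phi a - phi b" "a:A ==> phi (a^n) = phi a^n"
  "phi (of_nat k) = of_nat k" "phi (of_int j) = of_int j"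
proof -
 note closed = subring_closed[OF A]
 show one: "phi 1 = 1" using hom by(simp add: ring_hom_on_def)
 have add: "phi (a + b) = phi a + phi b" and mult: "phi (a * b) = phi a * phi b"
  if "a:A" "b:A" for a b
  using hom that by(simp_all add: ring_hom_on_def)
 show zero: "phi 0 = 0" using add[of 0 0] closed(2) by simp
 have uminus: "phi (- a) = - phi a" if "a:A" for a
  using add[OF that closed(3)[OF that]] zero by(simp add: eq_neg_iff_add_eq_0 add.commute)
 show of_nat: "phi (of_nat k) = of_nat k" for k by(induction k) (auto simp: zero one add closed)
 show "phi (of_int j) = of_int j" by(cases j) (auto simp: of_nat uminus closed simp del: of_nat_Suc)
 show "a:A ==> b:A ==> phi (a + b) = phi a + phi b"
  "a:A ==> b:A ==> phi (a * b) = phi a * phi b" "a:A ==> phi (- a) = - phi a"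
  by(rule add mult uminus; assumption)+
 show "a:A ==> b:A ==> phi (a - b) = phi a - phi b" using add[OF _ closed(3)] uminus by fastforce
 show "a:A ==> phi (a^n) = phi a^n" by(induction n) (auto simp: one mult closed)
qed

lemmas ring_hom_on_zero = ring_hom_on_simps(2)
 and ring_hom_on_add = ring_hom_on_simps(3) and ring_hom_on_mult = ring_hom_on_simps(4)
 and ring_hom_on_power = ring_hom_on_simps(7) and ring_hom_on_of_nat = ring_hom_on_simps(8)
 and ring_hom_on_of_int = ring_hom_on_simps(9)

lemma ring_hom_on_sum:
 assumes "ring_hom_on A phi" "subring A" "!!i. i:I ==> f i : A"
 shows "phi (sum f I) = (\<Sum>i\<in>I. phi (f i))"
 using assms(3)
proof(induction I rule: infinite_finite_induct)
 case (insert x F)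
 have "phi (f x + sum f F) = phi (f x) + phi (sum f F)"
  using insert.prems by(intro ring_hom_on_add[OF assms(1,2)] subring_sum[OF assms(2)]) auto
 thus ?case using insert by simp
qed(use ring_hom_on_zero[OF assms(1,2)] in auto)

lemma ring_hom_on_map_poly:
 assumes "ring_hom_on A phi" "subring A"
 shows "ring_hom_on (polys_over A) (map_poly phi)"
proof -
 note hom = ring_hom_on_simps[OF assms]
 have mult: "map_poly phi (f * g) = map_poly phi f * map_poly phi g"
  if fg: "f:polys_over A" "g:polys_over A" for f g
 proof(intro poly_eqI)
  fix n
  have "phi (\<Sum>i\<le>n. coeff f i * coeff g (n - i)) = (\<Sum>i\<le>n. phi (coeff f i * coeff g (n - i)))"
   using fg by(intro ring_hom_on_sum[OF assms] subring_mult[OF assms(2)] polys_over_coeff)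
  thus "coeff (map_poly phi (f * g)) n = coeff (map_poly phi f * map_poly phi g) n"
   using fg by(simp add: coeff_map_poly hom coeff_mult polys_over_coeff)
 qed
 have "map_poly phi 1 = 1" by(intro poly_eqI) (simp add: hom)
 moreover have "map_poly phi (f + g) = map_poly phi f + map_poly phi g"
  if "f:polys_over A" "g:polys_over A" for f g
  using that by(intro poly_eqI) (simp add: coeff_map_poly hom polys_over_coeff)
 ultimately show ?thesis using mult by(simp add: ring_hom_on_def)
qed

lemma ring_hom_on_poly:
 assumes "ring_hom_on A phi" "subring A" "f:polys_over A" "a:A"
 shows "phi (poly f a) = poly (map_poly phi f) (phi a)"
proof -
 note hom = ring_hom_on_simps[OF assms(1,2)] and closed = subring_closed[OF assms(2)]
 have "degree (map_poly phi f) <= degree f" by(intro degree_le) (simp add: coeff_map_poly hom coeff_eq_0)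
 hence "poly (map_poly phi f) (phi a) = (\<Sum>i\<le>degree f. phi (coeff f i) * phi a^i)"
  by(subst poly_altdef_le) (auto simp: coeff_map_poly hom)
 also have "... = (\<Sum>i\<le>degree f. phi (coeff f i * a^i))"
  using assms by(intro sum.cong) (auto simp: hom closed polys_over_coeff)
 also have "... = phi (poly f a)" unfolding poly_altdef
  using assms by(intro ring_hom_on_sum[symmetric]) (auto simp: closed polys_over_coeff)
 finally show ?thesis by simp
qed

lemma map_poly_smult_ring_hom_on:
 assumes "ring_hom_on A phi" "subring A" "c:A" "f:polys_over A"
 shows "map_poly phi (smult c f) = smult (phi c) (map_poly phi f)"
 using assms ring_hom_on_simps[OF assms(1,2)]
 by(intro poly_eqI) (simp add: coeff_map_poly polys_over_coeff)

lemma map_poly_pderiv_ring_hom_on: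
 assumes "ring_hom_on A phi" "subring A" "f:polys_over A"
 shows "map_poly phi (pderiv f) = pderiv (map_poly phi f)"
proof(intro poly_eqI)
 fix n
 have "phi (of_nat (Suc n) * coeff f (Suc n)) = of_nat (Suc n) * phi (coeff f (Suc n))"
  using ring_hom_on_simps[OF assms(1,2)] subring_of_nat[OF assms(2)] polys_over_coeff[OF assms(3)]
  by metis
 thus "coeff (map_poly phi (pderiv f)) n = coeff (pderiv (map_poly phi f)) n"
  using ring_hom_on_zero[OF assms(1,2)] by(simp add: coeff_pderiv coeff_map_poly del: of_nat_Suc)
qed

lemma pderiv_in_polys_over: "subring A ==> f:polys_over A ==> pderiv f : polys_over A"
 by(simp add: polys_over_def coeff_pderiv subring_mult subring_of_nat del: of_nat_Suc)

definition min_poly :: "'a::idom set => 'a => 'a poly => bool" where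
 "min_poly A x m \<longleftrightarrow> m : polys_over A & m ~= 0 & poly m x = 0 &
  (ALL f:polys_over A. f ~= 0 --> poly f x = 0 --> degree m <= degree f)"

lemma min_polyD:
 assumes "min_poly A x m"
 shows "m:polys_over A" "m ~= 0" "poly m x = 0"
  "f:polys_over A ==> poly f x = 0 ==> degree f < degree m ==> f = 0"
 using assms by(auto simp: min_poly_def not_le[symmetric])

lemma min_poly_exists:
 assumes "f:polys_over A" "f ~= 0" "poly f x = 0"
 shows "EX m. min_poly A x m"
proof -
 define P where "P f \<longleftrightarrow> f : polys_over A & f ~= 0 & poly f x = 0" for f
 have "P f" using assms by(simp add: P_def)
 then obtain m where "P m" "!!g. P g ==> degree m <= degree g" using ex_has_least_nat[of P f degree] by blast
 thus ?thesis by(auto simp: min_poly_def P_def)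
qed

lemma min_poly_degree: "min_poly A x m ==> degree m > 0"
 by(auto simp: min_poly_def elim!: degree_eq_zeroE intro!: Nat.gr0I)

lemma min_poly_coeff_0:
 assumes m: "min_poly A x m" and "x ~= 0"
 shows "coeff m 0 ~= 0"
proof
 obtain c g where cg: "m = pCons c g" by(cases m)
 assume "coeff m 0 = 0"
 hence "c = 0" by(simp add: cg)
 hence "poly g x = 0" "g ~= 0" "degree g < degree m" using min_polyD[OF m] cg `x ~= 0` by auto
 moreover have "coeff g i : A" for i using polys_over_coeff[OF min_polyD(1)[OF m], of "Suc i"] by(simp add: cg)
 hence "g:polys_over A" by(simp add: polys_over_def)
 ultimately show False using min_polyD(4)[OF m] by blast
qed

lemma degree_pseudo_division_step:
 fixes f m :: "'a::idom poly"
 assumes "f ~= 0" "degree m <= degree f"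
 defines "g \<equiv> smult (lead_coeff m) f - m * monom (lead_coeff f) (degree f - degree m)"
 shows "g = 0 | degree g < degree f"
proof -
 define t where "t = monom (lead_coeff f) (degree f - degree m)"
 have "degree (m * t) <= degree m + (degree f - degree m)"
  unfolding t_def by(intro order_trans[OF degree_mult_le] add_left_mono degree_monom_le)
 hence "degree g <= degree f" unfolding g_def t_def[symmetric] using assms(2) by(intro degree_diff_le) auto
 moreover have "coeff (m * t) (degree f) = lead_coeff m * lead_coeff f"
  using assms coeff_mult_degree_sum[of m t] by(simp add: t_def degree_monom_eq)
 hence "coeff g (degree f) = 0" by(simp add: g_def t_def)
 ultimately show ?thesis by(metis le_neq_implies_less leading_coeff_0_iff)
qed

lemma pseudo_division_over:
 fixes m :: "'a::idom poly"
 assumes A: "subring A" and m: "m:polys_over A" "m ~= 0" and f: "f:polys_over A"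
 obtains k q r where "q:polys_over A" "r:polys_over A"
  "smult (lead_coeff m ^ k) f = m * q + r" "r = 0 | degree r < degree m"
proof -
 define divides where "divides f k q r \<longleftrightarrow> q : polys_over A & r:polys_over A &
  smult (lead_coeff m ^ k) f = m * q + r & (r = 0 | degree r < degree m)" for f k q r
 note closed = subring_closed[OF subring_polys_over[OF A]] polys_over_intros[OF A]
 have "EX k q r. divides f k q r" using f
 proof(induction "degree f" arbitrary: f rule: less_induct)
  case (less f)
  show ?case
  proof(cases "f = 0 | degree f < degree m")
   case True
   hence "divides f 0 0 f" using less.prems closed(2) by(simp add: divides_def)
   thus ?thesis by blast
  next
   case False
   define t where "t = monom (lead_coeff f) (degree f - degree m)"
   define g where "g = smult (lead_coeff m) f - m * t"
   have t: "t:polys_over A" unfolding t_def by(intro closed polys_over_coeff less.prems)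
   hence g: "g:polys_over A" unfolding g_def by(intro closed m polys_over_coeff less.prems)
   have "g = 0 | degree g < degree f" using False degree_pseudo_division_step[of f m] by(simp add: g_def t_def)
   moreover have "divides 0 0 0 0" using closed(2) by(simp add: divides_def)
   ultimately obtain k q r where qr: "divides g k q r" using less.hyps[OF _ g] by blast
   have "smult (lead_coeff m ^ Suc k) f = m * (q + smult (lead_coeff m ^ k) t) + r"
    using qr by(simp add: divides_def g_def algebra_simps smult_diff_right)
   moreover have "q + smult (lead_coeff m ^ k) t : polys_over A"
    using qr t m by(intro closed subring_power[OF A] polys_over_coeff) (auto simp: divides_def)
   ultimately have "divides f (Suc k) (q + smult (lead_coeff m ^ k) t) r" using qr by(simp add: divides_def)
   thus ?thesis by blast
  qed
 qed
 thus thesis using that by(auto simp: divides_def)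
qed

lemma min_poly_dvd:
 assumes A: "subring A" and m: "min_poly A x m" and f: "f:polys_over A" "poly f x = 0"
 obtains k q where "q:polys_over A" "smult (lead_coeff m ^ k) f = m * q"
proof -
 obtain k q r where qr: "q:polys_over A" "r:polys_over A"
  "smult (lead_coeff m ^ k) f = m * q + r" "r = 0 | degree r < degree m"
  using pseudo_division_over[OF A min_polyD(1,2)[OF m] f(1)] .
 have "poly r x = 0" using arg_cong[OF qr(3), of "%p. poly p x"] f min_polyD(3)[OF m] by simp
 hence "r = 0" using qr(2,4) min_polyD(4)[OF m] by blast
 thus thesis using qr that by simp
qed

text \<open>Over an integral domain, values that are nonzero at an algebraic element divide a nonzero
 constant: a substitute for inverting them.\<close>

lemma min_poly_bezout:
 assumes A: "subring A" and m: "min_poly A x m" and f: "f:polys_over A" "poly f x ~= 0"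
 obtains h c where "h:polys_over A" "c:A" "c ~= 0" "poly h x * poly f x = c"
proof -
 note closed = subring_closed[OF subring_polys_over[OF A]] polys_over_intros[OF A]
 define multiple where "multiple g \<longleftrightarrow> g : polys_over A & poly g x ~= 0 &
  (EX h:polys_over A. poly g x = poly h x * poly f x)" for g
 have "multiple f" using f closed(1) by(auto simp: multiple_def intro!: bexI[of _ 1])
 then obtain g where g: "multiple g" and least: "!!g'. multiple g' ==> degree g <= degree g'"
  using ex_has_least_nat[of multiple f degree] by blast
 have g': "g:polys_over A" "g ~= 0" "poly g x ~= 0" using g by(auto simp: multiple_def)
 have multiple_mult: "multiple r"
  if "r:polys_over A" "h:polys_over A" "poly r x = poly h x * poly g x" "poly r x ~= 0" for h r
 proof -
  obtain h' where "h':polys_over A" "poly g x = poly h' x * poly f x"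
   using g by(auto simp: multiple_def)
  thus ?thesis using that closed(6)[of h h'] by(auto simp: multiple_def intro!: bexI[of _ "h * h'"])
 qed
 obtain k q r where qr: "q:polys_over A" "r:polys_over A"
  "smult (lead_coeff m ^ k) g = m * q + r" "r = 0 | degree r < degree m"
  using pseudo_division_over[OF A min_polyD(1,2)[OF m] g'(1)] .
 have "poly r x = lead_coeff m ^ k * poly g x" using arg_cong[OF qr(3), of "%p. poly p x"] min_polyD(3)[OF m] by simp
 hence "multiple r" using qr(2) g'(3) min_polyD(1,2)[OF m]
  by(intro multiple_mult[of r "[:lead_coeff m ^ k:]"] closed subring_power[OF A] polys_over_coeff) auto
 hence deg_g: "degree g < degree m" using least[of r] qr(4) by(auto simp: multiple_def)
 have "degree g = 0"
 proof(rule ccontr)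
  assume pos: "degree g ~= 0"
  obtain k q r where qr: "q:polys_over A" "r:polys_over A"
   "smult (lead_coeff g ^ k) m = g * q + r" "r = 0 | degree r < degree g"
   using pseudo_division_over[OF A g'(1,2) min_polyD(1)[OF m]] .
  have r: "poly r x = poly (- q) x * poly g x" using arg_cong[OF qr(3), of "%p. poly p x"] min_polyD(3)[OF m]
   by(simp add: eq_neg_iff_add_eq_0 algebra_simps)
  have "poly r x = 0" using multiple_mult[OF qr(2) closed(3)[OF qr(1)] r] least[of r] qr(4) pos by force
  hence "r = 0" using qr(2,4) deg_g min_polyD(4)[OF m] by auto
  hence eq: "smult (lead_coeff g ^ k) m = g * q" using qr(3) by simp
  have "q ~= 0" using eq min_polyD(2)[OF m] g' by auto
  moreover have "degree m = degree g + degree q" using arg_cong[OF eq, of degree] `q ~= 0` g' by(simp add: degree_mult_eq)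
  moreover have "poly q x = 0" using r `poly r x = 0` g' by auto
  ultimately show False using min_polyD(4)[OF m qr(1)] pos by simp
 qed
 then obtain c where c: "g = [:c:]" by(metis degree_eq_zeroE)
 moreover have "c:A" using polys_over_coeff[OF g'(1), of 0] c by simp
 ultimately show thesis using g that by(auto simp: multiple_def)
qed

lemma ring_hom_on_extend_root:
 fixes sig :: "'a::idom => 'b::idom"
 assumes A: "subring A" and hom: "ring_hom_on A sig"
  and zero: "!!f. f:polys_over A ==> poly f x = 0 ==> poly (map_poly sig f) xi = 0"
 obtains sig' where "ring_hom_on (adjoin A x) sig'" "!!a. a:A ==> sig' a = sig a" "sig' x = xi"
  "!!f. f:polys_over A ==> sig' (poly f x) = poly (map_poly sig f) xi"
proof -
 note closed = subring_closed[OF subring_polys_over[OF A]]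
 note hom_simps = ring_hom_on_simps[OF hom A]
  and hom_polys = ring_hom_on_simps[OF ring_hom_on_map_poly[OF hom A] subring_polys_over[OF A]]
 define sig' where "sig' z = poly (map_poly sig (SOME f. f:polys_over A & poly f x = z)) xi" for z
 have eval: "sig' (poly f x) = poly (map_poly sig f) xi" if f: "f:polys_over A" for f
 proof -
  define g where "g = (SOME g. g:polys_over A & poly g x = poly f x)"
  have g: "g:polys_over A" "poly g x = poly f x"
   unfolding g_def using someI[of "%g. g:polys_over A & poly g x = poly f x" f] f by auto
  have "poly (map_poly sig (g - f)) xi = 0" using zero[of "g - f"] f g closed by simp
  thus ?thesis using f g by(simp add: hom_polys sig'_def flip: g_def)
 qed
 have "ring_hom_on (adjoin A x) sig'" unfolding ring_hom_on_def
 proof(intro conjI ballI)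
  show "sig' 1 = 1" using eval[OF closed(1)] by(simp add: hom_polys)
  fix a b assume "a:adjoin A x" "b:adjoin A x"
  then obtain f g where fg: "f:polys_over A" "g:polys_over A" "a = poly f x" "b = poly g x" by(auto simp: adjoin_def)
  show "sig' (a + b) = sig' a + sig' b" using eval[of "f + g"] eval[of f] eval[of g] fg closed(5) by(simp add: hom_polys)
  show "sig' (a * b) = sig' a * sig' b" using eval[of "f * g"] eval[of f] eval[of g] fg closed(6) by(simp add: hom_polys)
 qed
 moreover have "sig' a = sig a" if "a:A" for a
  using eval[OF const_in_polys_over[OF A that]] by(simp add: map_poly_pCons hom_simps)
 moreover have "sig' x = xi" using eval[OF X_in_polys_over[OF A]] by(simp add: map_poly_pCons hom_simps)
 ultimately show thesis using that eval by blast
qed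

lemma root_of_map_min_poly:
 fixes sig :: "'a::idom => 'b::idom"
 assumes A: "subring A" and hom: "ring_hom_on A sig"
  and m: "min_poly A x m" and lead: "sig (lead_coeff m) ~= 0" and root: "poly (map_poly sig m) xi = 0"
  and f: "f:polys_over A" "poly f x = 0"
 shows "poly (map_poly sig f) xi = 0"
proof -
 note hom_polys = ring_hom_on_simps[OF ring_hom_on_map_poly[OF hom A] subring_polys_over[OF A]]
 have l: "lead_coeff m : A" using min_polyD(1)[OF m] by(simp add: polys_over_coeff)
 obtain k q where q: "q:polys_over A" "smult (lead_coeff m ^ k) f = m * q"
  using min_poly_dvd[OF A m f] .
 have "smult (sig (lead_coeff m) ^ k) (map_poly sig f) = map_poly sig m * map_poly sig q"
  using map_poly_smult_ring_hom_on[OF hom A subring_power[OF A l] f(1), of k] q min_polyD(1)[OF m]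
   ring_hom_on_power[OF hom A l] by(simp add: hom_polys)
 hence "sig (lead_coeff m) ^ k * poly (map_poly sig f) xi = 0" using root by(metis mult_zero_left poly_mult poly_smult)
 thus ?thesis using lead by simp
qed

section \<open>Valuation rings and integrality\<close>

definition valuation_ring :: "'a::field set => bool" where
 "valuation_ring V \<longleftrightarrow> subring V & (ALL x. x:V | inverse x : V)"

lemma valuation_ring_subring: "valuation_ring V ==> subring V" by(simp add: valuation_ring_def)

lemma Ints_subset_subring: "subring A ==> \<int> <= A" by(auto elim!: Ints_cases intro: subring_of_int)

lemma lead_coeff_mult_root_in_valuation_ring:
 assumes V: "valuation_ring V" and p: "p:polys_over V" "poly p x = 0"
 shows "lead_coeff p * x : V"
proof(cases "x:V")
 case True
 thus ?thesis using subring_mult[OF valuation_ring_subring[OF V]] polys_over_coeff[OF p(1)] by blast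
next
 case False
 note V' = valuation_ring_subring[OF V]
 have x: "inverse x : V" "x ~= 0" using V False subring_zero[OF V'] by(auto simp: valuation_ring_def)
 obtain c q where q: "reflect_poly p = pCons c q" by(cases "reflect_poly p")
 have c: "c = lead_coeff p" using arg_cong[OF q, of "%p. coeff p 0"] by simp
 have "coeff q i : V" for i using polys_over_coeff[OF reflect_poly_in_polys_over[OF V' p(1)], of "Suc i"] by(simp add: q)
 hence "poly q (inverse x) : V" using poly_in_subring[OF V' _ x(1)] by(simp add: polys_over_def)
 moreover have "c + inverse x * poly q (inverse x) = 0"
  using poly_reflect_poly_nz[of "inverse x" p] x p(2) by(simp add: q)
 hence "c * x = - poly q (inverse x)" using x(2) by(simp add: field_simps eq_neg_iff_add_eq_0)
 ultimately show ?thesis using subring_uminus[OF V'] by(simp add: c)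
qed

lemma algebraic_int_in_valuation_ring:
 assumes "valuation_ring V" "algebraic_int x"
 shows "x:V"
proof -
 obtain p where p: "lead_coeff p = 1" "!!i. coeff p i : \<int>" "poly p x = 0"
  using assms(2) by(auto simp: algebraic_int.simps)
 hence "p:polys_over V" using Ints_subset_subring[OF valuation_ring_subring[OF assms(1)]] by(auto simp: polys_over_def)
 from lead_coeff_mult_root_in_valuation_ring[OF assms(1) this p(3)] show ?thesis using p(1) by simp
qed

lemma algebraic_int_if_in_adjoin_inverse:
 assumes "x:adjoin \<int> (inverse x)" "x ~= 0"
 shows "algebraic_int x"
proof -
 obtain f where f: "f:polys_over \<int>" "x = poly f (inverse x)"
  using assms(1) by(auto simp: adjoin_def)
 define n where "n = degree f"
 define g where "g = monom 1 (Suc n) - reflect_poly f"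
 have deg: "degree (reflect_poly f) <= n" by(simp add: n_def degree_reflect_poly_le)
 have "poly (reflect_poly f) x = x^n * x" using poly_reflect_poly_nz[of x f] assms(2) f(2) by(simp add: n_def)
 hence root: "poly g x = 0" by(simp add: g_def poly_monom)
 have "coeff g (Suc n) = 1" using deg by(simp add: g_def coeff_eq_0)
 moreover have "degree g <= Suc n" unfolding g_def using deg by(intro degree_diff_le) (auto intro: degree_monom_le)
 ultimately have "lead_coeff g = 1" by(metis le_antisym le_degree one_neq_zero)
 moreover have "coeff g i : \<int>" for i
  using reflect_poly_in_polys_over[OF subring_Ints f(1)] by(auto simp: g_def polys_over_def)
 ultimately show ?thesis using root by(auto simp: algebraic_int.simps)
qed

lemma maximal_subring_avoiding:
 assumes A: "subring A" "x ~: A"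
 obtains V where "subring V" "A <= V" "x ~: V" "!!u. u ~: V ==> x:adjoin V u"
proof -
 define \<A> where "\<A> = {R. subring R & A <= R & x ~: R}"
 have "\<Union>C\<in>\<A>" if C: "C ~= {}" "subset.chain \<A> C" for C
 proof -
  have sub: "C <= \<A>" and chain: "!!R S. R:C ==> S:C ==> R <= S | S <= R" using C(2) by(auto simp: subset.chain_def)
  have "subring (\<Union>C)" unfolding subring_def
  proof(intro conjI ballI)
   show "1 : \<Union>C" using C(1) sub subring_one by(fastforce simp: \<A>_def)
   fix a b assume "a : \<Union>C" "b : \<Union>C"
   then obtain R where R: "R:C" "a:R" "b:R" using chain by blast
   hence "subring R" using sub by(auto simp: \<A>_def)
   from subring_diff[OF this R(2,3)] subring_mult[OF this R(2,3)]
   show "a - b : \<Union>C" "a * b : \<Union>C" using R(1) by auto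
  qed
  thus ?thesis using sub C(1) by(auto simp: \<A>_def)
 qed
 moreover have "\<A> ~= {}" using A by(auto simp: \<A>_def)
 ultimately obtain V where V: "V : \<A>" and maximal: "!!R. R : \<A> ==> V <= R ==> R = V"
  using subset_Zorn_nonempty[of \<A>] by blast
 have "x:adjoin V u" if "u ~: V" for u
 proof(rule ccontr)
  assume "x ~: adjoin V u"
  hence "adjoin V u : \<A>" using subring_adjoin[of V u] V by(auto simp: \<A>_def)
  thus False using maximal[of "adjoin V u"] subring_adjoin[of V u] V that by(auto simp: \<A>_def)
 qed
 thus thesis using that V by(auto simp: \<A>_def)
qed

text \<open>Chevalley's argument: a subring that is maximal among those containing \<open>y\<close> but not \<open>inverse y\<close> is a valuation ring.\<close>

context
 fixes V :: "'a::field set" and x y :: 'a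
 assumes V: "subring V" and xV: "x ~: V" and yV: "y:V" and xy: "x * y = 1"
  and maximal: "!!u. u ~: V ==> x:adjoin V u"
begin

lemma one_minus_multiple_unit:
 assumes b: "b:V"
 shows "1 - y * b ~= 0" "inverse (1 - y * b) : V"
proof -
 note closed = subring_closed[OF V]
 define t where "t = 1 - y * b"
 have cancel: "x * (y * c) = c" for c using xy by(simp flip: mult.assoc)
 show t0: "1 - y * b ~= 0" using cancel[of b] b xV by(metis eq_iff_diff_eq_0 mult.right_neutral)
 have power: "EX c:V. t^k = 1 - y * c" for k
 proof(induction k)
  case 0
  show ?case by(rule bexI[of _ 0]) (simp_all add: closed(2))
 next
  case (Suc k)
  then obtain c where c: "c:V" "t^k = 1 - y * c" by auto
  have "t^Suc k = 1 - y * (b + c - y * (b * c))" by(simp add: c(2)) (simp add: t_def algebra_simps)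
  moreover have "b + c - y * (b * c) : V" by(intro closed b c(1) yV)
  ultimately show ?case by blast
 qed
 show "inverse (1 - y * b) : V"
 proof(rule ccontr)
  assume "inverse (1 - y * b) ~: V"
  then obtain f where f: "f:polys_over V" "x = poly f (inverse t)" using maximal by(auto simp: adjoin_def t_def)
  have "t^degree f * x = poly (reflect_poly f) t" using t0 f(2) by(simp add: poly_reflect_poly_nz t_def)
  hence "t^degree f * x : V" using poly_in_subring[OF V reflect_poly_in_polys_over[OF V f(1)], of t] closed b yV
   by(simp add: t_def)
  moreover obtain c where c: "c:V" "t^degree f = 1 - y * c" using power by auto
  moreover have "(1 - y * c) * x = x - c" using cancel[of c] by(simp add: algebra_simps)
  ultimately have "x - c : V" by simp
  from closed(5)[OF this c(1)] show False using xV by simp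
 qed
qed

definition inverse_attained :: "'a => nat => bool" where
 "inverse_attained u n \<longleftrightarrow> (EX f:polys_over V. degree f <= n & y * poly f u = 1)"

lemma inverse_attained_0: "~ inverse_attained u 0"
proof
 assume "inverse_attained u 0"
 then obtain f where f: "f:polys_over V" "degree f = 0" "y * poly f u = 1" by(auto simp: inverse_attained_def)
 then obtain c where c: "f = [:c:]" by(metis degree_eq_zeroE)
 hence "x = c" using f(3) xy by(metis mult.assoc mult.commute mult_1 poly_const_conv)
 thus False using polys_over_coeff[OF f(1), of 0] c xV by simp
qed

lemma inverse_attained_mono: "inverse_attained u n ==> n <= m ==> inverse_attained u m"
 unfolding inverse_attained_def by(meson order_trans)

lemma power_eq_lower_poly:
 assumes u: "u ~= 0" and "inverse_attained (inverse u) (Suc n)"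
 obtains h where "h:polys_over V" "degree h <= n" "u^Suc n = poly h u"
proof -
 note closed = subring_closed[OF V] and closed_polys = subring_closed[OF subring_polys_over[OF V]]
 obtain g where g: "g:polys_over V" "degree g <= Suc n" "y * poly g (inverse u) = 1"
  using assms(2) by(auto simp: inverse_attained_def)
 obtain c g1 where g1: "g = pCons c g1" by(cases g)
 have c: "c:V" using polys_over_coeff[OF g(1), of 0] by(simp add: g1)
 have g1V: "g1:polys_over V" using polys_over_coeff[OF g(1), of "Suc _"] by(simp add: g1 polys_over_def)
 have deg: "degree g1 <= n" using g(2) by(auto simp: g1 split: if_splits)
 define e where "e = 1 - y * c"
 have e: "inverse e : V" "e ~= 0" using one_minus_multiple_unit[OF c] by(auto simp: e_def)
 have "e = y * (inverse u * poly g1 (inverse u))" using g(3) by(simp add: g1 e_def algebra_simps)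
 hence "u^Suc n * e = y * (u^n * poly g1 (inverse u))" using u by(simp add: field_simps)
 also have "u^n * poly g1 (inverse u) = u^(n - degree g1) * poly (reflect_poly g1) u"
  using u deg by(simp add: poly_reflect_poly_nz flip: power_add mult.assoc)
 finally have "u^Suc n = inverse e * (y * (u^(n - degree g1) * poly (reflect_poly g1) u))"
  using e(2) by(simp add: field_simps)
 moreover define h where "h = smult (inverse e * y) (monom 1 (n - degree g1) * reflect_poly g1)"
 moreover have "h:polys_over V" unfolding h_def
  by(intro smult_in_polys_over[OF V] closed_polys closed monom_in_polys_over[OF V] e yV
    reflect_poly_in_polys_over[OF V] g1V)
 moreover have "degree (monom 1 (n - degree g1) * reflect_poly g1) <= (n - degree g1) + degree g1"
  by(intro order_trans[OF degree_mult_le] add_mono degree_monom_le degree_reflect_poly_le)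
 hence "degree h <= n" unfolding h_def using deg degree_smult_le order_trans by fastforce
 ultimately show thesis using that[of h] by(simp add: poly_monom mult.assoc)
qed

lemma inverse_attained_reduce:
 assumes "u ~= 0" "inverse_attained u (Suc n)" "inverse_attained (inverse u) (Suc n)"
 shows "inverse_attained u n"
proof -
 note closed_polys = subring_closed[OF subring_polys_over[OF V]]
 obtain f where f: "f:polys_over V" "degree f <= Suc n" "y * poly f u = 1"
  using assms(2) by(auto simp: inverse_attained_def)
 obtain h where h: "h:polys_over V" "degree h <= n" "u^Suc n = poly h u"
  using power_eq_lower_poly[OF assms(1,3)] .
 define c where "c = coeff f (Suc n)"
 define f' where "f' = (f - monom c (Suc n)) + smult c h"
 have c: "c:V" using polys_over_coeff[OF f(1)] by(simp add: c_def)
 have "f':polys_over V" unfolding f'_def by(intro closed_polys monom_in_polys_over[OF V] smult_in_polys_over[OF V] f h c)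
 moreover have "degree (f - monom c (Suc n)) <= n" using f(2) by(intro degree_le) (auto simp: c_def coeff_eq_0 Suc_lessI)
 hence "degree f' <= n" unfolding f'_def using h(2) by(intro degree_add_le) (auto intro: order_trans[OF degree_smult_le])
 moreover have "poly f' u = poly f u" by(simp add: f'_def poly_monom flip: h(3))
 ultimately show ?thesis using f(3) by(auto simp: inverse_attained_def)
qed

lemma maximal_subring_valuation_ring: "valuation_ring V"
proof -
 have attained: "EX n. inverse_attained u n" if "u ~: V" for u
 proof -
  obtain f where "f:polys_over V" "x = poly f u" using maximal `u ~: V` by(auto simp: adjoin_def)
  hence "inverse_attained u (degree f)" using xy by(auto simp: inverse_attained_def mult.commute)
  thus ?thesis ..
 qed
 have "False" if "u ~= 0" "inverse_attained u n" "inverse_attained (inverse u) m" for u n m using that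
 proof(induction "n + m" arbitrary: u n m rule: less_induct)
  case less
  obtain n' m' where [simp]: "n = Suc n'" "m = Suc m'"
   using less.prems inverse_attained_0 by(metis not0_implies_Suc)
  show ?case
  proof(cases "m <= n")
   case True
   hence "inverse_attained u n'" using inverse_attained_reduce[of u n'] less.prems inverse_attained_mono by auto
   thus False using less.hyps[of n' m u] less.prems by simp
  next
   case False
   hence "inverse_attained (inverse u) m'"
    using inverse_attained_reduce[of "inverse u" m'] less.prems inverse_attained_mono[of u n m] by auto
   thus False using less.hyps[of n m' u] less.prems by simp
  qed
 qed
 thus ?thesis using V attained subring_zero[OF V] unfolding valuation_ring_def by(metis inverse_zero)
qed

end

lemma algebraic_int_iff_valuation_ring:
 "algebraic_int x \<longleftrightarrow> (ALL V. valuation_ring V --> x:V)"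
proof(intro iffI allI impI)
 assume inV: "ALL V. valuation_ring V --> x:V"
 show "algebraic_int x"
 proof(rule ccontr)
  assume nonint: "~ algebraic_int x"
  hence x0: "x ~= 0" by auto
  hence "x ~: adjoin \<int> (inverse x)" using algebraic_int_if_in_adjoin_inverse nonint by blast
  then obtain V where V: "subring V" "adjoin \<int> (inverse x) <= V" "x ~: V"
   "!!u. u ~: V ==> x:adjoin V u"
   using maximal_subring_avoiding[OF subring_adjoin(1)[OF subring_Ints]] by metis
  have "inverse x : V" using V(2) in_adjoin[OF subring_Ints] by auto
  from maximal_subring_valuation_ring[OF V(1,3) this _ V(4)] inV V(3) x0 show False by auto
 qed
qed(rule algebraic_int_in_valuation_ring)

lemma algebraic_int_ring:
 assumes "algebraic_int x" "algebraic_int y"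
 shows "algebraic_int (x * y)" "algebraic_int (x + y)" "algebraic_int (x - y)"
 using assms subring_diff subring_add subring_mult
 unfolding algebraic_int_iff_valuation_ring valuation_ring_def by blast+

lemma algebraic_int_of_nat_mult: "algebraic_int x ==> algebraic_int (of_nat n * x)" using algebraic_int_ring(1) by auto

lemma integral_multiple:
 fixes x :: "'a::field_char_0"
 assumes "algebraic x"
 obtains N :: nat where "N > 0" "algebraic_int (of_nat N * x)"
proof -
 obtain p where p: "!!i. coeff p i : \<int>" "p ~= 0" "poly p x = 0"
  using assms unfolding algebraic_def by blast
 obtain k where k: "lead_coeff p = of_int k" using p(1) by(auto elim: Ints_cases)
 have "algebraic_int (lead_coeff p * x)" unfolding algebraic_int_iff_valuation_ring
 proof(intro allI impI)
  fix V :: "'a set" assume V: "valuation_ring V"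
  have "p:polys_over V" using p(1) Ints_subset_subring[OF valuation_ring_subring[OF V]] by(auto simp: polys_over_def)
  from lead_coeff_mult_root_in_valuation_ring[OF V this p(3)] show "lead_coeff p * x : V" .
 qed
 hence "algebraic_int (of_nat (nat \<bar>k\<bar>) * x)" unfolding k by(cases "k >= 0") (auto dest: algebraic_int_minus)
 moreover have "nat \<bar>k\<bar> > 0" using k p(2) by auto
 ultimately show thesis using that by blast
qed

lemma ring_hom_on_algebraic_nonzero:
 fixes phi :: "'a::field_char_0 => 'b::{comm_ring_1,ring_char_0}"
 assumes hom: "ring_hom_on A phi" and A: "subring A" and x: "x:A" "x ~= 0" "algebraic x"
 shows "phi x ~= 0"
proof
 assume zero: "phi x = 0"
 obtain m where m: "min_poly \<int> x m"
  using x(3) min_poly_exists[of _ \<int> x] by(auto simp: algebraic_def polys_over_def)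
 have mA: "m:polys_over A" using min_polyD(1)[OF m] polys_over_mono[OF Ints_subset_subring[OF A]] by blast
 obtain j where j: "coeff m 0 = of_int j"
  using polys_over_coeff[OF min_polyD(1)[OF m]] by(auto elim: Ints_cases)
 have "poly (map_poly phi m) 0 = 0"
  using ring_hom_on_poly[OF hom A mA x(1)] zero min_polyD(3)[OF m] ring_hom_on_zero[OF hom A] by simp
 hence "(of_int j :: 'b) = 0" using ring_hom_on_simps[OF hom A] by(simp add: poly_0_coeff_0 coeff_map_poly j)
 thus False using min_poly_coeff_0[OF m x(2)] j by simp
qed

section \<open>Number fields and Northcott's theorem\<close>

interpretation rat_vs: vector_space "%(r::rat) (x::complex). of_rat r * x"
 by unfold_locales (auto simp: algebra_simps of_rat_add of_rat_mult)

definition number_field :: "complex set => bool" where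
 "number_field K \<longleftrightarrow> subring K & (EX B. finite B & K = rat_vs.span B)"

lemma number_field_subring: "number_field K ==> subring K" by(simp add: number_field_def)

lemma number_field_Rats: "number_field \<rat>"
proof -
 have "\<rat> = rat_vs.span {1}" unfolding rat_vs.span_singleton by(auto simp: Rats_def)
 thus ?thesis using subring_Rats by(auto simp: number_field_def intro!: exI[of _ "{1}"])
qed

lemma Rats_subset_number_field: "number_field K ==> \<rat> <= K"
proof
 fix x :: complex assume K: "number_field K" and "x : \<rat>"
 then obtain r where "x = of_rat r * 1" by(auto simp: Rats_def)
 thus "x:K" using K rat_vs.span_scale[of 1 _ r] subring_one by(auto simp: number_field_def)
qed

lemma number_field_bounded_degree:
 assumes "number_field K"
 obtains n where "!!x. x:K ==> EX f:polys_over \<rat>. f ~= 0 & degree f <= n & poly f x = 0"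
proof -
 obtain B where B: "finite B" "K = rat_vs.span B" and K: "subring K"
  using assms by(auto simp: number_field_def)
 have "EX f:polys_over \<rat>. f ~= 0 & degree f <= card B & poly f x = 0" if x: "x:K" for x
 proof(cases "inj_on (%i. x^i) {..card B}")
  case inj: True
  define S where "S = (%i. x^i) ` {..card B}"
  have "card S = Suc (card B)" unfolding S_def using card_image[OF inj] by simp
  moreover have "S <= rat_vs.span B" using subring_power[OF K x] B by(auto simp: S_def)
  ultimately have "rat_vs.dependent S" using rat_vs.independent_span_bound[OF B(1), of S] by auto
  then obtain u v where u: "v:S" "u v ~= 0" "(\<Sum>v\<in>S. of_rat (u v) * v) = 0"
   using rat_vs.dependent_finite[of S] by(auto simp: S_def)
  define f where "f = (\<Sum>i\<le>card B. monom (of_rat (u (x^i)) :: complex) i)"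
  have coeff_f: "coeff f i = (if i <= card B then of_rat (u (x^i)) else 0)" for i
   by(auto simp: f_def coeff_sum cong: if_cong)
  have "poly f x = (\<Sum>v\<in>S. of_rat (u v) * v)"
   unfolding f_def S_def sum.reindex[OF inj] by(simp add: poly_sum poly_monom)
  moreover obtain i where "i <= card B" "v = x^i" using u(1) by(auto simp: S_def)
  hence "coeff f i ~= 0" using u(2) by(simp add: coeff_f)
  hence "f ~= 0" by auto
  moreover have "degree f <= card B" by(rule degree_le) (auto simp: coeff_f)
  ultimately show ?thesis using u(3) by(intro bexI[of _ f]) (auto simp: polys_over_def coeff_f)
 next
  case False
  then obtain i j where ij: "i <= card B" "j <= card B" "i ~= j" "x^i = x^j" by(auto simp: inj_on_def)
  define f where "f = (monom 1 i - monom 1 j :: complex poly)"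
  have "coeff f i = 1" using ij by(simp add: f_def)
  hence "f ~= 0" by auto
  moreover have "degree f <= card B" unfolding f_def using ij by(intro degree_diff_le) (auto simp: degree_monom_eq)
  ultimately show ?thesis using ij by(intro bexI[of _ f]) (auto simp: f_def poly_monom polys_over_def)
 qed
 thus thesis by(rule that)
qed

lemma number_field_algebraic:
 assumes "number_field K" "x:K"
 obtains f where "f:polys_over \<rat>" "f ~= 0" "poly f x = 0" "algebraic x"
proof -
 obtain f where f: "f:polys_over \<rat>" "f ~= 0" "poly f x = 0"
  using number_field_bounded_degree[OF assms(1)] assms(2) by metis
 hence "algebraic x" unfolding algebraic_altdef by(auto simp: polys_over_def)
 thus thesis using that f by blast
qed

lemma number_field_inverse:
 assumes K: "number_field K" and x: "x:K"
 shows "inverse x : K"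
proof(cases "x = 0")
 case True
 thus ?thesis using subring_zero[OF number_field_subring[OF K]] by simp
next
 case False
 note K' = number_field_subring[OF K] and Rats = Rats_subset_number_field[OF K]
 obtain m where m: "min_poly \<rat> x m" using number_field_algebraic[OF K x] min_poly_exists by metis
 obtain c g where cg: "m = pCons c g" by(cases m)
 have c: "c ~= 0" "c : \<rat>"
  using min_poly_coeff_0[OF m False] polys_over_coeff[OF min_polyD(1)[OF m], of 0] by(simp_all add: cg)
 have "g:polys_over K" using polys_over_coeff[OF min_polyD(1)[OF m], of "Suc _"] Rats by(auto simp: cg polys_over_def)
 hence "poly g x : K" using poly_in_subring[OF K' _ x] by blast
 moreover have "inverse x = - (inverse c * poly g x)"
  using min_polyD(3)[OF m] cg False c by(simp add: field_simps eq_neg_iff_add_eq_0)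
 moreover have "inverse c : K" using Rats Rats_inverse[OF c(2)] by blast
 ultimately show ?thesis using subring_uminus[OF K'] subring_mult[OF K'] by simp
qed

lemma adjoin_eq_lower_polys:
 assumes K: "number_field K" and f: "f:polys_over K" "f ~= 0" "poly f x = 0" and z: "z:adjoin K x"
 obtains r where "r:polys_over K" "r = 0 | degree r < degree f" "z = poly r x"
proof -
 note K' = number_field_subring[OF K]
 define l where "l = lead_coeff f"
 obtain g where g: "g:polys_over K" "z = poly g x" using z by(auto simp: adjoin_def)
 obtain k q r where qr: "q:polys_over K" "r:polys_over K"
  "smult (l^k) g = f * q + r" "r = 0 | degree r < degree f"
  using pseudo_division_over[OF K' f(1,2) g(1)] unfolding l_def .
 have l: "l ~= 0" "l:K" using f by(auto simp: l_def polys_over_coeff)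
 have "l^k * z = poly r x" using arg_cong[OF qr(3), of "%p. poly p x"] f(3) g(2) by simp
 hence "z = poly (smult (inverse (l^k)) r) x" using l(1) by(simp add: field_simps)
 moreover have "smult (inverse (l^k)) r : polys_over K"
  by(intro smult_in_polys_over[OF K'] number_field_inverse[OF K] subring_power[OF K'] l qr)
 ultimately show thesis using that qr(4) by auto
qed

lemma number_field_adjoin:
 assumes K: "number_field K" and f: "f:polys_over K" "f ~= 0" "poly f x = 0"
 shows "number_field (adjoin K x)"
proof -
 note K' = number_field_subring[OF K]
 note closed = subring_closed[OF subring_adjoin(1)[OF K', of x]]
 note adj = subset_adjoin[OF K', of x] in_adjoin[OF K', of x]
 obtain B where B: "finite B" "K = rat_vs.span B" using K by(auto simp: number_field_def)
 define T where "T = (%(b,i). b * x^i) ` (B \<times> {..<degree f})"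
 have coeff_times_power: "k * x^i : rat_vs.span T" if k: "k:K" and i: "i < degree f" for k i
 proof -
  have "rat_vs.span B <= {k. k * x^i : rat_vs.span T}"
  proof(rule rat_vs.span_minimal)
   show "B <= {k. k * x^i : rat_vs.span T}"
    using i by(auto simp: T_def intro!: rat_vs.span_base image_eqI[of _ _ "(_, i)"])
   show "rat_vs.subspace {k. k * x^i : rat_vs.span T}" unfolding rat_vs.subspace_def
    using rat_vs.span_zero rat_vs.span_add rat_vs.span_scale by(auto simp: distrib_right mult.assoc)
  qed
  thus ?thesis using k B(2) by auto
 qed
 have "adjoin K x <= rat_vs.span T"
 proof
  fix z assume "z:adjoin K x"
  then obtain r where r: "r:polys_over K" "r = 0 | degree r < degree f" "z = poly r x"
   using adjoin_eq_lower_polys[OF K f] by blast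
  show "z:rat_vs.span T"
  proof(cases "r = 0")
   case False
   thus ?thesis unfolding r(3) poly_altdef using r(2)
    by(intro rat_vs.span_sum coeff_times_power polys_over_coeff[OF r(1)]) auto
  qed(use r(3) rat_vs.span_zero in simp)
 qed
 moreover have "rat_vs.span T <= adjoin K x"
 proof(rule rat_vs.span_minimal)
  have "B <= adjoin K x" using adj(1) B(2) rat_vs.span_superset[of B] by blast
  thus "T <= adjoin K x" using adj(2) by(auto simp: T_def intro!: closed(6,7))
  have "of_rat q : adjoin K x" for q using adj Rats_subset_number_field[OF K] Rats_of_rat by blast
  thus "rat_vs.subspace (adjoin K x)" unfolding rat_vs.subspace_def using closed(2,5,6) by blast
 qed
 moreover have "finite T" using B by(simp add: T_def)
 ultimately show ?thesis using subring_adjoin(1)[OF K'] by(auto simp: number_field_def intro!: exI[of _ T])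
qed

lemma embedding_extend:
 assumes K: "number_field K" and L: "number_field L" "L <= K" "ring_hom_on L (sig :: complex => complex)"
  and y: "y:K"
 obtains L' sig' where "number_field L'" "insert y L <= L'" "L' <= K"
  "ring_hom_on L' (sig' :: complex => complex)" "!!a. a:L ==> sig' a = sig a"
proof -
 note L' = number_field_subring[OF L(1)]
 obtain f where "f:polys_over \<rat>" "f ~= 0" "poly f y = 0" using number_field_algebraic[OF K y] .
 hence f: "f:polys_over L" "f ~= 0" "poly f y = 0" using polys_over_mono[OF Rats_subset_number_field[OF L(1)]] by auto
 obtain m where m: "min_poly L y m" using min_poly_exists[OF f] by blast
 have "lead_coeff m : L" "lead_coeff m ~= 0" using min_polyD[OF m] by(auto simp: polys_over_coeff)
 hence lead: "sig (lead_coeff m) ~= 0"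
  using ring_hom_on_algebraic_nonzero[OF L(3) L'] number_field_algebraic[OF L(1)] by metis
 hence "degree (map_poly sig m) > 0" using min_poly_degree[OF m] by(simp add: map_poly_degree_eq)
 then obtain xi where xi: "poly (map_poly sig m) xi = 0" using alg_closed_imp_poly_has_root by blast
 show thesis
 proof(rule ring_hom_on_extend_root[OF L' L(3) root_of_map_min_poly[OF L' L(3) m lead xi]])
  fix sig' assume sig': "ring_hom_on (adjoin L y) sig'" "!!a. a:L ==> sig' a = sig a"
  show thesis using that[OF number_field_adjoin[OF L(1) f] _ _ sig'] subring_adjoin[OF L', of y]
    adjoin_subset[OF number_field_subring[OF K] L(2) y] by blast
 qed
qed

lemma conjugate_embedding:
 assumes K: "number_field K" and x: "x:K" and m: "min_poly \<rat> x m" and root: "poly m r = 0"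
 obtains sig :: "complex => complex" where "ring_hom_on K sig" "sig x = r"
proof -
 have "map_poly (%z::complex. z) f = f" for f by(intro poly_eqI) simp
 hence "poly (map_poly (%z. z) f) r = 0" if "f:polys_over \<rat>" "poly f x = 0" for f
  using root_of_map_min_poly[OF subring_Rats ring_hom_on_id m _ _ that, of r] root min_polyD(2)[OF m] by simp
 then obtain sig0 where sig0: "ring_hom_on (adjoin \<rat> x) sig0" "sig0 x = r"
  using ring_hom_on_extend_root[OF subring_Rats ring_hom_on_id] by metis
 have extend: "EX L sig. number_field L & insert x C <= L & L <= K &
   ring_hom_on L (sig :: complex => complex) & sig x = r" if "finite C" "C <= K" for C
  using that
 proof(induction C)
  case empty
  show ?case using sig0 number_field_adjoin[OF number_field_Rats min_polyD(1-3)[OF m]] in_adjoin[OF subring_Rats, of x]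
    adjoin_subset[OF number_field_subring[OF K] Rats_subset_number_field[OF K] x] by blast
 next
  case (insert y C)
  then obtain L sig where L: "number_field L" "insert x C <= L" "L <= K"
   "ring_hom_on L (sig :: complex => complex)" "sig x = r" by auto
  have "y:K" using insert.prems by simp
  from embedding_extend[OF K L(1,3,4) this] obtain L' sig' where
   "number_field L'" "insert y L <= L'" "L' <= K" "ring_hom_on L' sig'" "!!a. a:L ==> sig' a = sig a" by metis
  thus ?case using L by(intro exI[of _ L'] exI[of _ sig']) auto
 qed
 obtain B where B: "finite B" "K = rat_vs.span B" using K by(auto simp: number_field_def)
 obtain L sig where L: "number_field L" "insert x B <= L" "L <= K" "ring_hom_on L sig" "sig x = r"
  using extend[OF B(1)] B rat_vs.span_superset by auto
 have "K <= L" using B L(1,2) rat_vs.span_minimal rat_vs.subspace_span by(auto simp: number_field_def)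
 thus thesis using that L by auto
qed

lemma embedding_Rats:
 assumes K: "number_field K" and sig: "ring_hom_on K (sig :: complex => complex)" and q: "q : \<rat>"
 shows "sig q = q"
proof -
 note K' = number_field_subring[OF K]
 obtain m k :: int where mk: "k > 0" "q = of_int m / of_int k" using q by(elim Rats_cases') auto
 have "sig (q * of_int k) = sig q * of_int k"
  using ring_hom_on_mult[OF sig K' _ subring_of_int[OF K']] ring_hom_on_of_int[OF sig K']
   Rats_subset_number_field[OF K] q by auto
 moreover have "q * of_int k = of_int m" using mk by simp
 ultimately have "sig q * of_int k = q * of_int k" using ring_hom_on_of_int[OF sig K'] by metis
 thus ?thesis using mk(1) by simp
qed

lemma embedding_root:
 assumes K: "number_field K" and sig: "ring_hom_on K (sig :: complex => complex)" and x: "x:K"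
  and f: "f:polys_over \<rat>" "poly f x = 0"
 shows "poly f (sig x) = 0"
proof -
 note K' = number_field_subring[OF K]
 have "map_poly sig f = f" using embedding_Rats[OF K sig] f(1) ring_hom_on_zero[OF sig K']
  by(intro poly_eqI) (auto simp: coeff_map_poly polys_over_def)
 moreover have "f:polys_over K" using f(1) polys_over_mono[OF Rats_subset_number_field[OF K]] by blast
 ultimately show ?thesis using ring_hom_on_poly[OF sig K' _ x] f(2) ring_hom_on_zero[OF sig K'] by metis
qed

lemma embeddings_bounded:
 assumes K: "number_field K" and x: "x:K"
 obtains B :: nat where "!!sig :: complex => complex. ring_hom_on K sig ==> cmod (sig x) <= B"
proof -
 obtain f where f: "f:polys_over \<rat>" "f ~= 0" "poly f x = 0" using number_field_algebraic[OF K x] .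
 have "bounded {z. poly f z = 0}" using f(2) by(intro finite_imp_bounded poly_roots_finite)
 then obtain b where "!!z. poly f z = 0 ==> cmod z <= b" by(auto simp: bounded_iff)
 moreover obtain B :: nat where "b <= B" using real_arch_simple by blast
 ultimately show thesis using that[of B] embedding_root[OF K _ x f(1,3)] by(meson order_trans)
qed

lemma uniform_denominator:
 assumes K: "number_field K" and "finite L" "L <= K"
 shows "EX N>0::nat. ALL x:L. algebraic_int (of_nat N * x)"
 using assms(2,3)
proof(induction L)
 case empty
 show ?case by auto
next
 case (insert y L)
 obtain N where N: "N > 0" "ALL x:L. algebraic_int (of_nat N * x)" using insert.IH insert.prems by auto
 have "algebraic y" using number_field_algebraic[OF K, of y] insert.prems by auto
 then obtain M where M: "M > 0" "algebraic_int (of_nat M * y)" using integral_multiple by blast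
 have "algebraic_int (of_nat (N * M) * x)" if "x:insert y L" for x
  using that algebraic_int_of_nat_mult[OF M(2), of N] algebraic_int_of_nat_mult[of "of_nat N * x" M] N(2)
  by(auto simp: mult_ac)
 thus ?case using N(1) M(1) by(intro exI[of _ "N * M"]) auto
qed

lemma uniform_embedding_bound:
 assumes K: "number_field K" and "finite L" "L <= K"
 shows "EX B>=2::nat. ALL x:L. ALL sig::complex => complex. ring_hom_on K sig --> cmod (sig x) <= B"
 using assms(2,3)
proof(induction L)
 case empty
 show ?case by auto
next
 case (insert y L)
 obtain B where B: "B >= 2" "ALL x:L. ALL sig::complex => complex. ring_hom_on K sig --> cmod (sig x) <= real B"
  using insert.IH insert.prems by auto
 obtain C where C: "!!sig :: complex => complex. ring_hom_on K sig ==> cmod (sig y) <= real C"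
  using embeddings_bounded[OF K, of y] insert.prems by auto
 have "cmod (sig x) <= real (B + C)" if "x:insert y L" "ring_hom_on K sig" for x sig
  using that B(2) C by(fastforce intro: order_trans[of _ "real B"] order_trans[of _ "real C"])
 thus ?case using B(1) by(intro exI[of _ "B + C"]) auto
qed

lemma monic_min_poly:
 assumes "min_poly \<rat> x m"
 obtains m' where "min_poly \<rat> x m'" "lead_coeff m' = (1::'a::field_char_0)"
proof
 have m: "m:polys_over \<rat>" "m ~= 0" using min_polyD[OF assms] by auto
 show "min_poly \<rat> x (smult (inverse (lead_coeff m)) m)"
  using assms by(auto simp: min_poly_def polys_over_def intro!: Rats_mult Rats_inverse)
 show "lead_coeff (smult (inverse (lead_coeff m)) m) = 1" using m by simp
qed

lemma prod_linear_in_polys_over: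
 "subring A ==> set_mset R <= A ==> (\<Prod>r\<in>#R. [:-r, 1:]) : polys_over A"
proof(induction R)
 case (add r R)
 hence "[:-r, 1:] : polys_over A" by(intro pCons_in_polys_over const_in_polys_over) (auto intro: subring_closed)
 thus ?case using add subring_mult[OF subring_polys_over[OF `subring A`]] by fastforce
qed(simp add: subring_one subring_polys_over)

lemma norm_coeff_prod_linear_le:
 fixes R :: "'a::{real_normed_field} multiset"
 assumes "!!r. r \<in># R ==> norm r <= b" and "b >= 0"
 shows "norm (coeff (\<Prod>r\<in>#R. [:-r, 1:]) k) <= (1 + b)^size R"
 using assms(1)
proof(induction R arbitrary: k)
 case empty
 show ?case by(cases k) auto
next
 case (add r R)
 define p where "p = (\<Prod>r\<in>#R. [:-r, 1:])"
 have IH: "norm (coeff p j) <= (1 + b)^size R" for j using add by(auto simp: p_def)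
 have r_times: "norm (r * coeff p k) <= b * (1 + b)^size R"
  using add.prems[of r] IH[of k] assms(2) unfolding norm_mult by(intro mult_mono) auto
 have "norm (coeff ([:-r, 1:] * p) k) <= b * (1 + b)^size R + (1 + b)^size R"
 proof(cases k)
  case 0
  thus ?thesis using r_times assms(2) by(simp add: add_increasing2)
 next
  case (Suc j)
  have coeff_k: "coeff ([:-r, 1:] * p) k = coeff p j - r * coeff p k" using Suc by simp
  show ?thesis unfolding coeff_k using norm_triangle_ineq4[of "coeff p j" "r * coeff p k"] r_times IH[of j] by linarith
 qed
 thus ?case by(simp add: p_def algebra_simps)
qed

lemma coeff_monic_min_poly_Ints:
 fixes y :: complex
 assumes m: "min_poly \<rat> y m" "lead_coeff m = 1" and y: "algebraic_int y"
 shows "coeff m i : \<int>"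
proof -
 obtain R where R: "m = (\<Prod>r\<in>#R. [:-r, 1:])"
  using alg_closed_imp_factorization[OF min_polyD(2)[OF m(1)]] m(2) by auto
 obtain p where p: "lead_coeff p = 1" "!!i. coeff p i : \<int>" "poly p y = 0"
  using y by(auto simp: algebraic_int.simps)
 have "p:polys_over \<rat>" using p(2) Ints_subset_Rats by(auto simp: polys_over_def)
 then obtain k q where q: "smult (lead_coeff m ^ k) p = m * q" using min_poly_dvd[OF subring_Rats m(1) _ p(3)] by metis
 have "poly m r = 0" if "r \<in># R" for r using that unfolding R by(auto simp: poly_prod_mset prod_mset_zero_iff)
 hence root_int: "algebraic_int r" if "r \<in># R" for r
  using that q m(2) p by(auto simp: algebraic_int.simps intro!: exI[of _ p])
 have "algebraic_int (coeff m i)" unfolding algebraic_int_iff_valuation_ring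
 proof(intro allI impI)
  fix V :: "complex set" assume V: "valuation_ring V"
  have "set_mset R <= V" using root_int algebraic_int_in_valuation_ring[OF V] by auto
  thus "coeff m i : V" using prod_linear_in_polys_over[OF valuation_ring_subring[OF V]] polys_over_coeff R by metis
 qed
 moreover have "coeff m i : \<rat>" using polys_over_coeff[OF min_polyD(1)[OF m(1)]] .
 ultimately show ?thesis by(rule rational_algebraic_int_is_int)
qed

lemma finite_roots_of_bounded_integer_polys:
 "finite {y::complex. EX p. p ~= 0 & degree p <= n & (ALL i. coeff p i : \<int> & cmod (coeff p i) <= M) & poly p y = 0}"
  (is "finite ?Y")
proof -
 define Z :: "complex set" where "Z = of_int ` {-\<lfloor>M\<rfloor>..\<lfloor>M\<rfloor>}"
 define F where "F = {p. set (coeffs p) <= Z & length (coeffs p) <= Suc n & p ~= 0}"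
 have "coeffs ` F <= {xs. set xs <= Z & length xs <= Suc n}" by(auto simp: F_def)
 moreover have "finite {xs. set xs <= Z & length xs <= Suc n}" by(intro finite_lists_length_le) (simp add: Z_def)
 ultimately have "finite F" by(metis finite_imageD finite_subset inj_onI coeffs_eq_iff)
 hence "finite (\<Union>p\<in>F. {y. poly p y = 0})" by(intro finite_UN_I) (auto simp: F_def intro: poly_roots_finite)
 moreover have "?Y <= (\<Union>p\<in>F. {y. poly p y = 0})"
 proof
  fix y assume "y : ?Y"
  then obtain p where p: "p ~= 0" "degree p <= n" "poly p y = 0"
   "!!i. coeff p i : \<int>" "!!i. cmod (coeff p i) <= M" by blast
  have "coeff p i : Z" for i
  proof -
   obtain z where z: "coeff p i = of_int z" using p(4) by(auto elim: Ints_cases)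
   hence "\<bar>of_int z\<bar> <= M" using p(5)[of i] by simp
   hence "z:{-\<lfloor>M\<rfloor>..\<lfloor>M\<rfloor>}" by(auto simp: abs_le_iff le_floor_iff minus_le_iff)
   thus ?thesis unfolding z Z_def by(rule imageI)
  qed
  hence "p:F" using p by(auto simp: F_def coeffs_def)
  thus "y:(\<Union>p\<in>F. {y. poly p y = 0})" using p(3) by blast
 qed
 ultimately show ?thesis using finite_subset by blast
qed

lemma northcott_integral:
 assumes K: "number_field K"
 shows "finite {y:K. algebraic_int y & (ALL sig::complex => complex. ring_hom_on K sig --> cmod (sig y) <= b)}"
  (is "finite ?X")
proof -
 obtain n where n: "!!y. y:K ==> EX f:polys_over \<rat>. f ~= 0 & degree f <= n & poly f y = 0"
  using number_field_bounded_degree[OF K] by metis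
 show ?thesis
 proof(rule finite_subset[OF _ finite_roots_of_bounded_integer_polys[of n "(1 + \<bar>b\<bar>)^n"]], safe)
  fix y assume y: "y:K" "algebraic_int y"
   "ALL sig::complex => complex. ring_hom_on K sig --> cmod (sig y) <= b"
  obtain f where f: "f:polys_over \<rat>" "f ~= 0" "degree f <= n" "poly f y = 0" using n[OF y(1)] by blast
  obtain m where m: "min_poly \<rat> y m" "lead_coeff m = 1"
   using min_poly_exists[OF f(1,2,4)] monic_min_poly by metis
  have deg: "degree m <= n" using m(1) f by(auto simp: min_poly_def)
  obtain R where R: "size R = degree m" "m = (\<Prod>r\<in>#R. [:-r, 1:])"
   using alg_closed_imp_factorization[OF min_polyD(2)[OF m(1)]] m(2) by auto
  have root: "cmod r <= \<bar>b\<bar>" if "r \<in># R" for r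
  proof -
   have "poly m r = 0" using that unfolding R(2) by(auto simp: poly_prod_mset prod_mset_zero_iff)
   then obtain sig where "ring_hom_on K sig" "sig y = r" using conjugate_embedding[OF K y(1) m(1)] by blast
   thus ?thesis using y(3) by fastforce
  qed
  have "cmod (coeff m i) <= (1 + \<bar>b\<bar>)^n" for i
  proof -
   have "cmod (coeff m i) <= (1 + \<bar>b\<bar>)^degree m"
    using norm_coeff_prod_linear_le[of R "\<bar>b\<bar>" i] root R by simp
   also have "... <= (1 + \<bar>b\<bar>)^n" using deg by(intro power_increasing) auto
   finally show ?thesis .
  qed
  thus "EX p. p ~= 0 & degree p <= n & (ALL i. coeff p i : \<int> & cmod (coeff p i) <= (1 + \<bar>b\<bar>)^n) & poly p y = 0"
   using coeff_monic_min_poly_Ints[OF m y(2)] min_polyD(2,3)[OF m(1)] deg by blast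
 qed
qed

theorem northcott:
 assumes K: "number_field K" and N: "N > (0::nat)"
 shows "finite {x:K. algebraic_int (of_nat N * x) & (ALL sig::complex => complex. ring_hom_on K sig --> cmod (sig x) <= b)}"
  (is "finite ?X")
proof -
 note K' = number_field_subring[OF K]
 let ?Y = "{y:K. algebraic_int y & (ALL sig::complex => complex. ring_hom_on K sig --> cmod (sig y) <= N * b)}"
 have "of_nat N * x : ?Y" if x: "x : ?X" for x
 proof -
  have "cmod (sig (of_nat N * x)) <= N * b" if "ring_hom_on K sig" for sig :: "complex => complex"
   using ring_hom_on_mult[OF that K' subring_of_nat[OF K']] ring_hom_on_of_nat[OF that K'] x that
   by(auto simp: norm_mult intro: mult_left_mono)
  thus ?thesis using x subring_mult[OF K' subring_of_nat[OF K']] by blast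
 qed
 hence "(*) (of_nat N) ` ?X <= ?Y" by blast
 hence "finite ((*) (of_nat N) ` ?X)" using northcott_integral[OF K] finite_subset by blast
 thus ?thesis by(rule finite_imageD) (use N in \<open>auto intro: inj_onI\<close>)
qed

section \<open>Specialization into formal power series over a number field\<close>

unbundle no vec_syntax

lemma poly_taylor2:
 fixes F :: "'a::idom poly"
 obtains q where "poly F (x + y) = poly F x + y * poly (pderiv F) x + y\<^sup>2 * q"
proof -
 have "EX q. poly F (x + y) = poly F x + y * poly (pderiv F) x + y\<^sup>2 * q"
 proof(induction F)
  case (pCons a G)
  then obtain q where q: "poly G (x + y) = poly G x + y * poly (pderiv G) x + y\<^sup>2 * q" by blast
  have "poly (pCons a G) (x + y) = poly (pCons a G) x + y * poly (pderiv (pCons a G)) x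
    + y\<^sup>2 * (poly (pderiv G) x + (x + y) * q)"
   by(simp add: q pderiv_pCons algebra_simps power2_eq_square)
  thus ?case by blast
 qed(auto intro: exI[of _ 0])
 thus thesis using that by blast
qed

lemma diff_dvd_poly_diff:
 fixes F :: "'a::comm_ring_1 poly"
 shows "(x - y) dvd (poly F x - poly F y)"
proof(induction F)
 case (pCons a G)
 have "poly (pCons a G) x - poly (pCons a G) y = x * (poly G x - poly G y) + (x - y) * poly G y"
  by(simp add: algebra_simps)
 thus ?case using pCons by simp
qed auto

lemma fps_X_power_dvd_iff:
 fixes a :: "'a::comm_ring_1 fps"
 shows "fps_X^n dvd a \<longleftrightarrow> (ALL i<n. a$i = 0)"
proof
 assume "ALL i<n. a$i = 0"
 hence "a = fps_X^n * Abs_fps (%i. a$(i + n))" by(intro fps_ext) (simp add: fps_X_power_mult_nth)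
 thus "fps_X^n dvd a" by(rule dvdI)
qed(auto elim!: dvdE simp: fps_X_power_mult_nth)

lemma ring_hom_on_fps_nth_0: "ring_hom_on A (%f :: 'a::comm_ring_1 fps. f$0)" by(auto simp: ring_hom_on_def)

abbreviation const_terms :: "'a::zero fps poly => 'a poly" where
 "const_terms F \<equiv> map_poly (%c. c$0) F"

lemma poly_fps_nth_0: "poly F (x :: 'a::comm_ring_1 fps) $ 0 = poly (const_terms F) (x$0)"
 using ring_hom_on_poly[OF ring_hom_on_fps_nth_0 subring_UNIV, of F x] by(simp add: polys_over_def)

lemma pderiv_const_terms: "pderiv (const_terms (F :: 'a::idom fps poly)) = const_terms (pderiv F)"
 using map_poly_pderiv_ring_hom_on[OF ring_hom_on_fps_nth_0 subring_UNIV, of F]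
 by(simp add: polys_over_UNIV)

lemma hensel_step:
 fixes F :: "'a::field fps poly"
 assumes root: "ALL i<=n. poly F x $ i = 0" and simple: "poly (pderiv F) x $ 0 ~= 0"
 obtains c where "ALL i<=Suc n. poly F (x + fps_X^Suc n * fps_const c) $ i = 0"
proof -
 define c where "c = - (poly F x $ Suc n) / poly (pderiv F) x $ 0"
 obtain q where "poly F (x + fps_X^Suc n * fps_const c)
   = poly F x + (fps_X^Suc n * fps_const c) * poly (pderiv F) x + (fps_X^Suc n * fps_const c)\<^sup>2 * q"
  using poly_taylor2 .
 hence expansion: "poly F (x + fps_X^Suc n * fps_const c) = poly F x
   + fps_X^Suc n * (fps_const c * poly (pderiv F) x + fps_X * (fps_X^n * (fps_const c)\<^sup>2 * q))"
  by(simp add: power2_eq_square algebra_simps)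
 have "poly F (x + fps_X^Suc n * fps_const c) $ i = 0" if "i <= Suc n" for i
  using that root simple unfolding expansion fps_add_nth fps_X_power_mult_nth
  by(cases "i = Suc n") (auto simp: c_def)
 thus thesis using that by blast
qed

lemma hensel:
 fixes F :: "'a::field fps poly"
 assumes root: "poly (const_terms F) r = 0" and simple: "poly (pderiv (const_terms F)) r ~= 0"
 obtains x where "x$0 = r" "poly F x = 0"
proof -
 define P where "P n x \<longleftrightarrow> x$0 = r & (ALL i<=n. poly F x $ i = 0)" for n x
 have "EX X. ALL n. P n (X n) & (ALL i<=n. X (Suc n) $ i = X n $ i)"
 proof(rule dependent_nat_choice)
  show "EX x. P 0 x" using root by(intro exI[of _ "fps_const r"]) (simp add: P_def poly_fps_nth_0)
  fix x n assume x: "P n x"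
  hence "poly (pderiv F) x $ 0 ~= 0" using simple by(simp add: P_def poly_fps_nth_0 pderiv_const_terms)
  then obtain c where "ALL i<=Suc n. poly F (x + fps_X^Suc n * fps_const c) $ i = 0"
   using x hensel_step unfolding P_def by blast
  moreover have "(x + fps_X^Suc n * fps_const c) $ i = x$i" if "i <= n" for i
   using that by(simp add: fps_X_power_mult_nth del: power_Suc)
  ultimately show "EX x'. P (Suc n) x' & (ALL i<=n. x'$i = x$i)"
   using x by(intro exI[of _ "x + fps_X^Suc n * fps_const c"]) (auto simp: P_def)
 qed
 then obtain X where X: "!!n. P n (X n)" "!!n i. i <= n ==> X (Suc n) $ i = X n $ i" by blast
 define x where "x = Abs_fps (%n. X n $ n)"
 have stable: "X (n + k) $ i = X n $ i" if "i <= n" for n k i using that by(induction k) (auto simp: X(2))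
 have agree: "x$i = X n $ i" if "i <= n" for i n using stable[of i i "n - i"] that by(simp add: x_def)
 have "poly F x $ n = 0" for n
 proof -
  have "fps_X^Suc n dvd (x - X n)" unfolding fps_X_power_dvd_iff using agree by auto
  hence "fps_X^Suc n dvd (poly F x - poly F (X n))" using diff_dvd_poly_diff dvd_trans by blast
  thus ?thesis using X(1)[of n] unfolding fps_X_power_dvd_iff P_def by simp
 qed
 hence "poly F x = 0" by(intro fps_ext) simp
 moreover have "x$0 = r" using X(1)[of 0] by(simp add: x_def P_def)
 ultimately show thesis using that by blast
qed

text \<open>The constant terms take values in a number field, where places can be used; the whole series keep
 \<open>phi\<close> injective, so that no relation between words is created.\<close>

definition fps_specialization :: "complex set => complex set => (complex => complex fps) => bool" where
 "fps_specialization K A phi \<longleftrightarrow> number_field K & subring A & countable A & ring_hom_on A phi &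
  (ALL a:A. a ~= 0 --> phi a ~= 0) & (ALL a:A. phi a $ 0 : K)"

lemma fps_specializationD:
 assumes "fps_specialization K A phi"
 shows "number_field K" "subring A" "countable A" "ring_hom_on A phi"
  "a:A ==> a ~= 0 ==> phi a ~= 0" "a:A ==> phi a $ 0 : K" "ring_hom_on A (%a. phi a $ 0)"
 using assms by(auto simp: fps_specialization_def ring_hom_on_def)

lemma const_terms_map_poly:
 assumes "fps_specialization K A phi"
 shows "const_terms (map_poly phi p) = map_poly (%a. phi a $ 0) p"
 using ring_hom_on_zero[OF fps_specializationD(4,2)[OF assms]]
 by(intro poly_eqI) (simp add: coeff_map_poly)

lemma map_const_terms_in_polys_over:
 assumes "fps_specialization K A phi" "p:polys_over A"
 shows "map_poly (%a. phi a $ 0) p : polys_over K"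
 using assms fps_specializationD(6) ring_hom_on_zero[OF fps_specializationD(4,2)[OF assms(1)]]
 by(simp add: polys_over_def coeff_map_poly)

lemma exists_nat_nonroot:
 fixes f :: "'a::{idom,ring_char_0} poly"
 assumes "f ~= 0"
 obtains q :: nat where "q >= 2" "poly f (of_nat q) ~= 0"
proof -
 have "finite (of_nat -` {z. poly f z = 0} :: nat set)" using assms by(intro finite_vimageI poly_roots_finite) auto
 then obtain m where "!!q. poly f (of_nat q) = 0 ==> q < m" unfolding finite_nat_set_iff_bounded by auto
 thus thesis using that[of "max 2 m"] by fastforce
qed

lemma exists_generic_fps:
 assumes P: "countable P" "0 ~: P"
 obtains xi :: "complex fps" where "xi$0 = c" "!!p. p:P ==> poly p xi ~= 0"
proof -
 define xi where "xi tau = fps_const c + fps_const tau * fps_X" for tau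
 have xi: "xi tau $ 1 = tau" "xi tau $ 0 = c" for tau by(simp_all add: xi_def)
 have "finite {tau. poly p (xi tau) = 0}" if "p:P" for p
 proof -
  have "inj xi" by(metis injI xi(1))
  hence "finite (xi -` {z. poly p z = 0})" using that P(2) by(intro finite_vimageI poly_roots_finite) auto
  thus ?thesis by simp
 qed
 hence "countable (\<Union>p\<in>P. {tau. poly p (xi tau) = 0})"
  using P(1) by(intro countable_UN) (auto intro: countable_finite)
 hence "(\<Union>p\<in>P. {tau. poly p (xi tau) = 0}) ~= UNIV" using uncountable_UNIV_complex by auto
 then obtain tau where "!!p. p:P ==> poly p (xi tau) ~= 0" by blast
 thus thesis using that xi(2) by blast
qed

lemma fps_specialization_adjoin:
 assumes sp: "fps_specialization K A phi" and K': "number_field K'" "K <= K'" "xi$0 : K'"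
  and hom: "ring_hom_on (adjoin A x) phi'"
  and eval: "!!f. f:polys_over A ==> phi' (poly f x) = poly (map_poly phi f) xi"
  and inj: "!!f. f:polys_over A ==> poly f x ~= 0 ==> poly (map_poly phi f) xi ~= 0"
 shows "fps_specialization K' (adjoin A x) phi'"
 unfolding fps_specialization_def
proof(intro conjI ballI impI K' hom)
 note A = fps_specializationD(2)[OF sp]
 show "subring (adjoin A x)" by(rule subring_adjoin[OF A])
 show "countable (adjoin A x)" unfolding adjoin_def
  using countable_polys_over[OF fps_specializationD(3)[OF sp]] by(rule countable_image)
 fix a assume "a:adjoin A x"
 then obtain p where p: "p:polys_over A" "a = poly p x" by(auto simp: adjoin_def)
 show "phi' a ~= 0" if "a ~= 0" using that p eval inj by simp
 have "map_poly (%a. phi a $ 0) p : polys_over K'"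
  using map_const_terms_in_polys_over[OF sp p(1)] polys_over_mono[OF K'(2)] by blast
 thus "phi' a $ 0 : K'" using poly_in_subring[OF number_field_subring[OF K'(1)] _ K'(3)] p eval
  by(simp add: poly_fps_nth_0 const_terms_map_poly[OF sp])
qed

lemma fps_specialization_transcendental:
 assumes sp: "fps_specialization K A phi"
  and trans: "!!f. f:polys_over A ==> poly f x = 0 ==> f = 0"
  and f: "f:polys_over A" "phi (lead_coeff f) $ 0 ~= 0"
 obtains phi' q where "fps_specialization K (adjoin A x) phi'" "!!a. a:A ==> phi' a = phi a"
  "phi' (poly f x) $ 0 ~= 0" "q >= 2" "phi' x $ 0 = of_nat q"
proof -
 note A = fps_specializationD(2)[OF sp] and hom = fps_specializationD(4)[OF sp]
 note hom_simps = ring_hom_on_simps[OF hom A]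
 define f0 where "f0 = map_poly (%a. phi a $ 0) f"
 have "coeff f0 (degree f) ~= 0" using f(2) by(simp add: f0_def coeff_map_poly hom_simps)
 hence "f0 ~= 0" by auto
 then obtain q where q: "q >= 2" "poly f0 (of_nat q) ~= 0" by(rule exists_nat_nonroot)
 have nonzero: "map_poly phi p ~= 0" if p: "p:polys_over A" "p ~= 0" for p
 proof -
  have "coeff (map_poly phi p) (degree p) ~= 0"
   using p fps_specializationD(5)[OF sp] by(simp add: coeff_map_poly hom_simps polys_over_coeff)
  thus ?thesis by auto
 qed
 have "countable (map_poly phi ` (polys_over A - {0}))"
  using countable_polys_over[OF fps_specializationD(3)[OF sp]] by(intro countable_image) auto
 moreover have "0 ~: map_poly phi ` (polys_over A - {0})" using nonzero by force
 ultimately obtain xi where xi: "xi$0 = of_nat q"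
  "!!p. p:map_poly phi ` (polys_over A - {0}) ==> poly p xi ~= 0"
  using exists_generic_fps by metis
 have zero: "poly (map_poly phi p) xi = 0" if "p:polys_over A" "poly p x = 0" for p using trans[OF that] by simp
 show thesis
 proof(rule ring_hom_on_extend_root[OF A hom zero])
  fix phi' assume phi': "ring_hom_on (adjoin A x) phi'" "!!a. a:A ==> phi' a = phi a" "phi' x = xi"
   "!!f. f:polys_over A ==> phi' (poly f x) = poly (map_poly phi f) xi"
  note K = fps_specializationD(1)[OF sp]
  have "xi$0 : K" unfolding xi(1) by(rule subring_of_nat[OF number_field_subring[OF K]])
  hence "fps_specialization K (adjoin A x) phi'"
   using fps_specialization_adjoin[OF sp K order_refl _ phi'(1,4)] xi(2) by fastforce
  moreover have "phi' (poly f x) $ 0 ~= 0"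
   using phi'(4)[OF f(1)] q(2) xi(1) by(simp add: poly_fps_nth_0 const_terms_map_poly[OF sp] f0_def)
  ultimately show thesis using that phi'(2,3) q(1) xi(1) by blast
 qed
qed

lemma poly_pderiv_min_poly_nonzero:
 fixes x :: "'a::{idom,ring_char_0}"
 assumes "subring A" and m: "min_poly A x m"
 shows "poly (pderiv m) x ~= 0"
proof
 have "degree (pderiv m) < degree m" using min_poly_degree[OF m] by(simp add: degree_pderiv)
 moreover assume "poly (pderiv m) x = 0"
 ultimately have "pderiv m = 0" using min_polyD(4)[OF m] pderiv_in_polys_over[OF assms(1) min_polyD(1)[OF m]] by blast
 thus False using min_poly_degree[OF m] by(simp add: pderiv_eq_0_iff)
qed

lemma bezout_root_map_min_poly_nonzero:
 fixes e :: "'a::idom => 'b::idom"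
 assumes A: "subring A" and e: "ring_hom_on A e" and m: "min_poly A x m" "e (lead_coeff m) ~= 0"
  and g: "g:polys_over A" and h: "h:polys_over A" "c:A" "poly h x * poly g x = c" "e c ~= 0"
  and root: "poly (map_poly e m) xi = 0"
 shows "poly (map_poly e g) xi ~= 0"
proof -
 note closed = subring_closed[OF subring_polys_over[OF A]] const_in_polys_over[OF A]
 note hom = ring_hom_on_simps[OF ring_hom_on_map_poly[OF e A] subring_polys_over[OF A]]
 have "poly (h * g - [:c:]) x = 0" using h(3) by simp
 hence "poly (map_poly e (h * g - [:c:])) xi = 0" by(intro root_of_map_min_poly[OF A e m root] closed g h)
 moreover have "map_poly e (h * g - [:c:]) = map_poly e h * map_poly e g - [:e c:]"
  using closed g h ring_hom_on_zero[OF e A] by(simp add: hom map_poly_pCons)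
 ultimately show ?thesis using h(4) by auto
qed

lemma fps_specialization_algebraic:
 assumes sp: "fps_specialization K A phi" and m: "min_poly A x m" "phi (lead_coeff m) $ 0 ~= 0"
  and h: "h:polys_over A" "c:A" "poly h x * poly (pderiv m) x = c" "phi c $ 0 ~= 0"
 obtains K' phi' where "fps_specialization K' (adjoin A x) phi'" "!!a. a:A ==> phi' a = phi a"
proof -
 note A = fps_specializationD(2)[OF sp] and hom = fps_specializationD(4)[OF sp]
 note K = fps_specializationD(1)[OF sp] and e = fps_specializationD(7)[OF sp]
 define m0 where "m0 = map_poly (%a. phi a $ 0) m"
 have deg: "degree m0 = degree m" unfolding m0_def using m(2) by(intro map_poly_degree_eq) simp
 then obtain xi0 where xi0: "poly m0 xi0 = 0" using alg_closed_imp_poly_has_root min_poly_degree[OF m(1)] by metis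
 have "poly (pderiv m0) xi0 ~= 0"
  using bezout_root_map_min_poly_nonzero[OF A e m _ h xi0[unfolded m0_def]] min_polyD(1)[OF m(1)]
  by(simp add: m0_def pderiv_in_polys_over[OF A] flip: map_poly_pderiv_ring_hom_on[OF e A])
 then obtain xi where xi: "xi$0 = xi0" "poly (map_poly phi m) xi = 0"
  using hensel[of "map_poly phi m" xi0] xi0 by(auto simp: const_terms_map_poly[OF sp] m0_def)
 have lead: "phi (lead_coeff m) ~= 0" using m(2) by auto
 show thesis
 proof(rule ring_hom_on_extend_root[OF A hom root_of_map_min_poly[OF A hom m(1) lead xi(2)]])
  fix phi' assume phi': "ring_hom_on (adjoin A x) phi'" "!!a. a:A ==> phi' a = phi a"
   "!!f. f:polys_over A ==> phi' (poly f x) = poly (map_poly phi f) xi"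
  have "m0:polys_over K" "m0 ~= 0"
   using map_const_terms_in_polys_over[OF sp min_polyD(1)[OF m(1)]] deg min_poly_degree[OF m(1)]
   by(auto simp: m0_def)
  hence "number_field (adjoin K xi0)" using number_field_adjoin[OF K _ _ xi0] by blast
  moreover have "poly (map_poly phi f) xi ~= 0" if f: "f:polys_over A" "poly f x ~= 0" for f
  proof -
   obtain g w where w: "g:polys_over A" "w:A" "w ~= 0" "poly g x * poly f x = w"
    using min_poly_bezout[OF A m(1) f] .
   thus ?thesis using bezout_root_map_min_poly_nonzero[OF A hom m(1) lead f(1) w(1,2,4) _ xi(2)]
    fps_specializationD(5)[OF sp] by blast
  qed
  ultimately have "fps_specialization (adjoin K xi0) (adjoin A x) phi'"
   using fps_specialization_adjoin[OF sp _ _ _ phi'(1,3)] subring_adjoin[OF number_field_subring[OF K]] xi(1)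
   by blast
  thus thesis using that phi'(2) by blast
 qed
qed

definition specializable :: "(complex => bool) => complex => complex set => bool" where
 "specializable R l A \<longleftrightarrow> subring A & l:A & (ALL u:A. u ~= 0 -->
  (EX K phi. fps_specialization K A phi & phi u $ 0 ~= 0 & R (phi l $ 0)))"

lemma specializable_obtain:
 assumes "specializable R l A" "u:A" "u ~= 0"
 obtains K phi where "fps_specialization K A phi" "phi u $ 0 ~= 0" "R (phi l $ 0)"
 using assms unfolding specializable_def by blast

lemma specializable_adjoin_algebraic:
 assumes A: "specializable R l A" and m: "min_poly A x m" and v: "v:adjoin A x" "v ~= 0"
 shows "EX K phi. fps_specialization K (adjoin A x) phi & phi v $ 0 ~= 0 & R (phi l $ 0)"
proof -
 have sub: "subring A" "l:A" using A by(auto simp: specializable_def)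
 note closed = subring_closed[OF sub(1)] and m' = min_polyD(1)[OF m]
 obtain f where f: "f:polys_over A" "v = poly f x" using v by(auto simp: adjoin_def)
 obtain g c where g: "g:polys_over A" "c:A" "c ~= 0" "poly g x * poly f x = c"
  using min_poly_bezout[OF sub(1) m f(1)] v f by metis
 obtain h d where h: "h:polys_over A" "d:A" "d ~= 0" "poly h x * poly (pderiv m) x = d"
  using min_poly_bezout[OF sub(1) m pderiv_in_polys_over[OF sub(1) m'] poly_pderiv_min_poly_nonzero[OF sub(1) m]] .
 have l: "lead_coeff m : A" using m' by(simp add: polys_over_coeff)
 have "lead_coeff m * (c * d) : A" "lead_coeff m * (c * d) ~= 0" using l g h min_polyD(2)[OF m] closed(6) by auto
 then obtain K phi where phi: "fps_specialization K A phi" "phi (lead_coeff m * (c * d)) $ 0 ~= 0" "R (phi l $ 0)"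
  using specializable_obtain[OF A] by blast
 hence nz: "phi (lead_coeff m) $ 0 ~= 0" "phi c $ 0 ~= 0" "phi d $ 0 ~= 0"
  using ring_hom_on_mult[OF fps_specializationD(4,2)[OF phi(1)]] closed(6) l g(2) h(2) by auto
 obtain K' phi' where phi': "fps_specialization K' (adjoin A x) phi'" "!!a. a:A ==> phi' a = phi a"
  using fps_specialization_algebraic[OF phi(1) m nz(1) h(1,2,4) nz(3)] by blast
 have "phi' c = phi' (poly g x) * phi' v"
  using ring_hom_on_mult[OF fps_specializationD(4,2)[OF phi'(1)], of "poly g x" v] g v f
  by(auto simp: adjoin_def)
 hence "phi' v $ 0 ~= 0" using nz(2) phi'(2)[OF g(2)] by auto
 thus ?thesis using phi' phi(3) sub(2) by metis
qed

lemma specializable_adjoin: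
 assumes A: "specializable R l A"
 shows "specializable R l (adjoin A x)"
proof -
 have sub: "subring A" "l:A" using A by(auto simp: specializable_def)
 have "EX K phi. fps_specialization K (adjoin A x) phi & phi v $ 0 ~= 0 & R (phi l $ 0)"
  if v: "v:adjoin A x" "v ~= 0" for v
 proof(cases "EX m. min_poly A x m")
  case True
  thus ?thesis using specializable_adjoin_algebraic[OF A _ v] by blast
 next
  case False
  hence trans: "f = 0" if "f:polys_over A" "poly f x = 0" for f using min_poly_exists that by blast
  obtain f where f: "f:polys_over A" "v = poly f x" using v by(auto simp: adjoin_def)
  have "lead_coeff f : A" "lead_coeff f ~= 0" using f v by(auto simp: polys_over_coeff)
  then obtain K phi where phi: "fps_specialization K A phi" "phi (lead_coeff f) $ 0 ~= 0" "R (phi l $ 0)"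
   using specializable_obtain[OF A] by blast
  from fps_specialization_transcendental[OF phi(1) trans f(1) phi(2)] show ?thesis using phi(3) sub(2) f(2) by metis
 qed
 thus ?thesis using subring_adjoin[OF sub(1), of x] sub(2) by(auto simp: specializable_def)
qed

lemma specializable_insert_finite:
 assumes "finite L" and A: "specializable R l A"
 obtains B where "specializable R l B" "A <= B" "L <= B"
proof -
 have "EX B. specializable R l B & A <= B & L <= B" using assms(1)
 proof(induction L)
  case (insert x L)
  then obtain B where B: "specializable R l B" "A <= B" "L <= B" by blast
  thus ?case using specializable_adjoin[OF B(1), of x] subring_adjoin[of B x]
   by(intro exI[of _ "adjoin B x"]) (auto simp: specializable_def)
 qed(use A in auto)
 thus thesis using that by blast
qed

lemma fps_specialization_Ints: "fps_specialization \<rat> \<int> fps_const"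
proof -
 have "countable (\<int> :: complex set)" unfolding Ints_def by(rule countable_image) simp
 thus ?thesis unfolding fps_specialization_def
  using number_field_Rats Ints_subset_Rats subring_Ints by(auto simp: ring_hom_on_def)
qed

theorem fps_specialization_exists:
 assumes "finite L"
 obtains K A phi where "L <= A" "fps_specialization K A phi"
proof -
 have "specializable (%_. True) 1 \<int>" using fps_specialization_Ints subring_Ints
  by(auto simp: specializable_def intro!: exI[of _ \<rat>] exI[of _ fps_const])
 then obtain B where B: "specializable (%_. True) 1 B" "L <= B" using specializable_insert_finite[OF assms] by metis
 moreover have "1:B" using B(1) by(simp add: specializable_def)
 ultimately show thesis using that specializable_obtain[OF B(1), of 1] zero_neq_one by metis
qed

lemma specializable_adjoin_transcendental:
 assumes "~ algebraic l"
 shows "specializable (%z. ALL n>0. z^n ~= 1) l (adjoin \<int> l)"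
 unfolding specializable_def
proof(intro conjI ballI impI)
 fix u assume u: "u:adjoin \<int> l" "u ~= 0"
 have trans: "f = 0" if "f:polys_over \<int>" "poly f l = 0" for f
  using assms that by(auto simp: algebraic_def polys_over_def)
 obtain f where f: "f:polys_over \<int>" "u = poly f l" using u by(auto simp: adjoin_def)
 have "fps_const (lead_coeff f) $ 0 ~= 0" using f u by auto
 from fps_specialization_transcendental[OF fps_specialization_Ints trans f(1) this] obtain phi q where
  phi: "fps_specialization \<rat> (adjoin \<int> l) phi" "phi u $ 0 ~= 0" "q >= 2" "phi l $ 0 = of_nat q"
  unfolding f(2) by metis
 have "(of_nat q :: complex)^n ~= 1" if "n > 0" for n
 proof -
  have "q^n ~= 1" using that phi(3) by simp
  thus ?thesis by(metis of_nat_1 of_nat_eq_iff of_nat_power)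
 qed
 thus "EX K phi. fps_specialization K (adjoin \<int> l) phi & phi u $ 0 ~= 0 & (ALL n>0. (phi l $ 0)^n ~= 1)"
  using phi by metis
qed(auto intro: subring_adjoin subring_Ints in_adjoin)

theorem fps_specialization_exists_nonroot_of_unity:
 assumes "finite L" and nonroot: "!!n. n > 0 ==> l^n ~= 1"
 obtains K A phi where "insert l L <= A" "fps_specialization K A phi" "!!n. n > 0 ==> (phi l $ 0)^n ~= 1"
proof(cases "algebraic l")
 case True
 obtain K A phi where sp: "insert l L <= A" "fps_specialization K A phi"
  using fps_specialization_exists[of "insert l L"] assms(1) by(metis finite_insert)
 note A = fps_specializationD(2)[OF sp(2)] and hom = fps_specializationD(7)[OF sp(2)]
 have l: "l:A" using sp(1) by simp
 obtain N where N: "N > (0::nat)" "algebraic_int (of_nat N * l)" using integral_multiple[OF True] .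
 have "(phi l $ 0)^n ~= 1" if n: "n > 0" for n
 proof -
  have "algebraic_int (of_nat (N^n) * (l^n - 1))"
  proof -
   have "algebraic_int ((of_nat N * l)^n)" by(induction n) (auto intro: algebraic_int_ring(1) N(2))
   moreover have "algebraic_int (of_nat (N^n) :: complex)" by(simp add: int_imp_algebraic_int)
   ultimately show ?thesis using algebraic_int_ring(3) by(simp add: power_mult_distrib algebra_simps)
  qed
  moreover have "of_nat (N^n) * (l^n - 1) ~= 0" "of_nat (N^n) * (l^n - 1) : A"
   using nonroot[OF n] N(1) l by(auto intro!: subring_closed[OF A])
  ultimately have "phi (of_nat (N^n) * (l^n - 1)) $ 0 ~= 0"
   using ring_hom_on_algebraic_nonzero[OF hom A] algebraic_int_imp_algebraic by blast
  thus ?thesis using ring_hom_on_simps[OF hom A] subring_closed[OF A] l by(auto simp del: of_nat_power)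
 qed
 thus thesis using that sp by blast
next
 case False
 obtain B where B: "specializable (%z. ALL n>0. z^n ~= 1) l B" "L <= B"
  using specializable_insert_finite[OF assms(1) specializable_adjoin_transcendental[OF False]] by blast
 have mem: "1:B" "l:B" using B(1) subring_one by(auto simp: specializable_def)
 obtain K phi where "fps_specialization K B phi" "ALL n>0. (phi l $ 0)^n ~= 1"
  using specializable_obtain[OF B(1) mem(1) one_neq_zero] by blast
 thus thesis using that B(2) mem(2) by blast
qed

section \<open>Homogeneous maps of the plane\<close>

declare split_paired_All [simp del] split_paired_Ex [simp del]

definition hform :: "nat => (nat => 'a::comm_ring_1) => 'a => 'a => 'a" where
 "hform d a x y = (\<Sum>i\<le>d. a i * x^i * y^(d - i))"

definition dehom :: "nat => (nat => 'a::comm_ring_1) => 'a poly" where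
 "dehom d a = (\<Sum>i\<le>d. monom (a i) i)"

lemma coeff_dehom: "coeff (dehom d a) i = (if i <= d then a i else 0)" by(auto simp: dehom_def coeff_sum)

lemma degree_dehom_le: "degree (dehom d a) <= d" by(rule degree_le) (simp add: coeff_dehom)

lemma hform_1: "hform d a x 1 = poly (dehom d a) x" by(simp add: dehom_def hform_def poly_sum poly_monom)

lemma hform_1_0: "hform d a 1 0 = a d"
proof -
 have "hform d a 1 0 = (\<Sum>i\<le>d. if i = d then a d else 0)"
  unfolding hform_def by(intro sum.cong) (auto simp: power_0_left)
 thus ?thesis by simp
qed

lemma hform_0_1: "hform d a 0 1 = a 0" by(simp add: hform_1 poly_0_coeff_0 coeff_dehom)

lemma hform_scale: "hform d a (c*x) (c*y) = c^d*hform d a x y"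
proof -
 have "a i*(c*x)^i*(c*y)^(d - i) = c^d*(a i*x^i*y^(d - i))" if "i <= d" for i
 proof -
  have "c^d = c^i*c^(d - i)" using that by(simp flip: power_add)
  thus ?thesis by(simp add: power_mult_distrib)
 qed
 thus ?thesis unfolding hform_def sum_distrib_left by(intro sum.cong) auto
qed

lemma hform_divide: "(y::'a::field) ~= 0 ==> hform d a x y = y^d * poly (dehom d a) (x / y)"
 using hform_scale[of d a y "x / y" 1] by(simp add: hform_1)

lemma hform_swap: "hform d a x y = hform d (%i. a (d - i)) y x"
proof -
 have "hform d a x y = (\<Sum>i\<le>d. a (d - i)*x^(d - i)*y^(d - (d - i)))" unfolding hform_def
   by(rule sum.reindex_bij_witness[of _ "%i. d - i" "%i. d - i"]) auto
 also have "... = hform d (%i. a (d - i)) y x" unfolding hform_def by(intro sum.cong) (auto simp: mult_ac)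
 finally show ?thesis .
qed

lemma hform_eq_0_if_dehom_roots:
 fixes x :: "'a::{idom,ring_char_0}"
 assumes "!!z. hform d a z 1 = 0"
 shows "hform d a x y = 0"
proof -
 have "dehom d a = 0" using assms poly_all_0_iff_0 by(auto simp: hform_1)
 hence "a i = 0" if "i <= d" for i using that coeff_dehom[of d a i] by simp
 thus ?thesis by(simp add: hform_def)
qed

lemma ring_hom_on_hform:
 assumes "ring_hom_on A phi" "subring A" "!!i. i <= d ==> a i : A" "x:A" "y:A"
 shows "phi (hform d a x y) = hform d (%i. phi (a i)) (phi x) (phi y)" "hform d a x y : A"
proof -
 note closed = subring_closed[OF assms(2)] and hom = ring_hom_on_simps[OF assms(1,2)]
 have mem: "a i * x^i * y^(d - i) : A" if "i <= d" for i by(intro closed assms that)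
 show "hform d a x y : A" unfolding hform_def using mem by(intro subring_sum[OF assms(2)]) auto
 have "phi (hform d a x y) = (\<Sum>i\<le>d. phi (a i * x^i * y^(d - i)))"
  unfolding hform_def using mem by(intro ring_hom_on_sum[OF assms(1,2)]) auto
 also have "... = hform d (%i. phi (a i)) (phi x) (phi y)" unfolding hform_def
  using assms by(intro sum.cong) (simp_all add: hom closed)
 finally show "phi (hform d a x y) = hform d (%i. phi (a i)) (phi x) (phi y)" .
qed

lemma hform_in_subring:
 "subring A ==> (!!i. i <= d ==> a i : A) ==> x:A ==> y:A ==> hform d a x y : A"
 by(rule ring_hom_on_hform(2)[OF ring_hom_on_id])

definition is_hform :: "nat => ('a::comm_ring_1 => 'a => 'a) => bool" where
 "is_hform d f \<longleftrightarrow> (EX a. ALL x y. f x y = hform d a x y)"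

lemma is_hform_linear: "is_hform 1 (%x y. p * x + q * y)"
 unfolding is_hform_def by(intro exI[of _ "%i. if i = 1 then p else q"]) (auto simp: hform_def)

lemma is_hform_const: "is_hform 0 (%x y. c)" unfolding is_hform_def by(intro exI[of _ "%i. c"]) (auto simp: hform_def)

lemma is_hform_add:
 assumes "is_hform d f" "is_hform d g"
 shows "is_hform d (%x y. f x y + g x y)"
proof -
 obtain a b where "ALL x y. f x y = hform d a x y" "ALL x y. g x y = hform d b x y"
  using assms by(auto simp: is_hform_def)
 thus ?thesis unfolding is_hform_def by(intro exI[of _ "%i. a i + b i"]) (auto simp: hform_def algebra_simps sum.distrib)
qed

lemma is_hform_mult:
 assumes "is_hform d f" "is_hform e g"
 shows "is_hform (d + e) (%x y. f x y * g x y)"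
proof -
 obtain a b where a: "!!x y. f x y = hform d a x y" and b: "!!x y. g x y = hform e b x y"
  using assms by(auto simp: is_hform_def)
 define c where "c k = (\<Sum>(i,j)\<in>{(i,j) : {..d}\<times>{..e}. i + j = k}. a i * b j)" for k
 have "f x y * g x y = hform (d + e) c x y" for x y
 proof -
  have term_eq: "(a i * x^i * y^(d - i)) * (b j * x^j * y^(e - j)) = a i * b j * x^(i + j) * y^(d + e - (i + j))"
   if "i <= d" "j <= e" for i j
  proof -
   have "d + e - (i + j) = (d - i) + (e - j)" using that by simp
   thus ?thesis by(simp add: power_add)
  qed
  have "f x y * g x y = (\<Sum>(i,j)\<in>{..d}\<times>{..e}. (a i * x^i * y^(d - i)) * (b j * x^j * y^(e - j)))"
   unfolding a b hform_def sum_product sum.cartesian_product by simp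
  also have "... = (\<Sum>(i,j)\<in>{..d}\<times>{..e}. a i * b j * x^(i + j) * y^(d + e - (i + j)))"
   using term_eq by(intro sum.cong) auto
  also have "... = (\<Sum>k\<le>d + e. \<Sum>(i,j)\<in>{z:{..d}\<times>{..e}. fst z + snd z = k}.
    a i * b j * x^(i + j) * y^(d + e - (i + j)))"
   by(rule sum.group[symmetric]) auto
  also have "... = hform (d + e) c x y" unfolding hform_def c_def sum_distrib_right
   by(intro sum.cong) (auto intro!: sum.cong)
  finally show ?thesis .
 qed
 thus ?thesis by(auto simp: is_hform_def)
qed

lemma is_hform_power: "is_hform d f ==> is_hform (n * d) (%x y. f x y^n)"
 by(induction n) (auto intro: is_hform_const is_hform_mult)

lemma is_hform_sum:
 "finite I ==> (!!i. i:I ==> is_hform d (f i)) ==> is_hform d (%x y. \<Sum>i\<in>I. f i x y)"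
proof(induction I rule: finite_induct)
 case empty
 show ?case unfolding is_hform_def by(intro exI[of _ "%_. 0"]) (auto simp: hform_def)
qed(auto intro: is_hform_add)

lemma is_hform_comp:
 assumes "is_hform e f" "is_hform e g"
 shows "is_hform (d * e) (%x y. hform d a (f x y) (g x y))"
 unfolding hform_def
proof(rule is_hform_sum)
 fix i assume "i:{..d}"
 hence "d * e = (0 + i * e) + (d - i) * e" by(simp flip: add_mult_distrib)
 moreover have "is_hform ((0 + i * e) + (d - i) * e) (%x y. a i * f x y^i * g x y^(d - i))"
  by(intro is_hform_mult is_hform_power is_hform_const assms)
 ultimately show "is_hform (d * e) (%x y. a i * f x y^i * g x y^(d - i))" by simp
qed simp

lemma is_hform_eqI:
 fixes f g :: "'a::{idom,ring_char_0} => 'a => 'a"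
 assumes "is_hform d f" "is_hform d g" "!!z. f z 1 = g z 1"
 shows "f x y = g x y"
proof -
 have "is_hform (0 + d) (%x y. -1 * g x y)" by(intro is_hform_mult is_hform_const assms)
 hence "is_hform d (%x y. f x y + -1 * g x y)" using assms(1) by(intro is_hform_add) simp_all
 then obtain c where c: "!!x y. f x y + -1 * g x y = hform d c x y" unfolding is_hform_def by blast
 have "hform d c z 1 = 0" for z using c[of z 1] assms(3)[of z] by simp
 hence "hform d c x y = 0" by(rule hform_eq_0_if_dehom_roots)
 thus ?thesis using c[of x y] by simp
qed

definition hmap :: "nat => (nat => 'a::comm_ring_1) => (nat => 'a) => 'a * 'a => 'a * 'a" where
 "hmap d a b X = (hform d a (fst X) (snd X), hform d b (fst X) (snd X))"

definition wedge :: "'a::comm_ring_1 * 'a => 'a * 'a => 'a" where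
 "wedge X Y = fst X * snd Y - snd X * fst Y"

definition scale :: "'a::comm_ring_1 => 'a * 'a => 'a * 'a" where
 "scale c X = (c * fst X, c * snd X)"

definition lin :: "'a::comm_ring_1 => 'a => 'a => 'a => 'a * 'a => 'a * 'a" where
 "lin p q r s X = (p * fst X + q * snd X, r * fst X + s * snd X)"

definition nondegenerate :: "nat => (nat => 'a::comm_ring_1) => (nat => 'a) => bool" where
 "nondegenerate d a b \<longleftrightarrow> (ALL X. hmap d a b X = (0,0) --> X = (0,0))"

lemma wedge_self [simp]: "wedge X X = 0" by(simp add: wedge_def)

lemma wedge_commute: "wedge X Y = - wedge Y X" by(simp add: wedge_def)

lemma wedge_scale [simp]: "wedge (scale c X) Y = c * wedge X Y" "wedge X (scale c Y) = c * wedge X Y"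
 by(simp_all add: wedge_def scale_def algebra_simps)

lemma wedge_zero_imp_scale:
 fixes X Y :: "'a::field * 'a"
 assumes "wedge X Y = 0" "Y ~= (0,0)"
 obtains c where "X = scale c Y"
proof(cases "fst Y = 0")
 case True
 hence "snd Y ~= 0" using assms(2) by(metis prod.collapse)
 thus thesis using that[of "snd X / snd Y"] assms(1) True by(auto simp: wedge_def scale_def prod_eq_iff)
next
 case False
 thus thesis using that[of "fst X / fst Y"] assms(1) by(auto simp: wedge_def scale_def)
qed

lemma wedge_trans:
 fixes X Y Z :: "'a::field * 'a"
 assumes "wedge X Y = 0" "wedge Y Z = 0" "Y ~= (0,0)"
 shows "wedge X Z = 0"
 using wedge_zero_imp_scale[OF assms(1,3)] assms(2) by(metis mult_zero_right wedge_scale(1))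

lemma wedge_one_exists:
 assumes "v ~= (0,0)"
 obtains v' where "wedge v v' = (1::'a::field)"
proof(cases "fst v = 0")
 case True
 hence "snd v ~= 0" using assms by(auto simp: prod_eq_iff)
 thus thesis using that[of "(-1 / snd v, 0)"] True by(simp add: wedge_def)
next
 case False
 thus thesis using that[of "(0, 1 / fst v)"] by(simp add: wedge_def)
qed

lemma scale_scale [simp]: "scale c (scale c' X) = scale (c * c') X" by(simp add: scale_def)

lemma scale_1 [simp]: "scale 1 X = X" by(simp add: scale_def)

lemma scale_eq_0_iff: "scale (c::'a::idom) X = (0,0) \<longleftrightarrow> c = 0 | X = (0,0)"
 by(auto simp: scale_def prod_eq_iff)

lemma hmap_scale: "hmap d a b (scale c X) = scale (c^d) (hmap d a b X)" by(simp add: hmap_def scale_def hform_scale)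

lemma scale_hmap: "hmap d (%i. c * a i) (%i. c * b i) X = scale c (hmap d a b X)"
 by(simp add: hmap_def hform_def scale_def sum_distrib_left mult.assoc)

lemma wedge_lin: "wedge (lin p q r s X) (lin p q r s Y) = (p * s - q * r) * wedge X Y"
 by(simp add: wedge_def lin_def algebra_simps)

lemma lin_inverse:
 assumes "p * s - q * r = 1"
 shows "lin p q r s (lin s (-q) (-r) p X) = X" "lin s (-q) (-r) p (lin p q r s X) = X"
proof -
 have "p * (s * x) - q * (r * x) = x" for x using arg_cong[OF assms, of "%t. t * x"] by(simp add: algebra_simps)
 from this[of "fst X"] this[of "snd X"]
 show "lin p q r s (lin s (-q) (-r) p X) = X" "lin s (-q) (-r) p (lin p q r s X) = X" by(auto simp: lin_def algebra_simps)
qed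

lemma lin_add_scale: "lin p q r s (X + scale z E) = lin p q r s X + scale z (lin p q r s E)"
 by(simp add: lin_def scale_def algebra_simps)

lemma lin_scale: "lin p q r s (scale z X) = scale z (lin p q r s X)" by(simp add: lin_def scale_def algebra_simps)

lemma hmap_conj:
 obtains a' b' where "!!X. lin p q r s (hmap d a b (lin p' q' r' s' X)) = hmap d a' b' X"
proof -
 have forms: "is_hform d (%x y. c * hform d a (p' * x + q' * y) (r' * x + s' * y)
   + c' * hform d b (p' * x + q' * y) (r' * x + s' * y))" for c c'
 proof -
  have "is_hform (0 + d * 1) (%x y. k * hform d f (p' * x + q' * y) (r' * x + s' * y))" for k f
   by(intro is_hform_mult is_hform_const is_hform_comp is_hform_linear)
  thus ?thesis by(intro is_hform_add) simp_all
 qed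
 obtain a' b' where
  "!!x y. p * hform d a (p' * x + q' * y) (r' * x + s' * y)
   + q * hform d b (p' * x + q' * y) (r' * x + s' * y) = hform d a' x y"
  "!!x y. r * hform d a (p' * x + q' * y) (r' * x + s' * y)
   + s * hform d b (p' * x + q' * y) (r' * x + s' * y) = hform d b' x y"
  using forms[of p q] forms[of r s] unfolding is_hform_def by metis
 thus thesis using that[of a' b'] by(auto simp: lin_def hmap_def)
qed

lemma nondegenerate_nonzero: "nondegenerate d a b ==> X ~= (0,0) ==> hmap d a b X ~= (0,0)"
 unfolding nondegenerate_def by blast

lemma nondegenerate_swap:
 assumes "nondegenerate d a b"
 shows "nondegenerate d (%i. a (d - i)) (%i. b (d - i))"
 unfolding nondegenerate_def
proof(intro allI impI)
 fix X assume "hmap d (%i. a (d - i)) (%i. b (d - i)) X = (0,0)"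
 hence "hmap d a b (snd X, fst X) = (0,0)" by(simp add: hmap_def flip: hform_swap)
 hence "(snd X, fst X) = (0,0)" using assms unfolding nondegenerate_def by blast
 thus "X = (0,0)" by(auto simp: prod_eq_iff)
qed

lemma nondegenerate_conj:
 assumes conj: "!!X. hmap d a' b' X = lin p q r s (hmap d a b (lin s (-q) (-r) p X))"
  and det: "p * s - q * r = 1" and "nondegenerate d a b"
 shows "nondegenerate d a' b'"
 unfolding nondegenerate_def
proof(intro allI impI)
 have zero: "lin p q r s (0,0) = (0,0)" for p q r s :: 'a by(simp add: lin_def)
 fix X assume "hmap d a' b' X = (0,0)"
 hence "hmap d a b (lin s (-q) (-r) p X) = (0,0)" using conj lin_inverse(2)[OF det] zero by metis
 hence "lin s (-q) (-r) p X = (0,0)" using assms(3) unfolding nondegenerate_def by blast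
 thus "X = (0,0)" using lin_inverse(1)[OF det] zero by metis
qed

lemma nondegenerateI:
 fixes a b :: "nat => 'a::field"
 assumes "u * dehom d a + v * dehom d b = 1" and top: "a d ~= 0 | b d ~= 0"
 shows "nondegenerate d a b"
 unfolding nondegenerate_def
proof(intro allI impI)
 fix X assume X: "hmap d a b X = (0,0)"
 have "snd X = 0"
 proof(rule ccontr)
  assume y: "snd X ~= 0"
  hence "poly (dehom d a) (fst X / snd X) = 0" "poly (dehom d b) (fst X / snd X) = 0"
   using X by(auto simp: hmap_def hform_divide)
  thus False using arg_cong[OF assms(1), of "%p. poly p (fst X / snd X)"] by simp
 qed
 moreover have "hform d c (fst X) 0 = fst X^d * c d" for c using hform_scale[of d c "fst X" 1 0] by(simp add: hform_1_0)
 ultimately show "X = (0,0)" using X top by(auto simp: hmap_def prod_eq_iff)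
qed

lemma nondegenerate_top:
 assumes "nondegenerate d a b"
 shows "a d ~= 0 | b d ~= 0"
 using nondegenerate_nonzero[OF assms, of "(1,0)"] by(auto simp: hmap_def hform_1_0)

lemma nondegenerate_chart:
 assumes "nondegenerate d a b"
 shows "poly (dehom d a) z ~= 0 | poly (dehom d b) z ~= 0"
 using nondegenerate_nonzero[OF assms, of "(z,1)"] by(auto simp: hmap_def hform_1)

lemma coprime_dehom:
 fixes a b :: "nat => complex"
 assumes "nondegenerate d a b"
 shows "coprime (dehom d a) (dehom d b)"
proof(rule coprimeI)
 fix c assume c: "c dvd dehom d a" "c dvd dehom d b"
 have no_root: "poly c z ~= 0" for z using c nondegenerate_chart[OF assms, of z] by(auto elim!: dvdE)
 hence "degree c = 0" using alg_closed_imp_poly_has_root[of c] by blast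
 moreover have "c ~= 0" using no_root[of 0] by auto
 ultimately show "is_unit c" by(simp add: is_unit_iff_degree)
qed

lemma hform_zero_exists:
 fixes a :: "nat => complex"
 assumes "d > 0"
 obtains Y where "Y ~= (0,0)" "hform d a (fst Y) (snd Y) = 0"
proof(cases "a d = 0")
 case True
 thus thesis using that[of "(1,0)"] by(simp add: hform_1_0)
next
 case False
 hence "degree (dehom d a) >= d" by(intro le_degree) (simp add: coeff_dehom)
 then obtain z where "poly (dehom d a) z = 0" using alg_closed_imp_poly_has_root[of "dehom d a"] assms by auto
 thus thesis using that[of "(z,1)"] by(simp add: hform_1)
qed

lemma wedge_hmap_eq_hform:
 "wedge (hmap d a b Y) W = hform d (%i. a i * snd W - b i * fst W) (fst Y) (snd Y)"
 unfolding wedge_def hmap_def hform_def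
 by(simp add: sum_distrib_right flip: sum_subtractf) (simp add: algebra_simps)

lemma hmap_hits:
 fixes a b :: "nat => complex"
 assumes "d > 0"
 obtains Y where "Y ~= (0,0)" "wedge (hmap d a b Y) W = 0"
 using hform_zero_exists[OF assms] that by(metis wedge_hmap_eq_hform)

lemma proportional_if_coprime:
 fixes P Q P' Q' :: "complex poly"
 assumes "coprime P Q" and eq: "P * Q' = P' * Q"
 obtains R where "P' = R * P" "Q' = R * Q"
proof -
 have "Q dvd P * Q'" "P dvd P' * Q" using eq by(metis dvd_triv_left dvd_triv_right)+
 hence "Q dvd Q'" "P dvd P'"
  using assms(1) by(simp_all add: coprime_dvd_mult_right_iff coprime_dvd_mult_left_iff coprime_commute)
 then obtain R1 R2 where R: "Q' = Q * R1" "P' = P * R2" by(elim dvdE)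
 show thesis
 proof(cases "P = 0 | Q = 0")
  case True
  thus thesis using R that[of R1] that[of R2] by(auto simp: mult.commute)
 next
  case False
  have "P * Q * R1 = P * Q * R2" using eq R by(simp add: mult_ac)
  thus thesis using R that[of R1] False by(simp add: mult.commute)
 qed
qed

lemma proportional_hmaps:
 fixes p q p' q' :: "nat => complex"
 assumes nd: "nondegenerate e p q" and nd': "nondegenerate e' p' q'"
  and wedge: "!!z. wedge (hmap e p q (z,1)) (hmap e' p' q' (z,1)) = 0"
 obtains c where "e' = e" "c ~= 0" "!!X. hmap e' p' q' X = scale c (hmap e p q X)"
proof -
 have "poly (dehom e p * dehom e' q') z = poly (dehom e' p' * dehom e q) z" for z
  using wedge[of z] by(simp add: wedge_def hmap_def hform_1 mult_ac)
 hence "dehom e p * dehom e' q' = dehom e' p' * dehom e q" by(metis poly_eq_poly_eq_iff ext)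
 then obtain R where R: "dehom e' p' = R * dehom e p" "dehom e' q' = R * dehom e q"
  using proportional_if_coprime[OF coprime_dehom[OF nd]] by blast
 hence "is_unit R" using coprime_dehom[OF nd'] by(metis coprime_common_divisor dvd_triv_left)
 then obtain c where "R = [:c:]" "c dvd 1" unfolding is_unit_poly_iff by blast
 hence c: "R = [:c:]" "c ~= 0" by auto
 have coeffs: "coeff (dehom e' p') i = c * coeff (dehom e p) i"
  "coeff (dehom e' q') i = c * coeff (dehom e q) i" for i using R c by auto
 have "~ e < e'" using coeffs[of e'] nondegenerate_top[OF nd'] by(auto simp: coeff_dehom)
 moreover have "~ e' < e" using coeffs[of e] nondegenerate_top[OF nd] c(2) by(auto simp: coeff_dehom)
 ultimately have e: "e' = e" by simp
 have "p' i = c * p i" "q' i = c * q i" if "i <= e" for i using coeffs[of i] e that by(simp_all add: coeff_dehom)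
 hence "hform e p' x y = c * hform e p x y" "hform e q' x y = c * hform e q x y" for x y
  unfolding hform_def sum_distrib_left by(auto simp: mult.assoc intro!: sum.cong)
 hence "hmap e' p' q' X = scale c (hmap e p q X)" for X by(simp add: e hmap_def scale_def)
 thus thesis using that e c(2) by blast
qed

lemma hmap_not_identity:
 fixes a b :: "nat => complex"
 assumes d: "d >= 2" and nd: "nondegenerate d a b"
 obtains z where "wedge (hmap d a b (z,1)) (z,1) ~= 0"
proof -
 have False if "!!z. wedge (hmap d a b (z,1)) (z,1) = 0"
 proof -
  define p q where "p = dehom d a" and "q = dehom d b"
  have eval: "poly p z = z * poly q z" for z using that[of z] by(simp add: wedge_def hmap_def hform_1 p_def q_def)
  hence "p = [:0,1:] * q" by(intro iffD1[OF poly_eq_poly_eq_iff] ext) simp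
  hence shift: "coeff p (Suc i) = coeff q i" for i by simp
  have "poly q z ~= 0" for z using nondegenerate_chart[OF nd, of z] eval[of z] by(auto simp: p_def q_def)
  hence "degree q = 0" using alg_closed_imp_poly_has_root[of q] by blast
  hence "coeff q d = 0" "coeff q (d - 1) = 0" using d by(auto intro!: coeff_eq_0)
  moreover have "coeff p d = coeff q (d - 1)" using shift[of "d - 1"] d by simp
  ultimately show False using nondegenerate_top[OF nd] by(simp add: p_def q_def coeff_dehom)
 qed
 thus thesis using that by blast
qed

section \<open>Repelling periodic points\<close>

definition repelling_fixed :: "(complex * complex => complex * complex) => complex * complex => bool" where
 "repelling_fixed F X \<longleftrightarrow> X ~= (0,0) & (EX mu l. F X = scale mu X & mu ~= 0 & cmod l > 1 &
  (ALL E. ((%z. wedge (F (X + scale z E)) X) has_field_derivative l * mu * wedge E X) (at 0)))"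

lemma repelling_fixed_conj:
 assumes repelling: "repelling_fixed (%X. lin p q r s (F (lin s (-q) (-r) p X))) X" and det: "p * s - q * r = 1"
 shows "repelling_fixed F (lin s (-q) (-r) p X)"
proof -
 define L L' where "L = lin p q r s" and "L' = lin s (-q) (-r) p"
 have inverse: "L (L' X) = X" "L' (L X) = X" for X using lin_inverse[OF det] by(auto simp: L_def L'_def)
 have wedge_L: "wedge (L X) (L Y) = wedge X Y" for X Y using det by(simp add: L_def wedge_lin)
 obtain mu l where X: "X ~= (0,0)" and F: "L (F (L' X)) = scale mu X" and "mu ~= 0" "cmod l > 1"
  and deriv: "!!E. ((%z. wedge (L (F (L' (X + scale z E)))) X) has_field_derivative l * mu * wedge E X) (at 0)"
  using repelling unfolding repelling_fixed_def L_def L'_def by blast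
 moreover have "L (0,0) = (0,0)" by(simp add: L_def lin_def)
 hence "L' X ~= (0,0)" using X inverse(1) by metis
 moreover have "F (L' X) = scale mu (L' X)" using arg_cong[OF F, of L'] by(simp add: inverse) (simp add: L'_def lin_scale)
 moreover have "((%z. wedge (F (L' X + scale z E)) (L' X)) has_field_derivative l * mu * wedge E (L' X)) (at 0)" for E
 proof -
  have "L' (X + scale z (L E)) = L' X + scale z (L' (L E))" for z by(simp add: L'_def lin_add_scale)
  moreover have "wedge (L Y) X = wedge Y (L' X)" for Y using wedge_L[of Y "L' X"] by(simp add: inverse)
  ultimately show ?thesis using deriv[of "L E"] by(simp add: inverse)
 qed
 ultimately show ?thesis unfolding repelling_fixed_def L'_def[symmetric] by blast
qed

definition chart :: "'a::field * 'a => 'a" where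
 "chart X = fst X / snd X"

lemma chart_pair [simp]: "chart (z, 1) = z" by(simp add: chart_def)

lemma scale_snd_chart: "snd X ~= 0 ==> X = scale (snd X) (chart X, 1)" by(simp add: scale_def chart_def prod_eq_iff)

lemma chart_hmap:
 assumes "snd X ~= 0"
 shows "snd (hmap d a b X) = snd X^d * poly (dehom d b) (chart X)"
  "chart (hmap d a b X) = poly (dehom d a) (chart X) / poly (dehom d b) (chart X)"
 using assms by(auto simp: hmap_def chart_def hform_divide)

lemma hmap_pair: "hmap d a b (z, 1) = (poly (dehom d a) z, poly (dehom d b) z)" by(simp add: hmap_def hform_1)

lemma hmap_funpow_scale: "(hmap d a b ^^ n) (scale c X) = scale (c^(d^n)) ((hmap d a b ^^ n) X)"
 by(induction n) (simp_all add: hmap_scale flip: power_mult add: mult.commute)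

lemma hmap_funpow_nonzero: "nondegenerate d a b ==> X ~= (0,0) ==> (hmap d a b ^^ n) X ~= (0,0)"
 by(induction n) (auto simp: nondegenerate_nonzero)

lemma holomorphic_hmap_funpow:
 fixes a b :: "nat => complex"
 shows "(%z. fst ((hmap d a b ^^ n) (z,1))) holomorphic_on S" "(%z. snd ((hmap d a b ^^ n) (z,1))) holomorphic_on S"
proof(induction n)
 case (Suc n)
 { case 1 show ?case using Suc by(auto simp: hmap_def[of d a b] hform_def intro!: holomorphic_intros)
 next
  case 2 show ?case using Suc by(auto simp: hmap_def[of d a b] hform_def intro!: holomorphic_intros) }
qed(auto intro: holomorphic_intros)

lemma isCont_tendsto_nhds: "isCont f x ==> (f \<longlongrightarrow> f x) (nhds x)"
 by(simp add: isCont_def tendsto_at_iff_tendsto_nhds)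

lemma isCont_eventually_nonzero:
 fixes f :: "'a::t2_space => 'b::{t1_space,zero}"
 shows "isCont f x ==> f x ~= 0 ==> \<forall>\<^sub>F z in nhds x. f z ~= 0"
 using isCont_tendsto_nhds by(rule tendsto_imp_eventually_ne)

lemma repelling_fixedI:
 assumes scale: "!!c X. F (scale c X) = scale (c^k) (F X)"
  and nonzero: "snd (F (xi,1)) ~= 0" and fixed: "chart (F (xi,1)) = xi"
  and cont: "isCont (%z. snd (F (z,1))) xi"
  and deriv: "((%z. chart (F (z,1))) has_field_derivative l) (at xi)" and "cmod l > 1"
 shows "repelling_fixed F (xi,1)"
proof -
 define mu where "mu = snd (F (xi,1))"
 have "((%z. wedge (F ((xi,1) + scale z E)) (xi,1)) has_field_derivative l * mu * wedge E (xi,1)) (at 0)" for E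
 proof -
  define t where "t z = (xi + z * fst E) / (1 + z * snd E)" for z
  define g where "g z = (1 + z * snd E)^k * snd (F (t z, 1))" for z
  have t: "(t has_field_derivative wedge E (xi,1)) (at 0)" unfolding t_def wedge_def by(auto intro!: derivative_eq_intros)
  have t_cont: "isCont t 0" using t by(rule DERIV_isCont)
  have t_0: "t 0 = xi" by(simp add: t_def)
  have snd_cont: "isCont (%z. snd (F (t z, 1))) 0" using isCont_o2[OF t_cont] cont t_0 by simp
  have "((%z. chart (F (t z, 1))) has_field_derivative l * wedge E (xi,1)) (at 0)"
   using DERIV_chain2[OF _ t] deriv t_0 by simp
  then obtain D where D: "!!z. chart (F (t z, 1)) - xi = D z * z" "isCont D 0" "D 0 = l * wedge E (xi,1)"
   using fixed t_0 unfolding CARAT_DERIV by auto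
  have "isCont g 0" unfolding g_def by(intro continuous_intros snd_cont)
  hence "((%z. (g z * D z) * z) has_field_derivative l * mu * wedge E (xi,1)) (at 0)"
   unfolding CARAT_DERIV using D(2,3) t_0
   by(intro exI[of _ "%z. g z * D z"]) (simp add: isCont_mult, simp add: g_def mu_def)
  moreover have "\<forall>\<^sub>F z in nhds 0. (g z * D z) * z = wedge (F ((xi,1) + scale z E)) (xi,1)"
  proof -
   have "isCont (%z. 1 + z * snd E) 0" by(intro continuous_intros)
   hence "\<forall>\<^sub>F z in nhds 0. 1 + z * snd E ~= 0" by(rule isCont_eventually_nonzero) simp
   moreover have "\<forall>\<^sub>F z in nhds 0. snd (F (t z, 1)) ~= 0"
    using snd_cont by(rule isCont_eventually_nonzero) (simp add: t_0 nonzero)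
   ultimately show ?thesis
   proof eventually_elim
    case (elim z)
    have "(xi,1) + scale z E = scale (1 + z * snd E) (t z, 1)" using elim by(simp add: scale_def t_def prod_eq_iff)
    moreover have "wedge (F (t z, 1)) (xi,1) = snd (F (t z, 1)) * (chart (F (t z, 1)) - xi)"
     using elim by(simp add: wedge_def chart_def algebra_simps)
    ultimately show ?case by(simp add: scale g_def D(1) mult_ac)
   qed
  qed
  ultimately show ?thesis by(simp add: DERIV_cong_ev)
 qed
 moreover have "F (xi,1) = scale mu (xi,1)" using scale_snd_chart[OF nonzero] fixed by(simp add: mu_def)
 moreover have "(xi, 1::complex) ~= (0,0)" "mu ~= 0" using nonzero by(auto simp: mu_def)
 ultimately show ?thesis unfolding repelling_fixed_def using assms(6) by blast
qed

lemma limit_coefficient_bound: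
 fixes D :: "complex => complex"
 assumes hol: "D holomorphic_on ball 0 s" and s: "s > 0" and bound: "!!z. cmod z < s ==> cmod (D z) <= C"
  and lim: "((%z. D z / z^k) \<longlongrightarrow> L) (at 0)"
 shows "cmod L <= C / (s/2)^k"
proof -
 define E where "E z = (if z = 0 then L else D z / z^k)" for z
 have punctured: "E holomorphic_on ball 0 s - {0}"
 proof(rule holomorphic_transform)
  show "(%z. D z / z^k) holomorphic_on ball 0 s - {0}" by(intro holomorphic_intros holomorphic_on_subset[OF hol]) auto
 qed(auto simp: E_def)
 have "isCont E z" if "z:ball 0 s" for z
 proof(cases "z = 0")
  case True
  have "(E \<longlongrightarrow> L) (at 0)"
   using lim by(rule Lim_transform_eventually) (auto simp: E_def eventually_at_filter)
  thus ?thesis using True by(simp add: isCont_def E_def)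
 next
  case False
  thus ?thesis using that holomorphic_on_imp_continuous_on[OF punctured]
   by(auto simp: continuous_on_eq_continuous_at open_delete)
 qed
 hence "continuous_on (ball 0 s) E" by(simp add: continuous_at_imp_continuous_on)
 hence hol_E: "E holomorphic_on ball 0 s" by(rule no_isolated_singularity[OF _ punctured]) auto
 have "cmod (E 0) <= C / (s/2)^k"
 proof(rule maximum_modulus_frontier[where S = "ball 0 (s/2)" and f = E])
  show "continuous_on (closure (ball 0 (s/2))) E"
   using s by(intro holomorphic_on_imp_continuous_on holomorphic_on_subset[OF hol_E]) auto
  fix z :: complex assume "z:frontier (ball 0 (s/2))"
  hence z: "cmod z = s/2" using s by simp
  thus "cmod (E z) <= C / (s/2)^k"
   using s bound[of z] by(auto simp: E_def norm_divide norm_power intro!: divide_right_mono)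
 qed(use s in \<open>auto intro: holomorphic_on_subset[OF hol_E]\<close>)
 thus ?thesis by(simp add: E_def)
qed

lemma Schottky_half_disc:
 assumes hol: "U holomorphic_on cball 0 rho" and "rho > 0"
  and omits: "!!z. cmod z <= rho ==> U z ~= 0 & U z ~= 1" and z: "cmod z < rho/2"
 shows "cmod (U z) <= exp (pi * exp (pi * (14 + 2 * cmod (U 0))))"
proof -
 define v where "v zeta = U (of_real rho * zeta)" for zeta
 have "cmod (v (z / of_real rho)) <= exp (pi * exp (pi * (2 + 2 * cmod (U 0) + 12 * (1/2) / (1 - 1/2))))"
 proof(rule Schottky[where f = v and r = "cmod (U 0)" and t = "1/2"])
  have "(%x. complex_of_real rho * x) holomorphic_on cball 0 1" by(intro holomorphic_intros)
  moreover have "(%x. complex_of_real rho * x) ` cball 0 1 <= cball 0 rho" using assms(2) by(auto simp: norm_mult)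
  ultimately show "v holomorphic_on cball 0 1"
   using holomorphic_on_compose_gen[OF _ hol] by(simp add: v_def[abs_def] o_def)
  show "~ (v zeta = 0 | v zeta = 1)" if "zeta:cball 0 1" for zeta
   using omits[of "of_real rho * zeta"] that assms(2) by(simp add: v_def norm_mult)
  show "cmod (z / of_real rho) <= 1/2" using z assms(2) by(simp add: norm_divide)
 qed(auto simp: v_def)
 thus ?thesis using assms(2) by(simp add: v_def)
qed

lemma norm_le_norm_add: "0 <= inner x y ==> norm x <= norm (x + y)" by(simp add: norm_le inner_simps inner_commute)

text \<open>In a Fatou coordinate \<open>w\<close> the map is close to the translation by \<open>s\<close>, so that
 an orbit starting in the half plane into which \<open>s\<close> points never gets close to the origin.\<close>

lemma petal_orbit:
 fixes F w :: "complex => complex" and s :: real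
 assumes step: "!!z. z ~= 0 ==> cmod z < r ==> F z ~= 0 & cmod (w (F z) - w z - of_real s) <= 1/4"
  and petal: "!!z. z ~= 0 ==> cmod z < r \<longleftrightarrow> cmod (w z) > R"
  and "R >= 0" and s: "\<bar>s\<bar> = 1" and z: "z ~= 0" "s * Re (w z) >= 0" "cmod (w z) > 2 * R"
 shows "(F^^n) z ~= 0 & cmod ((F^^n) z) < r & cmod (w ((F^^n) z) - w z - of_real (n * s)) <= n/4
  & cmod (w ((F^^n) z)) >= 3/4 * n"
proof -
 have far: "cmod y >= 3/4 * cmod (w z) & cmod y >= 3/4 * n"
  if "cmod (y - w z - of_real (n * s)) <= n/4" for y and n :: nat
 proof -
  have "0 <= inner (w z) (of_real (n * s))" using z(2) by(simp add: inner_complex_def mult.left_commute mult.commute[of s])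
  hence "cmod (w z) <= cmod (w z + of_real (n * s))" "cmod (of_real (n * s)) <= cmod (of_real (n * s) + w z)"
   by(simp_all only: norm_le_norm_add inner_commute)
  moreover have "cmod (of_real (n * s)) = n" using s by(simp add: norm_mult abs_mult)
  moreover have "cmod (w z + of_real (n * s)) - cmod y <= cmod (y - w z - of_real (n * s))"
   using norm_triangle_ineq2[of "w z + of_real (n * s)" y] by(simp add: norm_minus_commute algebra_simps)
  ultimately show ?thesis using that by(simp add: add.commute)
 qed
 have "(F^^n) z ~= 0 & cmod ((F^^n) z) < r & cmod (w ((F^^n) z) - w z - of_real (n * s)) <= n/4"
 proof(induction n)
  case 0
  show ?case using z assms(3) petal[OF z(1)] by simp
 next
  case (Suc n)
  define y where "y = (F^^n) z"
  have F_y: "F y ~= 0" "cmod (w (F y) - w y - of_real s) <= 1/4" using step[of y] Suc by(auto simp: y_def)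
  have "w (F y) - w z - of_real (Suc n * s) = (w (F y) - w y - of_real s) + (w y - w z - of_real (n * s))"
   by(simp add: algebra_simps)
  hence "cmod (w (F y) - w z - of_real (Suc n * s))
    <= cmod (w (F y) - w y - of_real s) + cmod (w y - w z - of_real (n * s))" by(metis norm_triangle_ineq)
  also have "... <= 1/4 + real n/4" using Suc F_y(2) by(intro add_mono) (auto simp: y_def)
  finally have "cmod (w (F y) - w z - of_real (Suc n * s)) <= Suc n/4" by simp
  moreover from this have "cmod (w (F y)) > R" using far z(3) assms(3) by fastforce
  ultimately show ?case using F_y(1) petal[OF F_y(1)] by(simp add: y_def)
 qed
 thus ?thesis using far[where y = "w ((F^^n) z)" and n = n] by blast
qed

lemma log_derivative_dominates:
 fixes F :: "complex => complex"
 assumes hol: "F holomorphic_on ball x s" and s: "s > 0" and "F x = 0" "~ F constant_on ball x s"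
 shows "\<forall>\<^sub>F z in at x. F z ~= 0 & C * cmod (F z) < cmod (deriv F z)"
proof -
 obtain k rho e where e: "0 < (e::nat)" and rho: "0 < rho" and k: "k holomorphic_on ball x rho"
  "!!z. z:ball x rho ==> F z = (z - x)^e * k z" "!!z. z:ball x rho ==> k z ~= 0"
  using holomorphic_factor_zero_nonconstant[OF hol open_ball connected_ball centre_in_ball[THEN iffD2, OF s] assms(3,4)]
  by metis
 obtain e' where e': "e = Suc e'" using e by(cases e) auto
 define h where "h z = of_nat e * k z + (z - x) * deriv k z" for z
 have deriv_F: "deriv F z = (z - x)^e' * h z" if "z:ball x rho" for z
 proof -
  have "((%z. (z - x)^e * k z) has_field_derivative of_nat e * (z - x)^e' * k z + (z - x)^e * deriv k z) (at z)"
   using holomorphic_derivI[OF k(1) open_ball that]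
   by(auto intro!: derivative_eq_intros simp: e' simp del: of_nat_Suc power_Suc)
  hence "(F has_field_derivative of_nat e * (z - x)^e' * k z + (z - x)^e * deriv k z) (at z)"
   by(rule has_field_derivative_transform_within_open[OF _ open_ball that]) (simp add: k(2))
  thus ?thesis by(simp add: DERIV_imp_deriv h_def e' algebra_simps)
 qed
 have "isCont k x" "isCont (deriv k) x"
  using holomorphic_on_imp_continuous_on[OF k(1)] holomorphic_on_imp_continuous_on[OF holomorphic_deriv[OF k(1)]] rho
  by(auto simp: continuous_on_eq_continuous_at)
 hence "isCont (%z. cmod (h z) - C * cmod (z - x) * cmod (k z)) x" unfolding h_def by(intro continuous_intros)
 hence "\<forall>\<^sub>F z in at x. cmod (h z) - C * cmod (z - x) * cmod (k z) > 0"
  unfolding isCont_def by(rule order_tendstoD(1)) (use e rho k(3) in \<open>simp add: h_def norm_mult\<close>)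
 moreover have "\<forall>\<^sub>F z in at x. z:ball x rho" using rho by(intro eventually_at_in_open') auto
 ultimately show ?thesis using eventually_neq_at_within[of x x]
 proof eventually_elim
  case (elim z)
  hence "cmod (z - x)^e' * (C * cmod (z - x) * cmod (k z)) < cmod (z - x)^e' * cmod (h z)"
   by(intro mult_strict_left_mono) auto
  thus ?case unfolding deriv_F[OF elim(2)] k(2)[OF elim(2)] using elim(3) k(3)[OF elim(2)]
   by(simp add: norm_mult norm_power e' mult_ac)
 qed
qed

lemma steep_intersection:
 fixes F :: "complex => complex" and G :: "nat => complex => complex"
 assumes F: "F holomorphic_on ball x s" "s > 0" "F x = 0" "~ F constant_on ball x s"
  and G: "!!n. G n holomorphic_on ball x s" "!!n z. z:ball x s ==> G n z ~= 0"
  and slow: "!!n z. n >= 1 ==> z:ball x s ==> cmod (deriv (G n) z) <= C * cmod (G n z)"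
  and small: "!!eps. eps > 0 ==> EX n>=1. ALL z:ball x s. cmod (G n z) < eps"
 obtains n xi where "n >= 1" "xi:ball x s" "F xi = G n xi" "cmod (deriv (G n) xi) < cmod (deriv F xi)"
proof -
 have "\<forall>\<^sub>F z in at x. F z ~= 0 & C * cmod (F z) < cmod (deriv F z)" by(rule log_derivative_dominates[OF F])
 then obtain t where t: "t > 0" "!!z. z ~= x ==> dist z x < t ==> F z ~= 0 & C * cmod (F z) < cmod (deriv F z)"
  by(auto simp: eventually_at)
 define rho where "rho = min s t / 2"
 have rho: "rho > 0" "rho < s" "rho < t" using t(1) F(2) by(auto simp: rho_def)
 have disc: "cball x rho <= ball x s" using rho by auto
 have cont_F: "continuous_on (cball x rho) F"
  using F(1) disc by(blast intro: holomorphic_on_imp_continuous_on holomorphic_on_subset)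
 have "continuous_on (sphere x rho) (%z. cmod (F z))"
  using cont_F by(intro continuous_on_norm) (auto elim: continuous_on_subset)
 then obtain y where y: "y:sphere x rho" "!!z. z:sphere x rho ==> cmod (F y) <= cmod (F z)"
  using continuous_attains_inf[OF compact_sphere, of x rho "%z. cmod (F z)"] rho(1) by auto
 have "F y ~= 0" using t(2)[of y] y(1) rho by(auto simp: dist_commute)
 then obtain n where n: "n >= 1" "!!z. z:ball x s ==> cmod (G n z) < cmod (F y) / 2"
  using small[of "cmod (F y) / 2"] by auto
 obtain xi where xi: "xi:ball x rho" "F xi - G n xi = 0"
 proof(rule holomorphic_contract_to_zero[where f = "%z. F z - G n z" and \<xi> = x and r = rho])
  show "continuous_on (cball x rho) (%z. F z - G n z)" using cont_F G(1)[of n] disc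
   by(intro continuous_on_diff) (auto intro: holomorphic_on_imp_continuous_on holomorphic_on_subset)
  show "(%z. F z - G n z) holomorphic_on ball x rho"
   using rho(2) by(intro holomorphic_on_diff holomorphic_on_subset[OF F(1)] holomorphic_on_subset[OF G(1)]) auto
  fix z assume z: "cmod (x - z) = rho"
  have "cmod (F y) <= cmod (F z)" using y(2)[of z] z by(simp add: dist_norm)
  moreover have "cmod (G n z) < cmod (F y) / 2" "cmod (G n x) < cmod (F y) / 2"
   using n(2)[of z] n(2)[of x] z rho F(2) by(auto simp: dist_norm)
  moreover have "cmod (F z) - cmod (G n z) <= cmod (F z - G n z)" by(rule norm_triangle_ineq2)
  ultimately show "cmod (F x - G n x) < cmod (F z - G n z)" using F(3) by simp
 qed(use rho in auto)
 have in_ball: "xi:ball x s" using xi(1) rho by auto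
 have eq: "F xi = G n xi" using xi(2) by simp
 hence "xi ~= x" using F(3) G(2)[OF in_ball, of n] by auto
 hence "C * cmod (F xi) < cmod (deriv F xi)" using t(2)[of xi] xi(1) rho by(auto simp: dist_commute)
 moreover have "cmod (deriv (G n) xi) <= C * cmod (F xi)" using slow[OF n(1) in_ball] eq by simp
 ultimately show thesis using that[OF n(1) in_ball eq] by linarith
qed

definition cross_ratio :: "'a::field * 'a => 'a * 'a => 'a * 'a => 'a * 'a => 'a" where
 "cross_ratio A B C X = wedge B C * wedge X A / (wedge B A * wedge X C)"

lemma cross_ratio_scale: "c ~= 0 ==> cross_ratio A B C (scale c X) = cross_ratio A B C X" by(simp add: cross_ratio_def)

lemma cross_ratio_chart: "snd X ~= 0 ==> cross_ratio A B C X = cross_ratio A B C (chart X, 1)"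
 using cross_ratio_scale scale_snd_chart by metis

lemma cross_ratio_omits:
 assumes "wedge A B ~= 0" "wedge B C ~= 0" "wedge A C ~= 0" "wedge X A ~= 0" "wedge X B ~= 0" "wedge X C ~= 0"
 shows "cross_ratio A B C X ~= 0" "cross_ratio A B C X ~= 1"
proof -
 have BA: "wedge B A ~= 0" using assms(1) wedge_commute[of B A] by simp
 show "cross_ratio A B C X ~= 0" using assms BA by(simp add: cross_ratio_def)
 have "wedge B C * wedge X A - wedge B A * wedge X C = wedge X B * wedge A C" by(simp add: wedge_def algebra_simps)
 moreover have "wedge X B * wedge A C ~= 0" using assms by simp
 ultimately show "cross_ratio A B C X ~= 1" using assms(6) BA by(auto simp: cross_ratio_def)
qed

lemma cross_ratio_diff:
 assumes "wedge (y,1) C ~= 0" "wedge (z,1) C ~= 0"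
 shows "cross_ratio A B C (y,1) - cross_ratio A B C (z,1)
  = (y - z) * (wedge B C * wedge A C / (wedge B A * (wedge (y,1) C * wedge (z,1) C)))"
proof -
 have "cross_ratio A B C (y,1) - cross_ratio A B C (z,1)
   = wedge B C / wedge B A * ((wedge (y,1) A * wedge (z,1) C - wedge (z,1) A * wedge (y,1) C)
    / (wedge (y,1) C * wedge (z,1) C))"
  using assms by(simp add: cross_ratio_def diff_divide_distrib right_diff_distrib)
 also have "wedge (y,1) A * wedge (z,1) C - wedge (z,1) A * wedge (y,1) C = (y - z) * wedge A C"
  by(simp add: wedge_def algebra_simps)
 finally show ?thesis by(simp add: mult_ac)
qed

locale parabolic_hmap =
 fixes d :: nat and a b :: "nat => complex" and f :: "complex => complex" and m :: nat and u :: "complex => complex"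
 assumes degree: "d >= 2" and nondegenerate: "nondegenerate d a b"
  and a_0: "a 0 = 0" and a_1: "a 1 ~= 0" and b_0: "b 0 ~= 0"
  and f_eq: "!!z. f z = poly (dehom d a) z / poly (dehom d b) z"
  and m_pos: "m >= 1" and u_cont: "isCont u 0" and u_0: "u 0 ~= 0"
  and f_expansion: "\<forall>\<^sub>F z in nhds 0. f z = z + z^Suc m * u z"
begin

abbreviation H :: "complex * complex => complex * complex" where
 "H \<equiv> hmap d a b"

lemma zero_power_m [simp]: "0^m = (0::complex)" using m_pos by simp

lemma denominator_0: "poly (dehom d b) 0 ~= 0" using b_0 by(simp add: poly_0_coeff_0 coeff_dehom)

lemma f_0: "f 0 = 0" using a_0 by(simp add: f_eq poly_0_coeff_0 coeff_dehom)

lemma funpow_expansion: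
 obtains v where "isCont v 0" "v 0 = of_nat n * u 0" "\<forall>\<^sub>F z in nhds 0. (f^^n) z = z + z^Suc m * v z"
proof(induction n arbitrary: thesis)
 case 0
 show ?case by(rule 0[of "%_. 0"]) auto
next
 case (Suc n)
 obtain v where v: "isCont v 0" "v 0 = of_nat n * u 0" "\<forall>\<^sub>F z in nhds 0. (f^^n) z = z + z^Suc m * v z"
  using Suc.IH .
 define y where "y z = z + z^Suc m * v z" for z
 have y: "isCont y 0" "y 0 = 0" unfolding y_def by(auto intro!: continuous_intros v(1))
 define v' where "v' z = v z + (1 + z^m * v z)^Suc m * u (y z)" for z
 show ?case
 proof(rule Suc.prems)
  have "isCont (%z. u (y z)) 0" using isCont_o2[OF y(1)] u_cont y(2) by simp
  thus "isCont v' 0" unfolding v'_def by(intro continuous_intros v(1))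
  show "v' 0 = of_nat (Suc n) * u 0" using v(2) y(2) by(simp add: v'_def algebra_simps)
  have "filterlim y (nhds 0) (nhds 0)" using isCont_tendsto_nhds[OF y(1)] y(2) by simp
  hence "\<forall>\<^sub>F z in nhds 0. f (y z) = y z + y z^Suc m * u (y z)"
   using f_expansion by(rule eventually_compose_filterlim[rotated])
  thus "\<forall>\<^sub>F z in nhds 0. (f^^Suc n) z = z + z^Suc m * v' z" using v(3)
  proof eventually_elim
   case (elim z)
   have "y z = z * (1 + z^m * v z)" by(simp add: y_def algebra_simps)
   hence "y z^Suc m = z^Suc m * (1 + z^m * v z)^Suc m" by(simp only: power_mult_distrib)
   thus ?case using elim by(simp add: v'_def distrib_left flip: y_def) (simp add: y_def algebra_simps)
  qed
 qed
qed

lemma isCont_funpow: "isCont (f^^n) 0" and funpow_0: "(f^^n) 0 = 0"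
proof -
 show "(f^^n) 0 = 0" by(induction n) (simp_all add: f_0)
 obtain v where "isCont v 0" and expansion: "\<forall>\<^sub>F z in nhds 0. (f^^n) z = z + z^Suc m * v z"
  using funpow_expansion[of n] by blast
 hence "isCont (%z. z + z^Suc m * v z) 0" by(intro continuous_intros)
 thus "isCont (f^^n) 0" using isCont_cong[OF expansion] by simp
qed

lemma eventually_funpow_nonzero: "\<forall>\<^sub>F z in at 0. (f^^n) z ~= 0"
proof -
 obtain v where v: "isCont v 0" "\<forall>\<^sub>F z in nhds 0. (f^^n) z = z + z^Suc m * v z"
  using funpow_expansion[of n] by blast
 have "isCont (%z. 1 + z^m * v z) 0" by(intro continuous_intros v(1))
 hence "\<forall>\<^sub>F z in nhds 0. 1 + z^m * v z ~= 0" by(rule isCont_eventually_nonzero) simp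
 hence "\<forall>\<^sub>F z in nhds 0. z ~= 0 --> (f^^n) z ~= 0" using v(2)
 proof eventually_elim
  case (elim z)
  have "z + z^Suc m * v z = z * (1 + z^m * v z)" by(simp add: algebra_simps)
  thus ?case using elim by simp
 qed
 thus ?thesis by(simp add: eventually_at_filter)
qed

lemma eventually_denominator_nonzero: "\<forall>\<^sub>F z in nhds 0. ALL k<n. poly (dehom d b) ((f^^k) z) ~= 0"
proof -
 have "isCont (%z. poly (dehom d b) ((f^^k) z)) 0" for k by(rule isCont_o2[OF isCont_funpow]) simp
 hence "\<forall>\<^sub>F z in nhds 0. poly (dehom d b) ((f^^k) z) ~= 0" for k
  by(rule isCont_eventually_nonzero) (simp add: funpow_0 denominator_0)
 hence "\<forall>\<^sub>F z in nhds 0. ALL k:{..<n}. poly (dehom d b) ((f^^k) z) ~= 0" by(intro eventually_ball_finite) auto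
 thus ?thesis by(simp only: Ball_def lessThan_iff)
qed

lemma chart_funpow:
 assumes "snd X ~= 0" "!!k. k < n ==> poly (dehom d b) ((f^^k) (chart X)) ~= 0"
 shows "snd ((H^^n) X) ~= 0" "chart ((H^^n) X) = (f^^n) (chart X)"
proof -
 have "snd ((H^^n) X) ~= 0 & chart ((H^^n) X) = (f^^n) (chart X)" using assms(2)
  by(induction n) (auto simp: assms(1) chart_hmap f_eq)
 thus "snd ((H^^n) X) ~= 0" "chart ((H^^n) X) = (f^^n) (chart X)" by auto
qed

lemma fst_funpow_eq_0_cong:
 assumes "wedge X Y = 0" "X ~= (0,0)" "Y ~= (0,0)"
 shows "fst ((H^^n) X) = 0 \<longleftrightarrow> fst ((H^^n) Y) = 0"
proof -
 obtain c where c: "X = scale c Y" using wedge_zero_imp_scale[OF assms(1,3)] by blast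
 hence "c ~= 0" using assms(2) by(auto simp: scale_eq_0_iff)
 moreover have "fst ((H^^n) X) = c^(d^n) * fst ((H^^n) Y)" by(simp add: c hmap_funpow_scale) (simp add: scale_def)
 ultimately show ?thesis by simp
qed

lemma fst_funpow_eq_0_mono:
 assumes "fst ((H^^j) X) = 0" "j <= k"
 shows "fst ((H^^k) X) = 0"
 using assms(2,1)
proof(induction k rule: dec_induct)
 case (step k)
 hence "fst (hmap d a b ((H^^k) X)) = 0"
  using hform_scale[of d a "snd ((H^^k) X)" 0 1] a_0 by(simp add: hmap_def[of d a b "(H^^k) X"] hform_0_1)
 thus ?case by simp
qed simp

definition first_hit :: "nat => complex * complex => bool" where
 "first_hit k Y \<longleftrightarrow> Y ~= (0,0) & fst ((H^^k) Y) ~= 0 & fst ((H^^Suc k) Y) = 0"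

lemma first_hit_0_exists: obtains Y where "first_hit 0 Y"
proof(cases "a d = 0")
 case True
 thus thesis using that[of "(1,0)"] by(simp add: first_hit_def hmap_def hform_1_0)
next
 case False
 obtain c p where p: "dehom d a = pCons c p" by(cases "dehom d a")
 have coeffs: "coeff (pCons c p) i = (if i <= d then a i else 0)" for i using coeff_dehom[of d a] by(simp add: p)
 have "coeff p (d - 1) ~= 0" using coeffs[of d] False degree by(cases d) auto
 hence "degree p > 0" using le_degree[of p "d - 1"] degree by linarith
 then obtain z where z: "poly p z = 0" using alg_closed_imp_poly_has_root[of p] by blast
 have "coeff p 0 ~= 0" using coeffs[of 1] a_1 degree by simp
 hence "z ~= 0" using z by(auto simp: poly_0_coeff_0)
 moreover have "poly (dehom d a) z = 0" using coeffs[of 0] a_0 z by(simp add: p)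
 ultimately show thesis using that[of "(z,1)"] by(simp add: first_hit_def hmap_pair)
qed

lemma first_hit_exists: obtains Y where "first_hit k Y"
proof(induction k arbitrary: thesis)
 case 0
 thus ?case using first_hit_0_exists by blast
next
 case (Suc k)
 obtain Y where Y: "first_hit k Y" using Suc.IH .
 obtain Y' where Y': "Y' ~= (0,0)" "wedge (H Y') Y = 0" using hmap_hits[of d a b Y] degree by auto
 hence "fst ((H^^n) (H Y')) = 0 \<longleftrightarrow> fst ((H^^n) Y) = 0" for n
  using Y by(intro fst_funpow_eq_0_cong) (auto simp: first_hit_def nondegenerate_nonzero[OF nondegenerate])
 moreover have "(H^^n) (H Y') = (H^^Suc n) Y'" for n by(simp add: funpow_swap1)
 ultimately have "first_hit (Suc k) Y'" using Y Y'(1) unfolding first_hit_def by metis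
 thus ?case by(rule Suc.prems)
qed

lemma first_hit_wedge:
 assumes "first_hit j Y" "first_hit k Y'" "j < k"
 shows "wedge Y Y' ~= 0"
proof
 assume "wedge Y Y' = 0"
 hence "fst ((H^^Suc j) Y) = 0 \<longleftrightarrow> fst ((H^^Suc j) Y') = 0"
  using assms by(intro fst_funpow_eq_0_cong) (auto simp: first_hit_def)
 hence "fst ((H^^k) Y') = 0" using assms fst_funpow_eq_0_mono[of "Suc j" Y' k] by(simp add: first_hit_def)
 thus False using assms(2) by(simp add: first_hit_def)
qed

lemma first_hit_fst_nonzero: "first_hit k Y ==> fst Y ~= 0"
 using fst_funpow_eq_0_mono[of 0 Y k] by(auto simp: first_hit_def)

lemma iterates_avoid_first_hit:
 assumes "!!n. z ~= 0 ==> fst ((H^^n) (z,1)) ~= 0" "first_hit k Y"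
 shows "wedge ((H^^n) (z,1)) Y ~= 0"
proof
 define V where "V = (H^^n) (z,1)"
 have V: "V ~= (0,0)" unfolding V_def by(rule hmap_funpow_nonzero[OF nondegenerate]) simp
 assume wedge_0: "wedge ((H^^n) (z,1)) Y = 0"
 hence "fst ((H^^Suc k) V) = 0 \<longleftrightarrow> fst ((H^^Suc k) Y) = 0"
  using V assms(2) by(intro fst_funpow_eq_0_cong) (auto simp: first_hit_def V_def)
 hence "fst ((H^^(Suc k + n)) (z,1)) = 0" using assms(2) by(simp only: first_hit_def funpow_add V_def comp_def)
 hence "z = 0" using assms(1) by blast
 hence "fst V = 0" using fst_funpow_eq_0_mono[of 0 "(z,1)" n] by(simp add: V_def)
 moreover from this have "snd V ~= 0" using V by(metis prod.collapse)
 ultimately show False using wedge_0 first_hit_fst_nonzero[OF assms(2)] by(simp add: wedge_def flip: V_def)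
qed

lemma cross_ratio_iterate_limit:
 assumes C: "fst C ~= 0"
 shows "((%z. (cross_ratio A B C ((H^^n) (z,1)) - cross_ratio A B C (z,1)) / z^Suc m)
  \<longlongrightarrow> of_nat n * (u 0 * (wedge B C * wedge A C / (wedge B A * (fst C)\<^sup>2)))) (at 0)"
proof -
 obtain v where v: "isCont v 0" "v 0 = of_nat n * u 0" "\<forall>\<^sub>F z in nhds 0. (f^^n) z = z + z^Suc m * v z"
  using funpow_expansion by blast
 define g where "g z = wedge ((f^^n) z, 1) C * wedge (z,1) C" for z
 define A' where "A' z = v z * (wedge B C * wedge A C / (wedge B A * g z))" for z
 have g: "isCont g 0" "g 0 = (fst C)\<^sup>2"
  unfolding g_def wedge_def by(auto intro!: continuous_intros isCont_funpow simp: funpow_0 power2_eq_square)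
 have A': "A' z = v z * (wedge B C * wedge A C / wedge B A) / g z" for z by(simp add: A'_def)
 have "isCont A' 0" unfolding A' using g C by(intro continuous_intros v(1)) auto
 hence "(A' \<longlongrightarrow> A' 0) (at 0)" by(simp add: isCont_def)
 moreover have "\<forall>\<^sub>F z in nhds 0. g z ~= 0" by(rule isCont_eventually_nonzero[OF g(1)]) (simp add: g(2) C)
 with v(3) eventually_denominator_nonzero[of n] have "\<forall>\<^sub>F z in nhds 0. z ~= 0 -->
   A' z = (cross_ratio A B C ((H^^n) (z,1)) - cross_ratio A B C (z,1)) / z^Suc m"
 proof eventually_elim
  case (elim z)
  have V: "snd ((H^^n) (z,1)) ~= 0" "chart ((H^^n) (z,1)) = (f^^n) z" using chart_funpow[of "(z,1)" n] elim by auto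
  have "cross_ratio A B C ((H^^n) (z,1)) = cross_ratio A B C ((f^^n) z, 1)" using cross_ratio_chart[OF V(1)] V(2) by simp
  moreover have "cross_ratio A B C ((f^^n) z, 1) - cross_ratio A B C (z,1) = z^Suc m * A' z"
   using elim(3) by(subst cross_ratio_diff) (auto simp: g_def A'_def elim(1))
  ultimately show ?case by simp
 qed
 hence "\<forall>\<^sub>F z in at 0. A' z = (cross_ratio A B C ((H^^n) (z,1)) - cross_ratio A B C (z,1)) / z^Suc m"
  by(simp add: eventually_at_filter)
 ultimately show ?thesis using Lim_transform_eventually by(fastforce simp: A'_def[of 0] g(2) v(2) mult.assoc)
qed

text \<open>The iterates are not normal at the origin, because their coefficients of order \<open>m + 1\<close> grow linearly.
 Hence they cannot omit the first three generations of preimages of the origin.\<close>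

lemma iterated_preimages_accumulate:
 assumes rho: "rho > 0"
 obtains z n where "z ~= 0" "cmod z <= rho" "fst ((H^^n) (z,1)) = 0"
proof(rule ccontr)
 note witness = that
 assume "~ thesis"
 hence never: "fst ((H^^n) (z,1)) ~= 0" if "z ~= 0" "cmod z <= rho" for z n using witness that by blast
 obtain A B C where hits: "first_hit 0 A" "first_hit 1 B" "first_hit 2 C" using first_hit_exists by metis
 note wedges = first_hit_wedge[OF hits(1,2)] first_hit_wedge[OF hits(2,3)] first_hit_wedge[OF hits(1,3)]
 have C: "fst C ~= 0" by(rule first_hit_fst_nonzero[OF hits(3)])
 define U where "U n z = cross_ratio A B C ((H^^n) (z,1))" for n z
 have avoid: "wedge ((H^^n) (z,1)) A ~= 0" "wedge ((H^^n) (z,1)) B ~= 0" "wedge ((H^^n) (z,1)) C ~= 0"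
  if "cmod z <= rho" for n z using iterates_avoid_first_hit[OF never[OF _ that]] hits by blast+
 have omits: "U n z ~= 0 & U n z ~= 1" if "cmod z <= rho" for n z
  using cross_ratio_omits[OF _ _ _ avoid[OF that]] wedges by(simp add: U_def)
 have hol: "U n holomorphic_on cball 0 rho" for n
  unfolding U_def cross_ratio_def using avoid(3) wedges(1) wedge_commute[of A B]
  by(auto simp: wedge_def intro!: holomorphic_intros holomorphic_hmap_funpow)
 have U_0: "U n 0 = U 0 0" for n
 proof -
  have "snd ((H^^n) (0,1)) ~= 0" "chart ((H^^n) (0,1)) = 0"
   using chart_funpow[of "(0,1)" n] by(auto simp: funpow_0 denominator_0)
  thus ?thesis using cross_ratio_chart[of "(H^^n) (0,1)"] by(simp add: U_def)
 qed
 define M where "M = exp (pi * exp (pi * (14 + 2 * cmod (U 0 0))))"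
 have bound: "cmod (U n z) <= M" if "cmod z < rho/2" for n z
  using Schottky_half_disc[OF hol[of n] rho omits that] by(simp add: M_def U_0[of n])
 define L where "L = u 0 * (wedge B C * wedge A C / (wedge B A * (fst C)\<^sup>2))"
 have L: "L ~= 0" using wedges C u_0 wedge_commute[of A B] by(auto simp: L_def)
 have "cmod (of_nat n * L) <= 2 * M / (rho/2/2)^Suc m" for n
 proof(rule limit_coefficient_bound)
  show "(%z. U n z - U 0 z) holomorphic_on ball 0 (rho/2)"
   using rho by(intro holomorphic_intros holomorphic_on_subset[OF hol]) auto
  show "((%z. (U n z - U 0 z) / z^Suc m) \<longlongrightarrow> of_nat n * L) (at 0)"
   using cross_ratio_iterate_limit[OF C, of A B n] by(simp add: U_def L_def)
  show "cmod (U n z - U 0 z) <= 2 * M" if "cmod z < rho/2" for z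
   using bound[OF that, of n] bound[OF that, of 0] norm_triangle_ineq4[of "U n z" "U 0 z"] by simp
 qed(use rho in simp)
 hence "real n * cmod L <= 2 * M / (rho/2/2)^Suc m" for n by(simp only: norm_mult norm_of_nat)
 moreover obtain n where "2 * M / (rho/2/2)^Suc m < real n * cmod L" using reals_Archimedean3 L by(metis zero_less_norm_iff)
 ultimately show False by(meson not_less)
qed

end

context parabolic_hmap
begin

definition fatou_coeff :: complex where "fatou_coeff = -1 / (of_nat m * u 0)"

definition fatou :: "complex => complex" where "fatou z = fatou_coeff / z^m"

lemma fatou_coeff_nonzero: "fatou_coeff ~= 0" using m_pos u_0 by(simp add: fatou_coeff_def)

lemma fatou_step: "((%z. fatou (f z) - fatou z) \<longlongrightarrow> 1) (at 0)"
proof -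
 have "((%t::complex. inverse ((1 + t)^m)) has_field_derivative - of_nat m) (at 0)"
  by(rule derivative_eq_intros refl | simp)+
 then obtain G :: "complex => complex" where G: "!!t. inverse ((1 + t)^m) - 1 = G t * t" "isCont G 0" "G 0 = - of_nat m"
  unfolding CARAT_DERIV by auto
 have "isCont (%z. G (z^m * u z)) 0"
  by(rule isCont_o2[where f = "%z. z^m * u z"]) (auto intro!: continuous_intros u_cont G(2))
 hence "isCont (%z. fatou_coeff * u z * G (z^m * u z)) 0" by(intro continuous_intros u_cont)
 moreover have "fatou_coeff * u 0 * G 0 = 1" using m_pos u_0 by(simp add: fatou_coeff_def G(3))
 ultimately have lim: "((%z. fatou_coeff * u z * G (z^m * u z)) \<longlongrightarrow> 1) (at 0)" by(simp add: isCont_def)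
 have "\<forall>\<^sub>F z in nhds 0. z ~= 0 --> fatou_coeff * u z * G (z^m * u z) = fatou (f z) - fatou z"
  using f_expansion
 proof eventually_elim
  case (elim z)
  have "f z = z * (1 + z^m * u z)" using elim by(simp add: algebra_simps)
  hence "f z^m = z^m * (1 + z^m * u z)^m" by(simp only: power_mult_distrib)
  hence "fatou (f z) - fatou z = fatou_coeff / z^m * (inverse ((1 + z^m * u z)^m) - 1)"
   by(simp add: fatou_def divide_inverse right_diff_distrib)
  thus ?case by(simp add: G(1))
 qed
 thus ?thesis using Lim_transform_eventually[OF lim] by(simp add: eventually_at_filter)
qed

lemma cmod_fatou: "cmod (fatou z) = cmod fatou_coeff / cmod z^m" by(simp add: fatou_def norm_divide norm_power)

lemma fatou_deriv:
 assumes z: "z ~= 0"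
 shows "(fatou has_field_derivative - of_nat m * fatou z / z) (at z)"
proof -
 have power: "z^m = z * z^(m - 1)" using m_pos by(simp flip: power_Suc)
 have "(fatou has_field_derivative - fatou_coeff * (of_nat m * z^(m - 1)) / (z^m * z^m)) (at z)"
  unfolding fatou_def[abs_def] using z by(auto intro!: derivative_eq_intros)
 also have "- fatou_coeff * (of_nat m * z^(m - 1)) / (z^m * z^m) = - of_nat m * fatou z / z"
  using z unfolding fatou_def power by(simp add: divide_simps)
 finally show ?thesis .
qed

lemma local_inverse_exists:
 assumes "r1 > 0" "!!z. cmod z < r1 ==> poly (dehom d b) z ~= 0"
 obtains r g where "0 < r" "r <= r1" "g holomorphic_on ball 0 r"
  "!!z. cmod z < r ==> cmod (g z) < r1 & f (g z) = z"
proof -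
 have hol: "f holomorphic_on ball 0 r1" unfolding f_eq[abs_def] using assms(2) by(auto intro!: holomorphic_intros)
 obtain v where v: "isCont v 0" "\<forall>\<^sub>F z in nhds 0. f z = z + z^Suc m * v z"
  using u_cont f_expansion by blast
 have "((%z. (1 + z^m * v z) * z) has_field_derivative 1) (at 0)" unfolding CARAT_DERIV
  by(intro exI[of _ "%z. 1 + z^m * v z"]) (auto intro!: continuous_intros v(1))
 moreover have "\<forall>\<^sub>F z in nhds 0. (1 + z^m * v z) * z = f z"
  using v(2) by eventually_elim (simp add: algebra_simps)
 ultimately have "(f has_field_derivative 1) (at 0)" by(simp add: DERIV_cong_ev)
 hence deriv: "deriv f 0 ~= 0" by(simp add: DERIV_imp_deriv)
 obtain r2 where r2: "r2 > 0" "ball (0::complex) r2 <= ball 0 r1" "open (f ` ball 0 r2)" "inj_on f (ball 0 r2)"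
  using has_complex_derivative_locally_invertible[OF hol _ open_ball deriv] assms(1)
  by(metis centre_in_ball)
 have "f holomorphic_on ball 0 r2" using hol r2(2) by(rule holomorphic_on_subset)
 then obtain g where g: "g holomorphic_on f ` ball 0 r2" "!!z. z:ball 0 r2 ==> g (f z) = z"
  using holomorphic_has_inverse[OF _ open_ball r2(4)] by metis
 have "0:f ` ball 0 r2" using f_0 r2(1) by force
 then obtain r3 where r3: "r3 > 0" "ball 0 r3 <= f ` ball 0 r2" using r2(3) openE by blast
 show thesis
 proof(rule that[of "min r1 r3" g])
  show "g holomorphic_on ball 0 (min r1 r3)" using r3(2) by(auto intro!: holomorphic_on_subset[OF g(1)])
  fix z :: complex assume "cmod z < min r1 r3"
  then obtain y where "y:ball 0 r2" "z = f y" using r3(2) by(auto simp: subset_iff)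
  thus "cmod (g z) < r1 & f (g z) = z" using g(2) r2(2) by auto
 qed(use r3 assms(1) in auto)
qed

end

locale parabolic_petal = parabolic_hmap +
 fixes r :: real and g :: "complex => complex"
 assumes r_pos: "r > 0" and denominator: "!!z. cmod z < r ==> poly (dehom d b) z ~= 0"
  and forward: "!!z. z ~= 0 ==> cmod z < r ==> f z ~= 0 & cmod (fatou (f z) - fatou z - of_real 1) <= 1/4"
  and backward: "!!z. z ~= 0 ==> cmod z < r ==> g z ~= 0 & cmod (fatou (g z) - fatou z - of_real (-1)) <= 1/4"
  and inverse_hol: "g holomorphic_on ball 0 r" and f_g: "!!z. cmod z < r ==> f (g z) = z"

lemma (in parabolic_hmap) petal_exists:
 obtains r g where "parabolic_petal d a b f m u r g"
proof -
 have "\<forall>\<^sub>F z in at 0. dist (fatou (f z) - fatou z) 1 < 1/4" by(rule tendstoD[OF fatou_step]) simp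
 moreover have "\<forall>\<^sub>F z in at 0. f z ~= 0" using eventually_funpow_nonzero[of 1] by simp
 moreover have "\<forall>\<^sub>F z in nhds 0. poly (dehom d b) z ~= 0" using eventually_denominator_nonzero[of 1] by simp
 hence "\<forall>\<^sub>F z in at 0. poly (dehom d b) z ~= 0" by(simp add: eventually_nhds_conv_at)
 ultimately have "\<forall>\<^sub>F z in at 0. dist (fatou (f z) - fatou z) 1 < 1/4 & f z ~= 0 & poly (dehom d b) z ~= 0"
  by eventually_elim simp
 then obtain r1 where r1: "r1 > 0" "!!z. z ~= 0 ==> cmod z < r1 ==>
   dist (fatou (f z) - fatou z) 1 < 1/4 & f z ~= 0 & poly (dehom d b) z ~= 0"
  by(auto simp: eventually_at)
 hence denominator: "poly (dehom d b) z ~= 0" if "cmod z < r1" for z using that denominator_0 by(cases "z = 0") auto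
 obtain r g where g: "0 < r" "r <= r1" "g holomorphic_on ball 0 r"
  "!!z. cmod z < r ==> cmod (g z) < r1 & f (g z) = z"
  using local_inverse_exists[OF r1(1) denominator] by blast
 have "g z ~= 0 & cmod (fatou (g z) - fatou z - of_real (-1)) <= 1/4" if z: "z ~= 0" "cmod z < r" for z
 proof -
  have "g z ~= 0" using g(4)[OF z(2)] f_0 z(1) by auto
  moreover from this have "dist (fatou z - fatou (g z)) 1 < 1/4" using r1(2)[of "g z"] g(4)[OF z(2)] by auto
  moreover have "fatou (g z) - fatou z - of_real (-1) = 1 - (fatou z - fatou (g z))" by simp
  ultimately show ?thesis by(simp only: dist_norm norm_minus_commute) auto
 qed
 hence "parabolic_petal d a b f m u r g"
  using g r1(2) denominator by unfold_locales (auto simp: dist_norm intro: less_imp_le)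
 thus thesis by(rule that)
qed

context parabolic_petal
begin

definition R :: real where "R = cmod (fatou (of_real r))"

lemma R_eq: "R = cmod fatou_coeff / r^m" and R_pos: "R > 0"
 using r_pos fatou_coeff_nonzero by(simp_all add: R_def cmod_fatou)

lemma cmod_less_iff_fatou:
 assumes "z ~= 0"
 shows "cmod z < r \<longleftrightarrow> cmod (fatou z) > R"
proof -
 have "cmod z < r \<longleftrightarrow> cmod z^m < r^m" using power_mono_iff[of r "cmod z" m] r_pos m_pos by(simp add: not_le[symmetric])
 moreover have "K / A < K / B \<longleftrightarrow> B < A" if "K > 0" "A > 0" "B > 0" for K A B :: real
  using that by(simp add: divide_simps)
 ultimately show ?thesis unfolding cmod_fatou R_eq using assms r_pos fatou_coeff_nonzero by simp
qed

lemma forward_orbit: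
 assumes "z ~= 0" "Re (fatou z) >= 0" "cmod (fatou z) > 2 * R"
 shows "cmod ((f^^n) z) < r" "(f^^n) z ~= 0"
 using petal_orbit[OF forward cmod_less_iff_fatou, where z = z and n = n] assms R_pos by auto

lemma backward_orbit:
 assumes "z ~= 0" "Re (fatou z) < 0" "cmod (fatou z) > 2 * R"
 shows "cmod ((g^^n) z) < r" "(g^^n) z ~= 0" "cmod (fatou ((g^^n) z) + of_nat n - fatou z) <= n/4"
  "cmod (fatou ((g^^n) z)) >= 3/4 * n"
 using petal_orbit[OF backward cmod_less_iff_fatou, where z = z and n = n] assms R_pos by(auto simp: algebra_simps)

lemma backward_orbit_small:
 assumes "eps > 0"
 obtains n where "n >= 1"
  "!!z. z ~= 0 ==> Re (fatou z) < 0 ==> cmod (fatou z) > 2 * R ==> cmod ((g^^n) z) < eps"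
proof -
 define B where "B = cmod fatou_coeff / eps^m"
 obtain n :: nat where "real n > max 1 (4/3 * B)" using reals_Archimedean2 by blast
 hence n: "real n > 1" "real n > 4/3 * B" by simp_all
 have "cmod ((g^^n) z) < eps" if "z ~= 0" "Re (fatou z) < 0" "cmod (fatou z) > 2 * R" for z
 proof(rule ccontr)
  assume "~ cmod ((g^^n) z) < eps"
  hence "cmod fatou_coeff / cmod ((g^^n) z)^m <= B"
   unfolding B_def using assms by(intro divide_left_mono power_mono mult_pos_pos zero_less_power) auto
  hence "3/4 * n <= B" using backward_orbit(4)[OF that, of n] unfolding cmod_fatou by linarith
  thus False using n(2) by linarith
 qed
 thus thesis using that[of n] n by simp
qed

lemma homoclinic_point_exists:
 obtains x N where "x ~= 0" "Re (fatou x) < 0" "cmod (fatou x) > 2 * R" "fst ((H^^N) (x,1)) = 0"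
proof -
 obtain x N where x: "x ~= 0" "cmod x <= r/3" "fst ((H^^N) (x,1)) = 0"
  using iterated_preimages_accumulate[of "r/3"] r_pos by auto
 have large: "cmod (fatou x) > 2 * R"
 proof -
  have "cmod x^m <= (r/3)^m" using x(2) by(intro power_mono) auto
  moreover have "3 * (r/3)^m <= r^m"
   using self_le_power[of "3::real" m] m_pos r_pos by(simp add: power_divide divide_simps)
  ultimately have "3 * cmod x^m <= r^m" by linarith
  hence "cmod fatou_coeff / r^m <= cmod fatou_coeff / (3 * cmod x^m)" using r_pos x(1) by(intro divide_left_mono) auto
  hence "3 * R <= cmod (fatou x)" by(simp add: R_eq cmod_fatou)
  thus ?thesis using R_pos by simp
 qed
 have "Re (fatou x) < 0"
 proof(rule ccontr)
  assume "~ Re (fatou x) < 0"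
  hence orbit: "cmod ((f^^n) x) < r" "(f^^n) x ~= 0" for n using forward_orbit[OF x(1) _ large] by auto
  have "chart ((H^^N) (x,1)) = (f^^N) x" using chart_funpow(2)[of "(x,1)" N] denominator[OF orbit(1)] by simp
  thus False using x(3) orbit(2)[of N] by(simp add: chart_def)
 qed
 thus thesis using that x large by blast
qed

lemma backward_deriv:
 assumes "!!j. cmod ((g^^j) z) < r"
 shows "((g^^n) has_field_derivative deriv (g^^n) z) (at z)"
proof(induction n)
 case (Suc n)
 have "(g has_field_derivative deriv g ((g^^n) z)) (at ((g^^n) z))"
  using holomorphic_derivI[OF inverse_hol open_ball] assms[of n] by simp
 from DERIV_chain2[OF this Suc] show ?case by(simp add: DERIV_imp_deriv o_def)
qed(simp add: DERIV_imp_deriv)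

lemma backward_deriv_bound:
 assumes petal: "!!z. z:ball x delta ==> z ~= 0 & Re (fatou z) < 0 & cmod (fatou z) > 2 * R & cmod (fatou z) < M"
  and xi: "xi:ball x (delta/2)" and n: "n >= 1"
 shows "cmod (deriv (g^^n) xi) <= (M + 2) / (delta/2) * (4/3) * cmod ((g^^n) xi)"
proof -
 have orbit: "cmod ((g^^j) z) < r" "(g^^j) z ~= 0" "cmod (fatou ((g^^j) z) + of_nat j - fatou z) <= j/4"
  "cmod (fatou ((g^^j) z)) >= 3/4 * j" if "z:ball x delta" for z j using backward_orbit[of z j] petal[OF that] by auto
 define W W' where "W z = fatou ((g^^n) z)"
  and "W' z = - of_nat m * fatou ((g^^n) z) / (g^^n) z * deriv (g^^n) z" for z
 have W: "(W has_field_derivative W' z) (at z)" if "z:ball x delta" for z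
  unfolding W_def W'_def by(rule DERIV_chain2[OF fatou_deriv[OF orbit(2)[OF that]] backward_deriv[OF orbit(1)[OF that]]])
 define B where "B = M + 2"
 have bound: "cmod (W z) <= n * B" if "z:ball x delta" for z
 proof -
  have "cmod (W z) <= cmod (W z + of_nat n - fatou z) + cmod (fatou z) + n"
   using norm_triangle_ineq[of "W z + of_nat n - fatou z" "fatou z - of_nat n"] norm_triangle_ineq4[of "fatou z" "of_nat n"]
   by simp
  also have "... <= n/4 + M + n" using orbit(3)[OF that, of n] petal[OF that] by(simp add: W_def)
  also have "... <= n * B"
  proof -
   have "0 <= M" using petal[OF that] norm_ge_zero[of "fatou z"] by linarith
   hence "M <= n * M" using mult_right_mono[of 1 "real n" M] n by simp
   thus ?thesis by(simp add: B_def algebra_simps)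
  qed
  finally show ?thesis .
 qed
 have delta: "delta > 0" using xi by(smt (verit) ball_eq_empty empty_iff field_sum_of_halves)
 have disc: "cball xi (delta/2) <= ball x delta"
  using xi dist_triangle[of x _ xi] by(auto simp: subset_iff) (smt (verit) field_sum_of_halves)
 have "xi:ball x delta" using disc delta by(meson centre_in_cball half_gt_zero less_imp_le subsetD)
 note at_xi = W[OF this] orbit[OF this, of n]
 have hol: "W holomorphic_on ball x delta" unfolding holomorphic_on_open[OF open_ball] using W by blast
 define K q where "K = B / (delta/2)" and "q = cmod (deriv (g^^n) xi) / cmod ((g^^n) xi)"
 have "cmod ((deriv^^1) W xi) <= fact 1 * (n * B) / (delta/2)^1"
 proof(rule Cauchy_inequality)
  show "W holomorphic_on ball xi (delta/2)" using hol disc ball_subset_cball by(blast intro: holomorphic_on_subset)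
  show "continuous_on (cball xi (delta/2)) W"
   using hol disc by(blast intro: holomorphic_on_imp_continuous_on holomorphic_on_subset)
  show "cmod (W y) <= n * B" if "cmod (xi - y) = delta/2" for y using that disc by(intro bound) (auto simp: dist_norm)
 qed(use delta in simp)
 hence "cmod (W' xi) <= n * K" using DERIV_imp_deriv[OF at_xi(1)] by(simp add: K_def)
 hence "m * cmod (W xi) * q <= n * K" by(simp add: W'_def W_def q_def norm_mult norm_divide)
 moreover have "1 * (3/4 * n) * q <= m * cmod (W xi) * q"
  using at_xi(5) m_pos by(intro mult_right_mono mult_mono) (auto simp: W_def q_def)
 ultimately have "n * (3/4 * q) <= n * K" by(simp only: mult_1 mult_ac)
 hence "q <= K * (4/3)" using n by simp
 hence "cmod (deriv (g^^n) xi) <= K * (4/3) * cmod ((g^^n) xi)" using at_xi(3) by(simp add: q_def pos_divide_le_eq)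
 thus ?thesis by(simp only: K_def B_def)
qed

lemma repelling_iterate_if_steep:
 assumes orbit: "!!j. cmod ((g^^j) xi) < r" and "n >= 1"
  and snd: "snd ((H^^N) (xi,1)) ~= 0" and chart: "chart ((H^^N) (xi,1)) = (g^^n) xi"
  and deriv: "((%z. chart ((H^^N) (z,1))) has_field_derivative F') (at xi)"
  and steep: "cmod (deriv (g^^n) xi) < cmod F'"
 shows "repelling_fixed (H^^(n + N)) (xi,1)"
proof -
 have cont_snd: "isCont (%z. snd ((H^^k) (z,1))) xi" for k using holomorphic_hmap_funpow(2)[of k d a b UNIV]
  by(auto dest!: holomorphic_on_imp_continuous_on simp: continuous_on_eq_continuous_at)
 have f_deriv: "EX D. (f has_field_derivative D) (at ((g^^Suc k) xi)) & D * deriv (g^^Suc k) xi = deriv (g^^k) xi" for k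
 proof -
  have "f holomorphic_on ball 0 r" unfolding f_eq[abs_def] using denominator by(auto intro!: holomorphic_intros)
  hence f: "(f has_field_derivative deriv f ((g^^Suc k) xi)) (at ((g^^Suc k) xi))"
   using holomorphic_derivI[OF _ open_ball] orbit[of "Suc k"] by simp
  have "isCont (g^^k) xi" by(rule DERIV_isCont[OF backward_deriv[OF orbit]])
  hence "\<forall>\<^sub>F z in nhds xi. (g^^k) z : ball 0 r"
   using orbit[of k] isCont_tendsto_nhds by(intro topological_tendstoD) auto
  hence "\<forall>\<^sub>F z in nhds xi. f ((g^^Suc k) z) = (g^^k) z" by eventually_elim (simp add: f_g)
  hence "((g^^k) has_field_derivative deriv f ((g^^Suc k) xi) * deriv (g^^Suc k) xi) (at xi)"
   using DERIV_chain2[OF f backward_deriv[OF orbit]] by(simp only: DERIV_cong_ev)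
  thus ?thesis using f by(metis DERIV_imp_deriv)
 qed
 have "snd ((H^^(j + N)) (xi,1)) ~= 0 & chart ((H^^(j + N)) (xi,1)) = (g^^(n - j)) xi
   & (EX D. ((%z. chart ((H^^(j + N)) (z,1))) has_field_derivative D) (at xi)
    & D * deriv (g^^n) xi = F' * deriv (g^^(n - j)) xi)" if "j <= n" for j
  using that
 proof(induction j)
  case 0
  show ?case using snd chart deriv by auto
 next
  case (Suc j)
  define k V where "k = n - Suc j" and "V z = (H^^(j + N)) (z,1)" for z
  have k: "n - j = Suc k" using Suc.prems by(simp add: k_def)
  obtain D where IH: "snd (V xi) ~= 0" "chart (V xi) = (g^^Suc k) xi"
   "((%z. chart (V z)) has_field_derivative D) (at xi)" "D * deriv (g^^n) xi = F' * deriv (g^^Suc k) xi"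
   using Suc by(auto simp: V_def k simp del: funpow.simps)
  obtain D' where D': "(f has_field_derivative D') (at (chart (V xi)))" "D' * deriv (g^^Suc k) xi = deriv (g^^k) xi"
   using f_deriv[of k] IH(2) by metis
  have image: "chart (H (V z)) = f (chart (V z))" if "snd (V z) ~= 0" for z using chart_hmap(2)[OF that] by(simp add: f_eq)
  have "\<forall>\<^sub>F z in nhds xi. snd (V z) ~= 0" unfolding V_def
   by(rule isCont_eventually_nonzero[OF cont_snd]) (use IH(1) in \<open>simp add: V_def\<close>)
  hence "\<forall>\<^sub>F z in nhds xi. f (chart (V z)) = chart (H (V z))" by eventually_elim (simp add: image)
  hence "((%z. chart (H (V z))) has_field_derivative D' * D) (at xi)"
   using DERIV_chain2[OF D'(1) IH(3)] by(simp only: DERIV_cong_ev)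
  moreover have "D' * D * deriv (g^^n) xi = F' * deriv (g^^k) xi" using IH(4) D'(2) by(metis mult.assoc mult.left_commute)
  moreover have "chart (H (V xi)) = (g^^k) xi" using image[OF IH(1)] IH(2) f_g[OF orbit[of k]] by simp
  moreover have "snd (H (V xi)) ~= 0" using chart_hmap(1)[OF IH(1)] IH(1,2) denominator[OF orbit[of "Suc k"]] by simp
  ultimately show ?case by(auto simp: V_def k_def)
 qed
 from this[of n] obtain l where result: "snd ((H^^(n + N)) (xi,1)) ~= 0" "chart ((H^^(n + N)) (xi,1)) = xi"
  "((%z. chart ((H^^(n + N)) (z,1))) has_field_derivative l) (at xi)" "l * deriv (g^^n) xi = F'"
  by auto
 have "cmod (deriv (g^^n) xi) < cmod l * cmod (deriv (g^^n) xi)" using steep result(4) by(metis norm_mult)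
 hence "cmod l > 1" by(metis mult_cancel_right1 mult_left_le_one_le norm_ge_zero not_less order.asym)
 from repelling_fixedI[OF hmap_funpow_scale result(1,2) cont_snd result(3) this] show ?thesis .
qed

lemma iterate_chart_not_constant:
 assumes "delta > 0" "!!z. z:ball x delta ==> snd ((H^^N) (z,1)) ~= 0" "fst ((H^^N) (x,1)) = 0"
 shows "~ (%z. chart ((H^^N) (z,1))) constant_on ball x delta"
proof
 assume "(%z. chart ((H^^N) (z,1))) constant_on ball x delta"
 hence "chart ((H^^N) (z,1)) = 0" if "z:ball x delta" for z
  using assms(1,3) that unfolding constant_on_def by(metis centre_in_ball chart_def div_0)
 hence zero: "fst ((H^^N) (z,1)) = 0" if "z:ball x delta" for z using that assms(2)[OF that] by(auto simp: chart_def)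
 have "fst ((H^^N) (z,1)) = 0" for z
  by(rule analytic_continuation_open[where s = "ball x delta" and s' = UNIV and g = "%_. 0"])
   (use assms(1) zero in \<open>auto intro!: holomorphic_intros holomorphic_hmap_funpow\<close>)
 moreover have "\<forall>\<^sub>F z in at 0. ALL k<N. poly (dehom d b) ((f^^k) z) ~= 0"
  using eventually_denominator_nonzero by(simp add: eventually_nhds_conv_at)
 hence "\<forall>\<^sub>F z in at 0. (f^^N) z ~= 0 & (ALL k<N. poly (dehom d b) ((f^^k) z) ~= 0)"
  using eventually_funpow_nonzero by eventually_elim simp
 then obtain z where "(f^^N) z ~= 0" "!!k. k < N ==> poly (dehom d b) ((f^^k) z) ~= 0"
  using eventually_happens'[OF at_neq_bot] by blast
 ultimately show False using chart_funpow(2)[of "(z,1)" N] by(simp add: chart_def)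
qed

lemma repelling_iterate_exists:
 obtains k X where "k >= 1" "repelling_fixed (H^^k) X"
proof -
 obtain x N where x: "x ~= 0" "Re (fatou x) < 0" "cmod (fatou x) > 2 * R" "fst ((H^^N) (x,1)) = 0"
  using homoclinic_point_exists .
 define M where "M = cmod (fatou x) + 1"
 have "snd ((H^^N) (x,1)) ~= 0" using hmap_funpow_nonzero[OF nondegenerate, of "(x,1)" N] x(4) by(metis prod.collapse zero_neq_one prod.inject)
 moreover have "isCont (%z. snd ((H^^N) (z,1))) x" using holomorphic_hmap_funpow(2)[of N d a b UNIV]
  by(auto dest!: holomorphic_on_imp_continuous_on simp: continuous_on_eq_continuous_at)
 ultimately have "\<forall>\<^sub>F z in nhds x. snd ((H^^N) (z,1)) ~= 0" by(intro isCont_eventually_nonzero)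
 moreover have lim: "(fatou \<longlongrightarrow> fatou x) (nhds x)"
  by(rule isCont_tendsto_nhds[OF DERIV_isCont[OF fatou_deriv[OF x(1)]]])
 have "\<forall>\<^sub>F z in nhds x. z ~= 0" by(rule isCont_eventually_nonzero[OF continuous_ident x(1)])
 moreover have "\<forall>\<^sub>F z in nhds x. Re (fatou z) < 0" by(rule order_tendstoD(2)[OF tendsto_Re[OF lim] x(2)])
 moreover have "\<forall>\<^sub>F z in nhds x. cmod (fatou z) > 2 * R" by(rule order_tendstoD(1)[OF tendsto_norm[OF lim] x(3)])
 moreover have "\<forall>\<^sub>F z in nhds x. cmod (fatou z) < M" by(rule order_tendstoD(2)[OF tendsto_norm[OF lim]]) (simp add: M_def)
 ultimately have "\<forall>\<^sub>F z in nhds x. snd ((H^^N) (z,1)) ~= 0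
   & z ~= 0 & Re (fatou z) < 0 & cmod (fatou z) > 2 * R & cmod (fatou z) < M"
  by eventually_elim simp
 then obtain delta where delta: "delta > 0" and nonzero: "!!z. z:ball x delta ==> snd ((H^^N) (z,1)) ~= 0"
  and petal: "!!z. z:ball x delta ==> z ~= 0 & Re (fatou z) < 0 & cmod (fatou z) > 2 * R & cmod (fatou z) < M"
  unfolding eventually_nhds_metric mem_ball by(metis dist_commute)
 have half: "ball x (delta/2) <= ball x delta" using delta by auto
 note orbit = backward_orbit[OF petal[THEN conjunct1] petal[THEN conjunct2, THEN conjunct1] petal[THEN conjunct2, THEN conjunct2, THEN conjunct1]]
 define F where "F z = chart ((H^^N) (z,1))" for z
 have hol: "F holomorphic_on ball x (delta/2)" unfolding F_def chart_def
  using nonzero half by(intro holomorphic_intros holomorphic_hmap_funpow) auto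
 obtain n xi where n: "n >= 1" and xi: "xi:ball x (delta/2)" "F xi = (g^^n) xi" "cmod (deriv (g^^n) xi) < cmod (deriv F xi)"
 proof(rule steep_intersection[OF hol, where G = "%n. g^^n"])
  show "~ F constant_on ball x (delta/2)"
   unfolding F_def using delta nonzero half x(4) by(intro iterate_chart_not_constant) auto
  show "(g^^n) holomorphic_on ball x (delta/2)" for n
   unfolding holomorphic_on_open[OF open_ball] using backward_deriv[OF orbit(1)] half by blast
  show "(g^^n) z ~= 0" if "z:ball x (delta/2)" for n z using orbit(2) that half by blast
  show "cmod (deriv (g^^n) z) <= (M + 2) / (delta/2) * (4/3) * cmod ((g^^n) z)" if "n >= 1" "z:ball x (delta/2)" for n z
   by(rule backward_deriv_bound[OF petal that(2,1)])
  show "EX n>=1. ALL z:ball x (delta/2). cmod ((g^^n) z) < eps" if pos: "eps > 0" for eps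
  proof -
   obtain n where "n >= 1" "!!z. z ~= 0 ==> Re (fatou z) < 0 ==> cmod (fatou z) > 2 * R ==> cmod ((g^^n) z) < eps"
    using backward_orbit_small[OF pos] by metis
   thus ?thesis using petal half by blast
  qed
 qed(use delta x(4) that in \<open>auto simp: F_def chart_def\<close>)
 have "repelling_fixed (H^^(n + N)) (xi,1)"
 proof(rule repelling_iterate_if_steep[OF _ n])
  show "((%z. chart ((H^^N) (z,1))) has_field_derivative deriv F xi) (at xi)"
   using holomorphic_derivI[OF hol open_ball xi(1)] by(simp add: F_def[abs_def])
 qed(use xi orbit(1) nonzero half in \<open>auto simp: F_def\<close>)
 thus thesis using that[of "n + N"] n by simp
qed

end

lemma hmap_funpow_conj:
 assumes conj: "!!X. hmap d a' b' X = lin p q r s (hmap d a b (lin s (-q) (-r) p X))" and det: "p * s - q * r = 1"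
 shows "(hmap d a' b'^^k) X = lin p q r s ((hmap d a b^^k) (lin s (-q) (-r) p X))"
 by(induction k) (auto simp: conj lin_inverse[OF det])

lemma repelling_iterate_conj:
 assumes conj: "!!X. hmap d a' b' X = lin p q r s (hmap d a b (lin s (-q) (-r) p X))" and det: "p * s - q * r = 1"
  and "repelling_fixed (hmap d a' b'^^k) X"
 shows "repelling_fixed (hmap d a b^^k) (lin s (-q) (-r) p X)"
proof(rule repelling_fixed_conj[OF _ det])
 have "(hmap d a' b'^^k) = (%X. lin p q r s ((hmap d a b^^k) (lin s (-q) (-r) p X)))"
  using hmap_funpow_conj[OF conj det] by blast
 thus "repelling_fixed (%X. lin p q r s ((hmap d a b^^k) (lin s (-q) (-r) p X))) X" using assms(3) by simp
qed

definition fixed_point_poly :: "nat => (nat => complex) => (nat => complex) => complex poly" where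
 "fixed_point_poly d a b = [:0, 1:] * dehom d b - dehom d a"

lemma poly_fixed_point_poly: "poly (fixed_point_poly d a b) z = z * poly (dehom d b) z - poly (dehom d a) z"
 by(simp add: fixed_point_poly_def)

lemma coeff_fixed_point_poly:
 "coeff (fixed_point_poly d a b) 0 = - a 0"
 "coeff (fixed_point_poly d a b) (Suc i) = (if i <= d then b i else 0) - (if i < d then a (Suc i) else 0)"
 by(auto simp: fixed_point_poly_def coeff_dehom)

lemma fixed_point_poly_root:
 assumes "nondegenerate d a b" "poly (fixed_point_poly d a b) x = 0"
 shows "poly (dehom d a) x = x * poly (dehom d b) x" "poly (dehom d b) x ~= 0"
 using assms(2) nondegenerate_chart[OF assms(1), of x] by(auto simp: poly_fixed_point_poly)

lemma repelling_at_multiple_zero: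
 assumes d: "d >= 2" and nd: "nondegenerate d a b"
  and a_0: "a 0 = 0" and b_0: "b 0 ~= 0" and a_1: "a 1 = b 0" and nonzero: "fixed_point_poly d a b ~= 0"
 obtains k X where "k >= 1" "repelling_fixed (hmap d a b^^k) X"
proof -
 define E q where "E = fixed_point_poly d a b" and "q = dehom d b"
 obtain n e where E: "E = [:-0, 1:]^n * e" "poly e 0 ~= 0"
  using order_decomp[OF nonzero, of 0] unfolding E_def by(metis poly_eq_0_iff_dvd)
 have E_monom: "E = monom 1 n * e" using E(1) by(simp add: monom_altdef)
 have "coeff E 0 = 0" "coeff E 1 = 0"
  using d a_0 a_1 coeff_fixed_point_poly(2)[of d a b 0] by(simp_all add: E_def coeff_fixed_point_poly(1))
 moreover have "coeff E n ~= 0" unfolding E_monom using E(2) by(subst coeff_monom_mult) (simp add: poly_0_coeff_0)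
 ultimately have "n ~= 0" "n ~= 1" by metis+
 then obtain m where m: "m >= 1" "n = Suc m" by(metis One_nat_def Suc_le_eq not0_implies_Suc not_gr0)
 define u where "u z = - poly e z / poly q z" for z
 have q_0: "poly q 0 ~= 0" using b_0 by(simp add: q_def poly_0_coeff_0 coeff_dehom)
 have "\<forall>\<^sub>F z in nhds 0. poly q z ~= 0" by(rule isCont_eventually_nonzero) (simp_all add: q_0)
 hence "\<forall>\<^sub>F z in nhds 0. poly (dehom d a) z / poly (dehom d b) z = z + z^Suc m * u z"
 proof eventually_elim
  case (elim z)
  have "poly (dehom d a) z = z * poly q z - z^n * poly e z"
   using arg_cong[OF E(1), of "%p. poly p z"] by(simp add: E_def q_def poly_fixed_point_poly algebra_simps)
  thus ?case using elim by(simp add: u_def m(2) diff_divide_distrib flip: q_def)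
 qed
 moreover have "isCont u 0" unfolding u_def using q_0 by(intro continuous_intros) auto
 ultimately interpret parabolic_hmap d a b "%z. poly (dehom d a) z / poly (dehom d b) z" m u
  using d nd a_0 b_0 a_1 m(1) E(2) q_0 by unfold_locales (auto simp: u_def)
 obtain r g where "parabolic_petal d a b (%z. poly (dehom d a) z / poly (dehom d b) z) m u r g"
  using petal_exists .
 thus thesis using parabolic_petal.repelling_iterate_exists that by blast
qed

lemma card_roots_rsquarefree:
 fixes E :: "complex poly"
 assumes "rsquarefree E" "E ~= 0"
 shows "card {x. poly E x = 0} = degree E"
proof -
 have "degree E = degree (smult (lead_coeff E) (\<Prod>z | poly E z = 0. [:-z, 1:]))"
  using complex_poly_decompose_rsquarefree[OF assms(1)] by simp
 also have "... = (\<Sum>z | poly E z = 0. degree [:-z, 1:])"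
  using assms(2) by(simp only: degree_smult_eq leading_coeff_0_iff if_False) (rule degree_prod_eq_sum_degree, auto)
 finally show ?thesis by simp
qed

lemma sum_residues_at_roots:
 fixes E q :: "complex poly"
 assumes rsq: "rsquarefree E" and nonzero: "E ~= 0" and deg: "degree q < degree E"
 shows "(\<Sum>x | poly E x = 0. poly q x / poly (pderiv E) x) = coeff q (degree E - 1) / lead_coeff E"
proof -
 define R c L where "R = {x. poly E x = 0}" and "c = lead_coeff E" and "L x = (\<Prod>y\<in>R - {x}. [:-y, 1:])" for x
 have c: "c ~= 0" using nonzero by(simp add: c_def)
 have fin: "finite R" unfolding R_def using nonzero by(rule poly_roots_finite)
 have card: "card R = degree E" unfolding R_def by(rule card_roots_rsquarefree[OF rsq nonzero])
 have split: "E = smult c ([:-x, 1:] * L x)" if "x:R" for x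
  using complex_poly_decompose_rsquarefree[OF rsq] prod.remove[OF fin that, of "%y. [:-y, 1:]"]
  by(simp add: R_def c_def L_def)
 have deg_L: "degree (L x) = degree E - 1" "coeff (L x) (degree E - 1) = 1" if "x:R" for x
 proof -
  have "degree (L x) = (\<Sum>y\<in>R - {x}. degree [:-y, 1:])" unfolding L_def by(rule degree_prod_eq_sum_degree) auto
  thus degree: "degree (L x) = degree E - 1" using that card by simp
  have "lead_coeff (L x) = 1" unfolding L_def lead_coeff_prod by simp
  thus "coeff (L x) (degree E - 1) = 1" by(simp only: degree)
 qed
 have L_0: "poly (L x) y = 0" if "y:R" "y ~= x" for x y using fin that by(auto simp: L_def poly_prod)
 have L_x: "poly (L x) x ~= 0" for x using fin by(auto simp: L_def poly_prod)
 have pderiv: "poly (pderiv E) x = c * poly (L x) x" if "x:R" for x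
  by(subst split[OF that]) (simp add: pderiv_smult pderiv_mult pderiv_pCons del: mult_pCons_left)
 define T where "T = (\<Sum>x\<in>R. smult (poly q x / poly (L x) x) (L x))"
 have "T = q"
 proof(rule poly_eqI_degree[of R])
  fix y assume y: "y:R"
  have "poly T y = (\<Sum>x\<in>R. if x = y then poly q y else 0)"
   unfolding T_def poly_sum using L_0[OF y] L_x by(intro sum.cong) auto
  thus "poly T y = poly q y" using fin y by simp
 next
  have "degree T <= degree E - 1"
   unfolding T_def using deg_L(1) by(intro degree_sum_le fin) (auto intro: order.trans[OF degree_smult_le])
  thus "card R > degree T" using card deg by simp
 qed(use card deg in simp)
 hence "coeff q (degree E - 1) = (\<Sum>x\<in>R. poly q x / poly (L x) x * coeff (L x) (degree E - 1))"
  unfolding T_def by(metis (no_types, lifting) coeff_smult coeff_sum sum.cong)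
 also have "... = (\<Sum>x\<in>R. c * (poly q x / poly (pderiv E) x))" using deg_L(2) pderiv c by(intro sum.cong) auto
 also have "... = c * (\<Sum>x\<in>R. poly q x / poly (pderiv E) x)" by(rule sum_distrib_left[symmetric])
 finally show ?thesis using c by(simp add: R_def c_def)
qed

lemma Re_inverse_one_minus_ge:
 assumes "cmod l <= 1" "l ~= 1"
 shows "Re (1 / (1 - l)) >= 1/2"
proof -
 have "(cmod (1 - l))\<^sup>2 = 1 - 2 * Re l + (cmod l)\<^sup>2"
  by(simp add: cmod_power2) (simp add: power2_eq_square algebra_simps)
 moreover have "(cmod l)\<^sup>2 <= 1" using assms(1) by(simp add: power_le_one)
 ultimately have "(cmod (1 - l))\<^sup>2 <= 2 * (1 - Re l)" by simp
 moreover have "(cmod (1 - l))\<^sup>2 > 0" using assms(2) by simp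
 moreover have "Re (1 / (1 - l)) = (1 - Re l) / (cmod (1 - l))\<^sup>2" by(simp add: Re_divide cmod_power2)
 ultimately show ?thesis by(simp only: pos_le_divide_eq) simp
qed

text \<open>If all fixed points are simple, then the holomorphic fixed point formula forces one of the
 multipliers outside the closed unit disc.\<close>

lemma repelling_fixed_if_rsquarefree:
 assumes d: "d >= 2" and nd: "nondegenerate d a b" and b_d: "b d ~= 0" and rsq: "rsquarefree (fixed_point_poly d a b)"
 obtains X where "repelling_fixed (hmap d a b) X"
proof -
 define E p q where "E = fixed_point_poly d a b" and "p = dehom d a" and "q = dehom d b"
 have top: "coeff E (Suc d) = b d" by(simp add: E_def coeff_fixed_point_poly(2))
 hence nonzero: "E ~= 0" using b_d by auto
 have "degree E <= Suc d" by(rule degree_le) (auto simp: E_def coeff_fixed_point_poly(2) less_Suc_eq_le elim!: less_natE)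
 moreover have "degree E >= Suc d" using top b_d by(intro le_degree) simp
 ultimately have deg: "degree E = Suc d" by simp
 note root = fixed_point_poly_root[OF nd, folded E_def p_def q_def]
 define l where "l x = (poly (pderiv p) x - x * poly (pderiv q) x) / poly q x" for x
 have E': "poly (pderiv E) x = poly q x * (1 - l x)" if "poly E x = 0" for x
  using root[OF that] by(simp add: E_def fixed_point_poly_def l_def pderiv_diff pderiv_pCons field_simps flip: p_def q_def)
 have residue: "poly q x / poly (pderiv E) x = 1 / (1 - l x)" "l x ~= 1" if "poly E x = 0" for x
  using E'[OF that] root(2)[OF that] rsq that unfolding E_def rsquarefree_roots by auto
 have "(\<Sum>x | poly E x = 0. poly q x / poly (pderiv E) x) = 1"
  using sum_residues_at_roots[of E q] rsq nonzero degree_dehom_le[of d b] b_d top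
  by(simp add: deg coeff_dehom[of d b, folded q_def] flip: E_def q_def)
 hence "(\<Sum>x | poly E x = 0. 1 / (1 - l x)) = 1" using residue(1) by simp
 hence sum: "(\<Sum>x | poly E x = 0. Re (1 / (1 - l x))) = 1" by(metis Re_sum one_complex.simps(1))
 have "EX x. poly E x = 0 & cmod (l x) > 1"
 proof(rule ccontr)
  assume "\<nexists>x. poly E x = 0 & cmod (l x) > 1"
  hence "Re (1 / (1 - l x)) >= 1/2" if "poly E x = 0" for x
   using that residue(2)[OF that] by(intro Re_inverse_one_minus_ge) (auto simp: not_less)
  hence "(\<Sum>x | poly E x = 0. 1/2) <= (\<Sum>x | poly E x = 0. Re (1 / (1 - l x)))" by(intro sum_mono) auto
  thus False using sum card_roots_rsquarefree[of E] rsq nonzero d by(simp add: deg flip: E_def)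
 qed
 then obtain x where x: "poly E x = 0" "cmod (l x) > 1" by blast
 have "repelling_fixed (hmap d a b) (x, 1)"
 proof(rule repelling_fixedI[OF hmap_scale, where l = "l x"])
  have "((%z. poly p z / poly q z) has_field_derivative
    (poly (pderiv p) x * poly q x - poly p x * poly (pderiv q) x) / (poly q x * poly q x)) (at x)"
   using root[OF x(1)] by(intro DERIV_divide poly_DERIV) auto
  moreover have "(poly (pderiv p) x * poly q x - poly p x * poly (pderiv q) x) / (poly q x * poly q x) = l x"
   using root[OF x(1)] by(simp add: l_def field_simps)
  ultimately show "((%z. chart (hmap d a b (z, 1))) has_field_derivative l x) (at x)"
   by(simp add: hmap_pair chart_def p_def q_def)
 qed(use root[OF x(1)] x(2) in \<open>auto simp: hmap_pair chart_def p_def q_def\<close>)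
 thus thesis by(rule that)
qed

lemma repelling_iterate_if_infinity_not_fixed:
 assumes d: "d >= 2" and nd: "nondegenerate d a b" and b_d: "b d ~= 0"
 obtains k X where "k >= 1" "repelling_fixed (hmap d a b^^k) X"
proof(cases "rsquarefree (fixed_point_poly d a b)")
 case True
 then obtain X where "repelling_fixed (hmap d a b^^1) X" using repelling_fixed_if_rsquarefree[OF d nd b_d] by auto
 thus thesis by(intro that) auto
next
 case False
 define E where "E = fixed_point_poly d a b"
 obtain x where x: "poly E x = 0" "poly (pderiv E) x = 0" using False by(auto simp: rsquarefree_roots E_def)
 obtain a' b' where ab: "!!X. lin 1 (-x) 0 1 (hmap d a b (lin 1 x 0 1 X)) = hmap d a' b' X" using hmap_conj by metis
 hence conj: "hmap d a' b' X = lin 1 (-x) 0 1 (hmap d a b (lin 1 (-(-x)) (-0) 1 X))" for X by simp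
 have translate: "poly (dehom d a') z = poly (dehom d a) (z + x) - x * poly (dehom d b) (z + x)"
  "poly (dehom d b') z = poly (dehom d b) (z + x)" for z
  using ab[of "(z,1)"] by(auto simp: hmap_pair lin_def)
 have "poly (fixed_point_poly d a' b') z = poly (pcompose E [:x, 1:]) z" for z
  by(simp add: translate E_def poly_fixed_point_poly poly_pcompose algebra_simps)
 hence E': "fixed_point_poly d a' b' = pcompose E [:x, 1:]" by(metis poly_eq_poly_eq_iff ext)
 have "coeff (fixed_point_poly d a' b') 1 = poly (pderiv (pcompose E [:x, 1:])) 0"
  by(simp add: E' poly_0_coeff_0 coeff_pderiv)
 also have "... = 0" using x(2) by(simp add: pderiv_pcompose poly_pcompose)
 finally have double: "a' 1 = b' 0" using d coeff_fixed_point_poly(2)[of d a' b' 0] by simp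
 have "coeff E (Suc d) ~= 0" using b_d by(simp add: E_def coeff_fixed_point_poly(2))
 hence "E ~= 0" by auto
 hence nonzero: "fixed_point_poly d a' b' ~= 0" by(simp add: E' pcompose_eq_0_iff)
 have "poly (dehom d a') 0 = 0" "poly (dehom d b') 0 ~= 0"
  using translate[of 0] fixed_point_poly_root[OF nd, of x] x(1) by(simp_all add: E_def)
 hence "a' 0 = 0" "b' 0 ~= 0" by(simp_all add: poly_0_coeff_0 coeff_dehom)
 moreover have "nondegenerate d a' b'" by(rule nondegenerate_conj[OF conj _ nd]) simp
 ultimately obtain k X where "k >= 1" "repelling_fixed (hmap d a' b'^^k) X"
  using repelling_at_multiple_zero[OF d _ _ _ double nonzero] by blast
 thus thesis using that repelling_iterate_conj[OF conj] by fastforce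
qed

theorem repelling_periodic_point:
 fixes a b :: "nat => complex"
 assumes d: "d >= 2" and nd: "nondegenerate d a b"
 obtains k X where "k >= 1" "repelling_fixed (hmap d a b^^k) X"
proof -
 obtain x where x: "wedge (hmap d a b (x,1)) (x,1) ~= 0" using hmap_not_identity[OF d nd] .
 have det: "0 * x - 1 * (-1) = (1::complex)" by simp
 obtain a' b' where "!!X. lin 0 1 (-1) x (hmap d a b (lin x (-1) (-(-1)) 0 X)) = hmap d a' b' X" using hmap_conj by metis
 note conj = this[symmetric]
 have "b' d = - wedge (hmap d a b (x,1)) (x,1)" using arg_cong[OF conj[of "(1,0)"], of snd]
  by(simp add: lin_def hmap_def hform_1_0 wedge_def algebra_simps)
 hence "b' d ~= 0" using x by simp
 then obtain k X where "k >= 1" "repelling_fixed (hmap d a' b'^^k) X"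
  using repelling_iterate_if_infinity_not_fixed[OF d nondegenerate_conj[OF conj det nd]] by blast
 thus thesis using that repelling_iterate_conj[OF conj det] by blast
qed

section \<open>Resultants\<close>

text \<open>The linear factors \<open>v i\<close> of \<open>x \<mapsto> wedge (F x) w\<close> represent the preimages of the line through \<open>w\<close>.
 Up to sign, the product of the \<open>s i\<close> is the resultant of the components of \<open>F\<close>; in particular it does not depend on \<open>w\<close>.\<close>

definition preimage_factors :: "(complex * complex => complex * complex) => complex * complex => nat =>
  (nat => complex * complex) => (nat => complex) => bool" where
 "preimage_factors F w d v s \<longleftrightarrow> (ALL x. wedge (F x) w = (\<Prod>i<d. wedge x (v i)))
  & (ALL i<d. v i ~= (0,0) & F (v i) = scale (s i) w)"

definition resultant_one :: "(complex * complex => complex * complex) => nat => bool" where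
 "resultant_one F d \<longleftrightarrow> (ALL w. w ~= (0,0) --> (EX v s. preimage_factors F w d v s & (\<Prod>i<d. s i) = 1))"

lemma hform_linear_factors:
 fixes c :: "nat => complex"
 obtains l v where "!!x y. hform d c x y = l * (\<Prod>i<d. wedge (x,y) (v i))"
proof(induction d arbitrary: c thesis)
 case 0
 show ?case by(rule 0[of "c 0"]) (simp add: hform_def)
next
 case (Suc d)
 obtain v' c' where factor: "!!x y. hform (Suc d) c x y = wedge (x,y) v' * hform d c' x y"
 proof -
  obtain v' c' where v': "dehom (Suc d) c = [:fst v' * -1, snd v':] * dehom d c'"
  proof(cases "c (Suc d) = 0")
   case True
   have "dehom (Suc d) c = [:fst (-1, 0) * -1, snd (-1, 0):] * dehom d c"
    using True by(intro poly_eqI) (auto simp: coeff_dehom le_Suc_eq)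
   thus thesis by(rule that)
  next
   case False
   hence "degree (dehom (Suc d) c) >= Suc d" by(intro le_degree) (simp add: coeff_dehom)
   hence deg: "degree (dehom (Suc d) c) = Suc d" using degree_dehom_le by(rule antisym[rotated])
   then obtain z where "poly (dehom (Suc d) c) z = 0" using alg_closed_imp_poly_has_root[of "dehom (Suc d) c"] by auto
   then obtain q where q: "dehom (Suc d) c = [:-z, 1:] * q" by(auto simp: poly_eq_0_iff_dvd elim: dvdE)
   hence "q ~= 0" using deg by auto
   hence "degree q = d" using deg unfolding q by(subst (asm) degree_mult_eq) auto
   hence "dehom d (coeff q) = q" by(intro poly_eqI) (auto simp: coeff_dehom coeff_eq_0)
   thus thesis using that[of "(z,1)" "coeff q"] q by simp
  qed
  have product: "is_hform (1 + d) (%x y. (snd v' * x + (- fst v') * y) * hform d c' x y)"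
   by(intro is_hform_mult is_hform_linear) (auto simp: is_hform_def)
  have "is_hform (1 + d) (hform (Suc d) c)" by(auto simp: is_hform_def)
  from is_hform_eqI[OF this product] have "hform (Suc d) c x y = (snd v' * x + (- fst v') * y) * hform d c' x y" for x y
   by(simp add: hform_1 v' algebra_simps)
  thus thesis using that[of v' c'] by(simp add: wedge_def mult.commute)
 qed
 obtain l v where lv: "!!x y. hform d c' x y = l * (\<Prod>i<d. wedge (x,y) (v i))" using Suc.IH by blast
 have "hform (Suc d) c x y = l * (\<Prod>i<Suc d. wedge (x,y) ((v(d := v')) i))" for x y by(simp add: factor lv mult_ac)
 thus ?case by(rule Suc.prems)
qed

lemma preimage_factors_pairing:
 assumes F: "preimage_factors F w d v s" and G: "preimage_factors (%x. scale eps (F x)) w' d v' s'"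
  and "wedge w w' ~= 0"
 shows "eps^(2 * d) * (\<Prod>i<d. s i) = (\<Prod>i<d. s' i)"
proof -
 define W sig where "W = wedge w w'" and "sig = (-1::complex)^(d + 1)"
 have by_rows: "(\<Prod>j<d. wedge (v i) (v' j)) = eps * W * s i" if "i < d" for i
 proof -
  have "(\<Prod>j<d. wedge (v i) (v' j)) = wedge (scale eps (F (v i))) w'" using G by(simp add: preimage_factors_def)
  thus ?thesis using F that by(simp add: preimage_factors_def W_def mult_ac)
 qed
 have by_columns: "eps * (\<Prod>i<d. wedge (v i) (v' j)) = sig * W * s' j" if "j < d" for j
 proof -
  have "(\<Prod>i<d. wedge (v i) (v' j)) = (\<Prod>i<d. -1 * wedge (v' j) (v i))"
   by(intro prod.cong refl) (subst wedge_commute, simp)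
  also have "... = (-1)^d * (\<Prod>i<d. wedge (v' j) (v i))" unfolding prod.distrib by simp
  also have "(\<Prod>i<d. wedge (v' j) (v i)) = wedge (F (v' j)) w" using F by(simp add: preimage_factors_def)
  finally have "eps * (\<Prod>i<d. wedge (v i) (v' j)) = (-1)^d * wedge (scale eps (F (v' j))) w" by simp
  also have "scale eps (F (v' j)) = scale (s' j) w'" using G that by(simp add: preimage_factors_def)
  finally show ?thesis using wedge_commute[of w' w] by(simp add: W_def sig_def)
 qed
 have "eps^d * (\<Prod>i<d. \<Prod>j<d. wedge (v i) (v' j)) = eps^d * (eps^d * W^d * (\<Prod>i<d. s i))"
  using by_rows by(simp add: prod.distrib power_mult_distrib)
 moreover have "eps^d * (\<Prod>i<d. \<Prod>j<d. wedge (v i) (v' j)) = (\<Prod>j<d. eps * (\<Prod>i<d. wedge (v i) (v' j)))"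
  by(subst prod.swap) (simp add: prod.distrib)
 moreover have "(\<Prod>j<d. eps * (\<Prod>i<d. wedge (v i) (v' j))) = sig^d * W^d * (\<Prod>j<d. s' j)"
  using by_columns by(simp add: prod.distrib power_mult_distrib)
 moreover have "sig^d = 1" by(cases "even d") (auto simp: sig_def)
 ultimately have "W^d * (eps^d * eps^d * (\<Prod>i<d. s i)) = W^d * (\<Prod>j<d. s' j)" by(auto simp: mult_ac)
 thus ?thesis using assms(3) by(simp add: W_def mult_2 power_add)
qed

lemma preimage_factors_exist:
 fixes a b :: "nat => complex"
 assumes nd: "nondegenerate d a b" and d: "d > 0" and w: "w ~= (0,0)"
 obtains v s where "preimage_factors (hmap d a b) w d v s"
proof -
 obtain l v0 where lv: "!!x y. hform d (%i. a i * snd w - b i * fst w) x y = l * (\<Prod>i<d. wedge (x,y) (v0 i))"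
  using hform_linear_factors by blast
 define v where "v i = (if i = 0 then scale l (v0 i) else v0 i)" for i
 obtain e where e: "d = Suc e" using d by(cases d) auto
 have factors: "wedge (hmap d a b x) w = (\<Prod>i<d. wedge x (v i))" for x
  unfolding wedge_hmap_eq_hform lv by(simp add: e prod.lessThan_Suc_shift v_def del: prod.lessThan_Suc)
 obtain w' where "wedge w w' = 1" using wedge_one_exists[OF w] .
 obtain Y where Y: "Y ~= (0,0)" "wedge (hmap d a b Y) w' = 0" using hmap_hits[OF d] by blast
 have "wedge (hmap d a b Y) w ~= 0"
 proof
  assume "wedge (hmap d a b Y) w = 0"
  hence "wedge w (hmap d a b Y) = 0" using wedge_commute[of w] by simp
  hence "wedge w w' = 0" using wedge_trans Y(2) nondegenerate_nonzero[OF nd Y(1)] by blast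
  thus False using `wedge w w' = 1` by simp
 qed
 hence "wedge Y (v i) ~= 0" if "i < d" for i using factors[of Y] that by auto
 hence "v i ~= (0,0)" if "i < d" for i using that by(fastforce simp: wedge_def)
 moreover have "EX s. hmap d a b (v i) = scale s w" if "i < d" for i
 proof -
  have "wedge (hmap d a b (v i)) w = 0" unfolding factors using that by(intro prod_zero bexI[of _ i]) auto
  thus ?thesis using wedge_zero_imp_scale[OF _ w] by blast
 qed
 moreover from this obtain s where "!!i. i < d ==> hmap d a b (v i) = scale (s i) w" by metis
 ultimately show thesis using that[of v s] factors by(simp add: preimage_factors_def)
qed

lemma resultant_one_normalise:
 fixes a b :: "nat => complex"
 assumes nd: "nondegenerate d a b" and d: "d > 0"
 obtains c where "c ~= 0" "resultant_one (hmap d (%i. c * a i) (%i. c * b i)) d"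
proof -
 obtain v s where L: "preimage_factors (hmap d a b) (1,0) d v s" using preimage_factors_exist[OF nd d, of "(1,0)"] by auto
 define r where "r = (\<Prod>i<d. s i)"
 have "s i ~= 0" if "i < d" for i
  using L that nondegenerate_nonzero[OF nd, of "v i"] by(auto simp: preimage_factors_def scale_def)
 hence "r ~= 0" by(simp add: r_def)
 define P where "P = monom r (2 * d) - (1::complex poly)"
 have "degree P >= 2 * d" using d `r ~= 0` by(intro le_degree) (simp add: P_def)
 then obtain c where "poly P c = 0" using alg_closed_imp_poly_has_root[of P] d by auto
 hence c: "c^(2 * d) * r = 1" by(simp add: P_def poly_monom mult.commute)
 hence "c ~= 0" using d by(auto simp: power_0_left split: if_splits)
 have scaled: "hmap d (%i. c * a i) (%i. c * b i) = (%x. scale c (hmap d a b x))" by(auto simp: scale_hmap)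
 have nd': "nondegenerate d (%i. c * a i) (%i. c * b i)"
  using nd `c ~= 0` by(simp add: nondegenerate_def scale_hmap scale_eq_0_iff)
 obtain v1 s1 where L1: "preimage_factors (hmap d a b) (0,1) d v1 s1" using preimage_factors_exist[OF nd d, of "(0,1)"] by auto
 have r1: "(\<Prod>i<d. s1 i) = r"
  using preimage_factors_pairing[OF L, of 1 "(0,1)" v1 s1] L1 by(simp add: r_def wedge_def)
 have "EX v s. preimage_factors (%x. scale c (hmap d a b x)) w d v s & (\<Prod>i<d. s i) = 1" if w: "w ~= (0,0)" for w
 proof -
  obtain v' s' where L': "preimage_factors (%x. scale c (hmap d a b x)) w d v' s'"
   using preimage_factors_exist[OF nd' d w] unfolding scaled by blast
  have "wedge (1,0) w ~= 0 | wedge (0,1) w ~= 0" using w by(auto simp: wedge_def prod_eq_iff)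
  hence "(\<Prod>i<d. s' i) = c^(2 * d) * r"
   using preimage_factors_pairing[OF L L'] preimage_factors_pairing[OF L1 L'] r1 by(auto simp: r_def)
  thus ?thesis using L' c by auto
 qed
 hence "resultant_one (hmap d (%i. c * a i) (%i. c * b i)) d" unfolding resultant_one_def scaled by blast
 thus thesis by(rule that[OF `c ~= 0`])
qed

lemma resultant_one_scale:
 assumes "resultant_one F d" "resultant_one (%x. scale eps (F x)) d"
 shows "eps^(2 * d) = 1"
proof -
 obtain v s where L: "preimage_factors F (1,0) d v s" "(\<Prod>i<d. s i) = 1"
  using assms(1) unfolding resultant_one_def by(metis prod.inject zero_neq_one)
 obtain v' s' where L': "preimage_factors (%x. scale eps (F x)) (0,1) d v' s'" "(\<Prod>i<d. s' i) = 1"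
  using assms(2) unfolding resultant_one_def by(metis prod.inject zero_neq_one)
 show ?thesis using preimage_factors_pairing[OF L(1) L'(1)] L(2) L'(2) by(simp add: wedge_def)
qed

lemma resultant_one_id: "resultant_one (%x. x) 1" unfolding resultant_one_def preimage_factors_def
 by(intro allI impI exI[of _ "%_. _"] exI[of _ "%_. 1"]) auto

lemma prod_div_mod: "(\<Prod>k<d * e. f (k div e) (k mod e)) = (\<Prod>i<d. \<Prod>j<e. f i (j::nat))"
proof -
 have "(\<Prod>k\<in>{i * e..<i * e + e}. f (k div e) (k mod e)) = (\<Prod>j<e. f i j)" for i
  using prod.shift_bounds_nat_ivl[of "%k. f (k div e) (k mod e)" 0 "i * e" e]
  by(auto simp: add.commute atLeast0LessThan intro!: prod.cong)
 thus ?thesis by(simp flip: prod.nat_group)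
qed

lemma resultant_one_comp:
 assumes F: "resultant_one F d" "!!c x. F (scale c x) = scale (c^d) (F x)" and G: "resultant_one G e"
 shows "resultant_one (%x. F (G x)) (d * e)"
 unfolding resultant_one_def
proof(intro allI impI)
 fix w :: "complex * complex" assume "w ~= (0,0)"
 then obtain v s where L: "preimage_factors F w d v s" "(\<Prod>i<d. s i) = 1"
  using F(1) unfolding resultant_one_def by blast
 have "ALL i:{..<d}. EX u t. preimage_factors G (v i) e u t & (\<Prod>j<e. t j) = 1"
  using L(1) G unfolding preimage_factors_def resultant_one_def by blast
 then obtain u t where M: "!!i. i < d ==> preimage_factors G (v i) e (u i) (t i)" "!!i. i < d ==> (\<Prod>j<e. t i j) = 1"
  by(metis lessThan_iff)
 define v' where "v' k = u (k div e) (k mod e)" for k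
 define s' where "s' k = t (k div e) (k mod e)^d * s (k div e)" for k
 have "preimage_factors (%x. F (G x)) w (d * e) v' s'" unfolding preimage_factors_def
 proof(intro conjI allI impI)
  fix x
  have "wedge (F (G x)) w = (\<Prod>i<d. wedge (G x) (v i))" using L(1) by(simp add: preimage_factors_def)
  also have "... = (\<Prod>i<d. \<Prod>j<e. wedge x (u i j))" using M(1) by(simp add: preimage_factors_def)
  finally show "wedge (F (G x)) w = (\<Prod>k<d * e. wedge x (v' k))"
   by(simp add: v'_def prod_div_mod[of "%i j. wedge x (u i j)"])
 next
  fix k assume "k < d * e"
  hence k: "k div e < d" "k mod e < e" by(auto simp: less_mult_imp_div_less) (cases "e = 0"; simp)
  thus "v' k ~= (0,0)" "F (G (v' k)) = scale (s' k) w"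
   using M(1)[OF k(1)] L(1) by(auto simp: preimage_factors_def v'_def s'_def F(2))
 qed
 moreover have "(\<Prod>k<d * e. s' k) = (\<Prod>i<d. (\<Prod>j<e. t i j)^d * s i^e)"
  unfolding s'_def prod_div_mod[of "%i j. t i j^d * s i"] by(simp add: prod.distrib prod_power_distrib)
 moreover have "... = 1" using M(2) L(2) by(simp add: prod.distrib flip: prod_power_distrib)
 ultimately show "EX v s. preimage_factors (%x. F (G x)) w (d * e) v s & (\<Prod>i<d * e. s i) = 1" by auto
qed

section \<open>Words in homogeneous maps\<close>

fun act :: "('g => nat) => ('g => nat => 'r::comm_ring_1) => ('g => nat => 'r) => 'g list => 'r * 'r => 'r * 'r" where
 "act D a b [] X = X"
| "act D a b (g # w) X = hmap (D g) (a g) (b g) (act D a b w X)"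

definition wdeg :: "('g => nat) => 'g list => nat" where
 "wdeg D w = prod_list (map D w)"

lemma wdeg_simps [simp]: "wdeg D [] = 1" "wdeg D (g # w) = D g * wdeg D w" "wdeg D (u @ v) = wdeg D u * wdeg D v"
 by(simp_all add: wdeg_def)

lemma act_append: "act D a b (u @ v) X = act D a b u (act D a b v X)" by(induction u) auto

lemma act_scale: "act D a b w (scale c X) = scale (c^wdeg D w) (act D a b w X)"
 by(induction w) (auto simp: hmap_scale mult.commute simp flip: power_mult)

lemma act_replicate: "act D a b (replicate k g) X = (hmap (D g) (a g) (b g)^^k) X" by(induction k) auto

lemma wdeg_replicate: "wdeg D (replicate k g) = D g^k" by(induction k) auto

lemma act_conj:
 assumes conj: "!!g X. g:set w ==> hmap (D g) (a' g) (b' g) X = lin p q r s (hmap (D g) (a g) (b g) (lin s (-q) (-r) p X))"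
  and det: "p * s - q * r = 1"
 shows "act D a' b' w X = lin p q r s (act D a b w (lin s (-q) (-r) p X))"
 using conj by(induction w) (auto simp: lin_inverse[OF det])

lemma ring_hom_on_act:
 assumes hom: "ring_hom_on A phi" and A: "subring A" and coeffs: "!!g i. g:set w ==> a g i : A & b g i : A"
  and X: "X:A \<times> A"
 shows "map_prod phi phi (act D a b w X) = act D (%g i. phi (a g i)) (%g i. phi (b g i)) w (map_prod phi phi X)"
  "act D a b w X : A \<times> A"
proof -
 have "map_prod phi phi (act D a b w X) = act D (%g i. phi (a g i)) (%g i. phi (b g i)) w (map_prod phi phi X)
   & act D a b w X : A \<times> A" using coeffs
 proof(induction w)
  case (Cons g w)
  define Y where "Y = act D a b w X"
  have IH: "map_prod phi phi Y = act D (%g i. phi (a g i)) (%g i. phi (b g i)) w (map_prod phi phi X)"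
   and Y: "fst Y : A" "snd Y : A" using Cons by(auto simp: Y_def mem_Times_iff)
  have "a g i : A" "b g i : A" for i using Cons.prems[of g] by auto
  thus ?case using ring_hom_on_hform[OF hom A _ Y] unfolding act.simps IH[symmetric]
   by(simp add: hmap_def map_prod_def split_beta flip: Y_def)
 qed(use X in simp)
 thus "map_prod phi phi (act D a b w X) = act D (%g i. phi (a g i)) (%g i. phi (b g i)) w (map_prod phi phi X)"
  "act D a b w X : A \<times> A" by auto
qed

lemma act_in_subring:
 "subring A ==> (!!g i. g:set w ==> a g i : A & b g i : A) ==> X:A \<times> A ==> act D a b w X : A \<times> A"
 by(rule ring_hom_on_act(2)[OF ring_hom_on_id])

lemma act_is_hmap: obtains p q where "!!X. act D a b w X = hmap (wdeg D w) p q X"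
proof -
 have "EX p q. ALL X. act D a b w X = hmap (wdeg D w) p q X"
 proof(induction w)
  case Nil
  show ?case
   by(intro exI[of _ "%i. if i = 1 then 1 else 0"] exI[of _ "%i. if i = 1 then 0 else 1"]) (simp add: hmap_def hform_def)
 next
  case (Cons g w)
  then obtain p q where pq: "!!X. act D a b w X = hmap (wdeg D w) p q X" by blast
  have "is_hform (D g * wdeg D w) (%x y. hform (D g) c (hform (wdeg D w) p x y) (hform (wdeg D w) q x y))" for c
   by(rule is_hform_comp) (auto simp: is_hform_def)
  then obtain p' q' where
   "!!x y. hform (D g) (a g) (hform (wdeg D w) p x y) (hform (wdeg D w) q x y) = hform (D g * wdeg D w) p' x y"
   "!!x y. hform (D g) (b g) (hform (wdeg D w) p x y) (hform (wdeg D w) q x y) = hform (D g * wdeg D w) q' x y"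
   unfolding is_hform_def by metis
  thus ?case by(intro exI[of _ p'] exI[of _ q']) (simp add: pq, simp add: hmap_def)
 qed
 thus thesis using that by blast
qed

definition act_poly :: "('g => nat) => ('g => nat => 'r::comm_ring_1) => ('g => nat => 'r) => 'g list => 'r poly * 'r poly" where
 "act_poly D a b w = act D (%g i. [:a g i:]) (%g i. [:b g i:]) w ([:0, 1:], 1)"

definition proj_eq :: "('g => nat) => ('g => nat => 'r::comm_ring_1) => ('g => nat => 'r) => 'g list => 'g list => bool" where
 "proj_eq D a b w w' \<longleftrightarrow> wedge (act_poly D a b w) (act_poly D a b w') = 0"

lemma poly_act_poly:
 "poly (fst (act_poly D a b w)) z = fst (act D a b w (z,1))" "poly (snd (act_poly D a b w)) z = snd (act D a b w (z,1))"
proof -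
 have "ring_hom_on UNIV (%p. poly p z)" by(simp add: ring_hom_on_def)
 from ring_hom_on_act(1)[OF this subring_UNIV, of w "%g i. [:a g i:]" "%g i. [:b g i:]" "([:0, 1:], 1)" D]
 have "map_prod (%p. poly p z) (%p. poly p z) (act_poly D a b w) = act D a b w (z,1)" by(simp add: act_poly_def)
 thus "poly (fst (act_poly D a b w)) z = fst (act D a b w (z,1))" "poly (snd (act_poly D a b w)) z = snd (act D a b w (z,1))"
  by(auto simp: map_prod_def prod_eq_iff split_beta)
qed

lemma act_poly_in_polys_over:
 assumes A: "subring A" and "!!g i. g:set w ==> a g i : A & b g i : A"
 shows "act_poly D a b w : polys_over A \<times> polys_over A"
 unfolding act_poly_def
 by(rule act_in_subring[OF subring_polys_over[OF A]])
  (use assms in \<open>auto intro: const_in_polys_over X_in_polys_over subring_one subring_polys_over\<close>)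

lemma map_act_poly:
 assumes hom: "ring_hom_on A phi" and A: "subring A" and coeffs: "!!g i. g:set w ==> a g i : A & b g i : A"
 shows "map_prod (map_poly phi) (map_poly phi) (act_poly D a b w) = act_poly D (%g i. phi (a g i)) (%g i. phi (b g i)) w"
proof -
 have "phi 0 = 0" "phi 1 = 1" using ring_hom_on_simps[OF hom A] by auto
 hence const: "map_poly phi [:c:] = [:phi c:]" and X: "map_poly phi [:0, 1:] = [:0, 1:]" "map_poly phi 1 = 1" for c
  by(auto simp: map_poly_pCons one_pCons)
 show ?thesis unfolding act_poly_def
  by(subst ring_hom_on_act(1)[OF ring_hom_on_map_poly[OF hom A] subring_polys_over[OF A]])
   (use coeffs A in \<open>auto simp: const X intro: const_in_polys_over X_in_polys_over subring_one subring_polys_over\<close>)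
qed

lemma proj_eq_iff_chart:
 fixes a b :: "'g => nat => 'r::{idom,ring_char_0}"
 shows "proj_eq D a b w w' \<longleftrightarrow> (ALL z. wedge (act D a b w (z,1)) (act D a b w' (z,1)) = 0)"
proof -
 have "poly (wedge (act_poly D a b w) (act_poly D a b w')) z = wedge (act D a b w (z,1)) (act D a b w' (z,1))" for z
  by(simp add: wedge_def poly_act_poly)
 thus ?thesis unfolding proj_eq_def by(metis poly_all_0_iff_0)
qed

lemma proj_eq_iff:
 fixes a b :: "'g => nat => 'r::{idom,ring_char_0}"
 shows "proj_eq D a b w w' \<longleftrightarrow> (ALL X. wedge (act D a b w X) (act D a b w' X) = 0)"
proof -
 obtain p q where pq: "!!X. act D a b w X = hmap (wdeg D w) p q X" using act_is_hmap[of D a b w] by blast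
 obtain p' q' where pq': "!!X. act D a b w' X = hmap (wdeg D w') p' q' X" using act_is_hmap[of D a b w'] by blast
 have forms: "is_hform (wdeg D w + wdeg D w') (%x y. hform (wdeg D w) c x y * hform (wdeg D w') c' x y)" for c c'
  by(rule is_hform_mult) (auto simp: is_hform_def)
 have "wedge (act D a b w X) (act D a b w' X) = 0" if "proj_eq D a b w w'" for X
  using is_hform_eqI[OF forms[of p q'] forms[of q p'], of "fst X" "snd X"] that
  unfolding proj_eq_iff_chart by(simp add: pq pq' wedge_def hmap_def)
 thus ?thesis unfolding proj_eq_iff_chart by blast
qed

lemma proj_eq_sym: "proj_eq D a b w w' ==> proj_eq D a b w' w"
 using wedge_commute[of "act_poly D a b w" "act_poly D a b w'"] by(simp add: proj_eq_def)

lemma proj_eq_map: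
 assumes hom: "ring_hom_on A phi" and A: "subring A"
  and coeffs: "!!g i. g:set w Un set w' ==> a g i : A & b g i : A"
 shows "proj_eq D a b w w' ==> proj_eq D (%g i. phi (a g i)) (%g i. phi (b g i)) w w'"
  and "(!!x. x:A ==> x ~= 0 ==> phi x ~= 0) ==> proj_eq D (%g i. phi (a g i)) (%g i. phi (b g i)) w w' ==> proj_eq D a b w w'"
proof -
 note polys = subring_polys_over[OF A]
 note hom_simps = ring_hom_on_simps[OF ring_hom_on_map_poly[OF hom A] polys]
 define P P' W where "P = act_poly D a b w" and "P' = act_poly D a b w'" and "W = wedge P P'"
 have mem: "fst P : polys_over A" "snd P : polys_over A" "fst P' : polys_over A" "snd P' : polys_over A"
  using act_poly_in_polys_over[OF A, of w a b D] act_poly_in_polys_over[OF A, of w' a b D] coeffs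
  by(auto simp: P_def P'_def mem_Times_iff)
 hence W: "W:polys_over A" unfolding W_def wedge_def by(intro subring_diff[OF polys] subring_mult[OF polys])
 have "act_poly D (%g i. phi (a g i)) (%g i. phi (b g i)) w = map_prod (map_poly phi) (map_poly phi) P"
  "act_poly D (%g i. phi (a g i)) (%g i. phi (b g i)) w' = map_prod (map_poly phi) (map_poly phi) P'"
  using map_act_poly[OF hom A, of w a b D] map_act_poly[OF hom A, of w' a b D] coeffs by(simp_all add: P_def P'_def)
 hence eq: "proj_eq D (%g i. phi (a g i)) (%g i. phi (b g i)) w w' \<longleftrightarrow> map_poly phi W = 0"
  using mem by(simp add: proj_eq_def W_def wedge_def hom_simps subring_mult[OF polys] map_prod_def split_beta)
 show "proj_eq D a b w w' ==> proj_eq D (%g i. phi (a g i)) (%g i. phi (b g i)) w w'"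
  unfolding eq using W_def P_def P'_def hom_simps(2) by(simp add: proj_eq_def)
 assume inj: "!!x. x:A ==> x ~= 0 ==> phi x ~= 0" and "proj_eq D (%g i. phi (a g i)) (%g i. phi (b g i)) w w'"
 hence "phi (coeff W i) = 0" for i unfolding eq using coeff_map_poly[of phi W i] ring_hom_on_simps(2)[OF hom A] by simp
 hence "W = 0" using inj polys_over_coeff[OF W] by(intro poly_eqI) (metis coeff_0)
 thus "proj_eq D a b w w'" by(simp add: proj_eq_def W_def P_def P'_def)
qed

lemma act_rescale:
 fixes a b :: "'g => nat => 'r::idom"
 assumes "!!g. g:set w ==> c g ~= 0"
 shows "EX k. k ~= 0 & (ALL X. act D (%g i. c g * a g i) (%g i. c g * b g i) w X = scale k (act D a b w X))"
 using assms
proof(induction w)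
 case Nil
 show ?case by(auto intro!: exI[of _ 1])
next
 case (Cons g w)
 then obtain k where "k ~= 0" "!!X. act D (%g i. c g * a g i) (%g i. c g * b g i) w X = scale k (act D a b w X)" by auto
 thus ?case using Cons.prems by(intro exI[of _ "c g * k^D g"]) (auto simp: hmap_scale scale_hmap mult.commute)
qed

lemma proj_eq_rescale:
 fixes a b :: "'g => nat => 'r::{idom,ring_char_0}"
 assumes "!!g. g:set w Un set w' ==> c g ~= 0"
 shows "proj_eq D (%g i. c g * a g i) (%g i. c g * b g i) w w' \<longleftrightarrow> proj_eq D a b w w'"
proof -
 obtain k where k: "k ~= 0" "!!X. act D (%g i. c g * a g i) (%g i. c g * b g i) w X = scale k (act D a b w X)"
  using act_rescale[of w c D a b] assms by auto
 obtain k' where k': "k' ~= 0" "!!X. act D (%g i. c g * a g i) (%g i. c g * b g i) w' X = scale k' (act D a b w' X)"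
  using act_rescale[of w' c D a b] assms by auto
 show ?thesis unfolding proj_eq_iff k(2) k'(2) using k(1) k'(1) by simp
qed

lemma proj_eq_conj:
 fixes a b :: "'g => nat => 'r::{idom,ring_char_0}"
 assumes conj: "!!g X. g:set w Un set w' ==>
   hmap (D g) (a' g) (b' g) X = lin p q r s (hmap (D g) (a g) (b g) (lin s (-q) (-r) p X))"
  and det: "p * s - q * r = 1" and "proj_eq D a' b' w w'"
 shows "proj_eq D a b w w'"
 unfolding proj_eq_iff
proof
 fix X
 have "wedge (act D a' b' w (lin p q r s X)) (act D a' b' w' (lin p q r s X)) = 0"
  using assms(3) unfolding proj_eq_iff by blast
 thus "wedge (act D a b w X) (act D a b w' X) = 0"
  using act_conj[OF conj det, of w] act_conj[OF conj det, of w'] det by(simp add: wedge_lin lin_inverse)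
qed

locale hmap_system =
 fixes D :: "'g => nat" and a b :: "'g => nat => complex" and I :: "'g set"
 assumes nondegenerate: "!!g. g:I ==> nondegenerate (D g) (a g) (b g)" and degree_pos: "!!g. g:I ==> D g >= 1"
begin

lemma wdeg_pos: "set w <= I ==> wdeg D w >= 1" using degree_pos by(induction w) (auto simp: Suc_le_eq)

lemma act_nonzero: "set w <= I ==> X ~= (0,0) ==> act D a b w X ~= (0,0)"
 using nondegenerate by(induction w) (auto simp: nondegenerate_def)

lemma act_nondegenerate:
 assumes "set w <= I"
 obtains p q where "nondegenerate (wdeg D w) p q" "!!X. act D a b w X = hmap (wdeg D w) p q X"
proof -
 obtain p q where "!!X. act D a b w X = hmap (wdeg D w) p q X" using act_is_hmap[of D a b w] by blast
 thus thesis using that act_nonzero[OF assms] unfolding nondegenerate_def by metis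
qed

lemma proj_eq_iff_scale:
 assumes "set w <= I" "set w' <= I"
 shows "proj_eq D a b w w' \<longleftrightarrow>
  wdeg D w' = wdeg D w & (EX eps. eps ~= 0 & (ALL X. act D a b w' X = scale eps (act D a b w X)))"
proof
 assume "proj_eq D a b w w'"
 hence wedge: "wedge (act D a b w X) (act D a b w' X) = 0" for X unfolding proj_eq_iff by blast
 obtain p q where pq: "nondegenerate (wdeg D w) p q" "!!X. act D a b w X = hmap (wdeg D w) p q X"
  using act_nondegenerate[OF assms(1)] by blast
 obtain p' q' where pq': "nondegenerate (wdeg D w') p' q'" "!!X. act D a b w' X = hmap (wdeg D w') p' q' X"
  using act_nondegenerate[OF assms(2)] by blast
 show "wdeg D w' = wdeg D w & (EX eps. eps ~= 0 & (ALL X. act D a b w' X = scale eps (act D a b w X)))"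
  using proportional_hmaps[OF pq(1) pq'(1)] wedge unfolding pq(2) pq'(2) by metis
qed(auto simp: proj_eq_iff)

lemma proj_eq_append:
 assumes "set w <= I" "set w' <= I" "set u <= I" "set v <= I" "proj_eq D a b w w'"
 shows "proj_eq D a b (u @ w @ v) (u @ w' @ v)"
proof -
 obtain eps where "!!X. act D a b w' X = scale eps (act D a b w X)" using assms by(auto simp: proj_eq_iff_scale)
 thus ?thesis unfolding proj_eq_iff by(simp add: act_append act_scale)
qed

lemma proj_eq_cancel:
 assumes v: "set v <= I" and eq: "proj_eq D a b (w @ v) (w' @ v)"
 shows "proj_eq D a b w w'"
 unfolding proj_eq_iff_chart
proof
 fix z
 obtain p q where pq: "nondegenerate (wdeg D v) p q" "!!X. act D a b v X = hmap (wdeg D v) p q X"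
  using act_nondegenerate[OF v] by blast
 obtain Y where Y: "Y ~= (0,0)" "wedge (act D a b v Y) (z,1) = 0"
  using hmap_hits[of "wdeg D v" p q "(z,1)"] wdeg_pos[OF v] pq(2) by auto
 obtain c where c: "act D a b v Y = scale c (z,1)" using wedge_zero_imp_scale[OF Y(2)] by auto
 hence "c ~= 0" using act_nonzero[OF v Y(1)] by(auto simp: scale_eq_0_iff)
 moreover have "wedge (act D a b (w @ v) Y) (act D a b (w' @ v) Y) = 0" using eq unfolding proj_eq_iff by blast
 ultimately show "wedge (act D a b w (z,1)) (act D a b w' (z,1)) = 0" by(simp add: act_append c act_scale)
qed

lemma act_resultant_one:
 assumes "set w <= I" "!!g. g:I ==> resultant_one (hmap (D g) (a g) (b g)) (D g)"
 shows "resultant_one (act D a b w) (wdeg D w)"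
 using assms(1)
proof(induction w)
 case Nil
 show ?case using resultant_one_id by(simp add: act.simps(1)[abs_def])
next
 case (Cons g w)
 hence "resultant_one (%x. hmap (D g) (a g) (b g) (act D a b w x)) (D g * wdeg D w)"
  by(intro resultant_one_comp assms(2) hmap_scale) auto
 thus ?case by(simp add: act.simps(2)[abs_def])
qed

lemma proj_eq_root_of_unity:
 assumes "!!g. g:I ==> resultant_one (hmap (D g) (a g) (b g)) (D g)"
  and w: "set w <= I" "set w' <= I" "proj_eq D a b w w'"
 obtains eps m where "m > 0" "eps^m = 1" "!!X. act D a b w' X = scale eps (act D a b w X)"
proof -
 obtain eps where eps: "!!X. act D a b w' X = scale eps (act D a b w X)" and "wdeg D w' = wdeg D w"
  using w by(auto simp: proj_eq_iff_scale)
 hence "resultant_one (%X. scale eps (act D a b w X)) (wdeg D w)"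
  using act_resultant_one[OF w(2) assms(1)] by(simp flip: eps)
 hence "eps^(2 * wdeg D w) = 1" using resultant_one_scale[OF act_resultant_one[OF w(1) assms(1)]] by blast
 thus thesis using that[of "2 * wdeg D w" eps] eps wdeg_pos[OF w(1)] by(simp add: Suc_le_eq)
qed

lemma proj_eq_specialize_root_of_unity:
 assumes "!!g. g:I ==> resultant_one (hmap (D g) (a g) (b g)) (D g)"
  and w: "set w <= I" "set w' <= I" "proj_eq D a b w w'"
  and hom: "ring_hom_on A phi" "subring A" and coeffs: "!!g i. g:I ==> a g i : A & b g i : A"
  and spec: "hmap_system D (%g i. phi (a g i)) (%g i. phi (b g i)) I"
 obtains eps :: complex and m where "m > 0" "eps^m = 1"
  "!!X. act D (%g i. phi (a g i)) (%g i. phi (b g i)) w' X = scale eps (act D (%g i. phi (a g i)) (%g i. phi (b g i)) w X)"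
proof -
 interpret spec: hmap_system D "%g i. phi (a g i)" "%g i. phi (b g i)" I by(rule spec)
 define W where "W = act D (%g i. phi (a g i)) (%g i. phi (b g i)) w (1,0)"
 have coeffs': "!!g i. g:set w Un set w' ==> a g i : A & b g i : A" using coeffs w by blast
 obtain eps where eps: "!!X. act D (%g i. phi (a g i)) (%g i. phi (b g i)) w' X
   = scale eps (act D (%g i. phi (a g i)) (%g i. phi (b g i)) w X)"
  using proj_eq_map(1)[OF hom coeffs' w(3)] spec.proj_eq_iff_scale[OF w(1,2)] by blast
 obtain eta m where eta: "m > 0" "eta^m = 1" "!!X. act D a b w' X = scale eta (act D a b w X)"
  using proj_eq_root_of_unity[OF assms(1) w] by metis
 have one_zero: "(1,0) : A \<times> A" "phi 1 = 1" "phi 0 = 0"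
  using subring_one[OF hom(2)] subring_zero[OF hom(2)] ring_hom_on_simps[OF hom] by auto
 have image: "act D (%g i. phi (a g i)) (%g i. phi (b g i)) v (1,0) = map_prod phi phi (act D a b v (1,0))"
  "act D a b v (1,0) : A \<times> A" if "v = w | v = w'" for v
  using ring_hom_on_act[OF hom _ one_zero(1), of v a b D] coeffs' that by(auto simp: one_zero(2,3))
 have powers: "(eps * phi x)^m = phi x^m" if "x:A" "y:A" "y = eta * x" "phi y = eps * phi x" for x y
  using that eta(2) ring_hom_on_power[OF hom, symmetric] by(metis mult_1 power_mult_distrib)
 have W: "W = map_prod phi phi (act D a b w (1,0))" "scale eps W = map_prod phi phi (scale eta (act D a b w (1,0)))"
  using image(1)[of w] image(1)[of w'] by(simp_all add: W_def eps eta(3))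
 have "(eps * fst W)^m = fst W^m" "(eps * snd W)^m = snd W^m"
  using powers[of "fst (act D a b w (1,0))" "fst (act D a b w' (1,0))"] powers[of "snd (act D a b w (1,0))" "snd (act D a b w' (1,0))"]
   image(2)[of w] image(2)[of w'] W by(auto simp: eta(3) scale_def map_prod_def split_beta mem_Times_iff)
 moreover have "fst W ~= 0 | snd W ~= 0" using spec.act_nonzero[OF w(1), of "(1,0)"] by(auto simp: W_def prod_eq_iff)
 ultimately have "eps^m = 1" by(auto simp: power_mult_distrib)
 thus thesis using that eta(1) eps by blast
qed

end

section \<open>Places and finite orbits\<close>

locale place =
 fixes K :: "complex set" and le :: "complex => complex => bool" (infix "<~" 50) and n :: complex
 assumes subring: "subring K" and inverse_closed: "!!x. x:K ==> inverse x : K" and n_in_K: "n:K"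
  and total: "!!x y. x:K ==> y:K ==> x <~ y | y <~ x"
  and trans: "!!x y z. x <~ y ==> y <~ z ==> x:K ==> y:K ==> z:K ==> x <~ z"
  and mult_right: "!!x y z. x <~ y ==> x:K ==> y:K ==> z:K ==> x * z <~ y * z"
  and zero_le: "!!x. x:K ==> 0 <~ x" and one_le: "1 <~ n" and not_one_le_zero: "~ 1 <~ 0"
  and add_le: "!!x y z. x <~ z ==> y <~ z ==> x:K ==> y:K ==> z:K ==> x + y <~ n * z"
begin

lemma closed [simp, intro]:
 "n:K" "0:K" "1:K" "x:K ==> y:K ==> x * y : K" "x:K ==> x^k : K" "x:K ==> y:K ==> x + y : K"
 "x:K ==> y:K ==> x / y : K" "x:K ==> - x : K" "x:K ==> y:K ==> x - y : K"
 using n_in_K inverse_closed by(auto simp: subring_closed[OF subring] divide_inverse)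

lemma refl [simp, intro]: "x:K ==> x <~ x" using total by blast

lemma mult_le: "x <~ y ==> x' <~ y' ==> x:K ==> y:K ==> x':K ==> y':K ==> x * x' <~ y * y'"
 using trans[OF mult_right[of x y x'] mult_right[of x' y' y, unfolded mult.commute[of _ y]]] by simp

lemma power_le: "x <~ y ==> x:K ==> y:K ==> x^k <~ y^k" by(induction k) (auto intro: mult_le)

lemma n_power_le:
 assumes "i <= j"
 shows "n^i <~ n^j"
proof -
 have "n^i * 1^(j - i) <~ n^i * n^(j - i)" by(intro mult_le power_le one_le) auto
 thus ?thesis using assms by(simp flip: power_add)
qed

lemma le_n_power_mono:
 assumes "x <~ n^i * y" "i <= j" "x:K" "y:K"
 shows "x <~ n^j * y"
 by(rule trans[OF assms(1) mult_right[OF n_power_le[OF assms(2)]]]) (use assms in auto)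

lemma sum_le:
 assumes "c:K" "!!i. i <= m ==> f i : K & f i <~ c"
 shows "(\<Sum>i\<le>m. f i) <~ n^m * c"
 using assms(2)
proof(induction m)
 case (Suc m)
 have "f (Suc m) <~ n^m * c" using le_n_power_mono[of "f (Suc m)" 0 c m] Suc.prems[of "Suc m"] assms(1) by simp
 moreover have "(\<Sum>i\<le>m. f i) : K" using Suc.prems by(intro subring_sum[OF subring]) auto
 ultimately have "(\<Sum>i\<le>m. f i) + f (Suc m) <~ n * (n^m * c)" using Suc assms(1) by(intro add_le) auto
 thus ?case by(simp add: mult.assoc)
qed simp

lemma le_cancel:
 assumes "x * z <~ y * z" "x:K" "y:K" "z:K" "z ~= 0"
 shows "x <~ y"
 using mult_right[OF assms(1) _ _ inverse_closed[OF assms(4)]] assms by(simp add: mult.assoc)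

lemma le_power_cancel:
 assumes "x^k <~ y^k" "k > 0" "x:K" "y:K"
 shows "x <~ y"
proof(rule ccontr)
 assume not_le: "~ x <~ y"
 hence "y <~ x" "x ~= 0" using total zero_le assms by blast+
 obtain j where j: "k = Suc j" using assms(2) by(cases k) auto
 have "y * y^j <~ y * x^j" using assms `y <~ x` by(intro mult_le power_le) auto
 hence "x * x^j <~ y * x^j" using trans[of "x * x^j" "y * y^j"] assms j by simp
 thus False using not_le le_cancel[of x "x^j" y] assms `x ~= 0` by simp
qed

lemma root_of_unity_bounds: "e:K ==> e^m = 1 ==> m > 0 ==> e <~ 1 & 1 <~ e"
 using le_power_cancel[of e m 1] le_power_cancel[of 1 m e] by simp

lemma le_zero_imp_zero:
 assumes "x <~ 0" "x:K"
 shows "x = 0"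
 using mult_right[of x 0 "1 / x"] assms not_one_le_zero by(cases "x = 0") auto

definition vnorm :: "complex * complex => complex" where
 "vnorm X = (if fst X <~ snd X then snd X else fst X)"

lemma vnorm_in_K [simp, intro]: "X:K \<times> K ==> vnorm X : K" by(auto simp: vnorm_def)

lemma le_vnorm: "X:K \<times> K ==> fst X <~ vnorm X" "X:K \<times> K ==> snd X <~ vnorm X"
 using total[of "fst X" "snd X"] by(auto simp: vnorm_def)

lemma vnorm_le: "fst X <~ c ==> snd X <~ c ==> vnorm X <~ c" by(simp add: vnorm_def)

lemma vnorm_nonzero:
 assumes "X:K \<times> K" "X ~= (0,0)"
 shows "vnorm X ~= 0"
 using le_vnorm[OF assms(1)] le_zero_imp_zero assms by(auto simp: prod_eq_iff)

definition distorts :: "(complex * complex => complex * complex) => nat => nat => bool" where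
 "distorts F e c \<longleftrightarrow> (ALL X:K \<times> K. F X : K \<times> K & vnorm (F X) <~ n^c * vnorm X^e & vnorm X^e <~ n^c * vnorm (F X))"

lemma distortsD:
 assumes "distorts F e c" "X:K \<times> K"
 shows "F X : K \<times> K" "vnorm (F X) <~ n^c * vnorm X^e" "vnorm X^e <~ n^c * vnorm (F X)"
 using bspec[OF assms(1)[unfolded distorts_def] assms(2)] by simp_all

lemma distorts_id: "distorts (%X. X) 1 0" by(auto simp: distorts_def)

lemma distorts_comp:
 assumes F: "distorts F e c" and G: "distorts G e' c'"
 shows "distorts (%X. F (G X)) (e * e') (c + e * c')"
 unfolding distorts_def
proof(intro ballI conjI)
 fix X assume X: "X:K \<times> K"
 note GX = distortsD[OF G X]
 note FX = distortsD[OF F GX(1)]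
 show "F (G X) : K \<times> K" by(rule FX(1))
 note in_K = vnorm_in_K[OF X] vnorm_in_K[OF GX(1)] vnorm_in_K[OF FX(1)]
 have "n^c * vnorm (G X)^e <~ n^c * (n^c' * vnorm X^e')^e" using GX in_K by(intro mult_le power_le) auto
 hence "vnorm (F (G X)) <~ n^c * (n^c' * vnorm X^e')^e" using trans[OF FX(2)] in_K by simp
 thus "vnorm (F (G X)) <~ n^(c + e * c') * vnorm X^(e * e')"
  by(simp add: power_mult_distrib power_add mult_ac flip: power_mult)
 have "(vnorm X^e')^e <~ (n^c' * vnorm (G X))^e" using GX in_K by(intro power_le) auto
 hence "vnorm X^(e * e') <~ n^(e * c') * vnorm (G X)^e" by(simp add: power_mult_distrib mult.commute flip: power_mult)
 moreover have "n^(e * c') * vnorm (G X)^e <~ n^(e * c') * (n^c * vnorm (F (G X)))"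
  using in_K FX(3) by(intro mult_le) auto
 ultimately have "vnorm X^(e * e') <~ n^(e * c') * (n^c * vnorm (F (G X)))" by(rule trans) (use in_K in auto)
 thus "vnorm X^(e * e') <~ n^(c + e * c') * vnorm (F (G X))" by(simp add: power_add mult_ac)
qed

lemma distorts_mono:
 assumes "distorts F e c" "c <= c'"
 shows "distorts F e c'"
 unfolding distorts_def
proof(intro ballI conjI)
 fix X assume X: "X:K \<times> K"
 note F = distortsD[OF assms(1) X]
 show "F X : K \<times> K" by(rule F(1))
 show "vnorm (F X) <~ n^c' * vnorm X^e" "vnorm X^e <~ n^c' * vnorm (F X)"
  using le_n_power_mono[OF F(2) assms(2)] le_n_power_mono[OF F(3) assms(2)] X F(1) by auto
qed

definition bounded_poly :: "nat => complex poly => bool" where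
 "bounded_poly k f \<longleftrightarrow> f : polys_over K & degree f <= k & (ALL i. coeff f i <~ n)"

lemma poly_le:
 assumes f: "bounded_poly k f" and z: "z:K" "z <~ 1"
 shows "poly f z <~ n^k * n" "poly f z : K"
proof -
 have "coeff f i * z^i : K & coeff f i * z^i <~ n" for i
 proof -
  have "coeff f i : K" using f polys_over_coeff unfolding bounded_poly_def by blast
  moreover from this have "coeff f i * z^i <~ n * 1^i" using f z by(intro mult_le power_le) (auto simp: bounded_poly_def)
  ultimately show ?thesis using z by simp
 qed
 hence "(\<Sum>i\<le>k. coeff f i * z^i) <~ n^k * n" by(intro sum_le) auto
 thus "poly f z <~ n^k * n" using poly_altdef_le[of f k] f by(simp add: bounded_poly_def)
 show "poly f z : K" using f z by(intro poly_in_subring[OF subring]) (auto simp: bounded_poly_def)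
qed

lemma hform_le:
 assumes a: "bounded_poly d (dehom d a)" and X: "X:K \<times> K"
 shows "hform d a (fst X) (snd X) <~ n^(d + 1) * vnorm X^d" "hform d a (fst X) (snd X) : K"
proof -
 have a: "a i : K" "a i <~ n" if "i <= d" for i
  using a polys_over_coeff[of "dehom d a" K i] that by(auto simp: bounded_poly_def coeff_dehom split: if_splits)
 show "hform d a (fst X) (snd X) : K" using a(1) X by(intro hform_in_subring[OF subring]) auto
 have "hform d a (fst X) (snd X) <~ n^d * (n * vnorm X^d)" unfolding hform_def
 proof(rule sum_le)
  fix i assume "i <= d"
  moreover from this have "a i * fst X^i * snd X^(d - i) <~ n * vnorm X^i * vnorm X^(d - i)"
   using a X le_vnorm[OF X] by(intro mult_le power_le) auto
  ultimately show "a i * fst X^i * snd X^(d - i) : K & a i * fst X^i * snd X^(d - i) <~ n * vnorm X^d"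
   using a X by(auto simp: mult.assoc simp flip: power_add)
 qed(use X in auto)
 thus "hform d a (fst X) (snd X) <~ n^(d + 1) * vnorm X^d" by(simp add: mult_ac)
qed

lemma power_snd_le:
 assumes uv: "bounded_poly k u" "bounded_poly k v" and bezout: "u * dehom d a + v * dehom d b = 1"
  and x: "x:K" "y:K" "x <~ y" "y ~= 0"
  and s: "s:K" "hform d a x y : K" "hform d b x y : K" "hform d a x y <~ s" "hform d b x y <~ s"
 shows "y^d <~ n^(k + 2) * s"
proof -
 define z where "z = x / y"
 have z: "z:K" "z <~ 1"
  using mult_right[OF x(3,1,2) inverse_closed[OF x(2)]] x inverse_closed by(auto simp: z_def divide_inverse)
 have "y^d * (poly u z * poly (dehom d a) z + poly v z * poly (dehom d b) z) = y^d * 1"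
  using arg_cong[OF bezout, of "%p. poly p z"] by simp
 hence "y^d = poly u z * hform d a x y + poly v z * hform d b x y"
  using x(4) by(simp add: hform_divide z_def algebra_simps)
 moreover have "poly u z * hform d a x y <~ n^k * n * s" "poly v z * hform d b x y <~ n^k * n * s"
  using poly_le[OF uv(1) z] poly_le[OF uv(2) z] s by(auto intro!: mult_le)
 ultimately have "y^d <~ n * (n^k * n * s)" using poly_le(2)[OF uv(1) z] poly_le(2)[OF uv(2) z] s by(auto intro!: add_le)
 thus ?thesis by(simp add: mult_ac)
qed

lemma hmap_distorts:
 assumes ab: "bounded_poly d (dehom d a)" "bounded_poly d (dehom d b)" and d: "d >= 1"
  and uv: "bounded_poly k u" "bounded_poly k v" "bounded_poly k u'" "bounded_poly k v'"
  and bezout: "u * dehom d a + v * dehom d b = 1"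
   "u' * dehom d (%i. a (d - i)) + v' * dehom d (%i. b (d - i)) = 1"
 shows "distorts (hmap d a b) d (d + k + 2)"
 unfolding distorts_def
proof(intro ballI conjI)
 fix X assume X: "X:K \<times> K"
 define F where "F = hmap d a b X"
 show F: "F:K \<times> K" using hform_le(2)[OF ab(1) X] hform_le(2)[OF ab(2) X] by(simp add: F_def hmap_def)
 have "vnorm F <~ n^(d + 1) * vnorm X^d"
  using hform_le(1)[OF ab(1) X] hform_le(1)[OF ab(2) X] by(intro vnorm_le) (simp_all add: F_def hmap_def)
 thus "vnorm F <~ n^(d + k + 2) * vnorm X^d" by(rule le_n_power_mono) (use F X in auto)
 have le_F: "hform d a (fst X) (snd X) <~ vnorm F" "hform d b (fst X) (snd X) <~ vnorm F"
  using le_vnorm[OF F] by(auto simp: F_def hmap_def)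
 note in_K = hform_le(2)[OF ab(1) X] hform_le(2)[OF ab(2) X] vnorm_in_K[OF F]
 have "vnorm X^d <~ n^(k + 2) * vnorm F"
 proof(cases "X = (0,0)")
  case True
  thus ?thesis using d F by(auto simp: vnorm_def power_0_left intro: zero_le)
 next
  case False
  show ?thesis
  proof(cases "fst X <~ snd X")
   case True
   thus ?thesis using power_snd_le[OF uv(1,2) bezout(1), of "fst X" "snd X" "vnorm F"] vnorm_nonzero[OF X False]
     X le_F in_K by(auto simp: vnorm_def)
  next
   case not_le: False
   hence "snd X <~ fst X" using total[of "fst X" "snd X"] X by auto
   thus ?thesis using power_snd_le[OF uv(3,4) bezout(2), of "snd X" "fst X" "vnorm F"] vnorm_nonzero[OF X False]
     X le_F in_K not_le by(auto simp: vnorm_def simp flip: hform_swap)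
  qed
 qed
 thus "vnorm X^d <~ n^(d + k + 2) * vnorm F" by(rule le_n_power_mono) (use F X in auto)
qed

end

fun cost :: "nat => ('g => nat) => 'g list => nat" where
 "cost kappa D [] = 0"
| "cost kappa D (g # w) = kappa + D g * cost kappa D w"

lemma cost_append: "cost kappa D (u @ v) = cost kappa D u + wdeg D u * cost kappa D v"
 by(induction u) (auto simp: algebra_simps)

lemma cost_append_le:
 assumes "cost kappa D u <= c * (wdeg D u - 1)" "cost kappa D v <= c * (wdeg D v - 1)" "wdeg D u >= 1" "wdeg D v >= 1"
 shows "cost kappa D (u @ v) <= c * (wdeg D (u @ v) - 1)"
proof -
 obtain i j where ij: "wdeg D u = Suc i" "wdeg D v = Suc j" using assms by(metis Suc_le_D One_nat_def)
 have "cost kappa D u + wdeg D u * cost kappa D v <= c * i + Suc i * (c * j)"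
  unfolding ij(1) using assms ij by(intro add_mono mult_le_mono) auto
 also have "... = c * (Suc i * Suc j - 1)" by(simp add: algebra_simps)
 finally show ?thesis by(simp add: cost_append ij)
qed

definition word_subst :: "'g list => 'g list => bool list => 'g list" where
 "word_subst x y u = concat (map (%t. if t then x else y) u)"

lemma word_subst_simps [simp]:
 "word_subst x y [] = []" "word_subst x y (t # u) = (if t then x else y) @ word_subst x y u"
 "word_subst x y (u @ v) = word_subst x y u @ word_subst x y v"
 by(auto simp: word_subst_def)

lemma set_word_subst: "set x <= I ==> set y <= I ==> set (word_subst x y u) <= I" by(induction u) auto

lemma cost_word_subst:
 assumes "cost kappa D x <= c * (wdeg D x - 1)" "cost kappa D y <= c * (wdeg D y - 1)" "wdeg D x >= 1" "wdeg D y >= 1"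
 shows "cost kappa D (word_subst x y u) <= c * (wdeg D (word_subst x y u) - 1)" "wdeg D (word_subst x y u) >= 1"
proof -
 have "cost kappa D (word_subst x y u) <= c * (wdeg D (word_subst x y u) - 1) & wdeg D (word_subst x y u) >= 1"
  using assms by(induction u) (auto intro!: cost_append_le[simplified])
 thus "cost kappa D (word_subst x y u) <= c * (wdeg D (word_subst x y u) - 1)" "wdeg D (word_subst x y u) >= 1" by auto
qed

context place
begin

lemma act_distorts:
 assumes "!!g. g:set w ==> distorts (hmap (D g) (a g) (b g)) (D g) kappa"
 shows "distorts (act D a b w) (wdeg D w) (cost kappa D w)"
 using assms
proof(induction w)
 case Nil
 show ?case using distorts_id by(simp add: act.simps(1)[abs_def])
next
 case (Cons g w)
 hence "distorts (%X. hmap (D g) (a g) (b g) (act D a b w X)) (D g * wdeg D w) (kappa + D g * cost kappa D w)"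
  by(intro distorts_comp) auto
 thus ?case by(simp add: act.simps(2)[abs_def])
qed

lemma vnorm_le_vnorm_if_root_of_unity:
 assumes "U = scale eps V" "eps^m = 1" "m > 0" "U:K \<times> K" "V:K \<times> K" "V ~= (0,0)"
 shows "vnorm V <~ vnorm U"
proof(rule vnorm_le)
 have "eps = fst U / fst V | eps = snd U / snd V" using assms(1,6) by(auto simp: scale_def prod_eq_iff)
 hence eps: "eps:K" using assms(4,5) by(auto simp: mem_Times_iff)
 hence "1 <~ eps" using root_of_unity_bounds assms(2,3) by blast
 hence le: "x <~ eps * x" if "x:K" for x using mult_right[of 1 eps x] eps that by simp
 show "fst V <~ vnorm U" "snd V <~ vnorm U"
  using trans[OF le[of "fst V"]] trans[OF le[of "snd V"]] le_vnorm[OF assms(4)] assms(4,5) eps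
  by(auto simp: assms(1) scale_def mem_Times_iff)
qed

lemma orbit_upper_bound:
 assumes bounds: "!!w. distorts (act D a b (word_subst A B w)) (wdeg D (word_subst A B w)) (cost kappa D (word_subst A B w))"
  and cost: "!!w. cost kappa D (word_subst A B w) <= c * wdeg D (word_subst A B w)"
  and deg: "wdeg D A >= 1" "wdeg D B = e"
  and P: "vnorm P <~ n" "act D a b A P = P" and C: "act D a b B P = C" "C:K \<times> K"
 shows "EX k. vnorm (act D a b (word_subst A B u) P) <~ n^(c * k + 1) * vnorm C^k & k * e <= wdeg D (word_subst A B u)"
proof(induction u rule: rev_induct)
 case Nil
 show ?case using P(1) by(intro exI[of _ 0]) simp
next
 case (snoc t u)
 define k where "k = wdeg D (word_subst A B u)"
 show ?case
 proof(cases t)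
  case True
  obtain k where k: "vnorm (act D a b (word_subst A B u) P) <~ n^(c * k + 1) * vnorm C^k" "k * e <= wdeg D (word_subst A B u)"
   using snoc by blast
  have "k * e * 1 <= wdeg D (word_subst A B u) * wdeg D A" by(rule mult_le_mono[OF k(2) deg(1)])
  thus ?thesis using True P(2) k(1) by(intro exI[of _ k]) (simp add: act_append)
 next
  case False
  note image = distortsD[OF bounds[of u] C(2), folded k_def]
  have "cost kappa D (word_subst A B u) <= c * k + 1" using cost[of u] by(simp add: k_def)
  from le_n_power_mono[OF image(2) this] have "vnorm (act D a b (word_subst A B u) C) <~ n^(c * k + 1) * vnorm C^k"
   using image(1) C(2) vnorm_in_K closed(5) by metis
  thus ?thesis using False C(1) deg(2) by(intro exI[of _ k]) (simp add: act_append k_def)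
 qed
qed

text \<open>The relation expresses a large power of \<open>vnorm C\<close> by a smaller one, since \<open>A\<close> has degree at least \<open>2\<close>.\<close>

lemma orbit_bound:
 assumes bounds: "!!w. distorts (act D a b (word_subst A B w)) (wdeg D (word_subst A B w)) (cost kappa D (word_subst A B w))"
  and cost: "cost kappa D A <= c * (wdeg D A - 1)" "cost kappa D B <= c * (wdeg D B - 1)"
  and deg: "wdeg D A = d" "d >= 2" "wdeg D B = e * d" "e >= 1"
  and P: "P:K \<times> K" "vnorm P <~ n" "act D a b A P = P"
  and C: "act D a b B P = C" "C:K \<times> K" "C ~= (0,0)" and nonzero: "act D a b (word_subst A B v) C ~= (0,0)"
  and rel: "wdeg D (word_subst A B u @ A) = wdeg D (word_subst A B v @ B)"
   "!!X. act D a b (word_subst A B u @ A) X = scale eps (act D a b (word_subst A B v @ B) X)" "eps^m = 1" "m > 0"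
 shows "vnorm C <~ n^(3 * c + 1)"
proof -
 define U V where "U = act D a b (word_subst A B u) P" and "V = act D a b (word_subst A B v) C"
 have costs: "cost kappa D (word_subst A B w) <= c * (wdeg D (word_subst A B w) - 1)" "wdeg D (word_subst A B w) >= 1" for w
  using cost_word_subst[OF cost] deg by(auto simp: Suc_le_eq)
 have "cost kappa D (word_subst A B w) <= c * wdeg D (word_subst A B w)" for w
  using costs(1)[of w] by(rule order.trans) simp
 then obtain k where k: "vnorm U <~ n^(c * k + 1) * vnorm C^k" "k * (e * d) <= wdeg D (word_subst A B u)"
  using orbit_upper_bound[OF bounds _ _ deg(3) P(2,3) C(1,2)] deg(1,2) unfolding U_def by force
 define dv where "dv = wdeg D (word_subst A B v)"
 have "k * (e * d) * d <= dv * (e * d)" using mult_le_mono1[OF k(2), of d] rel(1) deg by(simp add: dv_def)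
 hence "k * d <= dv" using deg by(simp add: mult_ac)
 hence "k * 2 <= dv" using mult_le_mono2[OF deg(2), of k] by linarith
 then obtain l where l: "dv = 2 * k + l" by(metis le_Suc_ex mult.commute)
 have dv_sum: "dv = (k + l) + k" using l by simp
 have dv: "dv >= 1" using costs(2)[of v] deg by(simp add: dv_def)
 have in_K: "U:K \<times> K" "V:K \<times> K" using distortsD(1)[OF bounds] P(1) C(2) by(simp_all add: U_def V_def)
 have "U = scale eps V" using rel(2)[of P] P(3) C(1) by(simp add: act_append U_def V_def)
 hence VU: "vnorm V <~ vnorm U" using vnorm_le_vnorm_if_root_of_unity rel(3,4) in_K nonzero by(simp add: V_def)
 have "vnorm C^dv <~ n^cost kappa D (word_subst A B v) * vnorm V"
  using distortsD(3)[OF bounds C(2)] by(simp add: V_def dv_def)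
 hence "vnorm C^dv <~ n^(c * (dv - 1)) * vnorm V"
  using costs(1)[of v] C(2) in_K by(auto simp: dv_def intro: le_n_power_mono)
 moreover have "n^(c * (dv - 1)) * vnorm V <~ n^(c * (dv - 1)) * (n^(c * k + 1) * vnorm C^k)"
  using trans[OF VU k(1)] in_K C(2) by(intro mult_le) auto
 ultimately have "vnorm C^dv <~ n^(c * (dv - 1)) * (n^(c * k + 1) * vnorm C^k)" by(rule trans) (use in_K C(2) in auto)
 hence "vnorm C^(k + l) * vnorm C^k <~ n^(c * (dv - 1) + (c * k + 1)) * vnorm C^k"
  by(simp only: dv_sum power_add mult.assoc)
 hence le: "vnorm C^(k + l) <~ n^(c * (dv - 1) + (c * k + 1))" by(rule le_cancel) (use C vnorm_nonzero in auto)
 have exponents: "c * (dv - 1) + (c * k + 1) <= (3 * c + 1) * (k + l)"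
 proof -
  obtain j where j: "k + l = Suc j" using l dv by(cases "k + l") auto
  hence "dv - 1 = j + k" using l by simp
  moreover have "c * k <= c * Suc j" using j by(intro mult_le_mono2) simp
  ultimately show ?thesis by(simp add: j algebra_simps)
 qed
 have "vnorm C^(k + l) <~ (n^(3 * c + 1))^(k + l)" unfolding power_mult[symmetric]
  by(rule trans[OF le n_power_le[OF exponents]]) (use C(2) in auto)
 thus ?thesis by(rule le_power_cancel) (use l dv C(2) in auto)
qed

end

lemma valuation_ring_place:
 assumes V: "valuation_ring V" and K: "number_field K" and N: "N > (0::nat)"
 shows "place K (%x y. EX v:V. x = y * v) (1 / of_nat N)"
proof -
 note subring_V = valuation_ring_subring[OF V] and subring_K = number_field_subring[OF K]
 note closed = subring_closed[OF subring_V]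
 show ?thesis
 proof
  show "1 / of_nat N : K" using number_field_inverse[OF K subring_of_nat[OF subring_K, of N]] by(simp add: divide_inverse)
  fix x y z :: complex
  show "(EX v:V. x = y * v) | (EX v:V. y = x * v)"
  proof(cases "y = 0 | x = 0")
   case True
   thus ?thesis using closed(2) by force
  next
   case False
   have "x / y : V | inverse (x / y) : V" using V unfolding valuation_ring_def by blast
   thus ?thesis
    using False by(elim disjE) (force intro: bexI[of _ "x / y"] bexI[of _ "inverse (x / y)"] simp: field_simps)+
  qed
  show "EX v:V. x = y * v ==> EX v:V. y = z * v ==> EX v:V. x = z * v"
   using subring_mult[OF subring_V] by(metis mult.assoc)
  show "EX v:V. 0 = x * v" using closed(2) by force
  show "EX v:V. x = z * v ==> EX v:V. y = z * v ==> EX v:V. x + y = 1 / of_nat N * z * v"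
  proof(elim bexE)
   fix v v' assume "v:V" "x = z * v" "v':V" "y = z * v'"
   thus "EX v:V. x + y = 1 / of_nat N * z * v" using N closed
    by(intro bexI[of _ "of_nat N * (v + v')"]) (auto simp: field_simps)
  qed
  show "EX v:V. 1 = 1 / of_nat N * v" using N subring_of_nat[OF subring_V, of N] by(intro bexI[of _ "of_nat N"]) auto
 qed(use subring_K number_field_inverse[OF K] in \<open>auto simp: mult_ac\<close>)
qed

lemma embedding_place:
 assumes K: "number_field K" and sig: "ring_hom_on K sig" and B: "B >= (2::nat)"
 shows "place K (%x y. cmod (sig x) <= cmod (sig y)) (of_nat B)"
proof -
 note subring_K = number_field_subring[OF K]
 note hom = ring_hom_on_simps[OF sig subring_K]
 show ?thesis
 proof
  fix x y z assume K: "x:K" "y:K" "z:K"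
  assume le: "cmod (sig x) <= cmod (sig z)" "cmod (sig y) <= cmod (sig z)"
  have "cmod (sig x + sig y) <= 2 * cmod (sig z)" using norm_triangle_ineq[of "sig x" "sig y"] le by linarith
  also have "... <= real B * cmod (sig z)" using B by(intro mult_right_mono) auto
  finally show "cmod (sig (x + y)) <= cmod (sig (of_nat B * z))"
   using K subring_of_nat[OF subring_K] by(simp add: hom norm_mult)
 qed(use subring_K number_field_inverse[OF K] subring_of_nat[OF subring_K] B in
   \<open>auto simp: hom norm_mult mult_right_mono\<close>)
qed

lemma place_northcott:
 assumes K: "number_field K" and L: "finite L" "L <= K"
 obtains X where "finite X"
  "!!x. x:K ==> (!!le n. place K le n ==> (ALL y:L. le y n) ==> le x (n^E)) ==> x:X"
proof -
 note subring_K = number_field_subring[OF K]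
 obtain N where N: "N > (0::nat)" "!!x. x:L ==> algebraic_int (of_nat N * x)"
  using uniform_denominator[OF K L] by blast
 obtain B where B: "B >= (2::nat)" "!!x sig. x:L ==> ring_hom_on K sig ==> cmod (sig x) <= B"
  using uniform_embedding_bound[OF K L] by blast
 define X where "X = {x:K. algebraic_int (of_nat (N^E) * x)
  & (ALL sig::complex => complex. ring_hom_on K sig --> cmod (sig x) <= real B^E)}"
 show thesis
 proof(rule that[of X])
  show "finite X" unfolding X_def by(rule northcott[OF K]) (use N(1) in simp)
  fix x assume x: "x:K" and le: "!!le n. place K le n ==> ALL y:L. le y n ==> le x (n^E)"
  have "of_nat (N^E) * x : V" if V: "valuation_ring V" for V
  proof -
   have "EX v:V. y = 1 / of_nat N * v" if "y:L" for y
    using algebraic_int_in_valuation_ring[OF V N(2)[OF that]] N(1) by(intro bexI[of _ "of_nat N * y"]) auto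
   with le[OF valuation_ring_place[OF V K N(1)]] obtain v where "v:V" "x = (1 / of_nat N)^E * v" by auto
   thus ?thesis using N(1) by(simp add: power_one_over)
  qed
  moreover have "cmod (sig x) <= real B^E" if sig: "ring_hom_on K sig" for sig
  proof -
   note hom = ring_hom_on_simps[OF sig subring_K]
   have "ALL y:L. cmod (sig y) <= cmod (sig (of_nat B))" using B(2)[OF _ sig] by(simp add: hom)
   hence "cmod (sig x) <= cmod (sig (of_nat B^E))" using le[OF embedding_place[OF K sig B(1)]] by blast
   thus ?thesis using ring_hom_on_power[OF sig subring_K subring_of_nat[OF subring_K, of B]] by(simp add: hom norm_power)
  qed
  ultimately show "x:X" using x by(simp add: X_def algebraic_int_iff_valuation_ring)
 qed
qed

definition bezout_over :: "'a::comm_ring_1 set => nat => (nat => 'a) => (nat => 'a) => bool" where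
 "bezout_over A d a b \<longleftrightarrow> (EX u:polys_over A. EX v:polys_over A. u * dehom d a + v * dehom d b = 1)"

definition nondegenerate_over :: "'a::comm_ring_1 set => nat => (nat => 'a) => (nat => 'a) => bool" where
 "nondegenerate_over A d a b \<longleftrightarrow> bezout_over A d a b & bezout_over A d (%i. a (d - i)) (%i. b (d - i))"

lemma in_polys_over_if_coeffs:
 assumes "subring A" "set (coeffs f) <= A"
 shows "f:polys_over A"
proof -
 have "range (coeff f) <= A" unfolding range_coeff using assms subring_zero by simp
 thus ?thesis by(auto simp: polys_over_def)
qed

lemma coeffs_if_in_polys_over: "f:polys_over A ==> set (coeffs f) <= A" by(auto simp: polys_over_def coeffs_def)

lemma bezout_over_if_nondegenerate:
 fixes a b :: "nat => complex"
 assumes "nondegenerate d a b"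
 obtains L where "finite L" "!!A. subring A ==> L <= A ==> bezout_over A d a b"
proof -
 obtain u v where "u * dehom d a + v * dehom d b = 1"
  using bezout_coefficients_fst_snd[of "dehom d a" "dehom d b"] coprime_dehom[OF assms]
  by(metis coprime_imp_gcd_eq_1)
 hence "bezout_over A d a b" if "subring A" "set (coeffs u) Un set (coeffs v) <= A" for A
  using that in_polys_over_if_coeffs unfolding bezout_over_def by blast
 thus thesis using that[of "set (coeffs u) Un set (coeffs v)"] by simp
qed

lemma nondegenerate_over_if_nondegenerate:
 fixes a b :: "nat => complex"
 assumes "nondegenerate d a b"
 obtains L where "finite L" "!!A. subring A ==> L <= A ==> nondegenerate_over A d a b"
proof -
 obtain L where L: "finite L" "!!A. subring A ==> L <= A ==> bezout_over A d a b"
  using bezout_over_if_nondegenerate[OF assms] by metis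
 obtain L' where L': "finite L'" "!!A. subring A ==> L' <= A ==> bezout_over A d (%i. a (d - i)) (%i. b (d - i))"
  using bezout_over_if_nondegenerate[OF nondegenerate_swap[OF assms]] by metis
 show thesis using that[of "L Un L'"] L L' by(simp add: nondegenerate_over_def)
qed

lemma dehom_in_polys_over: "subring A ==> (!!i. i <= d ==> a i : A) ==> dehom d a : polys_over A"
 by(auto simp: polys_over_def coeff_dehom subring_zero)

lemma bezout_over_map:
 assumes hom: "ring_hom_on A phi" and A: "subring A" and ab: "!!i. a i : A" "!!i. b i : A"
  and K: "!!x. x:A ==> phi x : K" and "bezout_over A d a b"
 shows "bezout_over K d (%i. phi (a i)) (%i. phi (b i))"
proof -
 note polys = subring_polys_over[OF A]
 note hom_simps = ring_hom_on_simps[OF ring_hom_on_map_poly[OF hom A] polys]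
 have zero: "phi 0 = 0" by(rule ring_hom_on_simps(2)[OF hom A])
 have map_mem: "map_poly phi f : polys_over K" if "f:polys_over A" for f
  using that zero K by(auto simp: polys_over_def coeff_map_poly)
 have map_dehom: "map_poly phi (dehom d c) = dehom d (%i. phi (c i))" for c
  by(rule poly_eqI) (simp add: coeff_map_poly coeff_dehom zero)
 obtain u v where uv: "u:polys_over A" "v:polys_over A" "u * dehom d a + v * dehom d b = 1"
  using assms(6) unfolding bezout_over_def by blast
 have "map_poly phi (u * dehom d a + v * dehom d b) = 1" unfolding uv(3) by(rule hom_simps(1))
 hence "map_poly phi u * dehom d (%i. phi (a i)) + map_poly phi v * dehom d (%i. phi (b i)) = 1"
  using uv(1,2) dehom_in_polys_over[OF A] ab subring_mult[OF polys] by(simp add: hom_simps map_dehom)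
 thus ?thesis unfolding bezout_over_def using map_mem uv(1,2) by blast
qed

lemma nondegenerate_over_imp_nondegenerate:
 fixes a b :: "nat => complex"
 assumes "nondegenerate_over K d a b"
 shows "nondegenerate d a b"
proof -
 obtain u v where uv: "u * dehom d a + v * dehom d b = 1"
  using assms unfolding nondegenerate_over_def bezout_over_def by blast
 obtain u' v' where "u' * dehom d (%i. a (d - i)) + v' * dehom d (%i. b (d - i)) = 1"
  using assms unfolding nondegenerate_over_def bezout_over_def by blast
 from arg_cong[OF this, of "%p. coeff p 0"] have "a d ~= 0 | b d ~= 0" by(auto simp: coeff_mult coeff_dehom)
 thus ?thesis by(rule nondegenerateI[OF uv])
qed

lemma algebraic_fixed_line:
 assumes sys: "hmap_system D a b I" and K: "number_field K" and coeffs: "!!g i. g:I ==> a g i : K & b g i : K"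
  and h: "set h <= I" "wdeg D h >= 2" and P: "P ~= (0,0)" "wedge (act D a b h P) P = 0"
 obtains k P' K' where "k ~= 0" "P = scale k P'" "number_field K'" "K <= K'" "P':K' \<times> K'"
proof(cases "snd P = 0")
 case True
 have "(1,0) : K \<times> K" using subring_closed[OF number_field_subring[OF K]] by auto
 thus thesis using that[of "fst P" "(1,0)" K] True K P(1) by(auto simp: scale_def prod_eq_iff)
next
 case False
 interpret hmap_system D a b I by(rule sys)
 note subring_K = number_field_subring[OF K]
 define x where "x = chart P"
 have Px: "P = scale (snd P) (x,1)" unfolding x_def by(rule scale_snd_chart[OF False])
 have fixed: "wedge (act D a b h (x,1)) (x,1) = 0" using P(2) False by(subst (asm) (1 2) Px) (simp add: act_scale)
 define E where "E = [:0, 1:] * snd (act_poly D a b h) - fst (act_poly D a b h)"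
 have eval: "poly E z = - wedge (act D a b h (z,1)) (z,1)" for z by(simp add: E_def poly_act_poly wedge_def)
 have "act_poly D a b h : polys_over K \<times> polys_over K" using act_poly_in_polys_over[OF subring_K, of h a b D] coeffs h(1) by(meson subsetD)
 hence E: "E:polys_over K" unfolding E_def using subring_polys_over[OF subring_K]
  by(intro subring_diff subring_mult X_in_polys_over subring_K) auto
 obtain p q where pq: "nondegenerate (wdeg D h) p q" "!!X. act D a b h X = hmap (wdeg D h) p q X"
  using act_nondegenerate[OF h(1)] by blast
 obtain z where "wedge (hmap (wdeg D h) p q (z,1)) (z,1) ~= 0" using hmap_not_identity[OF h(2) pq(1)] by blast
 hence "poly E z ~= 0" by(simp add: eval pq(2))
 hence "E ~= 0" by auto
 hence "number_field (adjoin K x)" using number_field_adjoin[OF K E] fixed by(simp add: eval)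
 thus thesis using that[of "snd P" "(x,1)" "adjoin K x"] False Px in_adjoin[OF subring_K] subset_adjoin[OF subring_K]
   subring_one[OF subring_K] by auto
qed

lemma algebraic_fixed_vector:
 assumes sys: "hmap_system D a b I" and K: "number_field K" and coeffs: "!!g i. g:I ==> a g i : K & b g i : K"
  and h: "set h <= I" "wdeg D h >= 2" and P: "P ~= (0,0)" "act D a b h P = scale mu P" "mu ~= 0"
 obtains c K' where "c ~= 0" "number_field K'" "K <= K'" "scale c P : K' \<times> K'" "act D a b h (scale c P) = scale c P"
proof -
 obtain k P' K1 where P': "k ~= 0" "P = scale k P'" "number_field K1" "K <= K1" "P':K1 \<times> K1"
  using algebraic_fixed_line[OF sys K coeffs h P(1)] P(2) by(metis mult_zero_right wedge_scale(1) wedge_self)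
 note subring_K1 = number_field_subring[OF P'(3)]
 define e where "e = wdeg D h - 1"
 have d: "wdeg D h = Suc e" and e: "e > 0" using h(2) by(auto simp: e_def)
 define nu where "nu = mu / k^e"
 have "scale (k^Suc e) (act D a b h P') = scale (mu * k) P'" using P(2) act_scale[of D a b h k P'] by(simp add: P'(2) d)
 hence "scale (inverse (k^Suc e)) (scale (k^Suc e) (act D a b h P')) = scale (inverse (k^Suc e)) (scale (mu * k) P')"
  by simp
 moreover have "inverse (k^Suc e) * k^Suc e = 1" "inverse (k^Suc e) * (mu * k) = nu"
  using P'(1) by(simp_all add: nu_def field_simps)
 ultimately have fixed: "act D a b h P' = scale nu P'" by(simp only: scale_scale scale_1)
 have nu: "nu ~= 0" using P(3) P'(1) by(simp add: nu_def)
 have "scale nu P' : K1 \<times> K1"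
  using act_in_subring[OF subring_K1 _ P'(5), of h a b D] coeffs h(1) P'(4) unfolding fixed by(meson subsetD)
 moreover have "P' ~= (0,0)" using P(1) by(auto simp: P'(2) scale_def)
 ultimately have "nu:K1" using P'(5) number_field_inverse[OF P'(3)] subring_mult[OF subring_K1]
  by(auto simp: scale_def prod_eq_iff mem_Times_iff)
   (metis mult.assoc mult.right_neutral right_inverse)+
 define f where "f = monom nu e - 1"
 have f: "coeff f e = nu" using e by(simp add: f_def)
 have "degree f >= e" using f nu by(intro le_degree) simp
 then obtain c where root: "poly f c = 0" using alg_closed_imp_poly_has_root[of f] e by auto
 hence c: "nu * c^e = 1" by(simp add: f_def poly_monom)
 hence "c ~= 0" using e by(auto simp: power_0_left)
 have "f:polys_over K1" unfolding f_def
  by(intro subring_diff subring_one subring_polys_over[OF subring_K1] monom_in_polys_over subring_K1 `nu:K1`)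
 hence "number_field (adjoin K1 c)" using number_field_adjoin[OF P'(3)] f nu root by(metis coeff_0)
 moreover have "scale c P' : adjoin K1 c \<times> adjoin K1 c"
  using P'(5) subset_adjoin[OF subring_K1] in_adjoin[OF subring_K1] subring_mult[OF subring_adjoin(1)[OF subring_K1]]
  by(auto simp: scale_def subset_iff)
 moreover have "c^Suc e * nu = c" using c by(simp add: mult_ac)
 hence "act D a b h (scale c P') = scale c P'" by(simp only: act_scale fixed d scale_scale)
 moreover have "scale c P' = scale (c / k) P" using P'(1,2) by simp
 ultimately show thesis using that[of "c / k" "adjoin K1 c"] `c ~= 0` P'(1)
   order.trans[OF P'(4) subset_adjoin[OF subring_K1]] by simp
qed

text \<open>The words \<open>h^j\<close> and \<open>f h^j\<close> are related, which bounds the image of \<open>P\<close> under \<open>f\<close> independently of \<open>f\<close>.\<close>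

lemma (in place) orbit_of_fixed_vector_bound:
 assumes sys: "hmap_system D a b I" and distorts: "!!g. g:I ==> distorts (hmap (D g) (a g) (b g)) (D g) kappa"
  and words: "set h <= I" "set f <= I" "wdeg D h >= 2"
  and P: "P:K \<times> K" "P ~= (0,0)" "vnorm P <~ n" "act D a b h P = P"
  and rel: "!!x y. set x <= I ==> set y <= I ==> EX u v eps m. m > (0::nat) & eps^m = 1
   & wdeg D (word_subst x y u @ x) = wdeg D (word_subst x y v @ y)
   & (ALL X. act D a b (word_subst x y u @ x) X = scale eps (act D a b (word_subst x y v @ y) X))"
 shows "vnorm (act D a b f P) <~ n^(6 * (cost kappa D h + 1) + 1)" "act D a b f P : K \<times> K"
proof -
 interpret hmap_system D a b I by(rule sys)
 define c j A where "c = cost kappa D h + 1" and "j = cost kappa D f + 1" and "A = word_subst h h (replicate j True)"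
 have word_distorts: "distorts (act D a b w) (wdeg D w) (cost kappa D w)" if "set w <= I" for w
  using that distorts by(intro act_distorts) auto
 note f_P = distortsD[OF word_distorts[OF words(2)] P(1)]
 show "act D a b f P : K \<times> K" by(rule f_P(1))
 have A_I: "set A <= I" unfolding A_def by(rule set_word_subst[OF words(1,1)])
 have "act D a b (word_subst h h (replicate i True)) P = P" "wdeg D (word_subst h h (replicate i True)) = wdeg D h^i" for i
  using P(4) by(induction i) (auto simp: act_append)
 hence A: "act D a b A P = P" "wdeg D A = wdeg D h^j" by(simp_all add: A_def)
 have "c * 1 <= c * (wdeg D h - 1)" using words(3) by(intro mult_le_mono2) simp
 hence "cost kappa D h <= c * (wdeg D h - 1)" by(simp add: c_def)
 hence cost_A: "cost kappa D A <= c * (wdeg D A - 1)" unfolding A_def using words(3) by(intro cost_word_subst) auto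
 have "j < 2^j" by(rule less_exp)
 also have "(2::nat)^j <= wdeg D h^j" using words(3) by(intro power_mono) auto
 finally have j: "j < wdeg D A" by(simp add: A(2))
 define e where "e = wdeg D f"
 have e: "e >= 1" unfolding e_def by(rule wdeg_pos[OF words(2)])
 have "cost kappa D (f @ A) <= c * (e * wdeg D A - 1) + c * (e * wdeg D A - 1)"
 proof -
  have "cost kappa D f <= 1 * (wdeg D A - 1)" using j by(simp add: j_def)
  also have "... <= c * (e * wdeg D A - 1)" using e by(intro mult_le_mono diff_le_mono) (auto simp: c_def)
  finally have "cost kappa D f <= c * (e * wdeg D A - 1)" .
  moreover have "e * (wdeg D A - 1) <= e * wdeg D A - 1" using e by(simp add: diff_mult_distrib2)
  hence "e * (c * (wdeg D A - 1)) <= c * (e * wdeg D A - 1)" by(metis mult.left_commute mult_le_mono2)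
  hence "e * cost kappa D A <= c * (e * wdeg D A - 1)" using mult_le_mono2[OF cost_A] order.trans by blast
  ultimately show ?thesis by(simp add: cost_append e_def)
 qed
 hence cost_B: "cost kappa D (f @ A) <= 2 * c * (wdeg D (f @ A) - 1)" by(simp add: e_def)
 have "set (f @ A) <= I" using A_I words(2) by simp
 then obtain u v eps m where rel': "m > (0::nat)" "eps^m = 1" "wdeg D (word_subst A (f @ A) u @ A) = wdeg D (word_subst A (f @ A) v @ f @ A)"
  "!!X. act D a b (word_subst A (f @ A) u @ A) X = scale eps (act D a b (word_subst A (f @ A) v @ f @ A) X)"
  using rel[OF A_I] by metis
 have subst_I: "set (word_subst A (f @ A) w) <= I" for w using A_I words(2) by(intro set_word_subst) auto
 have nonzero: "act D a b f P ~= (0,0)" by(rule act_nonzero[OF words(2) P(2)])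
 have "vnorm (act D a b f P) <~ n^(3 * (2 * c) + 1)"
 proof(rule orbit_bound[OF word_distorts[OF subst_I] _ cost_B HOL.refl _ _ e P(1,3) A(1) _ f_P(1) nonzero _ rel'(3,4,2,1)])
  show "cost kappa D A <= 2 * c * (wdeg D A - 1)" using cost_A by simp
  show "wdeg D A >= 2" using j by(simp add: j_def)
  show "act D a b (word_subst A (f @ A) v) (act D a b f P) ~= (0,0)" by(rule act_nonzero[OF subst_I nonzero])
 qed(simp_all add: e_def act_append A(1))
 thus "vnorm (act D a b f P) <~ n^(6 * (cost kappa D h + 1) + 1)" by(simp add: c_def)
qed

lemma place_distorts_uniform:
 assumes fin: "finite I" and subring: "subring K" and degree_pos: "!!g. g:I ==> D g >= 1"
  and coeffs: "!!g i. g:I ==> a g i : K & b g i : K"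
  and nondeg: "!!g. g:I ==> nondegenerate_over K (D g) (a g) (b g)"
 obtains L kappa where "finite L" "L <= K"
  "!!g K' le n. g:I ==> place K' le n ==> K <= K' ==> (ALL x:L. le x n) ==>
   place.distorts K' le n (hmap (D g) (a g) (b g)) (D g) kappa"
proof -
 have "ALL g:I. EX u v u' v'. {u, v, u', v'} <= polys_over K & u * dehom (D g) (a g) + v * dehom (D g) (b g) = 1
   & u' * dehom (D g) (%i. a g (D g - i)) + v' * dehom (D g) (%i. b g (D g - i)) = 1"
  using nondeg unfolding nondegenerate_over_def bezout_over_def by(simp add: Bex_def) metis
 then obtain u v u' v' where uv: "!!g. g:I ==> {u g, v g, u' g, v' g} <= polys_over K"
  "!!g. g:I ==> u g * dehom (D g) (a g) + v g * dehom (D g) (b g) = 1"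
  "!!g. g:I ==> u' g * dehom (D g) (%i. a g (D g - i)) + v' g * dehom (D g) (%i. b g (D g - i)) = 1"
  by metis
 define S where "S g = {u g, v g, u' g, v' g, dehom (D g) (a g), dehom (D g) (b g)}" for g
 have S: "S g <= polys_over K" if "g:I" for g
  using uv(1)[OF that] dehom_in_polys_over[OF subring] coeffs[OF that] by(auto simp: S_def)
 define k where "k g = degree (u g) + degree (v g) + degree (u' g) + degree (v' g)" for g
 define kappa where "kappa = (\<Sum>g\<in>I. D g + k g + 2)"
 define L where "L = (\<Union>g\<in>I. \<Union>f\<in>S g. set (coeffs f))"
 show thesis
 proof(rule that[of L kappa])
  show "finite L" using fin by(auto simp: L_def S_def)
  show "L <= K" unfolding L_def using S coeffs_if_in_polys_over by blast
  fix g K' le n assume g: "g:I" and pl: "place K' le n" and "K <= K'" and L: "ALL x:L. le x n"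
  interpret place K' le n by(rule pl)
  have bounded: "bounded_poly k f" if "f:S g" "degree f <= k" for f k
  proof -
   have "le (coeff f i) n" for i
   proof -
    have "coeff f i : insert 0 (set (coeffs f))" using range_coeff[of f] by blast
    thus ?thesis using L zero_le[OF closed(1)] g that(1) by(auto simp: L_def)
   qed
   thus ?thesis using S[OF g] that polys_over_mono[OF `K <= K'`] by(auto simp: bounded_poly_def)
  qed
  have "distorts (hmap (D g) (a g) (b g)) (D g) (D g + k g + 2)" using uv(2,3)[OF g] degree_pos[OF g]
   by(intro hmap_distorts[where u = "u g" and v = "v g" and u' = "u' g" and v' = "v' g"] bounded)
    (auto simp: S_def k_def degree_dehom_le)
  moreover have "D g + k g + 2 <= kappa" unfolding kappa_def by(rule member_le_sum[OF g _ fin]) simp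
  ultimately show "distorts (hmap (D g) (a g) (b g)) (D g) kappa" by(rule distorts_mono)
 qed
qed

theorem finite_orbit:
 assumes sys: "hmap_system D a b I" and fin: "finite I" and K: "number_field K"
  and coeffs: "!!g i. g:I ==> a g i : K & b g i : K"
  and nondeg: "!!g. g:I ==> nondegenerate_over K (D g) (a g) (b g)"
  and h: "set h <= I" "wdeg D h >= 2" and P: "P ~= (0,0)" "act D a b h P = scale mu P" "mu ~= 0"
  and rel: "!!x y. set x <= I ==> set y <= I ==> EX u v eps m. m > (0::nat) & eps^m = 1
   & wdeg D (word_subst x y u @ x) = wdeg D (word_subst x y v @ y)
   & (ALL X. act D a b (word_subst x y u @ x) X = scale eps (act D a b (word_subst x y v @ y) X))"
 obtains c where "c ~= 0" "act D a b h (scale c P) = scale c P" "finite {act D a b w (scale c P) |w. set w <= I}"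
proof -
 obtain c K' where K': "c ~= 0" "number_field K'" "K <= K'" "scale c P : K' \<times> K'" "act D a b h (scale c P) = scale c P"
  using algebraic_fixed_vector[OF sys K coeffs h P] by metis
 define Q where "Q = scale c P"
 have Q: "Q ~= (0,0)" "Q:K' \<times> K'" using K'(1,4) P(1) by(auto simp: Q_def scale_eq_0_iff)
 obtain L kappa where L: "finite L" "L <= K"
  and distorts: "!!g le n. g:I ==> place K' le n ==> ALL x:L. le x n ==>
   place.distorts K' le n (hmap (D g) (a g) (b g)) (D g) kappa"
  using place_distorts_uniform[where D = D and a = a and b = b, OF fin number_field_subring[OF K] hmap_system.degree_pos[OF sys] coeffs nondeg]
   K'(3) by metis
 define E where "E = 6 * (cost kappa D h + 1) + 1"
 obtain X where X: "finite X" "!!x. x:K' ==> (!!le n. place K' le n ==>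
   ALL y:insert (fst Q) (insert (snd Q) L). le y n ==> le x (n^E)) ==> x:X"
  using place_northcott[OF K'(2), of "insert (fst Q) (insert (snd Q) L)" E] L K'(3) Q(2) by(auto simp: mem_Times_iff)
 have "act D a b f Q : X \<times> X" if f: "set f <= I" for f
 proof -
  have f_Q: "act D a b f Q : K' \<times> K'"
   using act_in_subring[OF number_field_subring[OF K'(2)] _ Q(2), of f a b D] coeffs f K'(3) by(meson subsetD)
  have "le (fst (act D a b f Q)) (n^E) & le (snd (act D a b f Q)) (n^E)"
   if pl: "place K' le n" and le: "ALL y:insert (fst Q) (insert (snd Q) L). le y n" for le n
  proof -
   interpret place K' le n by(rule pl)
   have "le (vnorm Q) n" using le by(intro vnorm_le) auto
   hence "le (vnorm (act D a b f Q)) (n^E)"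
    using orbit_of_fixed_vector_bound(1)[OF sys distorts[OF _ pl] h(1) f h(2) Q(2,1) _ _ rel] le K'(5)
    by(simp add: E_def Q_def)
   thus ?thesis using trans[OF le_vnorm(1)[OF f_Q]] trans[OF le_vnorm(2)[OF f_Q]] f_Q by(auto simp: mem_Times_iff)
  qed
  hence "fst (act D a b f Q) : X" "snd (act D a b f Q) : X" using f_Q by(auto simp: mem_Times_iff intro!: X(2))
  thus ?thesis by(simp add: mem_Times_iff)
 qed
 hence "{act D a b w Q |w. set w <= I} <= X \<times> X" by blast
 hence "finite {act D a b w Q |w. set w <= I}" using X(1) by(meson finite_SigmaI finite_subset)
 thus thesis using that K'(1,5) unfolding Q_def by blast
qed

section \<open>Germs of orbits through a finite invariant set\<close>

instance fps :: (ring_char_0) ring_char_0 ..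

lemma nth_subdegree_fps_compose:
 fixes F G :: "'a::idom fps"
 assumes "G$0 = 0"
 shows "(F oo G) $ (subdegree F * subdegree G) = F $ subdegree F * (G $ subdegree G)^subdegree F"
proof -
 define m H where "m = subdegree F" and "H = fps_shift m F"
 have "F = H * fps_X^m" by(simp add: H_def m_def fps_shift_times_fps_X_power)
 hence F: "F oo G = (H oo G) * G^m" using assms by(simp add: fps_compose_mult_distrib flip: fps_compose_power)
 show ?thesis
 proof(cases "F = 0")
  case False
  hence "H $ 0 ~= 0" by(simp add: H_def m_def)
  hence "subdegree (H oo G) = 0" by(intro subdegree_eq_0) simp
  hence "((H oo G) * G^m) $ (m * subdegree G) = (H oo G) $ 0 * (G^m) $ subdegree (G^m)"
   using nth_subdegree_mult[of "H oo G" "G^m"] by simp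
  thus ?thesis using F by(simp add: H_def m_def)
 qed simp
qed

fun digits :: "complex => bool list => complex" where
 "digits r [] = 0"
| "digits r (s # u) = of_bool s + r * digits r u"

lemma digits_inj_if_norm_le_half:
 assumes r: "r ~= 0" "cmod r <= 1/2" and len: "length u = length v" and eq: "digits r u = digits r v"
 shows "u = v"
proof -
 have contract: "cmod (r * z) <= cmod z / 2" for z using mult_right_mono[OF r(2), of "cmod z"] by(simp add: norm_mult)
 have less: "cmod (digits r u - digits r v) < 2" if "length u = length v" for u v using that
 proof(induction u v rule: list_induct2)
  case (Cons s u t v)
  have "digits r (s # u) - digits r (t # v) = (of_bool s - of_bool t) + r * (digits r u - digits r v)"
   by(simp add: algebra_simps)
  hence "cmod (digits r (s # u) - digits r (t # v)) <= cmod (of_bool s - of_bool t) + cmod (r * (digits r u - digits r v))"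
   by(metis norm_triangle_ineq)
  moreover have "cmod (of_bool s - of_bool t) <= 1" by auto
  ultimately show ?case using contract[of "digits r u - digits r v"] Cons by linarith
 qed simp
 show ?thesis using len eq
 proof(induction u v rule: list_induct2)
  case (Cons s u t v)
  have sum: "of_bool t - of_bool s = r * (digits r u - digits r v)" using Cons.prems by(simp add: algebra_simps)
  hence "cmod (of_bool t - of_bool s) < 1" using contract[of "digits r u - digits r v"] less[OF Cons.hyps] by simp
  hence "s = t" by(cases s; cases t) auto
  thus ?case using Cons sum r by auto
 qed simp
qed

lemma digits_rev: "r ~= 0 ==> r^length u * digits (1 / r) (rev u) = r * digits r u"
proof(induction u)
 case (Cons s u)
 have "digits q (v @ [s]) = digits q v + q^length v * of_bool s" for q v by(induction v) (auto simp: algebra_simps)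
 hence "r^length (s # u) * digits (1 / r) (rev (s # u))
   = r * (r^length u * digits (1 / r) (rev u)) + r * of_bool s"
  using Cons.prems by(simp add: algebra_simps power_one_over)
 also have "... = r * digits r (s # u)" using Cons by(simp add: algebra_simps)
 finally show ?case .
qed simp

lemma digits_inj:
 assumes "r ~= 0" "cmod r >= 2 | cmod r <= 1/2" and len: "length u = length v" and eq: "digits r u = digits r v"
 shows "u = v"
proof(cases "cmod r <= 1/2")
 case False
 have "r^length v * digits (1 / r) (rev u) = r^length v * digits (1 / r) (rev v)"
  using digits_rev[OF assms(1), of u] digits_rev[OF assms(1), of v] len eq by simp
 hence "digits (1 / r) (rev u) = digits (1 / r) (rev v)" using assms(1) by simp
 moreover have "cmod (1 / r) <= 1/2" using False assms(2) by(auto simp: norm_divide divide_le_eq)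
 ultimately have "rev u = rev v" using assms(1) len by(intro digits_inj_if_norm_le_half[of "1 / r"]) auto
 thus ?thesis by simp
qed(use assms in \<open>auto intro: digits_inj_if_norm_le_half\<close>)

lemma affine_differences_nonzero:
 fixes \<Delta> :: "bool list => bool list => complex => bool"
 assumes base: "\<Delta> [] [] 0"
  and step: "!!s t u v c. length u = length v ==> \<Delta> u v c
   ==> \<Delta> (s # u) (t # v) (r * c + theta * nu^length u * (of_bool s - of_bool t))"
  and nonzero: "r ~= 0" "theta ~= 0" "nu ~= 0" and size: "cmod (r / nu) >= 2 | cmod (r / nu) <= 1/2"
  and len: "length u = length v" and "u ~= v"
 obtains c where "c ~= 0" "\<Delta> u v c"
proof -
 define rho c where "rho = r / nu" and "c u v = theta * nu^length u * (digits rho u - digits rho v) / nu" for u v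
 have r: "r = nu * rho" using nonzero(3) by(simp add: rho_def)
 have "\<Delta> u v (c u v)" using len
 proof(induction u v rule: list_induct2)
  case Nil
  show ?case using base by(simp add: c_def)
 next
  case (Cons s u t v)
  have "digits rho (s # u) - digits rho (t # v) = (of_bool s - of_bool t) + rho * (digits rho u - digits rho v)"
   by(simp add: algebra_simps)
  moreover have "theta * (nu * N) * (e + rho * d) / nu = nu * rho * (theta * N * d / nu) + theta * N * e" for N d e
   using nonzero(3) by(simp add: algebra_simps)
  ultimately have "c (s # u) (t # v) = r * c u v + theta * nu^length u * (of_bool s - of_bool t)"
   unfolding c_def r by(simp only: list.size add_0_right add_Suc_right power_Suc)
  thus ?case using step[OF Cons.hyps Cons.IH] by simp
 qed
 moreover have "c u v ~= 0" using digits_inj[OF _ size len] `u ~= v` nonzero by(auto simp: c_def rho_def)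
 ultimately show thesis using that by blast
qed

lemma exists_power_mult_far_from_unit:
 fixes mu :: complex
 assumes "mu ~= 0" "delta ~= 0" "cmod mu ~= 1"
 obtains N where "N >= 1" "cmod (mu^N * delta) >= 2 | cmod (mu^N * delta) <= 1/2"
proof(cases "cmod mu > 1")
 case True
 obtain n where "2 / cmod (mu * delta) < cmod mu^n" using real_arch_pow[OF True] by blast
 hence "2 < cmod (mu^Suc n * delta)" using assms by(simp add: pos_divide_less_eq norm_mult norm_power mult_ac)
 thus thesis using that[of "Suc n"] by auto
next
 case False
 have "0 < 1 / (2 * cmod (mu * delta))" using assms by simp
 then obtain n where "cmod mu^n < 1 / (2 * cmod (mu * delta))" using real_arch_pow_inv False assms(3) by force
 hence "cmod (mu^Suc n * delta) < 1/2" using assms by(simp add: pos_less_divide_eq norm_mult norm_power mult_ac)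
 thus thesis using that[of "Suc n"] by auto
qed

lemma poly_map_fps_const_shift:
 fixes f :: "'a::comm_ring_1 poly"
 shows "poly (map_poly fps_const f) (fps_const y + fps_X) = fps_of_poly (pcompose f [:y, 1:])"
 by(induction f) (simp_all add: map_poly_pCons pcompose_pCons fps_of_poly_add fps_of_poly_mult fps_of_poly_const
   fps_of_poly_pCons mult.commute)

lemma ring_hom_on_fps_const: "ring_hom_on UNIV (fps_const :: 'a::comm_ring_1 => 'a fps)" by(simp add: ring_hom_on_def)

locale chart_system =
 fixes D :: "'g => nat" and a b :: "'g => nat => complex" and I :: "'g set" and Z :: "complex set"
 assumes denominator: "!!g y. g:I ==> y:Z ==> poly (dehom (D g) (b g)) y ~= 0"
  and invariant: "!!g y. g:I ==> y:Z ==> poly (dehom (D g) (a g)) y / poly (dehom (D g) (b g)) y : Z"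
begin

definition ratmap :: "'g => complex => complex" where
 "ratmap g y = poly (dehom (D g) (a g)) y / poly (dehom (D g) (b g)) y"

definition ratmap_deriv :: "'g => complex => complex" where
 "ratmap_deriv g y = (poly (pderiv (dehom (D g) (a g))) y * poly (dehom (D g) (b g)) y
  - poly (dehom (D g) (a g)) y * poly (pderiv (dehom (D g) (b g))) y) / poly (dehom (D g) (b g)) y^2"

fun orbit :: "'g list => complex => complex" where
 "orbit [] y = y"
| "orbit (g # w) y = ratmap g (orbit w y)"

fun multiplier :: "'g list => complex => complex" where
 "multiplier [] y = 1"
| "multiplier (g # w) y = ratmap_deriv g (orbit w y) * multiplier w y"

definition reach :: "complex => complex set" where
 "reach y = {orbit w y |w. set w <= I}"

definition loops :: "complex => 'g list set" where
 "loops y = {w. set w <= I & orbit w y = y}"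

lemma orbit_append: "orbit (u @ v) y = orbit u (orbit v y)" by(induction u) auto

lemma multiplier_append: "multiplier (u @ v) y = multiplier u (orbit v y) * multiplier v y"
 by(induction u) (auto simp: orbit_append)

lemma orbit_in: "set w <= I ==> y:Z ==> orbit w y : Z" by(induction w) (auto simp: ratmap_def invariant)

lemma reach_subset: "y:Z ==> reach y <= Z" unfolding reach_def using orbit_in by auto

lemma reachI: "set w <= I ==> orbit w y : reach y" unfolding reach_def by blast

lemma reach_self: "y:reach y" using reachI[of "[]" y] by simp

lemma reach_trans: "z:reach y ==> reach z <= reach y"
 unfolding reach_def by clarify (metis orbit_append set_append Un_subset_iff)

lemma loops_append: "u:loops y ==> v:loops y ==> u @ v : loops y" by(simp add: loops_def orbit_append)

lemma loops_word_subst: "u:loops y ==> v:loops y ==> word_subst u v s : loops y"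
 by(induction s) (auto simp: loops_append, auto simp: loops_def)

lemma terminal_exists:
 assumes Z: "finite Z" "y:Z"
 obtains p where "p:reach y" "!!z. z:reach p ==> p:reach z"
proof -
 define p where "p = (ARG_MIN (%z. card (reach z)) z. z:reach y)"
 have p: "p:reach y" unfolding p_def by(rule arg_min_natI) (rule reach_self)
 have minimal: "card (reach p) <= card (reach z)" if "z:reach y" for z unfolding p_def by(rule arg_min_nat_le) (rule that)
 have "p:reach z" if z: "z:reach p" for z
 proof -
  have "finite (reach p)" using reach_subset[OF Z(2)] reach_trans[OF p] Z(1) by(meson finite_subset order.trans)
  hence "reach z = reach p" using reach_trans[OF z] minimal[of z] z reach_trans[OF p] card_seteq by blast
  thus ?thesis using reach_self by blast
 qed
 thus thesis using that p by blast
qed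

end

locale fps_chart = chart_system D a b I Z for D :: "'g => nat" and a b :: "'g => nat => complex" and I Z +
 fixes A B :: "'g => nat => complex fps"
 assumes const_term: "!!g i. A g i $ 0 = a g i" "!!g i. B g i $ 0 = b g i"
begin

definition fps_ratmap :: "'g => complex fps => complex fps" where
 "fps_ratmap g x = poly (dehom (D g) (A g)) x * inverse (poly (dehom (D g) (B g)) x)"

definition slope :: "'g => complex fps => complex fps" where
 "slope g x = (poly (pderiv (dehom (D g) (A g))) x * poly (dehom (D g) (B g)) x
  - poly (dehom (D g) (A g)) x * poly (pderiv (dehom (D g) (B g))) x) * inverse (poly (dehom (D g) (B g)) x)^2"

fun lift :: "'g list => complex fps => complex fps" where
 "lift [] x = x"
| "lift (g # w) x = fps_ratmap g (lift w x)"

fun lift_slope :: "'g list => complex fps => complex fps" where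
 "lift_slope [] x = 1"
| "lift_slope (g # w) x = slope g (lift w x) * lift_slope w x"

lemma lift_append: "lift (u @ v) x = lift u (lift v x)" by(induction u) auto

lemma lift_slope_append: "lift_slope (u @ v) x = lift_slope u (lift v x) * lift_slope v x"
 by(induction u) (auto simp: lift_append)

lemma const_terms_dehom:
 "const_terms (dehom (D g) (A g)) = dehom (D g) (a g)" "const_terms (dehom (D g) (B g)) = dehom (D g) (b g)"
 by(intro poly_eqI; simp add: coeff_map_poly coeff_dehom const_term)+

lemma poly_dehom_nth_0:
 "poly (dehom (D g) (A g)) x $ 0 = poly (dehom (D g) (a g)) (x$0)"
 "poly (dehom (D g) (B g)) x $ 0 = poly (dehom (D g) (b g)) (x$0)"
 "poly (pderiv (dehom (D g) (A g))) x $ 0 = poly (pderiv (dehom (D g) (a g))) (x$0)"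
 "poly (pderiv (dehom (D g) (B g))) x $ 0 = poly (pderiv (dehom (D g) (b g))) (x$0)"
 by(simp_all add: poly_fps_nth_0 const_terms_dehom flip: pderiv_const_terms)

lemma fps_ratmap_nth_0: "fps_ratmap g x $ 0 = ratmap g (x$0)"
 by(simp add: fps_ratmap_def ratmap_def poly_dehom_nth_0 divide_inverse)

lemma slope_nth_0: "slope g x $ 0 = ratmap_deriv g (x$0)"
 by(simp add: slope_def ratmap_deriv_def poly_dehom_nth_0 divide_inverse power2_eq_square)

lemma lift_nth_0: "lift w x $ 0 = orbit w (x$0)" by(induction w) (auto simp: fps_ratmap_nth_0)

lemma lift_slope_nth_0: "lift_slope w x $ 0 = multiplier w (x$0)" by(induction w) (auto simp: slope_nth_0 lift_nth_0)

lemma unit_denominator: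
 assumes "g:I" "x$0 : Z"
 shows "poly (dehom (D g) (B g)) x dvd 1"
  "inverse (poly (dehom (D g) (B g)) x) * poly (dehom (D g) (B g)) x = 1"
 using denominator[OF assms] by(simp_all add: poly_dehom_nth_0 inverse_mult_eq_1)

lemma act_lift:
 assumes "set w <= I" "x$0 : Z"
 shows "act D A B w (x, 1) = scale (snd (act D A B w (x, 1))) (lift w x, 1)" "snd (act D A B w (x, 1)) $ 0 ~= 0"
proof -
 have "act D A B w (x, 1) = scale (snd (act D A B w (x, 1))) (lift w x, 1) & snd (act D A B w (x, 1)) $ 0 ~= 0"
  using assms(1)
 proof(induction w)
  case Nil
  show ?case by simp
 next
  case (Cons g w)
  define k y where "k = snd (act D A B w (x, 1))" and "y = lift w x"
  have IH: "act D A B w (x, 1) = scale k (y, 1)" "k$0 ~= 0" using Cons by(auto simp: k_def y_def)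
  have y: "y$0 : Z" unfolding y_def lift_nth_0 using Cons.prems assms(2) by(intro orbit_in) auto
  define q where "q = poly (dehom (D g) (B g)) y"
  have q: "inverse q * q = 1" "q$0 ~= 0" using unit_denominator[OF _ y, of g] Cons.prems by(auto simp: q_def)
  have "poly (dehom (D g) (A g)) y = q * fps_ratmap g y" using q(1) by(simp add: fps_ratmap_def q_def mult_ac)
  hence "act D A B (g # w) (x, 1) = scale (k^D g * q) (lift (g # w) x, 1)"
   by(simp add: IH(1) hmap_scale) (simp add: hmap_def hform_1 scale_def q_def y_def mult_ac)
  moreover have "(k^D g * q) $ 0 ~= 0" using IH(2) q(2) by(simp add: fps_power_zeroth)
  ultimately show ?case by(simp add: scale_def)
 qed
 thus "act D A B w (x, 1) = scale (snd (act D A B w (x, 1))) (lift w x, 1)" "snd (act D A B w (x, 1)) $ 0 ~= 0" by blast+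
qed

lemma wedge_act_lift:
 assumes "set w <= I" "set w' <= I" "x$0 : Z"
 shows "wedge (act D A B w (x,1)) (act D A B w' (x,1))
  = snd (act D A B w (x,1)) * snd (act D A B w' (x,1)) * (lift w x - lift w' x)"
 by(subst act_lift(1)[OF assms(1,3)], subst act_lift(1)[OF assms(2,3)]) (simp, simp add: wedge_def mult_ac)

lemma lift_eq_iff:
 assumes "set w <= I" "set w' <= I" "x$0 : Z"
 shows "lift w x = lift w' x \<longleftrightarrow> wedge (act D A B w (x,1)) (act D A B w' (x,1)) = 0"
 using wedge_act_lift[OF assms] act_lift(2)[OF assms(1,3)] act_lift(2)[OF assms(2,3)] by auto

lemma lift_eq_if_proj_eq:
 "set w <= I ==> set w' <= I ==> x$0 : Z ==> proj_eq D A B w w' ==> lift w x = lift w' x"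
 using lift_eq_iff[of w w' x] proj_eq_iff_chart[of D A B w w'] by blast

lemma proj_eq_if_lift_eq:
 assumes "set w <= I" "set w' <= I" "y:Z" and eq: "!!x. x$0 = y ==> lift w x = lift w' x"
 shows "proj_eq D A B w w'"
proof(rule ccontr)
 assume "~ proj_eq D A B w w'"
 hence nonzero: "wedge (act_poly D A B w) (act_poly D A B w') ~= 0" by(simp add: proj_eq_def)
 have "poly (wedge (act_poly D A B w) (act_poly D A B w')) x = 0" if "x$0 = y" for x
  using lift_eq_iff[OF assms(1,2), of x] assms(3) eq that by(simp add: wedge_def poly_act_poly)
 hence "range (%c. fps_const y + fps_const c * fps_X) <= {x. poly (wedge (act_poly D A B w) (act_poly D A B w')) x = 0}"
  by auto
 moreover have "inj (%c. fps_const y + fps_const c * fps_X)" by(rule injI) (drule arg_cong[of _ _ "%f. f$1"], simp)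
 ultimately show False using poly_roots_finite[OF nonzero] infinite_UNIV_char_0 finite_subset finite_imageD by blast
qed

lemma fps_ratmap_taylor:
 assumes g: "g:I" and x: "x$0 : Z" "x'$0 = x$0"
 shows "(x' - x)^2 dvd fps_ratmap g x' - fps_ratmap g x - slope g x * (x' - x)"
proof -
 define P Q P' Q' R S i j h where "P = poly (dehom (D g) (A g)) x" and "Q = poly (dehom (D g) (B g)) x"
  and "P' = poly (pderiv (dehom (D g) (A g))) x" and "Q' = poly (pderiv (dehom (D g) (B g))) x"
  and "R = poly (dehom (D g) (A g)) x'" and "S = poly (dehom (D g) (B g)) x'"
  and "i = inverse Q" and "j = inverse S" and "h = x' - x"
 obtain c where c: "R = P + h * P' + h^2 * c"
  using poly_taylor2[of "dehom (D g) (A g)" x h] by(auto simp: R_def P_def P'_def h_def)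
 obtain d where d: "S = Q + h * Q' + h^2 * d"
  using poly_taylor2[of "dehom (D g) (B g)" x h] by(auto simp: S_def Q_def Q'_def h_def)
 have units: "i * Q = 1" "j * S = 1" "Q dvd 1" "S dvd 1"
  using unit_denominator[OF g, of x] unit_denominator[OF g, of x'] x by(auto simp: i_def j_def Q_def S_def)
 have "(R * j - P * i - (P' * Q - P * Q') * i^2 * h) * (S * Q^2)
   = R * Q^2 * (j * S) - P * (i * Q) * S * Q - (P' * Q - P * Q') * h * S * (i * Q)^2"
  by(simp add: algebra_simps power2_eq_square)
 also have "... = h^2 * (Q * (c * Q - P * d) - (P' * Q - P * Q') * (Q' + h * d))"
  unfolding units(1,2) unfolding c d by(simp add: algebra_simps power2_eq_square)
 finally have "h^2 dvd (R * j - P * i - (P' * Q - P * Q') * i^2 * h) * (S * Q^2)" by(metis dvd_triv_left)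
 moreover have "is_unit (S * Q^2)" using units(3,4) by(simp add: is_unit_power_iff)
 ultimately have "h^2 dvd R * j - P * i - (P' * Q - P * Q') * i^2 * h" by(simp add: dvd_mult_unit_iff)
 thus ?thesis by(simp add: fps_ratmap_def slope_def P_def Q_def P'_def Q'_def R_def S_def i_def j_def h_def)
qed

lemma lift_taylor:
 assumes "set w <= I" and x: "x$0 : Z" "x'$0 = x$0"
 shows "(x' - x)^2 dvd lift w x' - lift w x - lift_slope w x * (x' - x)"
 using assms(1)
proof(induction w)
 case Nil
 show ?case by simp
next
 case (Cons g w)
 define k h s where "k = lift w x' - lift w x" and "h = x' - x" and "s = slope g (lift w x)"
 obtain c where c: "k - lift_slope w x * h = h^2 * c" using Cons by(auto simp: k_def h_def elim: dvdE)
 have k: "k = lift_slope w x * h + h^2 * c" using c by(simp add: algebra_simps)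
 have "lift w x $ 0 : Z" "lift w x' $ 0 = lift w x $ 0" using orbit_in Cons.prems x by(auto simp: lift_nth_0)
 then obtain d where d: "lift (g # w) x' - lift (g # w) x - s * k = k^2 * d"
  using fps_ratmap_taylor[of g "lift w x" "lift w x'"] Cons.prems by(auto simp: k_def s_def elim: dvdE)
 have "lift (g # w) x' - lift (g # w) x - s * lift_slope w x * h
   = (lift (g # w) x' - lift (g # w) x - s * k) + s * (k - lift_slope w x * h)"
  by(simp add: algebra_simps)
 also have "... = h^2 * ((lift_slope w x + h * c)^2 * d + s * c)"
  unfolding c d unfolding k by(simp add: algebra_simps power2_eq_square)
 finally show ?case by(simp add: h_def s_def)
qed

lemma lift_perturb:
 assumes "set w <= I" "x$0 : Z" "m >= 1"
 obtains k' where "lift w (x + fps_X^m * k) = lift w x + fps_X^m * k'" "k'$0 = multiplier w (x$0) * k$0"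
proof -
 define h where "h = fps_X^m * k"
 have h: "h$0 = 0" using assms(3) by(simp add: h_def fps_power_zeroth)
 obtain c where "lift w (x + h) - lift w x - lift_slope w x * h = h^2 * c"
  using lift_taylor[OF assms(1,2), of "x + h"] h by(auto elim: dvdE)
 hence "lift w (x + h) = lift w x + fps_X^m * (lift_slope w x * k + h * k * c)"
  by(simp add: h_def algebra_simps power2_eq_square)
 moreover have "(lift_slope w x * k + h * k * c) $ 0 = multiplier w (x$0) * k$0" by(simp add: h lift_slope_nth_0)
 ultimately show thesis using that unfolding h_def by blast
qed

lemma lift_inj:
 assumes "set w <= I" and x: "x$0 : Z" "x'$0 = x$0" "multiplier w (x$0) ~= 0" "lift w x' = lift w x"
 shows "x' = x"
proof(rule ccontr)
 assume "x' ~= x"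
 define m k where "m = subdegree (x' - x)" and "k = fps_shift m (x' - x)"
 have m: "x' = x + fps_X^m * k" using fps_shift_times_fps_X_power[of m "x' - x"] by(simp add: m_def k_def mult.commute)
 have "k$0 = (x' - x) $ subdegree (x' - x)" by(simp only: k_def m_def fps_shift_nth add_0)
 hence k: "k$0 ~= 0" using `x' ~= x` nth_subdegree_nonzero[of "x' - x"] by simp
 have "m >= 1" using m k x(2) by(cases m) auto
 then obtain k' where "lift w x' = lift w x + fps_X^m * k'" "k'$0 = multiplier w (x$0) * k$0"
  using lift_perturb[OF assms(1) x(1)] m by metis
 thus False using x(3,4) k by auto
qed

lemma multiplier_act_poly:
 assumes w: "set w <= I" and y: "y:Z" and P: "P = fst (act_poly D a b w)" and Q: "Q = snd (act_poly D a b w)"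
 shows "poly P y = poly Q y * orbit w y" "poly Q y ~= 0"
  "poly (pderiv P) y = poly (pderiv Q) y * orbit w y + poly Q y * multiplier w y"
proof -
 define F G where "F = fst (act_poly D A B w)" and "G = snd (act_poly D A B w)"
 have "map_prod const_terms const_terms (act_poly D A B w) = act_poly D a b w"
  using map_act_poly[OF ring_hom_on_fps_nth_0 subring_UNIV, of w A B D] by(simp add: const_term)
 hence const: "const_terms F = P" "const_terms G = Q" by(auto simp: F_def G_def P Q prod_eq_iff)
 have eval: "poly F x = poly G x * lift w x" "poly G x $ 0 ~= 0" if "x$0 = y" for x
  using act_lift[OF w, of x] y that by(auto simp: F_def G_def poly_act_poly scale_def prod_eq_iff)
 define x where "x = fps_const y"
 have x: "x$0 = y" by(simp add: x_def)
 show "poly P y = poly Q y * orbit w y" "poly Q y ~= 0"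
  using arg_cong[OF eval(1)[OF x], of "%f. f$0"] eval(2)[OF x] by(simp_all add: poly_fps_nth_0 const x lift_nth_0)
 obtain k where k: "lift w (x + fps_X) = lift w x + fps_X * k" "k$0 = multiplier w y"
  using lift_perturb[OF w, of x 1 1] x y by auto
 obtain r where r: "poly F (x + fps_X) = poly F x + fps_X * poly (pderiv F) x + fps_X^2 * r" using poly_taylor2 by blast
 obtain s where s: "poly G (x + fps_X) = poly G x + fps_X * poly (pderiv G) x + fps_X^2 * s" using poly_taylor2 by blast
 have "(poly F (x + fps_X)) $ 1 = (poly G (x + fps_X) * lift w (x + fps_X)) $ 1" using eval(1)[of "x + fps_X"] x by simp
 hence "poly F x $ 1 + poly (pderiv F) x $ 0
   = (poly G x * lift w x) $ 1 + (poly (pderiv G) x $ 0 * lift w x $ 0 + poly G x $ 0 * k $ 0)"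
  unfolding r s k(1) by(simp add: algebra_simps fps_mult_nth_1 power2_eq_square)
 thus "poly (pderiv P) y = poly (pderiv Q) y * orbit w y + poly Q y * multiplier w y"
  using eval(1)[OF x] k(2) x by(simp add: poly_fps_nth_0 lift_nth_0 const flip: const pderiv_const_terms)
qed

end

sublocale fps_chart \<subseteq> const: fps_chart D a b I Z "%g i. fps_const (a g i)" "%g i. fps_const (b g i)"
 by unfold_locales auto

context fps_chart
begin

definition germ :: "'g list => complex => complex fps" where
 "germ w y = const.lift w (fps_const y + fps_X) - fps_const (orbit w y)"

lemma germ_nth_0 [simp]: "germ w y $ 0 = 0" by(simp add: germ_def const.lift_nth_0)

lemma const_lift_compose:
 assumes w: "set w <= I" and x: "x$0 : Z" and z: "z$0 = 0"
 shows "const.lift w (x oo z) = const.lift w x oo z"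
 using w
proof(induction w)
 case Nil
 show ?case by simp
next
 case (Cons g w)
 have "ring_hom_on UNIV (%f. f oo z)" by(simp add: ring_hom_on_def fps_compose_add_distrib fps_compose_mult_distrib[OF z])
 moreover have "map_poly (%f. f oo z) (dehom d (%i. fps_const (c i))) = dehom d (%i. fps_const (c i))" for d c
  by(intro poly_eqI) (simp add: coeff_map_poly coeff_dehom)
 ultimately have poly: "poly (dehom d (%i. fps_const (c i))) (f oo z) = poly (dehom d (%i. fps_const (c i))) f oo z" for d c f
  using ring_hom_on_poly[OF _ subring_UNIV, of "%f. f oo z"] by(simp add: polys_over_UNIV)
 have "orbit w (x$0) : Z" using Cons.prems x by(intro orbit_in) auto
 hence "poly (dehom (D g) (%i. fps_const (b g i))) (const.lift w x) $ 0 ~= 0"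
  using denominator[of g] Cons.prems by(simp add: const.poly_dehom_nth_0 const.lift_nth_0)
 thus ?case using Cons by(simp add: const.fps_ratmap_def poly fps_compose_mult_distrib[OF z] fps_inverse_compose[OF z])
qed

lemma const_lift_eq_germ:
 assumes "set w <= I" "x$0 : Z"
 shows "const.lift w x = fps_const (orbit w (x$0)) + (germ w (x$0) oo (x - fps_const (x$0)))"
 using const_lift_compose[OF assms(1), of "fps_const (x$0) + fps_X" "x - fps_const (x$0)"] assms(2)
 by(simp add: germ_def fps_compose_add_distrib fps_compose_sub_distrib)

lemma germ_append:
 assumes "set u <= I" "set v <= I" "y:Z"
 shows "germ (u @ v) y = germ u (orbit v y) oo germ v y"
 using const_lift_eq_germ[OF assms(1), of "const.lift v (fps_const y + fps_X)"] orbit_in[OF assms(2,3)]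
 by(simp add: germ_def const.lift_append const.lift_nth_0 orbit_append)

lemma germ_eq_if_proj_eq:
 assumes "set w <= I" "set w' <= I" "y:Z" and "proj_eq D A B w w'"
 shows "orbit w y = orbit w' y" "germ w y = germ w' y" "proj_eq D a b w w'"
proof -
 show eq: "proj_eq D a b w w'"
  using proj_eq_map(1)[OF ring_hom_on_fps_nth_0 subring_UNIV _ assms(4)] by(simp add: const_term)
 have "proj_eq D (%g i. fps_const (a g i)) (%g i. fps_const (b g i)) w w'"
  by(rule proj_eq_map(1)[OF ring_hom_on_fps_const subring_UNIV _ eq]) simp
 hence lift: "const.lift w x = const.lift w' x" if "x$0 = y" for x
  using const.lift_eq_if_proj_eq[OF assms(1,2)] assms(3) that by simp
 show "orbit w y = orbit w' y" using arg_cong[OF lift[of "fps_const y"], of "%f. f$0"] by(simp add: const.lift_nth_0)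
 thus "germ w y = germ w' y" using lift[of "fps_const y + fps_X"] by(simp add: germ_def)
qed

lemma germ_nth_1:
 assumes "set w <= I" "y:Z"
 shows "germ w y $ 1 = multiplier w y"
proof -
 obtain k where k: "const.lift w (fps_const y + fps_X) = const.lift w (fps_const y) + fps_X * k" "k$0 = multiplier w y"
  using const.lift_perturb[OF assms(1), of "fps_const y" 1 1] assms(2) by auto
 have "const.lift w (fps_const y) = fps_const (orbit w y)"
  using const_lift_eq_germ[OF assms(1), of "fps_const y"] assms(2) by simp
 hence "germ w y = fps_X * k" using k(1) by(simp add: germ_def)
 thus ?thesis using k(2) by simp
qed

end

locale relation_system = fps_chart D a b I Z A B + hmap_system D a b I
 for D :: "'g => nat" and a b :: "'g => nat => complex" and I Z A B +
 assumes finite_I: "finite I" and finite_Z: "finite Z"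
  and relation: "!!x y. set x <= I ==> set y <= I
   ==> EX u v. proj_eq D A B (word_subst x y (u @ [True])) (word_subst x y (v @ [False]))"
begin

lemma relation_obtain:
 assumes xy: "set x <= I" "set y <= I"
 obtains u v where "wdeg D (word_subst x y (u @ [True])) = wdeg D (word_subst x y (v @ [False]))"
  "!!z. z$0 : Z ==> lift (word_subst x y (u @ [True])) z = lift (word_subst x y (v @ [False])) z"
  "!!z. z:Z ==> orbit (word_subst x y (u @ [True])) z = orbit (word_subst x y (v @ [False])) z"
  "!!z. z:Z ==> germ (word_subst x y (u @ [True])) z = germ (word_subst x y (v @ [False])) z"
proof -
 obtain u v where uv: "proj_eq D A B (word_subst x y (u @ [True])) (word_subst x y (v @ [False]))"
  using relation[OF xy] by blast
 note subset = set_word_subst[OF xy, of "u @ [True]"] set_word_subst[OF xy, of "v @ [False]"]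
 have "wdeg D (word_subst x y (u @ [True])) = wdeg D (word_subst x y (v @ [False]))"
  using proj_eq_map(1)[OF ring_hom_on_fps_nth_0 subring_UNIV _ uv] proj_eq_iff_scale[OF subset] by(simp add: const_term)
 thus thesis using that lift_eq_if_proj_eq[OF subset _ uv] germ_eq_if_proj_eq(1,2)[OF subset _ uv] by blast
qed

lemma relation_equal_length:
 assumes "x:loops p" "y:loops p" "wdeg D x = wdeg D y" "wdeg D x >= 2"
 obtains u v where "length u = length v" "u ~= v" "!!z. z$0 : Z ==> lift (word_subst x y u) z = lift (word_subst x y v) z"
proof -
 have deg: "wdeg D (word_subst x y w) = wdeg D x^length w" for w using assms(3) by(induction w) auto
 have I: "set x <= I" "set y <= I" using assms(1,2) by(auto simp: loops_def)
 obtain u v where uv: "wdeg D (word_subst x y (u @ [True])) = wdeg D (word_subst x y (v @ [False]))"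
  "!!z. z$0 : Z ==> lift (word_subst x y (u @ [True])) z = lift (word_subst x y (v @ [False])) z"
  using relation_obtain[OF I] by metis
 have "length (u @ [True]) = length (v @ [False])" using uv(1) assms(4) unfolding deg by(subst (asm) power_inject_exp) auto
 thus thesis using uv(2) that[of "u @ [True]" "v @ [False]"] by simp
qed

lemma germ_letter_nonzero:
 assumes g: "g:I" and y: "y:Z"
 shows "germ [g] y ~= 0"
proof
 assume "germ [g] y = 0"
 define P Q c where "P = pcompose (dehom (D g) (a g)) [:y, 1:]" and "Q = pcompose (dehom (D g) (b g)) [:y, 1:]"
  and "c = orbit [g] y"
 have map: "dehom d (%i. fps_const (e i)) = map_poly fps_const (dehom d e)" for d and e :: "nat => complex"
  by(intro poly_eqI) (simp add: coeff_map_poly coeff_dehom)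
 have "inverse (fps_of_poly Q) * fps_of_poly Q = 1" using const.unit_denominator(2)[OF g, of "fps_const y + fps_X"] y
  by(simp add: map poly_map_fps_const_shift Q_def)
 moreover have "fps_of_poly P * inverse (fps_of_poly Q) = fps_const c"
  using `germ [g] y = 0` by(simp add: germ_def const.fps_ratmap_def map poly_map_fps_const_shift P_def Q_def c_def)
 ultimately have "fps_of_poly P = fps_const c * fps_of_poly Q" by(metis mult.assoc mult.right_neutral)
 hence "pcompose (dehom (D g) (a g) - smult c (dehom (D g) (b g))) [:y, 1:] = 0"
  by(intro iffD1[OF fps_of_poly_eq_iff]) (simp add: P_def Q_def pcompose_diff pcompose_smult fps_of_poly_diff fps_of_poly_smult)
 hence proportional: "dehom (D g) (a g) = smult c (dehom (D g) (b g))" by(simp add: pcompose_eq_0_iff)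
 hence "is_unit (dehom (D g) (b g))"
  using coprime_dehom[OF nondegenerate[OF g]] by(metis coprime_common_divisor dvd_refl dvd_smult)
 hence "degree (dehom (D g) (b g)) = 0" by(metis is_unit_iff_degree not_is_unit_0)
 hence "coeff (dehom (D g) (b g)) (D g) = 0" using degree_pos[OF g] by(intro coeff_eq_0) simp
 thus False using nondegenerate_top[OF nondegenerate[OF g]] arg_cong[OF proportional, of "%f. coeff f (D g)"]
  by(simp add: coeff_dehom)
qed

lemma germ_nonzero:
 assumes "set w <= I" "y:Z"
 shows "germ w y ~= 0"
 using assms(1)
proof(induction w)
 case Nil
 show ?case by(simp add: germ_def)
next
 case (Cons g w)
 thus ?case using germ_append[of "[g]" w y] germ_letter_nonzero[of g "orbit w y"] orbit_in[of w y] assms(2)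
  by(simp add: fps_compose_eq_0_iff)
qed

definition local_degree :: "'g list => complex => nat" where
 "local_degree w y = subdegree (germ w y)"

definition leading_coeff :: "'g list => complex => complex" where
 "leading_coeff w y = germ w y $ local_degree w y"

lemma leading_coeff_nonzero: "set w <= I ==> y:Z ==> leading_coeff w y ~= 0"
 using germ_nonzero by(simp add: leading_coeff_def local_degree_def)

lemma local_degree_pos: "set w <= I ==> y:Z ==> local_degree w y >= 1"
 using leading_coeff_nonzero[of w y] germ_nth_0[of w y] unfolding leading_coeff_def by(cases "local_degree w y") auto

lemma local_degree_append:
 "set u <= I ==> set v <= I ==> y:Z ==> local_degree (u @ v) y = local_degree u (orbit v y) * local_degree v y"
 by(simp add: local_degree_def germ_append)

lemma leading_coeff_append:
 assumes "set u <= I" "set v <= I" "y:Z"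
 shows "leading_coeff (u @ v) y = leading_coeff u (orbit v y) * leading_coeff v y^local_degree u (orbit v y)"
 using nth_subdegree_fps_compose[OF germ_nth_0] local_degree_append[OF assms] germ_append[OF assms]
 by(simp add: leading_coeff_def local_degree_def)

lemma multiplier_eq:
 assumes "set w <= I" "y:Z"
 shows "multiplier w y = (if local_degree w y = 1 then leading_coeff w y else 0)"
 using germ_nth_1[OF assms] local_degree_pos[OF assms] nth_less_subdegree_zero[of 1 "germ w y"]
 by(auto simp: leading_coeff_def local_degree_def)

definition log_affine :: "'g list => complex => real => real" where
 "log_affine w y l = real (local_degree w y) * l + ln (cmod (leading_coeff w y))"

lemma log_affine_append:
 assumes "set u <= I" "set v <= I" "y:Z"
 shows "log_affine (u @ v) y l = log_affine u (orbit v y) (log_affine v y l)"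
 using leading_coeff_nonzero[OF assms(2,3)] leading_coeff_nonzero[OF assms(1) orbit_in[OF assms(2,3)]]
 by(simp add: log_affine_def local_degree_append[OF assms] leading_coeff_append[OF assms] norm_mult norm_power
   ln_mult ln_realpow algebra_simps)

lemma log_affine_inj: "set w <= I ==> y:Z ==> log_affine w y l = log_affine w y m ==> l = m"
 using local_degree_pos[of w y] by(simp add: log_affine_def)

lemma log_affine_cong: "germ w y = germ w' y ==> log_affine w y = log_affine w' y"
 by(simp add: log_affine_def leading_coeff_def local_degree_def fun_eq_iff)

lemma log_affine_commute:
 assumes r: "r:loops p" "s:loops p" "p:Z" and Q: "local_degree r p * local_degree s p >= 2"
 shows "log_affine r p (log_affine s p l) = log_affine s p (log_affine r p l)"
proof -
 define Q x y where "Q = local_degree r p * local_degree s p" and "x = r @ s" and "y = s @ r"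
 have I: "set r <= I" "set s <= I" "orbit r p = p" "orbit s p = p" using r by(auto simp: loops_def)
 have Q_ge: "Q >= 2" using Q by(simp add: Q_def)
 have loops: "x:loops p" "y:loops p" using r by(auto simp: x_def y_def loops_append)
 have xy: "set x <= I" "set y <= I" "local_degree x p = Q" "local_degree y p = Q"
  using I r(3) by(auto simp: x_def y_def Q_def local_degree_append)
 obtain u v where uv: "!!z. z:Z ==> germ (word_subst x y (u @ [True])) z = germ (word_subst x y (v @ [False])) z"
  using relation_obtain[OF xy(1,2)] by metis
 have word: "set (word_subst x y w) <= I" "orbit (word_subst x y w) p = p" for w
  using loops_word_subst[OF loops] by(auto simp: loops_def)
 have "local_degree (word_subst x y w) p = Q^length w" for w
 proof(induction w)
  case (Cons t w)
  thus ?case using local_degree_append[of "if t then x else y" "word_subst x y w" p] word[of w] xy r(3) by simp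
 qed(simp add: local_degree_def germ_def)
 moreover have "inj (%n. Q^n)" using Q_ge by(intro injI) simp
 ultimately have len: "length (u @ [True]) = length (v @ [False])"
  using uv[OF r(3)] unfolding local_degree_def by(metis (mono_tags, lifting) injD)
 define theta where "theta = ln (cmod (leading_coeff x p)) - ln (cmod (leading_coeff y p))"
 have "theta = 0"
 proof(rule ccontr)
  assume "theta ~= 0"
  have "EX c. c ~= 0 & complex_of_real (log_affine (word_subst x y (u @ [True])) p 0 - log_affine (word_subst x y (v @ [False])) p 0) = c"
  proof(rule affine_differences_nonzero[where r = "of_nat Q" and theta = "of_real theta" and nu = 1 and u = "u @ [True]" and v = "v @ [False]"
     and \<Delta> = "%u v c. of_real (log_affine (word_subst x y u) p 0 - log_affine (word_subst x y v) p 0) = c"])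
   fix t t' w w' c
   assume IH: "of_real (log_affine (word_subst x y w) p 0 - log_affine (word_subst x y w') p 0) = (c :: complex)"
   have step: "log_affine (word_subst x y (t # w)) p 0
     = Q * log_affine (word_subst x y w) p 0 + ln (cmod (leading_coeff (if t then x else y) p))" for t w
    using log_affine_append[of "if t then x else y" "word_subst x y w" p 0] word[of w] xy r(3)
    by(simp add: log_affine_def[of x] log_affine_def[of y])
   show "of_real (log_affine (word_subst x y (t # w)) p 0 - log_affine (word_subst x y (t' # w')) p 0)
     = of_nat Q * c + of_real theta * 1^length w * (of_bool t - of_bool t')"
    unfolding step IH[symmetric] by(simp add: theta_def algebra_simps)
  qed(use Q_ge len `theta ~= 0` in auto)
  thus False using log_affine_cong[OF uv[OF r(3)]] by simp
 qed
 hence "log_affine x p l = log_affine y p l" by(simp add: log_affine_def xy theta_def)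
 thus ?thesis using I r(3) by(simp add: x_def y_def log_affine_append)
qed

lemma common_fixed_value:
 assumes p: "p:Z" and unit: "!!f. f:loops p ==> local_degree f p = 1 ==> ln (cmod (leading_coeff f p)) = 0"
 obtains theta where "!!f. f:loops p ==> log_affine f p theta = theta"
proof(cases "EX r:loops p. local_degree r p >= 2")
 case True
 then obtain r where r: "r:loops p" "local_degree r p >= 2" by blast
 define theta where "theta = ln (cmod (leading_coeff r p)) / (1 - real (local_degree r p))"
 have fixed_iff: "log_affine r p x = x \<longleftrightarrow> x = theta" for x using r(2) by(auto simp: log_affine_def theta_def field_simps)
 have "log_affine f p theta = theta" if f: "f:loops p" for f
 proof -
  have "local_degree f p >= 1" using local_degree_pos f p by(simp add: loops_def)
  hence "local_degree r p * local_degree f p >= 2 * 1" using r(2) by(intro mult_le_mono) auto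
  hence "log_affine r p (log_affine f p theta) = log_affine f p (log_affine r p theta)"
   using log_affine_commute[OF r(1) f p] by simp
  thus ?thesis using fixed_iff by metis
 qed
 thus thesis using that by blast
next
 case False
 have "log_affine f p 0 = 0" if f: "f:loops p" for f
 proof -
  have "local_degree f p >= 1" using local_degree_pos f p by(simp add: loops_def)
  hence "local_degree f p = 1" using False f by force
  thus ?thesis using unit[OF f] by(simp add: log_affine_def)
 qed
 thus thesis using that by blast
qed

lemma hyperbolic_loop_transfer:
 assumes P: "P:Z" and h: "h:loops P" "local_degree h P = 1" "ln (cmod (leading_coeff h P)) ~= 0"
  and p: "p:reach P" "!!z. z:reach p ==> p:reach z"
 obtains f where "f:loops p" "local_degree f p = 1" "ln (cmod (leading_coeff f p)) ~= 0"
proof(rule ccontr)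
 assume contra: "~ thesis"
 have pZ: "p:Z" using p(1) reach_subset[OF P] by blast
 note conclusion = that
 have "ln (cmod (leading_coeff f p)) = 0" if "f:loops p" "local_degree f p = 1" for f
  using contra conclusion that by blast
 then obtain theta where theta: "!!f. f:loops p ==> log_affine f p theta = theta" using common_fixed_value[OF pZ] by blast
 obtain g where g: "set g <= I" "orbit g P = p" using p(1) by(auto simp: reach_def)
 have hP: "set h <= I" "orbit h P = P" using h by(auto simp: loops_def)
 have xy: "set g <= I" "set (g @ h) <= I" using g hP by auto
 obtain u v where uv: "!!z. z:Z ==> orbit (word_subst g (g @ h) (u @ [True])) z = orbit (word_subst g (g @ h) (v @ [False])) z"
  "!!z. z:Z ==> germ (word_subst g (g @ h) (u @ [True])) z = germ (word_subst g (g @ h) (v @ [False])) z"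
  using relation_obtain[OF xy] by metis
 define U V where "U = word_subst g (g @ h) u" and "V = word_subst g (g @ h) v"
 have UV: "set U <= I" "set V <= I" unfolding U_def V_def using set_word_subst[OF xy] by auto
 have orbit_eq: "orbit V p = orbit U p" and germ_eq: "germ (U @ g) P = germ (V @ g @ h) P"
  using uv[OF P] g hP by(simp_all add: U_def V_def orbit_append)
 obtain rho where rho: "set rho <= I" "orbit rho (orbit U p) = p" using p(2)[OF reachI[OF UV(1)]] by(force simp: reach_def)
 have return: "rho @ U : loops p" "rho @ V : loops p" using rho UV orbit_eq by(auto simp: loops_def orbit_append)
 define l where "l = (theta - ln (cmod (leading_coeff g P))) / local_degree g P"
 have l: "log_affine g P l = theta" using local_degree_pos[OF g(1) P] by(simp add: l_def log_affine_def)
 have "germ ((rho @ U) @ g) P = germ ((rho @ V) @ g @ h) P"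
  using germ_append[OF rho(1), of "U @ g" P] germ_append[OF rho(1), of "V @ g @ h" P] UV g hP P germ_eq orbit_eq
  by(simp add: orbit_append)
 hence "log_affine ((rho @ U) @ g) P l = log_affine ((rho @ V) @ g @ h) P l" by(rule log_affine_cong[THEN fun_cong])
 hence "log_affine (rho @ U) p theta = log_affine (rho @ V) p (log_affine (g @ h) P l)"
  using log_affine_append[of "rho @ U" g P l] log_affine_append[of "rho @ V" "g @ h" P l] rho(1) UV g hP P l
  by(simp add: orbit_append)
 hence "log_affine (rho @ V) p (log_affine (g @ h) P l) = log_affine (rho @ V) p theta" using theta[OF return(1)] theta[OF return(2)] by simp
 hence "log_affine (g @ h) P l = theta" using log_affine_inj[of "rho @ V"] rho(1) UV(2) pZ by simp
 hence "log_affine g P (log_affine h P l) = log_affine g P l" using log_affine_append[OF g(1) hP(1) P] hP l by simp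
 hence "log_affine h P l = l" by(rule log_affine_inj[OF g(1) P])
 thus False using h(2,3) by(simp add: log_affine_def)
qed

lemma terminal_hyperbolic_point:
 assumes P: "P:Z" and h: "h:loops P" "cmod (multiplier h P) ~= 1" "multiplier h P ~= 0" "wdeg D h >= 2"
 obtains p f where "p:Z" "f:loops p" "wdeg D f >= 2" "cmod (multiplier f p) ~= 1"
  "!!z. z:reach p ==> p:reach z" "!!z w. z:reach p ==> set w <= I ==> multiplier w z ~= 0"
proof -
 have hP: "set h <= I" "orbit h P = P" using h by(auto simp: loops_def)
 obtain p where p: "p:reach P" "!!z. z:reach p ==> p:reach z" using terminal_exists[OF finite_Z P] by metis
 have pZ: "p:Z" using p(1) reach_subset[OF P] by blast
 have h1: "local_degree h P = 1" "leading_coeff h P = multiplier h P"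
  using multiplier_eq[OF hP(1) P] h(3) by(auto split: if_splits)
 obtain f where f: "f:loops p" "local_degree f p = 1" "ln (cmod (leading_coeff f p)) ~= 0"
  using hyperbolic_loop_transfer[OF P h(1) h1(1) _ p] h1(2) h(2,3) by(metis ln_eq_zero_iff zero_less_norm_iff)
 have degree_1: "local_degree s p = 1" if s: "s:loops p" for s
 proof(rule ccontr)
  assume "local_degree s p ~= 1"
  hence s2: "local_degree s p >= 2" using local_degree_pos[of s p] s pZ by(auto simp: loops_def)
  hence "log_affine f p (log_affine s p 0) = log_affine s p (log_affine f p 0)"
   using f(2) by(intro log_affine_commute[OF f(1) s pZ]) simp
  hence "(real (local_degree s p) - 1) * ln (cmod (leading_coeff f p)) = 0"
   by(simp add: log_affine_def f(2) algebra_simps)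
  thus False using f(3) s2 by simp
 qed
 have nonzero: "multiplier w z ~= 0" if z: "z:reach p" and w: "set w <= I" for w z
 proof -
  obtain v where v: "set v <= I" "orbit v p = z" using z by(auto simp: reach_def)
  have zZ: "z:Z" using z reach_subset[OF pZ] by blast
  have "orbit w z : reach p" using reach_trans[OF z] reachI[OF w] by blast
  then obtain rho where rho: "set rho <= I" "orbit rho (orbit w z) = p" using p(2) by(force simp: reach_def)
  have "rho @ w @ v : loops p" using rho v w by(auto simp: loops_def orbit_append)
  from degree_1[OF this] have "local_degree w z = 1" using v rho w pZ by(simp add: local_degree_append)
  thus ?thesis using multiplier_eq[OF w zZ] leading_coeff_nonzero[OF w zZ] by simp
 qed
 obtain rho where rho: "set rho <= I" "orbit rho (orbit h p) = p" using p(2)[OF reachI[OF hP(1)]] by(force simp: reach_def)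
 define s where "s = rho @ h"
 have s: "s:loops p" "wdeg D s >= 2" using rho hP h(4) wdeg_pos[OF rho(1)] mult_le_mono[of 1 "wdeg D rho" 2 "wdeg D h"]
  by(auto simp: s_def loops_def orbit_append)
 have "multiplier (s @ f) p = multiplier s p * multiplier f p" "wdeg D (s @ f) >= 2" "s @ f : loops p"
  using f(1) s wdeg_pos[of f] mult_le_mono[of 2 "wdeg D s" 1 "wdeg D f"] loops_append[OF s(1) f(1)]
  by(auto simp: multiplier_append loops_def)
 moreover have "cmod (multiplier f p) ~= 1" using multiplier_eq[of f p] f pZ by(auto simp: loops_def)
 ultimately have "EX f:loops p. wdeg D f >= 2 & cmod (multiplier f p) ~= 1" using s by(metis mult_1 norm_mult)
 thus thesis using that pZ p(2) nonzero by blast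
qed

end

section \<open>Orbits through a hyperbolic fixed point\<close>

definition poly_growth :: "('g list => 'g list => bool) => 'g set => bool" where
 "poly_growth E I \<longleftrightarrow> (EX C k::nat. ALL n. EX X. finite X & card X <= C * (n + 1)^k &
  (ALL w. set w <= I --> length w <= n --> (EX w':X. set w' <= I & E w w')))"

lemma poly_growth_mono:
 assumes "poly_growth E I" "!!w w'. set w <= I ==> set w' <= I ==> E w w' ==> E' w w'"
 shows "poly_growth E' I"
 using assms unfolding poly_growth_def by meson

lemma poly_growth_if_invariant:
 assumes complete: "!!w w'. set w <= I ==> set w' <= I ==> f w = f w' ==> E w w'"
  and bound: "!!n. finite (F n) & card (F n) <= C * (n + 1)^k"
  and range: "!!n w. set w <= I ==> length w <= n ==> f w : F n"
 shows "poly_growth E I"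
 unfolding poly_growth_def
proof(rule exI[of _ C], rule exI[of _ k], rule allI)
 fix n
 define W where "W = {w. set w <= I & length w <= n}"
 have subset: "f ` W <= F n" using range by(auto simp: W_def)
 hence finite: "finite (f ` W)" using bound finite_subset by blast
 have "card (inv_into W f ` f ` W) <= card (f ` W)" by(rule card_image_le[OF finite])
 also have "... <= C * (n + 1)^k" using card_mono[OF _ subset] bound order.trans by blast
 finally have "card (inv_into W f ` f ` W) <= C * (n + 1)^k" .
 moreover have "inv_into W f (f w) : W & E w (inv_into W f (f w))" if "w:W" for w
  using complete[of w "inv_into W f (f w)"] f_inv_into_f[of "f w" f W] inv_into_into[of "f w" f W] that
  by(auto simp: W_def)
 ultimately show "EX X. finite X & card X <= C * (n + 1)^k &
   (ALL w. set w <= I --> length w <= n --> (EX w':X. set w' <= I & E w w'))"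
  using finite by(intro exI[of _ "inv_into W f ` f ` W"]) (fastforce simp: W_def)
qed

lemma poly_growth_if_multiset_invariant:
 assumes finite: "finite Z" "finite S"
  and range: "!!w. set w <= I ==> f w : Z & set_mset (E w) <= S & size (E w) = length w"
  and complete: "!!w w'. set w <= I ==> set w' <= I ==> E w = E w' ==> f w = f w' ==> R w w'"
 shows "poly_growth R I"
proof(rule poly_growth_if_invariant)
 define F where "F n = Z \<times> (S \<rightarrow>\<^sub>E {..n})" for n :: nat
 show "finite (F n) & card (F n) <= card Z * (n + 1)^card S" for n
  using finite by(auto simp: F_def card_cartesian_product card_PiE intro!: finite_PiE)
 show "(f w, restrict (count (E w)) S) : F n" if "set w <= I" "length w <= n" for n w
 proof -
  have "count (E w) e <= n" for e using range[OF that(1)] that(2) count_le_size[of "E w" e] by simp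
  thus ?thesis using range[OF that(1)] by(auto simp: F_def)
 qed
 show "R w w'" if w: "set w <= I" "set w' <= I" and eq: "(f w, restrict (count (E w)) S) = (f w', restrict (count (E w')) S)" for w w'
 proof(rule complete[OF w])
  show "f w = f w'" using eq by simp
  show "E w = E w'"
  proof(rule multiset_eqI)
   fix e
   have "restrict (count (E w)) S e = restrict (count (E w')) S e" using eq by simp
   moreover have "e \<notin># E w" "e \<notin># E w'" if "e ~: S" using range[OF w(1)] range[OF w(2)] that by auto
   ultimately show "count (E w) e = count (E w') e" by(cases "e:S") (simp_all add: restrict_def not_in_iff)
  qed
 qed
qed

locale hyperbolic_system = relation_system D a b I Z A B
 for D :: "'g => nat" and a b :: "'g => nat => complex" and I Z A B +
 fixes y0 :: complex and h :: "'g list"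
 assumes y0: "y0:Z" and h: "h:loops y0" and wdeg_h: "wdeg D h >= 2" and hyperbolic: "cmod (multiplier h y0) ~= 1"
  and return: "!!z. z:reach y0 ==> y0:reach z"
  and multiplier_nonzero: "!!z w. z:reach y0 ==> set w <= I ==> multiplier w z ~= 0"
begin

lemma loop_simps: "w:loops y0 ==> set w <= I" "w:loops y0 ==> orbit w y0 = y0" by(auto simp: loops_def)

lemma fixed_series_exists: "EX x. x$0 = y0 & lift h x = x"
proof -
 define P Q F where "P = fst (act_poly D A B h)" and "Q = snd (act_poly D A B h)" and "F = [:0, 1:] * Q - P"
 define p q where "p = fst (act_poly D a b h)" and "q = snd (act_poly D a b h)"
 have "map_prod const_terms const_terms (act_poly D A B h) = act_poly D a b h"
  using map_act_poly[OF ring_hom_on_fps_nth_0 subring_UNIV, of h A B D] by(simp add: const_term)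
 hence "const_terms P = p" "const_terms Q = q" by(auto simp: P_def Q_def p_def q_def prod_eq_iff)
 hence F: "const_terms F = [:0, 1:] * q - p"
  by(intro poly_eqI) (auto simp: F_def coeff_map_poly coeff_pCons split: nat.splits)
 note mult = multiplier_act_poly[OF loop_simps(1)[OF h] y0 p_def q_def]
 have "poly (const_terms F) y0 = 0" using mult(1) loop_simps(2)[OF h] unfolding F by simp
 moreover have "poly (pderiv (const_terms F)) y0 = poly q y0 * (1 - multiplier h y0)"
  using mult(3) loop_simps(2)[OF h] unfolding F by(simp add: pderiv_diff pderiv_mult pderiv_pCons algebra_simps)
 moreover have "multiplier h y0 ~= 1" using hyperbolic by auto
 ultimately obtain x where x: "x$0 = y0" "poly F x = 0" using hensel[of F y0] mult(2) by auto
 have "poly P x = poly Q x * lift h x" "poly Q x ~= 0"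
  using act_lift[OF loop_simps(1)[OF h], of x] x(1) y0 by(auto simp: P_def Q_def poly_act_poly scale_def prod_eq_iff)
 hence "poly Q x * x = poly Q x * lift h x" using x(2) by(simp add: F_def mult.commute)
 thus ?thesis using x(1) `poly Q x ~= 0` by auto
qed

definition p :: "complex fps" where
 "p = (SOME x. x$0 = y0 & lift h x = x)"

lemma p_nth_0 [simp]: "p$0 = y0" and lift_h_p: "lift h p = p" using someI_ex[OF fixed_series_exists] by(auto simp: p_def)

definition h_power :: "nat => 'g list" where
 "h_power N = concat (replicate N h)"

lemma h_power:
 "h_power N : loops y0" "lift (h_power N) p = p" "multiplier (h_power N) y0 = multiplier h y0^N"
 "N >= 1 ==> wdeg D (h_power N) >= 2"
proof -
 have "h_power N : loops y0 & lift (h_power N) p = p & multiplier (h_power N) y0 = multiplier h y0^N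
   & wdeg D (h_power N) = wdeg D h^N"
  unfolding h_power_def
  by(induction N) (use h lift_h_p in \<open>auto simp: loops_def orbit_append lift_append multiplier_append\<close>)
 thus "h_power N : loops y0" "lift (h_power N) p = p" "multiplier (h_power N) y0 = multiplier h y0^N"
  "N >= 1 ==> wdeg D (h_power N) >= 2"
  using wdeg_h self_le_power[of "wdeg D h" N] by auto
qed

lemma exists_h_power:
 assumes "delta ~= 0"
 obtains N where "N >= 1" "cmod (multiplier (h_power N) y0 * delta) >= 2 | cmod (multiplier (h_power N) y0 * delta) <= 1/2"
 using exists_power_mult_far_from_unit[OF multiplier_nonzero[OF reach_self loop_simps(1)[OF h]] assms hyperbolic] h_power(3)
 by metis

text \<open>If two loops with the same multiplier \<open>r\<close> separated power series to order \<open>e\<close>, the words in them would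
 have distinct effects on \<open>x0\<close>, encoded by the digit expansions of the words in base \<open>r / nu\<close>.\<close>

lemma loops_not_separated:
 assumes x: "x:loops y0" and y: "y:loops y0" and deg: "wdeg D x = wdeg D y" "wdeg D x >= 2"
  and r: "multiplier x y0 = r" "multiplier y y0 = r" and "cmod (r / nu) >= 2 | cmod (r / nu) <= 1/2"
  and "theta ~= 0" "nu ~= 0" "e >= 1" and x0: "x0$0 = y0"
  and separated: "!!w. EX U. lift x (lift (word_subst x y w) x0) - lift y (lift (word_subst x y w) x0) = fps_X^e * U
   & U$0 = theta * nu^length w"
 shows False
proof -
 define z where "z w = lift (word_subst x y w) x0" for w
 have z: "z w $ 0 = y0" for w using loops_word_subst[OF x y] x0 by(simp add: z_def lift_nth_0 loops_def)
 have z_Cons: "z (s # w) = lift (if s then x else y) (z w)" for s w by(simp add: z_def lift_append)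
 obtain u v where uv: "length u = length v" "u ~= v" "z u = z v"
  using relation_equal_length[OF x y deg] x0 y0 unfolding z_def by metis
 obtain c where "c ~= 0" "EX k. z u = z v + fps_X^e * k & k$0 = c"
 proof(rule affine_differences_nonzero[where \<Delta> = "%u v c. EX k. z u = z v + fps_X^e * k & k$0 = c"
    and r = r and theta = theta and nu = nu and u = u and v = v])
  fix s t u v c assume len: "length u = length v" and "EX k. z u = z v + fps_X^e * k & k$0 = (c :: complex)"
  then obtain k where k: "z u = z v + fps_X^e * k" "k$0 = c" by blast
  have move: "EX k'. lift l (z u) = lift l (z v) + fps_X^e * k' & k'$0 = r * c" if "l:{x, y}" for l
   using lift_perturb[of l "z v" e k] loop_simps(1)[of l] that x y y0 z k r `e >= 1` by(metis empty_iff insert_iff)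
  obtain U where U: "lift x (z v) = lift y (z v) + fps_X^e * U" "U$0 = theta * nu^length u"
   using separated[of v] len unfolding z_def by(metis add_diff_cancel_left' diff_add_cancel add.commute)
  obtain k' where k': "lift (if s then x else y) (z u) = lift (if s then x else y) (z v) + fps_X^e * k'" "k'$0 = r * c"
   using move[of x] move[of y] by(cases s) auto
  have "z (s # u) = z (t # v) + fps_X^e * (k' + (of_bool s - of_bool t) * U)"
   unfolding z_Cons k'(1) using U(1) by(cases s; cases t) (auto simp: algebra_simps)
  moreover have "(k' + (of_bool s - of_bool t) * U) $ 0 = r * c + theta * nu^length u * (of_bool s - of_bool t)"
   using k'(2) U(2) by(cases s; cases t) auto
  ultimately show "EX k. z (s # u) = z (t # v) + fps_X^e * k & k$0 = r * c + theta * nu^length u * (of_bool s - of_bool t)"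
   by blast
 next
  show "r ~= 0" using multiplier_nonzero[OF reach_self loop_simps(1)[OF x]] r by simp
  show "EX k. z [] = z [] + fps_X^e * k & k$0 = 0" by(intro exI[of _ 0]) simp
 qed(use assms uv in auto)
 thus False using uv(3) by auto
qed

lemma loop_fixes:
 assumes f: "f:loops y0"
 shows "lift f p = p"
proof(rule ccontr)
 assume "lift f p ~= p"
 define e c where "e = subdegree (lift f p - p)" and "c = fps_shift e (lift f p - p)"
 have fp: "lift f p = p + fps_X^e * c"
  using fps_shift_times_fps_X_power[of e "lift f p - p"] by(simp add: e_def c_def mult.commute)
 have "c$0 = (lift f p - p) $ subdegree (lift f p - p)" by(simp only: c_def e_def fps_shift_nth add_0)
 hence c: "c$0 ~= 0" using `lift f p ~= p` nth_subdegree_nonzero[of "lift f p - p"] by simp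
 have e: "e >= 1" using arg_cong[OF fp, of "%f. f$0"] c loop_simps(2)[OF f] lift_nth_0[of f p] by(cases e) auto
 define delta where "delta = multiplier f y0"
 obtain N where N: "N >= 1" "cmod (multiplier (h_power N) y0 * delta) >= 2 | cmod (multiplier (h_power N) y0 * delta) <= 1/2"
  using exists_h_power[of delta] multiplier_nonzero[OF reach_self loop_simps(1)[OF f]] unfolding delta_def by metis
 define k r x y where "k = h_power N" and "r = multiplier k y0 * delta" and "x = k @ f" and "y = f @ k"
 have k: "k:loops y0" "lift k p = p" "wdeg D k >= 2" using h_power(1,2,4) N(1) by(auto simp: k_def)
 have perturb: "EX d'. lift l (p + fps_X^e * d) = lift l p + fps_X^e * d' & d'$0 = multiplier l y0 * d$0"
  if "l:loops y0" for l d
  using lift_perturb[OF loop_simps(1)[OF that], of p e d] e y0 by(metis p_nth_0)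
 have xy: "x:loops y0" "y:loops y0" using k f by(auto simp: x_def y_def loops_append)
 have r: "multiplier x y0 = r" "multiplier y y0 = r"
  using loop_simps(2)[OF f] loop_simps(2)[OF k(1)] by(auto simp: x_def y_def r_def delta_def multiplier_append)
 obtain d where d: "lift k (p + fps_X^e * c) = p + fps_X^e * d" "d$0 = multiplier k y0 * c$0"
  using perturb[OF k(1), of c] k(2) by auto
 have xp: "lift x p = p + fps_X^e * d" and yp: "lift y p = p + fps_X^e * c"
  by(simp_all add: x_def y_def lift_append fp d(1) k(2))
 have stay: "EX z'. lift l (p + fps_X^e * z) = p + fps_X^e * z'" if l: "l:loops y0" "lift l p = p + fps_X^e * t" for l t z
 proof -
  obtain z' where "lift l (p + fps_X^e * z) = lift l p + fps_X^e * z'" using perturb[OF l(1), of z] by blast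
  thus ?thesis using l(2) by(intro exI[of _ "t + z'"]) (simp add: algebra_simps)
 qed
 have near: "EX d. lift (word_subst x y w) p = p + fps_X^e * d" for w
 proof(induction w)
  case (Cons s w)
  then obtain d where "lift (word_subst x y w) p = p + fps_X^e * d" by blast
  thus ?case using stay[OF xy(1) xp, of d] stay[OF xy(2) yp, of d] by(cases s) (auto simp: lift_append)
 qed(auto intro: exI[of _ 0])
 have "cmod (multiplier k y0) ~= 1"
  using hyperbolic N(1) power_eq_1_iff[of "cmod (multiplier h y0)" N] by(auto simp: k_def h_power(3) norm_power)
 hence "(multiplier k y0 - 1) * c$0 ~= 0" using c by auto
 moreover have "EX U. lift x (lift (word_subst x y w) p) - lift y (lift (word_subst x y w) p) = fps_X^e * U
   & U$0 = (multiplier k y0 - 1) * c$0 * 1^length w" for w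
 proof -
  obtain z where z: "lift (word_subst x y w) p = p + fps_X^e * z" using near by blast
  obtain s where s: "lift x (p + fps_X^e * z) = lift x p + fps_X^e * s" "s$0 = r * z$0"
   using perturb[OF xy(1), of z] r(1) by auto
  obtain t where t: "lift y (p + fps_X^e * z) = lift y p + fps_X^e * t" "t$0 = r * z$0"
   using perturb[OF xy(2), of z] r(2) by auto
  show ?thesis unfolding z s(1) t(1) xp yp by(intro exI[of _ "d - c + (s - t)"]) (simp add: d(2) s(2) t(2) algebra_simps)
 qed
 ultimately show False
  using loops_not_separated[OF xy _ _ r, of 1 "(multiplier k y0 - 1) * c$0" e p] N(2) e k(3) wdeg_pos[OF loop_simps(1)[OF f]]
   mult_le_mono[of 2 "wdeg D k" 1 "wdeg D f"]
  by(simp add: x_def y_def r_def k_def)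
qed

lemma lift_p_eq_if_orbit_eq:
 assumes w: "set w <= I" "set w' <= I" and eq: "orbit w y0 = orbit w' y0"
 shows "lift w p = lift w' p"
proof -
 have reach: "orbit w y0 : reach y0" by(rule reachI[OF w(1)])
 obtain rho where rho: "set rho <= I" "orbit rho (orbit w y0) = y0" using return[OF reach] by(auto simp: reach_def)
 have "rho @ w : loops y0" "rho @ w' : loops y0" using w rho eq by(auto simp: loops_def orbit_append)
 hence "lift rho (lift w p) = lift rho (lift w' p)" using loop_fixes by(metis lift_append)
 thus ?thesis
  using lift_inj[OF rho(1), of "lift w' p" "lift w p"] orbit_in[OF w(2) y0] eq multiplier_nonzero[OF reach rho(1)]
  by(simp add: lift_nth_0)
qed

definition lifted_point :: "complex => complex fps" where
 "lifted_point z = lift (SOME w. set w <= I & orbit w y0 = z) p"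

lemma lift_p:
 assumes "set w <= I"
 shows "lift w p = lifted_point (orbit w y0)"
 using someI[of "\<lambda>v. set v <= I & orbit v y0 = orbit w y0" w] lift_p_eq_if_orbit_eq[OF assms] assms
 unfolding lifted_point_def by metis

fun edges :: "'g list => ('g * complex) multiset" where
 "edges [] = {#}"
| "edges (g # w) = add_mset (g, orbit w y0) (edges w)"

lemma lift_slope_edges: "set w <= I ==> lift_slope w p = (\<Prod>e\<in>#edges w. slope (fst e) (lifted_point (snd e)))"
 by(induction w) (auto simp: lift_p)

lemma wdeg_edges: "wdeg D w = (\<Prod>e\<in>#edges w. D (fst e))" by(induction w) auto

lemma contact_order:
 assumes w: "a':loops y0" "b':loops y0" and "~ proj_eq D A B a' b'"
 obtains k n theta where "theta ~= 0" "!!m z. m > n ==>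
  EX U. lift a' (p + fps_X^m * z) - lift b' (p + fps_X^m * z) = fps_X^(m * k + n) * U & U$0 = theta * (z$0)^k"
proof -
 define W K where "W = wedge (act_poly D A B a') (act_poly D A B b')"
  and "K = snd (act_poly D A B a') * snd (act_poly D A B b')"
 have "W ~= 0" using assms(3) by(simp add: W_def proj_eq_def)
 then obtain k \<Gamma> where \<Gamma>: "W = [:-p, 1:]^k * \<Gamma>" "~ [:-p, 1:] dvd \<Gamma>" using order_decomp by metis
 have root: "poly \<Gamma> p ~= 0" using \<Gamma>(2) by(simp add: poly_eq_0_iff_dvd)
 have eval: "inverse (poly K z) * poly W z = lift a' z - lift b' z" "poly K z $ 0 = poly (const_terms K) y0"
  "poly (const_terms K) y0 ~= 0" if "z$0 = y0" for z
 proof -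
  have I: "set a' <= I" "set b' <= I" "z$0 : Z" using w that y0 by(auto simp: loops_def)
  have "poly W z = poly K z * (lift a' z - lift b' z)"
   using wedge_act_lift[OF I] by(simp add: W_def K_def wedge_def poly_act_poly)
  moreover have K: "poly K z $ 0 ~= 0"
   using act_lift(2)[OF I(1,3)] act_lift(2)[OF I(2,3)] by(simp add: K_def poly_act_poly)
  ultimately show "inverse (poly K z) * poly W z = lift a' z - lift b' z" by(simp add: inverse_mult_eq_1 flip: mult.assoc)
  show "poly K z $ 0 = poly (const_terms K) y0" "poly (const_terms K) y0 ~= 0"
   using K that by(simp_all add: poly_fps_nth_0)
 qed
 define n s where "n = subdegree (poly \<Gamma> p)" and "s = fps_shift n (poly \<Gamma> p)"
 have s: "poly \<Gamma> p = fps_X^n * s" "s$0 ~= 0"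
  using fps_shift_times_fps_X_power[of n "poly \<Gamma> p"] root by(simp_all add: n_def s_def mult.commute)
 have "EX U. lift a' (p + fps_X^m * z) - lift b' (p + fps_X^m * z) = fps_X^(m * k + n) * U
   & U$0 = s$0 / poly (const_terms K) y0 * (z$0)^k" if m: "m > n" for m z
 proof -
  define x where "x = p + fps_X^m * z"
  have x: "x$0 = y0" using m by(simp add: x_def fps_power_zeroth)
  obtain j where j: "m = Suc (n + j)" using m less_iff_Suc_add[of n m] by auto
  obtain q where "poly \<Gamma> x - poly \<Gamma> p = (x - p) * q" using diff_dvd_poly_diff[of x p \<Gamma>] by(elim dvdE)
  hence "poly \<Gamma> x = fps_X^n * (s + fps_X * (fps_X^j * z * q))"
   using s(1) by(simp add: x_def j power_add algebra_simps)
  hence "poly W x = fps_X^(m * k + n) * (z^k * (s + fps_X * (fps_X^j * z * q)))"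
   by(simp add: \<Gamma>(1) x_def power_mult_distrib power_add mult_ac flip: power_mult)
  hence "lift a' x - lift b' x = fps_X^(m * k + n) * (inverse (poly K x) * (z^k * (s + fps_X * (fps_X^j * z * q))))"
   unfolding eval(1)[OF x, symmetric] by(simp add: mult.left_commute)
  moreover have "(inverse (poly K x) * (z^k * (s + fps_X * (fps_X^j * z * q)))) $ 0 = s$0 / poly (const_terms K) y0 * (z$0)^k"
   by(simp add: eval(2)[OF x] fps_power_zeroth divide_inverse)
  ultimately show ?thesis unfolding x_def by blast
 qed
 thus thesis using that[of "s$0 / poly (const_terms K) y0" n k] s(2) eval(3)[of p] by simp
qed

lemma proj_eq_if_same_slope:
 assumes loops: "a':loops y0" "b':loops y0" and deg: "wdeg D a' = wdeg D b'" "wdeg D a' >= 2"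
  and slope: "lift_slope a' p = lift_slope b' p" and size: "cmod (multiplier a' y0) >= 2 | cmod (multiplier a' y0) <= 1/2"
 shows "proj_eq D A B a' b'"
proof(rule ccontr)
 assume "~ proj_eq D A B a' b'"
 then obtain k n theta where theta: "theta ~= 0" and contact: "!!m z. m > n ==>
   EX U. lift a' (p + fps_X^m * z) - lift b' (p + fps_X^m * z) = fps_X^(m * k + n) * U & U$0 = theta * (z$0)^k"
  using contact_order[OF loops] by metis
 define r m where "r = multiplier a' y0" and "m = Suc n"
 have I: "set a' <= I" "set b' <= I" using loops by(auto simp: loops_def)
 have r: "multiplier a' y0 = r" "multiplier b' y0 = r"
  using arg_cong[OF slope, of "%f. f$0"] by(simp_all add: r_def lift_slope_nth_0)
 have r0: "r ~= 0" using multiplier_nonzero[OF reach_self I(1)] by(simp add: r_def)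
 have "2 * m <= m * k + n"
 proof(rule ccontr)
  assume less: "~ 2 * m <= m * k + n"
  obtain U where U: "lift a' (p + fps_X^m) - lift b' (p + fps_X^m) = fps_X^(m * k + n) * U" "U$0 = theta"
   using contact[of m 1] by(auto simp: m_def)
  have taylor: "(fps_X^m)^2 dvd lift l (p + fps_X^m) - lift l p - lift_slope l p * fps_X^m" if "set l <= I" for l
   using lift_taylor[OF that, of p "p + fps_X^m"] y0 by(simp add: m_def)
  have "lift a' (p + fps_X^m) - lift b' (p + fps_X^m) = (lift a' (p + fps_X^m) - lift a' p - lift_slope a' p * fps_X^m)
    - (lift b' (p + fps_X^m) - lift b' p - lift_slope b' p * fps_X^m)"
   using loops by(simp add: slope loop_fixes)
  hence "(fps_X^m)^2 dvd lift a' (p + fps_X^m) - lift b' (p + fps_X^m)" using taylor[OF I(1)] taylor[OF I(2)] by(metis dvd_diff)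
  hence "(fps_X^(m * k + n) * U) $ (m * k + n) = 0"
   using less unfolding U(1) by(simp add: fps_X_power_dvd_iff mult.commute flip: power_mult)
  thus False using U(2) theta by(simp add: fps_X_power_mult_nth)
 qed
 moreover have "m * k + n < 2 * m" if "k < 2" using that by(cases k) (auto simp: m_def less_Suc_eq)
 ultimately have k: "k >= 2" by force
 have near: "EX z. lift (word_subst a' b' w) (p + fps_X^m) = p + fps_X^m * z & z$0 = r^length w" for w
 proof(induction w)
  case (Cons s w)
  then obtain z where z: "lift (word_subst a' b' w) (p + fps_X^m) = p + fps_X^m * z" "z$0 = r^length w" by blast
  define l where "l = (if s then a' else b')"
  have l: "set l <= I" "lift l p = p" "multiplier l y0 = r" using loops I r by(auto simp: l_def loop_fixes)
  obtain z' where "lift l (p + fps_X^m * z) = p + fps_X^m * z'" "z'$0 = r * z$0"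
   using lift_perturb[OF l(1), of p m z] y0 l by(auto simp: m_def)
  thus ?case using z by(auto simp: lift_append l_def)
 qed(auto intro: exI[of _ 1])
 have "EX U. lift a' (lift (word_subst a' b' w) (p + fps_X^m)) - lift b' (lift (word_subst a' b' w) (p + fps_X^m)) = fps_X^(m * k + n) * U
   & U$0 = theta * (r^k)^length w" for w
  using near[of w] contact[of m] by(metis m_def lessI power_mult mult.commute)
 moreover have "cmod (r / r^k) >= 2 | cmod (r / r^k) <= 1/2"
 proof -
  obtain j where j: "k = Suc (Suc j)" using k by(metis Suc_le_D numeral_2_eq_2 Suc_le_mono)
  have norm: "cmod (r / r^k) = 1 / cmod r^Suc j" using r0 by(simp add: j norm_divide norm_power norm_mult)
  show ?thesis using size
  proof
   assume "cmod (multiplier a' y0) >= 2"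
   hence "2 <= cmod r^Suc j" using power_increasing[of 1 "Suc j" "cmod r"] by(simp add: r_def)
   thus ?thesis unfolding norm by(auto simp: divide_le_eq)
  next
   assume "cmod (multiplier a' y0) <= 1/2"
   hence "cmod r^Suc j <= 1/2" using power_decreasing[of 1 "Suc j" "cmod r"] by(simp add: r_def)
   moreover have "cmod r^Suc j > 0" using r0 by simp
   ultimately show ?thesis unfolding norm by(auto simp: le_divide_eq)
  qed
 qed
 ultimately show False
  using loops_not_separated[OF loops deg r, of "r^k" theta "m * k + n" "p + fps_X^m"] theta r0 k by(simp add: m_def)
qed

lemma proj_eq_if_edges_eq:
 assumes w: "set w <= I" "set w' <= I" and edges: "edges w = edges w'" and orbit: "orbit w y0 = orbit w' y0"
 shows "proj_eq D A B w w'"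
proof(rule proj_eq_if_lift_eq[OF w y0])
 fix x :: "complex fps" assume x: "x$0 = y0"
 have reach: "orbit w y0 : reach y0" by(rule reachI[OF w(1)])
 obtain rho where rho: "set rho <= I" "orbit rho (orbit w y0) = y0" using return[OF reach] by(auto simp: reach_def)
 have nonzero: "multiplier (rho @ w) y0 ~= 0" using multiplier_nonzero[OF reach_self, of "rho @ w"] rho w by simp
 obtain N where N: "N >= 1" "cmod (multiplier (h_power N) y0 * multiplier (rho @ w) y0) >= 2
   | cmod (multiplier (h_power N) y0 * multiplier (rho @ w) y0) <= 1/2"
  using exists_h_power[OF nonzero] by metis
 define sig where "sig = h_power N @ rho"
 have sig: "set sig <= I" "orbit sig (orbit w y0) = y0" "wdeg D sig >= 2"
  using loop_simps[OF h_power(1)[of N]] rho h_power(4)[OF N(1)] wdeg_pos[OF rho(1)] mult_le_mono[of 2 "wdeg D (h_power N)" 1 "wdeg D rho"]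
  by(auto simp: sig_def orbit_append)
 have loops: "sig @ w : loops y0" "sig @ w' : loops y0" using w sig orbit by(auto simp: loops_def orbit_append)
 have "proj_eq D A B (sig @ w) (sig @ w')"
 proof(rule proj_eq_if_same_slope[OF loops])
  show "wdeg D (sig @ w) = wdeg D (sig @ w')" using edges by(simp add: wdeg_edges[of w] wdeg_edges[of w'])
  show "wdeg D (sig @ w) >= 2" using mult_le_mono[OF sig(3) wdeg_pos[OF w(1)]] by simp
  show "lift_slope (sig @ w) p = lift_slope (sig @ w') p"
   using w edges by(simp add: lift_slope_append lift_p_eq_if_orbit_eq[OF w orbit] lift_slope_edges)
  have "multiplier (sig @ w) y0 = multiplier (h_power N) y0 * multiplier (rho @ w) y0"
   using rho(2) by(simp add: sig_def multiplier_append orbit_append)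
  thus "cmod (multiplier (sig @ w) y0) >= 2 | cmod (multiplier (sig @ w) y0) <= 1/2" using N(2) by simp
 qed
 hence "lift sig (lift w x) = lift sig (lift w' x)"
  using lift_eq_if_proj_eq[of "sig @ w" "sig @ w'" x] loops x y0 by(simp add: loops_def lift_append)
 thus "lift w x = lift w' x"
  using lift_inj[OF sig(1), of "lift w' x" "lift w x"] orbit_in[OF w(2) y0] orbit x multiplier_nonzero[OF reach sig(1)]
  by(simp add: lift_nth_0)
qed

lemma poly_growth_proj_eq: "poly_growth (proj_eq D A B) I"
proof(rule poly_growth_if_multiset_invariant[where f = "%w. orbit w y0" and E = edges])
 show "finite Z" "finite (I \<times> Z)" using finite_I finite_Z by auto
 show "orbit w y0 : Z & set_mset (edges w) <= I \<times> Z & size (edges w) = length w" if w: "set w <= I" for w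
 proof -
  have "set_mset (edges w) <= I \<times> Z & size (edges w) = length w" using w by(induction w) (auto simp: orbit_in y0)
  thus ?thesis using orbit_in[OF w y0] by simp
 qed
qed(rule proj_eq_if_edges_eq)

end

theorem (in relation_system) poly_growth_if_hyperbolic:
 assumes "P:Z" "h:loops P" "cmod (multiplier h P) ~= 1" "multiplier h P ~= 0" "wdeg D h >= 2"
 shows "poly_growth (proj_eq D A B) I"
proof -
 obtain p f where "p:Z" "f:loops p" "wdeg D f >= 2" "cmod (multiplier f p) ~= 1"
  "!!z. z:reach p ==> p:reach z" "!!z w. z:reach p ==> set w <= I ==> multiplier w z ~= 0"
  using terminal_hyperbolic_point[OF assms] by metis
 then interpret hyperbolic_system D a b I Z A B p f by unfold_locales
 show ?thesis by(rule poly_growth_proj_eq)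
qed

section \<open>Degree at least two\<close>

lemma (in fps_chart) loop_of_repelling_fixed:
 assumes w: "set w <= I" and repelling: "repelling_fixed (act D a b w) Y" and Y: "snd Y ~= 0" "chart Y : Z"
 shows "w:loops (chart Y)" "cmod (multiplier w (chart Y)) > 1"
proof -
 define y k e P Q where "y = chart Y" and "k = snd Y" and "e = wdeg D w"
  and "P = fst (act_poly D a b w)" and "Q = snd (act_poly D a b w)"
 have Y_eq: "Y = scale k (y,1)" and k: "k ~= 0" using scale_snd_chart[OF Y(1)] Y(1) by(simp_all add: k_def y_def)
 have F: "act D a b w (scale k (z,1)) = scale (k^e) (poly P z, poly Q z)" for z
  by(simp add: act_scale e_def P_def Q_def poly_act_poly)
 obtain mu l where mu: "act D a b w Y = scale mu Y" "cmod l > 1"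
  and deriv: "!!E. ((%z. wedge (act D a b w (Y + scale z E)) Y) has_field_derivative l * mu * wedge E Y) (at 0)"
  using repelling unfolding repelling_fixed_def by blast
 have fixed: "k^e * poly P y = mu * k * y" "k^e * poly Q y = mu * k"
  using mu(1) unfolding Y_eq F by(simp_all add: scale_def)
 note mult = multiplier_act_poly[OF w Y(2)[folded y_def] P_def Q_def]
 have "(k^e * poly Q y) * orbit w y = k^e * poly P y" by(simp add: mult(1))
 also have "... = (k^e * poly Q y) * y" by(simp only: fixed)
 finally have "(k^e * poly Q y) * orbit w y = (k^e * poly Q y) * y" .
 hence orbit: "orbit w y = y" using mult(2) k by simp
 thus "w:loops (chart Y)" using w by(simp add: loops_def y_def)
 have "Y + scale z (k,0) = scale k (y + z,1)" for z unfolding Y_eq by(simp add: scale_def algebra_simps)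
 hence "wedge (act D a b w (Y + scale z (k,0))) Y = k^e * k * (poly P (y + z) - poly Q (y + z) * y)" for z
  by(simp add: F) (simp add: Y_eq wedge_def scale_def algebra_simps)
 moreover have "((%z. k^e * k * (poly P (y + z) - poly Q (y + z) * y)) has_field_derivative
   k^e * k * (poly (pderiv P) y - poly (pderiv Q) y * y)) (at 0)"
  by(auto intro!: derivative_eq_intros DERIV_chain2[OF poly_DERIV])
 ultimately have "k^e * k * (poly (pderiv P) y - poly (pderiv Q) y * y) = l * mu * wedge (k,0) Y"
  using DERIV_unique[OF _ deriv[of "(k,0)"]] by simp
 also have "... = (k^e * poly Q y) * k * l" unfolding fixed(2) by(simp add: Y_eq wedge_def scale_def)
 finally have "(k^e * poly Q y * k) * multiplier w y = (k^e * poly Q y * k) * l"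
  using mult(3) orbit by(simp add: algebra_simps)
 hence "multiplier w y = l" using mult(2) k by simp
 thus "cmod (multiplier w (chart Y)) > 1" using mu(2) by(simp add: y_def)
qed

lemma poly_growth_if_finite_affine_orbit:
 fixes A B :: "'g => nat => complex fps"
 assumes const: "!!g i. A g i $ 0 = a g i" "!!g i. B g i $ 0 = b g i" and sys: "hmap_system D a b I" and fin: "finite I"
  and rel: "!!x y. set x <= I ==> set y <= I
   ==> EX u v. proj_eq D A B (word_subst x y (u @ [True])) (word_subst x y (v @ [False]))"
  and h: "set h <= I" "wdeg D h >= 2" "repelling_fixed (act D a b h) X" and c: "c ~= 0"
  and orbit: "finite {act D a b w (scale c X) |w. set w <= I}" "!!w. set w <= I ==> snd (act D a b w (scale c X)) ~= 0"
 shows "poly_growth (proj_eq D A B) I"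
proof -
 define Z where "Z = {chart (act D a b w (scale c X)) |w. set w <= I}"
 have step: "poly (dehom (D g) (b g)) y ~= 0 & poly (dehom (D g) (a g)) y / poly (dehom (D g) (b g)) y : Z"
  if g: "g:I" and "y:Z" for g y
 proof -
  obtain w where w: "set w <= I" "y = chart (act D a b w (scale c X))" using `y : Z` by(auto simp: Z_def)
  have "act D a b (g # w) (scale c X) = hmap (D g) (a g) (b g) (act D a b w (scale c X))" by simp
  moreover have gw: "set (g # w) <= I" using g w(1) by simp
  moreover have "chart (act D a b (g # w) (scale c X)) : Z" unfolding Z_def using gw by blast
  ultimately show ?thesis using chart_hmap[OF orbit(2)[OF w(1)], of "D g" "a g" "b g"] orbit(2)[OF gw] w(2) by simp
 qed
 interpret hmap_system D a b I by(rule sys)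
 have "Z = chart ` {act D a b w (scale c X) |w. set w <= I}" by(auto simp: Z_def)
 hence "finite Z" using orbit(1) by simp
 interpret fps_chart D a b I Z A B by unfold_locales (use step in blast, use step in blast, rule const, rule const)
 interpret relation_system D a b I Z A B by unfold_locales (rule fin, rule `finite Z`, erule (1) rel)
 have "snd X ~= 0" "chart X : Z" using orbit(2)[of "[]"] c by(auto simp: Z_def chart_def scale_def intro!: exI[of _ "[]"])
 thus ?thesis using poly_growth_if_hyperbolic[of "chart X" h] loop_of_repelling_fixed[OF h(1,3)] h(2) by fastforce
qed

lemma conj_coefficients:
 fixes a b :: "'g => nat => 'r::{idom,ring_char_0}"
 assumes det: "p * s - q * r = 1"
 obtains a' b' where "!!w X. act D a' b' w X = lin p q r s (act D a b w (lin s (-q) (-r) p X))"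
  "!!w w'. proj_eq D a' b' w w' \<longleftrightarrow> proj_eq D a b w w'"
proof -
 have "EX a' b'. ALL X. lin p q r s (hmap (D g) (a g) (b g) (lin s (-q) (-r) p X)) = hmap (D g) a' b' X" for g
  using hmap_conj[of p q r s "D g" "a g" "b g" s "-q" "-r" p] by metis
 then obtain a' b' where conj: "!!g X. hmap (D g) (a' g) (b' g) X = lin p q r s (hmap (D g) (a g) (b g) (lin s (-q) (-r) p X))"
  by metis
 hence conj': "hmap (D g) (a g) (b g) X = lin s (-q) (-r) p (hmap (D g) (a' g) (b' g) (lin p (-(-q)) (-(-r)) s X))" for g X
  by(simp add: lin_inverse[OF det])
 have det': "s * p - (-q) * (-r) = 1" using det by(simp add: algebra_simps)
 show thesis
 proof(rule that)
  show "act D a' b' w X = lin p q r s (act D a b w (lin s (-q) (-r) p X))" for w X by(rule act_conj[OF conj det])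
  show "proj_eq D a' b' w w' \<longleftrightarrow> proj_eq D a b w w'" for w w'
   using proj_eq_conj[of w w' D a' b' p q r s a b, OF conj det] proj_eq_conj[of w w' D a b s "-q" "-r" p a' b', OF conj' det'] by blast
 qed
qed

lemma poly_growth_if_finite_orbit:
 fixes A B :: "'g => nat => complex fps"
 assumes const: "!!g i. A g i $ 0 = a g i" "!!g i. B g i $ 0 = b g i" and sys: "hmap_system D a b I" and fin: "finite I"
  and rel: "!!x y. set x <= I ==> set y <= I
   ==> EX u v. proj_eq D A B (word_subst x y (u @ [True])) (word_subst x y (v @ [False]))"
  and h: "set h <= I" "wdeg D h >= 2" "repelling_fixed (act D a b h) X" and c: "c ~= 0"
  and orbit: "finite {act D a b w (scale c X) |w. set w <= I}"
 shows "poly_growth (proj_eq D A B) I"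
proof -
 interpret hmap_system D a b I by(rule sys)
 have X: "scale c X ~= (0,0)" using h(3) c by(auto simp: repelling_fixed_def scale_eq_0_iff)
 have "infinite (range (of_nat :: nat => complex))" by(rule range_inj_infinite) (rule inj_of_nat)
 moreover have "finite ((\<lambda>v. - fst v / snd v) ` {act D a b w (scale c X) |w. set w <= I})" by(rule finite_imageI[OF orbit])
 ultimately have "~ range (of_nat :: nat => complex) <= (\<lambda>v. - fst v / snd v) ` {act D a b w (scale c X) |w. set w <= I}"
  using finite_subset by blast
 then obtain m :: nat where m: "of_nat m ~: (\<lambda>v. - fst v / snd v) ` {act D a b w (scale c X) |w. set w <= I}" by blast
 define M N where "M = (of_nat m :: complex)" and "N = (of_nat m :: complex fps)"
 have finite_point: "fst (act D a b w (scale c X)) + M * snd (act D a b w (scale c X)) ~= 0" if w: "set w <= I" for w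
 proof(cases "snd (act D a b w (scale c X)) = 0")
  case True
  thus ?thesis using act_nonzero[OF w X] by(auto simp: prod_eq_iff)
 next
  case False
  have "M ~= - fst (act D a b w (scale c X)) / snd (act D a b w (scale c X))" using m w by(auto simp: M_def)
  thus ?thesis using False by(auto simp: field_simps add_eq_0_iff)
 qed
 have det: "0 * N - (-1) * 1 = (1 :: complex fps)" "0 * M - (-1) * 1 = (1 :: complex)" by auto
 note inverse = lin_inverse[OF det(2), simplified]
 obtain A' B' where conj: "!!w X. act D A' B' w X = lin 0 (-1) 1 N (act D A B w (lin N 1 (-1) 0 X))"
  and proj_eq: "!!w w'. proj_eq D A' B' w w' \<longleftrightarrow> proj_eq D A B w w'"
  using conj_coefficients[OF det(1), of D A B] by auto
 define a' b' where "a' g i = A' g i $ 0" and "b' g i = B' g i $ 0" for g i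
 let ?nth_0 = "map_prod (%f :: complex fps. f$0) (%f. f$0)"
 have nth_0_act: "?nth_0 (act D C E w Y) = act D (%g i. C g i $ 0) (%g i. E g i $ 0) w (?nth_0 Y)"
  for C E :: "'g => nat => complex fps" and w Y
  using ring_hom_on_act(1)[OF ring_hom_on_fps_nth_0 subring_UNIV] by simp
 have act_conj_0: "act D a' b' w Y = lin 0 (-1) 1 M (act D a b w (lin M 1 (-1) 0 Y))" for w Y
 proof -
  have lin: "?nth_0 (lin p q r s Z) = lin (p$0) (q$0) (r$0) (s$0) (?nth_0 Z)" for p q r s Z by(simp add: lin_def)
  have "act D a' b' w Y = ?nth_0 (act D A' B' w (map_prod fps_const fps_const Y))"
   unfolding nth_0_act by(simp add: a'_def[abs_def] b'_def[abs_def] prod.map_comp comp_def)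
  also have "... = ?nth_0 (lin 0 (-1) 1 N (act D A B w (lin N 1 (-1) 0 (map_prod fps_const fps_const Y))))"
   unfolding conj ..
  also have "... = lin 0 (-1) 1 M (act D a b w (lin M 1 (-1) 0 Y))"
   unfolding lin nth_0_act by(simp add: const N_def M_def prod.map_comp comp_def flip: fps_of_nat)
  finally show ?thesis .
 qed
 have "hmap_system D a' b' I"
 proof
  show "nondegenerate (D g) (a' g) (b' g)" if "g:I" for g
   using nondegenerate_conj[OF _ det(2) nondegenerate[OF that]] act_conj_0[of "[g]"] by simp
 qed(rule degree_pos)
 moreover have "repelling_fixed (act D a' b' h) (lin 0 (-1) 1 M X)"
  using repelling_fixed_conj[of M 1 "-1" 0 "act D a' b' h" X] h(3) by(simp add: act_conj_0 inverse)
 moreover have "act D a' b' w (scale c (lin 0 (-1) 1 M X)) = lin 0 (-1) 1 M (act D a b w (scale c X))" for w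
  by(simp add: act_conj_0 inverse flip: lin_scale)
 moreover have "finite {lin 0 (-1) 1 M (act D a b w (scale c X)) |w. set w <= I}"
  using finite_imageI[OF orbit, of "lin 0 (-1) 1 M"] by(rule rev_finite_subset) auto
 moreover have "snd (lin 0 (-1) 1 M v) = fst v + M * snd v" for v by(simp add: lin_def)
 moreover have "proj_eq D A' B' = proj_eq D A B" using proj_eq by(intro ext) simp
 ultimately show ?thesis
  using poly_growth_if_finite_affine_orbit[of A' a' B' b' D I h "lin 0 (-1) 1 M X" c] fin rel h(1,2) c finite_point
  by(simp add: a'_def b'_def proj_eq)
qed

lemma specializable_system:
 assumes sys: "hmap_system D a b I" and fin: "finite I"
  and vanish: "!!g i. g:I ==> i > D g ==> a g i = 0 & b g i = 0"
 obtains L where "finite L" "!!K A phi. L <= A ==> fps_specialization K A phi ==>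
  (ALL g:I. ALL i. a g i : A & b g i : A) & (ALL g:I. nondegenerate_over K (D g) (%i. phi (a g i) $ 0) (%i. phi (b g i) $ 0))"
proof -
 have "ALL g:I. EX L. finite L & (ALL A. subring A --> L <= A --> nondegenerate_over A (D g) (a g) (b g))"
  using nondegenerate_over_if_nondegenerate[OF hmap_system.nondegenerate[OF sys]] by metis
 then obtain L where L: "!!g. g:I ==> finite (L g)"
  "!!g A. g:I ==> subring A ==> L g <= A ==> nondegenerate_over A (D g) (a g) (b g)"
  by metis
 show thesis
 proof(rule that[of "\<Union>g\<in>I. L g Un a g ` {..D g} Un b g ` {..D g}"])
  fix K A phi assume L_A: "(\<Union>g\<in>I. L g Un a g ` {..D g} Un b g ` {..D g}) <= A" and spec: "fps_specialization K A phi"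
  note A = fps_specializationD(2)[OF spec]
  have coeffs: "a g i : A" "b g i : A" if "g:I" for g i
   using L_A vanish[OF that, of i] subring_zero[OF A] that by(cases "i <= D g"; force)+
  moreover have "nondegenerate_over K (D g) (%i. phi (a g i) $ 0) (%i. phi (b g i) $ 0)" if g: "g:I" for g
  proof -
   have "nondegenerate_over A (D g) (a g) (b g)" using L(2)[OF g A] L_A g by blast
   thus ?thesis unfolding nondegenerate_over_def
    using bezout_over_map[OF fps_specializationD(7)[OF spec] A] coeffs[OF g] fps_specializationD(6)[OF spec] by simp
  qed
  ultimately show "(ALL g:I. ALL i. a g i : A & b g i : A)
    & (ALL g:I. nondegenerate_over K (D g) (%i. phi (a g i) $ 0) (%i. phi (b g i) $ 0))" by blast
 qed(use fin L(1) in auto)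
qed

lemma poly_growth_degree_ge_2_normalised:
 fixes D :: "'g => nat" and a b :: "'g => nat => complex"
 assumes sys: "hmap_system D a b I" and fin: "finite I"
  and vanish: "!!g i. g:I ==> i > D g ==> a g i = 0 & b g i = 0"
  and normalised: "!!g. g:I ==> resultant_one (hmap (D g) (a g) (b g)) (D g)" and g0: "g0:I" "D g0 >= 2"
  and rel: "!!x y. set x <= I ==> set y <= I
   ==> EX u v. proj_eq D a b (word_subst x y (u @ [True])) (word_subst x y (v @ [False]))"
 shows "poly_growth (proj_eq D a b) I"
proof -
 interpret S: hmap_system D a b I by(rule sys)
 obtain L where "finite L" and L: "!!K A phi. L <= A ==> fps_specialization K A phi ==>
   (ALL g:I. ALL i. a g i : A & b g i : A) & (ALL g:I. nondegenerate_over K (D g) (%i. phi (a g i) $ 0) (%i. phi (b g i) $ 0))"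
  using specializable_system[OF sys fin vanish] by metis
 then obtain K A phi where "L <= A" and spec: "fps_specialization K A phi" using fps_specialization_exists by metis
 note spec_simps = fps_specializationD[OF spec]
 have coeffs: "a g i : A & b g i : A" if "g:I" for g i using L[OF `L <= A` spec] that by blast
 define a' b' where "a' g i = phi (a g i) $ 0" and "b' g i = phi (b g i) $ 0" for g i
 have nondeg: "nondegenerate_over K (D g) (a' g) (b' g)" if "g:I" for g
  using L[OF `L <= A` spec] that by(simp add: a'_def[abs_def] b'_def[abs_def])
 have sys': "hmap_system D a' b' I"
  by unfold_locales (use nondegenerate_over_imp_nondegenerate[OF nondeg] S.degree_pos in auto)
 obtain k X where k: "k >= 1" "repelling_fixed (hmap (D g0) (a' g0) (b' g0)^^k) X"
  using repelling_periodic_point[OF g0(2) hmap_system.nondegenerate[OF sys' g0(1)]] by metis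
 define h where "h = replicate k g0"
 have h: "set h <= I" "wdeg D h >= 2" using g0 k(1) self_le_power[of "D g0" k] by(auto simp: h_def wdeg_replicate)
 have "act D a' b' h = hmap (D g0) (a' g0) (b' g0)^^k" by(intro ext) (simp add: h_def act_replicate)
 hence repelling: "repelling_fixed (act D a' b' h) X" using k(2) by simp
 then obtain mu where mu: "X ~= (0,0)" "act D a' b' h X = scale mu X" "mu ~= 0" unfolding repelling_fixed_def by blast
 have unity: "EX u v eps m. m > (0::nat) & eps^m = 1 & wdeg D (word_subst x y u @ x) = wdeg D (word_subst x y v @ y)
   & (ALL X. act D a' b' (word_subst x y u @ x) X = scale eps (act D a' b' (word_subst x y v @ y) X))"
  if xy: "set x <= I" "set y <= I" for x y
 proof -
  obtain u v where uv: "proj_eq D a b (word_subst x y u @ x) (word_subst x y v @ y)" using rel[OF xy] by auto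
  have subset: "set (word_subst x y u @ x) <= I" "set (word_subst x y v @ y) <= I" using set_word_subst[OF xy] xy by auto
  have "wdeg D (word_subst x y u @ x) = wdeg D (word_subst x y v @ y)" using uv S.proj_eq_iff_scale[OF subset] by simp
  thus ?thesis
   using S.proj_eq_specialize_root_of_unity[OF normalised subset(2,1) proj_eq_sym[OF uv] spec_simps(7,2) coeffs
     sys'[unfolded a'_def[abs_def] b'_def[abs_def]]]
   unfolding a'_def[abs_def] b'_def[abs_def] by metis
 qed
 have "a' g i : K & b' g i : K" if "g:I" for g i using coeffs[OF that] spec_simps(6) by(simp add: a'_def b'_def)
 then obtain c where c: "c ~= 0" "finite {act D a' b' w (scale c X) |w. set w <= I}"
  using finite_orbit[OF sys' fin spec_simps(1) _ nondeg h mu unity] by blast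
 have eq: "proj_eq D (%g i. phi (a g i)) (%g i. phi (b g i)) w w' \<longleftrightarrow> proj_eq D a b w w'"
  if "set w <= I" "set w' <= I" for w w'
  using proj_eq_map[OF spec_simps(4,2), of w w' a b D] coeffs spec_simps(5) that by blast
 have "poly_growth (proj_eq D (%g i. phi (a g i)) (%g i. phi (b g i))) I"
 proof(rule poly_growth_if_finite_orbit[OF _ _ sys' fin _ h repelling c])
  fix x y assume xy: "set x <= I" "set y <= I"
  show "EX u v. proj_eq D (%g i. phi (a g i)) (%g i. phi (b g i)) (word_subst x y (u @ [True])) (word_subst x y (v @ [False]))"
   using rel[OF xy] eq[OF set_word_subst[OF xy] set_word_subst[OF xy]] by blast
 qed(simp_all add: a'_def b'_def)
 thus ?thesis by(rule poly_growth_mono) (use eq in blast)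
qed

theorem poly_growth_degree_ge_2:
 fixes D :: "'g => nat" and a b :: "'g => nat => complex"
 assumes sys: "hmap_system D a b I" and fin: "finite I"
  and vanish: "!!g i. g:I ==> i > D g ==> a g i = 0 & b g i = 0" and g0: "g0:I" "D g0 >= 2"
  and rel: "!!x y. set x <= I ==> set y <= I
   ==> EX u v. proj_eq D a b (word_subst x y (u @ [True])) (word_subst x y (v @ [False]))"
 shows "poly_growth (proj_eq D a b) I"
proof -
 interpret S: hmap_system D a b I by(rule sys)
 have "ALL g:I. EX c. c ~= 0 & resultant_one (hmap (D g) (%i. c * a g i) (%i. c * b g i)) (D g)"
  using resultant_one_normalise[OF S.nondegenerate] S.degree_pos by(metis less_eq_Suc_le One_nat_def)
 then obtain c where c: "!!g. g:I ==> c g ~= 0"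
  "!!g. g:I ==> resultant_one (hmap (D g) (%i. c g * a g i) (%i. c g * b g i)) (D g)"
  by metis
 have eq: "proj_eq D (%g i. c g * a g i) (%g i. c g * b g i) w w' \<longleftrightarrow> proj_eq D a b w w'" if "set w <= I" "set w' <= I" for w w'
  using proj_eq_rescale[of w w' c D a b] c(1) that by auto
 have sys': "hmap_system D (%g i. c g * a g i) (%g i. c g * b g i) I" using S.nondegenerate S.degree_pos c(1)
  by unfold_locales (auto simp: nondegenerate_def scale_hmap scale_eq_0_iff)
 have rel': "EX u v. proj_eq D (%g i. c g * a g i) (%g i. c g * b g i) (word_subst x y (u @ [True])) (word_subst x y (v @ [False]))"
  if xy: "set x <= I" "set y <= I" for x y
  using rel[OF xy] eq[OF set_word_subst[OF xy] set_word_subst[OF xy]] by blast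
 have "poly_growth (proj_eq D (%g i. c g * a g i) (%g i. c g * b g i)) I"
  by(rule poly_growth_degree_ge_2_normalised[OF sys' fin _ _ g0 rel']) (use vanish c(2) in auto)
 thus ?thesis by(rule poly_growth_mono) (use eq in blast)
qed

section \<open>Degree one\<close>

lemma (in place) minus_le:
 assumes "x <~ y" "x:K" "y:K"
 shows "- x <~ y"
proof -
 have "- 1 <~ 1" using root_of_unity_bounds[of "- 1" 2] by auto
 thus ?thesis using mult_le[of "- 1" 1 x y] assms by auto
qed

lemma (in place) le_if_not_le_n_power:
 assumes "~ y <~ n^k * x" "x:K" "y:K"
 shows "x <~ y"
proof -
 have "n^k * x <~ y" using total[of "n^k * x" y] assms by auto
 moreover have "x <~ n^k * x" using le_n_power_mono[of x 0 x k] assms by simp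
 ultimately show ?thesis using trans[of x "n^k * x" y] assms by simp
qed

lemma (in place) dominated_sum:
 assumes K: "c:K" "d:K" "X:K" "S:K" and bounds: "c <~ n" "d <~ n" "inverse d <~ n" "d ~= 0"
  and small: "~ S <~ n^4 * X"
 shows "S <~ n^2 * (c * X + d * S)" "c * X + d * S <~ n^2 * S"
proof -
 define Q where "Q = c * X + d * S"
 have Q: "Q:K" using K by(simp add: Q_def)
 have cX: "c * X <~ n * X" "c * X : K" using K bounds by(auto intro: mult_le)
 have "inverse d * (d * S) <~ n * (d * S)" using K bounds inverse_closed by(intro mult_le) auto
 hence S: "S <~ n * (d * S)" using bounds(4) by(simp flip: mult.assoc)
 have "~ Q <~ c * X"
 proof
  assume "Q <~ c * X"
  hence "Q + (- (c * X)) <~ n * (c * X)" using Q cX(2) minus_le by(intro add_le) auto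
  hence dS: "d * S <~ n * (c * X)" by(simp add: Q_def)
  have "n * (c * X) <~ n * (n * X)" using cX K by(intro mult_le[OF refl]) auto
  hence "d * S <~ n * (n * X)" using trans[OF dS] cX K by simp
  hence "n * (d * S) <~ n * (n * (n * X))" using K by(intro mult_le[OF refl]) auto
  hence "S <~ n^3 * X" using trans[OF S] K by(simp add: power3_eq_cube mult.assoc)
  thus False using small le_n_power_mono[of S 3 X 4] K by simp
 qed
 hence "c * X <~ Q" using total Q cX(2) by blast
 hence "Q + (- (c * X)) <~ n * Q" using Q cX(2) minus_le by(intro add_le) auto
 hence "n * (d * S) <~ n * (n * Q)" using K Q by(intro mult_le[OF refl]) (auto simp: Q_def)
 thus "S <~ n^2 * (c * X + d * S)" using trans[OF S] K Q by(simp add: power2_eq_square mult.assoc Q_def)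
 have "n * X <~ n * S" using le_if_not_le_n_power[OF small] K by(intro mult_le[OF refl]) auto
 moreover have "d * S <~ n * S" using K bounds by(intro mult_le[OF _ refl]) auto
 ultimately have "c * X + d * S <~ n * (n * S)" using trans[OF cX(1), of "n * S"] cX(2) K by(intro add_le) auto
 thus "c * X + d * S <~ n^2 * S" by(simp add: power2_eq_square mult.assoc)
qed

lemma (in place) le_n_power_trans:
 assumes le: "x <~ n^i * y" "y <~ n^j * z" and K: "x:K" "y:K" "z:K"
 shows "x <~ n^(i + j) * z"
proof -
 have "n^i * y <~ n^i * (n^j * z)" using le(2) K by(intro mult_le[OF refl]) auto
 hence "x <~ n^i * (n^j * z)" using trans[OF le(1)] K by simp
 thus ?thesis by(simp add: power_add mult.assoc)
qed

lemma (in place) stretch_leaves_cone: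
 assumes K: "r:K" "s:K" "xi:K" "t:K" and nonzero: "s ~= 0" "xi ~= 0"
  and cone: "r <~ n^4 * s" and large: "~ t <~ n^8"
 shows "~ xi * t * s <~ n^4 * (xi * r)"
proof
 assume "xi * t * s <~ n^4 * (xi * r)"
 moreover have "xi * r <~ xi * (n^4 * s)" using cone K by(intro mult_le[OF refl]) auto
 hence "xi * r <~ n^4 * (xi * s)" by(simp add: mult_ac)
 ultimately have "xi * t * s <~ n^(4 + 4) * (xi * s)" using K by(intro le_n_power_trans[where y = "xi * r"]) auto
 hence "t * (xi * s) <~ n^8 * (xi * s)" by(simp add: mult_ac)
 thus False using le_cancel large K nonzero by simp
qed

lemma (in place) lin_dominated_by_snd:
 assumes entries: "x:K" "y:K" "z:K" "u:K" and bounds: "x <~ n" "y <~ n" "z <~ n" "u <~ n" "inverse y <~ n" "inverse u <~ n"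
  and nonzero: "y ~= 0" "u ~= 0" and Y: "Y:K \<times> K" "snd Y ~= 0" "~ snd Y <~ n^4 * fst Y"
 defines "Z \<equiv> lin x y z u Y"
 shows "Z:K \<times> K" "fst Z ~= 0" "snd Z ~= 0" "snd Y <~ n^2 * fst Z" "fst Z <~ n^2 * snd Y"
  "snd Y <~ n^2 * snd Z" "snd Z <~ n^2 * snd Y"
proof -
 have Z: "fst Z = x * fst Y + y * snd Y" "snd Z = z * fst Y + u * snd Y" by(simp_all add: Z_def lin_def)
 show sums: "snd Y <~ n^2 * fst Z" "fst Z <~ n^2 * snd Y" "snd Y <~ n^2 * snd Z" "snd Z <~ n^2 * snd Y"
  using Y dominated_sum entries bounds nonzero unfolding Z by(auto simp: mem_Times_iff)
 show "Z:K \<times> K" using Y(1) entries by(auto simp: mem_Times_iff Z)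
 show "fst Z ~= 0" "snd Z ~= 0" using sums(1,3) Y(1,2) le_zero_imp_zero by(auto simp: mem_Times_iff)
qed

lemma wedge_nonzero_if_branches_disjoint:
 fixes V :: "bool list => complex * complex"
 assumes same: "!!s w w'. wedge (V (s # w)) (V (s # w')) = c * wedge (V w) (V w')" and "c ~= 0"
  and disjoint: "!!w w'. wedge (V (True # w)) (V (False # w')) ~= 0" and distinct: "length v = length v'" "v ~= v'"
 shows "wedge (V v) (V v') ~= 0"
 using distinct
proof(induction v v' rule: list_induct2)
 case (Cons s w s' w')
 show ?case
 proof(cases "s = s'")
  case True
  thus ?thesis using Cons same `c ~= 0` by auto
 next
  case False
  thus ?thesis using disjoint[of w w'] disjoint[of w' w] wedge_commute[of "V (False # w)" "V (True # w')"] by(cases s) auto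
 qed
qed simp

lemma (in place) ping_pong:
 fixes V :: "bool list => complex * complex"
 assumes entries: "x:K" "y:K" "z:K" "u:K" and bounds: "x <~ n" "y <~ n" "z <~ n" "u <~ n" "inverse y <~ n" "inverse u <~ n"
  and nonzero: "y ~= 0" "u ~= 0" "xi ~= 0" and det: "x * u - y * z = 1" and xi: "xi:K" "t:K" and large: "~ t <~ n^8"
  and V_Nil: "V [] = (0, 1)" and V_True: "!!w. V (True # w) = (xi * fst (V w), xi * t * snd (V w))"
  and V_False: "!!w. V (False # w) = lin x y z u (V (True # w))" and distinct: "length v = length v'" "v ~= v'"
 shows "wedge (V v) (V v') ~= 0"
proof -
 define cone where "cone X \<longleftrightarrow> X : K \<times> K & snd X ~= 0 & fst X <~ n^4 * snd X" for X
 have t: "t ~= 0" using large zero_le[of "n^8"] by auto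
 have far: "V (True # w) : K \<times> K" "snd (V (True # w)) ~= 0" "~ snd (V (True # w)) <~ n^4 * fst (V (True # w))" if "cone (V w)" for w
  using that stretch_leaves_cone[of "fst (V w)" "snd (V w)" xi t] xi nonzero t large
  by(auto simp: V_True cone_def mem_Times_iff)
 note image = lin_dominated_by_snd[OF entries bounds nonzero(1,2) far, folded V_False]
 have cone: "cone (V w)" for w
 proof(induction w)
  case Nil
  show ?case using V_Nil zero_le by(simp add: cone_def)
 next
  case (Cons s w)
  note F = far[OF Cons] and Q = image[OF Cons Cons Cons]
  have "fst (V (True # w)) <~ n^4 * snd (V (True # w))"
   using le_if_not_le_n_power[OF F(3)] le_n_power_mono[of _ 0 _ 4] F(1) by(simp add: mem_Times_iff)
  moreover have "fst (V (False # w)) <~ n^4 * snd (V (False # w))"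
   using le_n_power_trans[OF Q(5,6)] F Q by(auto simp: mem_Times_iff)
  ultimately show ?case using F Q by(cases s) (auto simp: cone_def)
 qed
 have disjoint: "wedge (V (True # w)) (V (False # w')) ~= 0" for w w'
 proof
  note F = far[OF cone] and Q = image[OF cone cone cone]
  assume "wedge (V (True # w)) (V (False # w')) = 0"
  hence "snd (V (True # w)) * fst (V (False # w')) = fst (V (True # w)) * snd (V (False # w'))" by(simp add: wedge_def)
  also have "... <~ fst (V (True # w)) * (n^4 * fst (V (False # w')))"
   using le_n_power_trans[OF Q(7,4), of w'] F(1) Q(1) by(intro mult_le[OF refl]) (auto simp: mem_Times_iff)
  finally have "snd (V (True # w)) * fst (V (False # w')) <~ (n^4 * fst (V (True # w))) * fst (V (False # w'))" by(simp add: mult_ac)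
  hence "snd (V (True # w)) <~ n^4 * fst (V (True # w))"
   by(rule le_cancel) (use F(1) Q(1,2) in \<open>auto simp: mem_Times_iff\<close>)
  thus False using F(3) by blast
 qed
 have same: "wedge (V (s # w)) (V (s # w')) = xi * xi * t * wedge (V w) (V w')" for s w w'
  by(cases s) (simp_all add: V_True V_False wedge_lin det, simp_all add: wedge_def algebra_simps)
 show ?thesis by(rule wedge_nonzero_if_branches_disjoint[OF same _ disjoint distinct]) (use nonzero t in auto)
qed

definition root_of_unity :: "complex => bool" where
 "root_of_unity zeta \<longleftrightarrow> (EX m>0. zeta^m = 1)"

lemma cmod_root_of_unity: "root_of_unity zeta ==> cmod zeta = 1" unfolding root_of_unity_def using power_eq_1_iff by blast

lemma root_of_unity_nonzero: "root_of_unity zeta ==> zeta ~= 0" using cmod_root_of_unity by force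

lemma root_of_unity_inverse: "root_of_unity zeta ==> root_of_unity (1 / zeta)"
 unfolding root_of_unity_def by(metis div_by_1 power_one_over)

lemma algebraic_int_root_of_unity: "root_of_unity zeta ==> algebraic_int zeta" unfolding root_of_unity_def
 by(elim exE conjE, rule algebraic_int_root[of 1 "monom 1 m" for m])
  (auto simp: poly_monom degree_monom_eq lead_coeff_monom)

fun dickson :: "nat => 'a::comm_ring_1 => 'a" where
 "dickson 0 x = 2"
| "dickson (Suc 0) x = x"
| "dickson (Suc (Suc n)) x = x * dickson (Suc n) x - dickson n x"

lemma dickson_sum:
 fixes zeta :: complex
 assumes "zeta ~= 0"
 shows "dickson n (zeta + 1 / zeta) = zeta^n + 1 / zeta^n"
proof -
 have "dickson n (zeta + i) = zeta^n + i^n" if i: "zeta * i = 1" for i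
 proof(induction n rule: induct_nat_012)
  case (ge2 n)
  have reduce: "zeta * (i * z) = z" "i * (zeta * z) = z" for z using i by(simp_all flip: mult.assoc) (simp add: mult.commute)
  show ?case using ge2 by(simp add: algebra_simps reduce)
 qed simp_all
 from this[of "1 / zeta"] show ?thesis using assms by(simp add: power_one_over)
qed

lemma ring_hom_on_dickson:
 assumes hom: "ring_hom_on A phi" and A: "subring A" and x: "x:A"
 shows "phi (dickson n x) = dickson n (phi x)" "dickson n x : A"
proof -
 note hom = ring_hom_on_simps[OF hom A] and closed = subring_closed[OF A]
 have two: "phi 2 = 2" "2:A" using hom(8)[of 2] closed(8)[of 2] by simp_all
 have "phi (dickson n x) = dickson n (phi x) & dickson n x : A"
  using x by(induction n x rule: dickson.induct) (auto simp: two hom closed)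
 thus "phi (dickson n x) = dickson n (phi x)" "dickson n x : A" by auto
qed

lemma inverse_sum_exists:
 obtains zeta :: complex where "zeta ~= 0" "tau = zeta + 1 / zeta"
proof -
 obtain zeta where "poly [:1, - tau, 1:] zeta = 0" using alg_closed_imp_poly_has_root[of "[:1, - tau, 1:]"] by auto
 hence "zeta * zeta + 1 = tau * zeta" "zeta ~= 0" by(auto simp: algebra_simps)
 thus thesis using that[of zeta] by(simp add: field_simps)
qed

lemma root_of_unity_if_dickson_eq_2:
 assumes "m > 0" "dickson m x = 2"
 obtains zeta where "root_of_unity zeta" "x = zeta + 1 / zeta"
proof -
 obtain zeta where zeta: "zeta ~= 0" "x = zeta + 1 / zeta" using inverse_sum_exists by metis
 have "zeta^m * (zeta^m + 1 / zeta^m) = zeta^m * 2" using dickson_sum[OF zeta(1), of m] assms(2) zeta(2) by simp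
 hence "(zeta^m - 1)^2 = 0" using zeta(1) by(simp add: power2_eq_square algebra_simps)
 thus thesis using that zeta(2) assms(1) by(auto simp: root_of_unity_def)
qed

lemma cmod_sum_inverse_le_2: "root_of_unity zeta ==> cmod (zeta + 1 / zeta) <= 2"
 using norm_triangle_ineq[of zeta "1 / zeta"] cmod_root_of_unity[of zeta] by(simp add: norm_divide)

locale moebius_system = hmap_system D a b I for D :: "'g => nat" and a b I +
 assumes degree_1: "!!g. g:I ==> D g = 1" and finite_I: "finite I"
  and det_1: "!!g. g:I ==> wedge (hmap (D g) (a g) (b g) (1,0)) (hmap (D g) (a g) (b g) (0,1)) = 1"
  and relation: "!!x y. set x <= I ==> set y <= I
   ==> EX u v. proj_eq D a b (word_subst x y (u @ [True])) (word_subst x y (v @ [False]))"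
begin

lemma wdeg_1: "set w <= I ==> wdeg D w = 1" by(induction w) (auto simp: degree_1)

lemma act_lin:
 assumes "set w <= I"
 obtains p q r s where "!!X. act D a b w X = lin p q r s X"
proof -
 obtain p q where "!!X. act D a b w X = hmap 1 p q X" using act_is_hmap[of D a b w] wdeg_1[OF assms] by metis
 hence "act D a b w X = lin (p 1) (p 0) (q 1) (q 0) X" for X by(simp add: hmap_def hform_def lin_def)
 thus thesis using that by blast
qed

lemma wedge_act:
 assumes "set w <= I"
 shows "wedge (act D a b w X) (act D a b w Y) = wedge X Y"
 using assms
proof(induction w)
 case (Cons g w)
 have g: "set [g] <= I" using Cons.prems by simp
 obtain p q r s where lin: "!!X. act D a b [g] X = lin p q r s X" using act_lin[OF g] by metis
 have "p * s - q * r = 1" using det_1[of g] Cons.prems lin by(simp add: lin_def wedge_def mult.commute)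
 hence "wedge (act D a b [g] X) (act D a b [g] Y) = wedge X Y" for X Y unfolding lin by(simp add: wedge_lin)
 thus ?case using Cons by simp
qed simp

definition trace :: "'g list => complex" where
 "trace w = fst (act D a b w (1,0)) + snd (act D a b w (0,1))"

definition quasiunipotent :: bool where
 "quasiunipotent \<longleftrightarrow> (ALL w. set w <= I --> (EX zeta. root_of_unity zeta & trace w = zeta + 1 / zeta))"

lemma wedge_act_trace:
 assumes "set w <= I"
 shows "wedge (act D a b w v1) v2 + wedge v1 (act D a b w v2) = trace w * wedge v1 v2"
proof -
 obtain p q r s where "!!X. act D a b w X = lin p q r s X" using act_lin[OF assms] by metis
 thus ?thesis by(simp add: trace_def lin_def wedge_def algebra_simps)
qed

lemma eigenvector:
 assumes w: "set w <= I" and zeta: "zeta ~= 0" "trace w = zeta + 1 / zeta"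
 obtains v where "v ~= (0,0)" "act D a b w v = scale zeta v"
proof -
 obtain p q r s where lin: "!!X. act D a b w X = lin p q r s X" using act_lin[OF w] by metis
 define i where "i = 1 / zeta"
 have i: "zeta * i = 1" using zeta(1) by(simp add: i_def)
 have tr: "s = zeta + i - p" using zeta(2) by(auto simp: trace_def lin lin_def i_def algebra_simps)
 have "q * r = p * s - 1" using wedge_act[OF w, of "(1,0)" "(0,1)"] by(simp add: lin lin_def wedge_def algebra_simps)
 hence det: "q * r = p * zeta + p * i - p * p - 1" unfolding tr by(simp add: algebra_simps)
 have "act D a b w (p - i, r) = scale zeta (p - i, r)" "act D a b w (q, s - i) = scale zeta (q, s - i)"
  using det i unfolding lin tr by(simp_all add: lin_def scale_def algebra_simps)
 moreover have "act D a b w (1,0) = scale zeta (1,0)" if "(p - i, r) = (0,0)" "(q, s - i) = (0,0)"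
  using that tr by(simp add: lin lin_def scale_def)
 ultimately show thesis using that by(metis prod.inject zero_neq_one)
qed

lemma diagonalise:
 assumes w: "set w <= I" and zeta: "zeta ~= 0" "trace w = zeta + 1 / zeta" "zeta^2 ~= 1"
 obtains v1 v2 where "wedge v1 v2 = 1" "act D a b w v1 = scale zeta v1" "act D a b w v2 = scale (1 / zeta) v2"
proof -
 obtain v1 where v1: "v1 ~= (0,0)" "act D a b w v1 = scale zeta v1" using eigenvector[OF w zeta(1,2)] by metis
 obtain v2 where v2: "v2 ~= (0,0)" "act D a b w v2 = scale (1 / zeta) v2"
 proof(rule eigenvector[OF w])
  show "1 / zeta ~= 0" "trace w = 1 / zeta + 1 / (1 / zeta)" using zeta by simp_all
 qed
 have nonzero: "wedge v1 v2 ~= 0"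
 proof
  assume "wedge v1 v2 = 0"
  then obtain c where c: "v1 = scale c v2" using wedge_zero_imp_scale v2(1) by metis
  have "scale (zeta * c) v2 = scale (c * (1 / zeta)) v2" using v1(2) v2(2) wdeg_1[OF w] by(simp add: c act_scale)
  hence "scale ((zeta - 1 / zeta) * c) v2 = (0,0)" by(simp add: scale_def algebra_simps)
  moreover have "c ~= 0" using v1(1) by(auto simp: c scale_def)
  moreover have "zeta - 1 / zeta ~= 0" using zeta(1,3) by(auto simp: power2_eq_square eq_divide_eq)
  ultimately show False using v2(1) by(simp add: scale_eq_0_iff)
 qed
 show thesis
 proof(rule that)
  show "wedge v1 (scale (1 / wedge v1 v2) v2) = 1" using nonzero by simp
  show "act D a b w (scale (1 / wedge v1 v2) v2) = scale (1 / zeta) (scale (1 / wedge v1 v2) v2)"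
   using v2(2) wdeg_1[OF w] by(simp add: act_scale mult.commute)
 qed(rule v1(2))
qed

lemma relation_equal_length:
 assumes xy: "set x <= I" "set y <= I"
 obtains u v where "length u = length v" "u ~= v" "proj_eq D a b (word_subst x y u) (word_subst x y v)"
proof -
 obtain u v where uv: "proj_eq D a b (word_subst x y (u @ [True])) (word_subst x y (v @ [False]))" using relation[OF xy] by blast
 define p q where "p = u @ [True]" and "q = v @ [False]"
 obtain eps where eps: "!!X. act D a b (word_subst x y q) X = scale eps (act D a b (word_subst x y p) X)"
  using uv proj_eq_iff_scale[OF set_word_subst[OF xy] set_word_subst[OF xy]] by(auto simp only: p_def q_def)
 have "proj_eq D a b (word_subst x y (p @ q)) (word_subst x y (q @ p))"
  unfolding proj_eq_iff using wdeg_1[OF set_word_subst[OF xy]] by(simp add: act_append eps act_scale)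
 moreover have "p @ q ~= q @ p" by(metis last_appendR last_snoc p_def q_def snoc_eq_iff_butlast)
 ultimately show thesis using that[of "p @ q" "q @ p"] by simp
qed

end

locale moebius_basis = moebius_system D a b I for D :: "'g => nat" and a b I +
 fixes v1 v2 :: "complex * complex"
 assumes basis: "wedge v1 v2 = 1"
begin

definition m11 :: "'g list => complex" where "m11 w = wedge (act D a b w v1) v2"
definition m12 :: "'g list => complex" where "m12 w = wedge (act D a b w v2) v2"
definition m21 :: "'g list => complex" where "m21 w = wedge v1 (act D a b w v1)"
definition m22 :: "'g list => complex" where "m22 w = wedge v1 (act D a b w v2)"

lemmas entries_def = m11_def m12_def m21_def m22_def

lemma coordinates: "X = scale (wedge X v2) v1 + scale (wedge v1 X) v2"
proof -
 have "x * (fst v1 * snd v2 - snd v1 * fst v2) = x" for x using basis by(simp add: wedge_def)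
 from this[of "fst X"] this[of "snd X"] show ?thesis by(auto simp: scale_def wedge_def prod_eq_iff algebra_simps)
qed

lemma act_coordinates:
 assumes "set w <= I"
 shows "act D a b w X = scale (m11 w * wedge X v2 + m12 w * wedge v1 X) v1 + scale (m21 w * wedge X v2 + m22 w * wedge v1 X) v2"
proof -
 obtain p q r s where lin: "!!X. act D a b w X = lin p q r s X" using act_lin[OF assms] by metis
 have "act D a b w X = scale (wedge X v2) (act D a b w v1) + scale (wedge v1 X) (act D a b w v2)"
  unfolding lin by(subst coordinates[of X]) (simp add: lin_add_scale lin_scale)
 also have "... = scale (wedge X v2) (scale (m11 w) v1 + scale (m21 w) v2) + scale (wedge v1 X) (scale (m12 w) v1 + scale (m22 w) v2)"
  unfolding entries_def using coordinates[of "act D a b w v1"] coordinates[of "act D a b w v2"] by simp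
 finally show ?thesis by(simp add: scale_def algebra_simps)
qed

lemma entries_append:
 assumes "set u <= I" "set v <= I"
 shows "m11 (u @ v) = m11 u * m11 v + m12 u * m21 v" "m12 (u @ v) = m11 u * m12 v + m12 u * m22 v"
  "m21 (u @ v) = m21 u * m11 v + m22 u * m21 v" "m22 (u @ v) = m21 u * m12 v + m22 u * m22 v"
proof -
 have split: "wedge (X + Y) Z = wedge X Z + wedge Y Z" "wedge Z (X + Y) = wedge Z X + wedge Z Y" for X Y Z :: "complex * complex"
  by(simp_all add: wedge_def algebra_simps)
 have "wedge v2 v1 = -1" using basis wedge_commute[of v2 v1] by simp
 thus "m11 (u @ v) = m11 u * m11 v + m12 u * m21 v" "m12 (u @ v) = m11 u * m12 v + m12 u * m22 v"
  "m21 (u @ v) = m21 u * m11 v + m22 u * m21 v" "m22 (u @ v) = m21 u * m12 v + m22 u * m22 v"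
  unfolding entries_def[of "u @ v"] act_append act_coordinates[OF assms(1)] by(simp_all add: split basis entries_def[of v])
qed

lemma entries_Nil [simp]: "m11 [] = 1" "m12 [] = 0" "m21 [] = 0" "m22 [] = 1" by(simp_all add: entries_def basis)

lemma entries_Cons:
 assumes "g:I" "set w <= I"
 shows "m11 (g # w) = m11 [g] * m11 w + m12 [g] * m21 w" "m12 (g # w) = m11 [g] * m12 w + m12 [g] * m22 w"
  "m21 (g # w) = m21 [g] * m11 w + m22 [g] * m21 w" "m22 (g # w) = m21 [g] * m12 w + m22 [g] * m22 w"
 using entries_append[of "[g]" w] assms by auto

lemma entries_in_subring:
 assumes A: "subring A" and "!!g. g:I ==> {m11 [g], m12 [g], m21 [g], m22 [g]} <= A" and "set w <= I"
 shows "{m11 w, m12 w, m21 w, m22 w} <= A"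
 using assms(3)
proof(induction w)
 case (Cons g w)
 thus ?case using entries_Cons[of g w] assms(2)[of g] by(auto intro!: subring_add[OF A] subring_mult[OF A])
qed(use subring_one[OF A] subring_zero[OF A] in simp)

lemma trace_eq: "set w <= I ==> m11 w + m22 w = trace w" using wedge_act_trace[of w v1 v2] basis by(simp add: entries_def)

lemma det: "set w <= I ==> m11 w * m22 w - m12 w * m21 w = 1"
proof -
 assume w: "set w <= I"
 have "wedge (scale (m11 w) v1 + scale (m21 w) v2) (scale (m12 w) v1 + scale (m22 w) v2) = 1"
  using wedge_act[OF w, of v1 v2] basis coordinates[of "act D a b w v1"] coordinates[of "act D a b w v2"] by(simp add: entries_def)
 moreover have "wedge (scale p v1 + scale q v2) (scale r v1 + scale s v2) = (p * s - r * q) * wedge v1 v2" for p q r s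
  by(simp add: wedge_def scale_def algebra_simps)
 ultimately show ?thesis using basis by simp
qed

lemma proj_eq_if_entries:
 assumes "set w <= I" "set w' <= I" "m11 w = k * m11 w'" "m12 w = k * m12 w'" "m21 w = k * m21 w'" "m22 w = k * m22 w'"
 shows "proj_eq D a b w w'"
proof -
 have "act D a b w X = scale k (act D a b w' X)" for X
  unfolding act_coordinates[OF assms(1)] act_coordinates[OF assms(2)] assms(3-) by(simp add: scale_def algebra_simps)
 thus ?thesis unfolding proj_eq_iff by simp
qed

lemma column_eq_if_proj_eq:
 assumes "set w <= I" "set w' <= I" "proj_eq D a b w w'"
 shows "m12 w * m22 w' = m22 w * m12 w'"
proof -
 have "wedge (scale (m12 w) v1 + scale (m22 w) v2) (scale (m12 w') v1 + scale (m22 w') v2) = 0"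
  using assms(3) coordinates[of "act D a b w v2"] coordinates[of "act D a b w' v2"] unfolding proj_eq_iff entries_def by metis
 moreover have "wedge (scale p v1 + scale q v2) (scale r v1 + scale s v2) = (p * s - q * r) * wedge v1 v2" for p q r s
  by(simp add: wedge_def scale_def algebra_simps)
 ultimately show ?thesis using basis by simp
qed

lemma finite_traces:
 assumes unity: quasiunipotent
 shows "finite {trace w |w. set w <= I}"
proof -
 have "finite (\<Union>g\<in>I. {m11 [g], m12 [g], m21 [g], m22 [g]})" using finite_I by simp
 then obtain K A phi where L: "(\<Union>g\<in>I. {m11 [g], m12 [g], m21 [g], m22 [g]}) <= A" and spec: "fps_specialization K A phi"
  by(rule fps_specialization_exists)
 note spec_simps = fps_specializationD[OF spec]
 define psi where "psi x = phi x $ 0" for x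
 have hom: "ring_hom_on A psi" using spec_simps(7) by(simp add: psi_def[abs_def])
 have K: "subring K" by(rule number_field_subring[OF spec_simps(1)])
 have trace_A: "trace w : A" if "set w <= I" for w
  using entries_in_subring[OF spec_simps(2) _ that] L subring_add[OF spec_simps(2), of "m11 w" "m22 w"]
  by(simp add: UN_subset_iff flip: trace_eq[OF that])
 have integral: "algebraic_int (zeta + 1 / zeta)" if "root_of_unity zeta" for zeta
  using that root_of_unity_inverse algebraic_int_root_of_unity by(intro algebraic_int_ring(2)) auto
 define X where "X = {x:K. algebraic_int (of_nat 1 * x) & (ALL sig::complex => complex. ring_hom_on K sig --> cmod (sig x) <= 2)}"
 have "psi (trace w) : X" if w: "set w <= I" for w
 proof -
  obtain zeta m where zeta: "trace w = zeta + 1 / zeta" "root_of_unity zeta" "m > 0" "zeta^m = 1"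
   using unity w unfolding quasiunipotent_def root_of_unity_def by blast
  have "dickson m (trace w) = 2" using dickson_sum[OF root_of_unity_nonzero[OF zeta(2)], of m] zeta by simp
  hence dickson: "dickson m (psi (trace w)) = 2"
   using ring_hom_on_dickson(1)[OF hom spec_simps(2) trace_A[OF w], of m] ring_hom_on_simps(8)[OF hom spec_simps(2), of 2] by simp
  have in_K: "psi (trace w) : K" using spec_simps(6)[OF trace_A[OF w]] by(simp add: psi_def)
  have "cmod (sig (psi (trace w))) <= 2" if sig: "ring_hom_on K sig" for sig :: "complex => complex"
  proof -
   have "dickson m (sig (psi (trace w))) = 2"
    using ring_hom_on_dickson(1)[OF sig K in_K, of m] dickson ring_hom_on_simps(8)[OF sig K, of 2] by simp
   thus ?thesis using root_of_unity_if_dickson_eq_2[OF zeta(3)] cmod_sum_inverse_le_2 by metis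
  qed
  moreover have "algebraic_int (psi (trace w))" using root_of_unity_if_dickson_eq_2[OF zeta(3) dickson] integral by metis
  ultimately show ?thesis using in_K by(simp add: X_def)
 qed
 hence "psi ` {trace w |w. set w <= I} <= X" by auto
 moreover have "finite X" unfolding X_def by(rule northcott[OF spec_simps(1)]) simp
 ultimately have "finite (psi ` {trace w |w. set w <= I})" using finite_subset by blast
 moreover have "inj_on psi {trace w |w. set w <= I}"
 proof(rule inj_onI, clarify)
  fix w w' assume w: "set w <= I" "set w' <= I" "psi (trace w) = psi (trace w')"
  have "algebraic_int (trace w - trace w')"
   using unity w(1,2) integral unfolding quasiunipotent_def by(intro algebraic_int_ring(3)) metis+
  hence "algebraic (trace w - trace w')" by(rule algebraic_int_imp_algebraic)
  moreover have "psi (trace w - trace w') = 0" using w trace_A by(simp add: ring_hom_on_simps[OF hom spec_simps(2)])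
  ultimately show "trace w = trace w'"
   using ring_hom_on_algebraic_nonzero[OF hom spec_simps(2), of "trace w - trace w'"] trace_A w subring_diff[OF spec_simps(2)]
   by fastforce
 qed
 ultimately show ?thesis using finite_imageD by blast
qed

fun affine_terms :: "'g list => (complex * 'g) multiset" where
 "affine_terms [] = {#}"
| "affine_terms (g # w) = add_mset (1, g) (image_mset (%e. (m11 [g]^2 * fst e, snd e)) (affine_terms w))"

lemma affine_entries:
 assumes triangular: "!!g. g:I ==> m21 [g] = 0" and "set w <= I"
 shows "m21 w = 0" "m11 w = prod_list (map (%g. m11 [g]) w)"
  "m11 w * m12 w = (\<Sum>e\<in>#affine_terms w. fst e * (m11 [snd e] * m12 [snd e]))"
proof -
 have "m21 w = 0 & m11 w = prod_list (map (%g. m11 [g]) w)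
   & m11 w * m12 w = (\<Sum>e\<in>#affine_terms w. fst e * (m11 [snd e] * m12 [snd e]))"
  using assms(2)
 proof(induction w)
  case (Cons g w)
  hence g: "g:I" "set w <= I" by auto
  have "(\<Sum>e\<in>#E. c * fst e * k (snd e)) = c * (\<Sum>e\<in>#E. fst e * k (snd e))" for E c and k :: "'g => complex"
   by(induction E) (auto simp: algebra_simps)
  from this[of "m11 [g]^2" "%h. m11 [h] * m12 [h]"]
  have sum: "(\<Sum>e\<in>#affine_terms (g # w). fst e * (m11 [snd e] * m12 [snd e]))
    = m11 [g] * m12 [g] + m11 [g]^2 * (\<Sum>e\<in>#affine_terms w. fst e * (m11 [snd e] * m12 [snd e]))"
   by(simp add: image_mset.compositionality comp_def)
  have "m11 w * m22 w = 1" using det[OF g(2)] Cons by simp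
  hence "m11 (g # w) * m12 (g # w) = m11 [g]^2 * (m11 w * m12 w) + m11 [g] * m12 [g]"
   using entries_Cons[OF g] Cons triangular[OF g(1)] by(simp add: power2_eq_square algebra_simps)
  moreover have "m11 w * m12 w = (\<Sum>e\<in>#affine_terms w. fst e * (m11 [snd e] * m12 [snd e]))" using Cons.IH g(2) by blast
  ultimately show ?case using entries_Cons[OF g] Cons triangular[OF g(1)] by(simp add: sum del: affine_terms.simps)
 qed simp
 thus "m21 w = 0" "m11 w = prod_list (map (%g. m11 [g]) w)"
  "m11 w * m12 w = (\<Sum>e\<in>#affine_terms w. fst e * (m11 [snd e] * m12 [snd e]))" by blast+
qed

lemma poly_growth_if_triangular:
 assumes triangular: "!!g. g:I ==> m21 [g] = 0" and unity: quasiunipotent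
 shows "poly_growth (proj_eq D a b) I"
proof -
 have "root_of_unity (m11 [g])" if g: "g:I" for g
 proof -
  obtain zeta where zeta: "root_of_unity zeta" "m11 [g] + m22 [g] = zeta + 1 / zeta"
   using unity g trace_eq[of "[g]"] unfolding quasiunipotent_def by force
  have "(m11 [g] - zeta) * (m11 [g] - 1 / zeta) = m11 [g] * m11 [g] - (zeta + 1 / zeta) * m11 [g] + zeta * (1 / zeta)"
   by(simp add: algebra_simps)
  also have "... = 1 - m11 [g] * m22 [g]"
   using root_of_unity_nonzero[OF zeta(1)] unfolding zeta(2)[symmetric] by(simp add: algebra_simps)
  also have "... = 0" using det[of "[g]"] triangular[OF g] g by simp
  finally have "(m11 [g] - zeta) * (m11 [g] - 1 / zeta) = 0" .
  thus ?thesis using zeta(1) root_of_unity_inverse by auto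
 qed
 then obtain d where d: "!!g. g:I ==> d g > (0::nat) & m11 [g]^d g = 1" unfolding root_of_unity_def by metis
 define M where "M = (\<Prod>g\<in>I. d g)"
 have M: "M > 0" unfolding M_def using d by(intro prod_pos) auto
 have unit: "m11 [g]^M = 1" if "g:I" for g
 proof -
  have "d g dvd M" unfolding M_def using finite_I that by(intro dvd_prodI) auto
  thus ?thesis using d[OF that] by(auto simp: power_mult elim!: dvdE)
 qed
 show ?thesis
 proof(rule poly_growth_if_multiset_invariant)
  show "finite {z :: complex. z^M = 1}" using M by(intro finite_roots_unity) simp
  show "finite ({z :: complex. z^M = 1} \<times> I)" using `finite {z :: complex. z^M = 1}` finite_I by simp
  show "m11 w : {z. z^M = 1} & set_mset (affine_terms w) <= {z. z^M = 1} \<times> I & size (affine_terms w) = length w"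
   if w: "set w <= I" for w
  proof -
   have "prod_list (map (%g. m11 [g]) w)^M = 1 & set_mset (affine_terms w) <= {z. z^M = 1} \<times> I & size (affine_terms w) = length w"
    using w by(induction w) (auto simp: power_mult_distrib unit power_mult[symmetric] mult.commute[of 2] dest: subsetD, auto simp: power_mult unit)
   thus ?thesis using affine_entries(2)[OF triangular w] by simp
  qed
  fix w w' assume w: "set w <= I" "set w' <= I" and eq: "affine_terms w = affine_terms w'" "m11 w = m11 w'"
  have "m11 w * m22 w = 1" "m11 w' * m22 w' = 1" "m11 w * m12 w = m11 w' * m12 w'"
   using det[OF w(1)] det[OF w(2)] affine_entries[OF triangular w(1)] affine_entries[OF triangular w(2)] eq(1) by auto
  hence "m22 w = m22 w'" "m12 w = m12 w'" using eq(2) by(metis mult_left_cancel mult_zero_left zero_neq_one)+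
  thus "proj_eq D a b w w'" using affine_entries(1)[OF triangular] w eq(2) by(intro proj_eq_if_entries[OF w, of 1]) auto
 qed
qed

fun signed_letters :: "'g list => (bool * 'g) multiset" where
 "signed_letters [] = {#}"
| "signed_letters (g # w) = add_mset (True, g) (if m12 [g] = 0 then signed_letters w else image_mset (map_prod Not id) (signed_letters w))"

definition letter_ratio :: "bool * 'g => complex" where
 "letter_ratio e = (let r = (if m12 [snd e] = 0 then m11 [snd e] / m22 [snd e] else m12 [snd e] / m21 [snd e]) in if fst e then r else 1 / r)"

lemma monomial_entries:
 assumes monomial: "!!g. g:I ==> (m12 [g] = 0 & m21 [g] = 0) | (m11 [g] = 0 & m22 [g] = 0)" and "set w <= I"
 shows "if m12 w = 0 then m21 w = 0 & m22 w ~= 0 & m11 w = prod_mset (image_mset letter_ratio (signed_letters w)) * m22 w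
  else m11 w = 0 & m22 w = 0 & m21 w ~= 0 & m12 w = prod_mset (image_mset letter_ratio (signed_letters w)) * m21 w"
 using assms(2)
proof(induction w)
 case (Cons g w)
 hence g: "g:I" "set w <= I" by auto
 define V where "V = prod_mset (image_mset letter_ratio (signed_letters w))"
 have det_g: "m11 [g] * m22 [g] - m12 [g] * m21 [g] = 1" using det[of "[g]"] g by simp
 have "letter_ratio (map_prod Not id e) = 1 / letter_ratio e" for e by(cases "fst e") (auto simp: letter_ratio_def Let_def)
 hence "prod_mset (image_mset letter_ratio (image_mset (map_prod Not id) E)) = 1 / prod_mset (image_mset letter_ratio E)" for E
  by(induction E) (auto simp: field_simps)
 hence V: "prod_mset (image_mset letter_ratio (signed_letters (g # w))) = letter_ratio (True, g) * (if m12 [g] = 0 then V else 1 / V)"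
  by(simp add: V_def)
 show ?case
 proof(cases "m12 [g] = 0")
  case True
  hence "m21 [g] = 0" "m11 [g] ~= 0" "m22 [g] ~= 0" using monomial[OF g(1)] det_g by auto
  thus ?thesis using Cons g entries_Cons[OF g] True unfolding V by(auto simp: letter_ratio_def V_def[symmetric])
 next
  case False
  hence "m11 [g] = 0" "m22 [g] = 0" "m21 [g] ~= 0" using monomial[OF g(1)] det_g by auto
  moreover have "V ~= 0" using Cons g det[OF g(2)] by(auto simp: V_def[symmetric] split: if_splits)
  ultimately show ?thesis using Cons g entries_Cons[OF g] False det[OF g(2)] unfolding V
   by(auto simp: letter_ratio_def V_def[symmetric] split: if_splits)
 qed
qed simp

lemma poly_growth_if_monomial:
 assumes monomial: "!!g. g:I ==> (m12 [g] = 0 & m21 [g] = 0) | (m11 [g] = 0 & m22 [g] = 0)"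
 shows "poly_growth (proj_eq D a b) I"
proof(rule poly_growth_if_multiset_invariant)
 show "finite (UNIV :: bool set)" "finite ((UNIV :: bool set) \<times> I)" using finite_I by auto
 show "(m12 w = 0) : UNIV & set_mset (signed_letters w) <= UNIV \<times> I & size (signed_letters w) = length w" if "set w <= I" for w
  using that by(induction w) auto
 fix w w' assume w: "set w <= I" "set w' <= I" and eq: "signed_letters w = signed_letters w'" "(m12 w = 0) = (m12 w' = 0)"
 note W = monomial_entries[OF monomial w(1), unfolded eq(1)] monomial_entries[OF monomial w(2)]
 show "proj_eq D a b w w'"
 proof(cases "m12 w = 0")
  case True
  thus ?thesis using W eq(2) by(intro proj_eq_if_entries[OF w, of "m22 w / m22 w'"]) auto
 next
  case False
  thus ?thesis using W eq(2) by(intro proj_eq_if_entries[OF w, of "m21 w / m21 w'"]) auto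
 qed
qed

lemma poly_growth_if_irreducible:
 assumes fin: "finite {trace w |w. set w <= I}" and w0: "set w0 <= I" "m12 w0 = 0" "m21 w0 = 0" "m11 w0 ~= m22 w0"
  and f: "set f <= I" "m21 f ~= 0" and f': "set f' <= I" "m12 f' ~= 0"
 shows "poly_growth (proj_eq D a b) I"
proof(rule poly_growth_if_invariant)
 define T where "T = {trace w |w. set w <= I}"
 define k where "k w = (trace w, trace (w0 @ w))" for w
 have T: "finite T" "!!w. set w <= I ==> trace w : T" using fin by(auto simp: T_def)
 have diagonal: "m11 u = m11 u' & m22 u = m22 u'" if "set u <= I" "set u' <= I" "k u = k u'" for u u'
 proof -
  have "(m11 w0 - m22 w0) * m11 u = trace (w0 @ u) - m22 w0 * trace u" if "set u <= I" for u
   using trace_eq[of "w0 @ u"] trace_eq[of u] entries_append[OF w0(1) that] that w0 by(simp add: algebra_simps flip: trace_eq)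
  hence "(m11 w0 - m22 w0) * m11 u = (m11 w0 - m22 w0) * m11 u'" using that by(simp add: k_def)
  hence "m11 u = m11 u'" using w0(4) by simp
  moreover have "m11 u + m22 u = m11 u' + m22 u'" using trace_eq that by(simp add: k_def)
  ultimately show ?thesis by simp
 qed
 show "proj_eq D a b w w'" if w: "set w <= I" "set w' <= I" and eq: "(k w, k (w @ f), k (w @ f')) = (k w', k (w' @ f), k (w' @ f'))" for w w'
 proof(rule proj_eq_if_entries[OF w, of 1])
  show "m11 w = 1 * m11 w'" "m22 w = 1 * m22 w'" using diagonal[OF w] eq by auto
  have "m11 (w @ f) = m11 (w' @ f)" "m22 (w @ f') = m22 (w' @ f')" "m11 w = m11 w'" "m22 w = m22 w'"
   using diagonal[OF w] diagonal[of "w @ f" "w' @ f"] diagonal[of "w @ f'" "w' @ f'"] w f(1) f'(1) eq by auto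
  thus "m12 w = 1 * m12 w'" "m21 w = 1 * m21 w'"
   using entries_append(1)[OF _ f(1)] entries_append(4)[OF _ f'(1)] w f(2) f'(2) by auto
 qed
 define F where "F (n::nat) = (T \<times> T) \<times> (T \<times> T) \<times> (T \<times> T)" for n
 show "finite (F n) & card (F n) <= card (F 0) * (n + 1)^0" for n using T(1) by(simp add: F_def)
 show "(k w, k (w @ f), k (w @ f')) : F n" if "set w <= I" "length w <= n" for n w
  using T(2) that(1) w0(1) f(1) f'(1) by(simp add: F_def k_def)
qed

end

lemma power_exceeds_at_some_place:
 assumes K: "number_field K" and E: "finite E" "E <= K" and q: "q:K" "q ~= 0" and nonroot: "!!k. k > 0 ==> q^k ~= 1"
 obtains m le n where "place K le n" "!!e. e:E ==> le e n" "~ le (q^Suc m) (n^N)"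
proof -
 obtain X where X: "finite X" "!!c. c:K ==> (!!le n. place K le n ==> ALL e:E. le e n ==> le c (n^N)) ==> c:X"
  using place_northcott[OF K E, of N] by auto
 have power_q: "q^Suc m : K" for m using q(1) subring_power[OF number_field_subring[OF K]] by blast
 have "inj (%m. q^Suc m)"
 proof(rule linorder_injI)
  fix i j :: nat assume "i < j"
  hence "q^Suc j = q^Suc i * q^(j - i)" by(simp flip: power_add)
  thus "q^Suc i ~= q^Suc j" using nonroot[of "j - i"] `i < j` q(2) by simp
 qed
 hence "~ range (%m. q^Suc m) <= X" using X(1) finite_subset range_inj_infinite by blast
 then obtain m where "q^Suc m ~: X" by blast
 thus thesis using X(2)[OF power_q] that by blast
qed

lemma (in moebius_basis) diagonal_word_power:
 assumes w: "set w <= I" "m12 w = 0" "m21 w = 0"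
 defines "W \<equiv> %k. concat (replicate k w)"
 shows "set (W k) <= I & m11 (W k) = m11 w^k & m12 (W k) = 0 & m21 (W k) = 0 & m22 (W k) = m11 w^k * (m22 w^2)^k"
 unfolding W_def
proof(induction k)
 case (Suc k)
 have "m22 w = m11 w * m22 w^2" using det[OF w(1)] w(2) by(simp add: power2_eq_square flip: mult.assoc)
 thus ?case using Suc w entries_append[OF w(1), of "concat (replicate k w)"] by(simp add: mult_ac)
qed simp

lemma (in moebius_basis) antidiagonal_if_nonroot:
 assumes w: "set w <= I" "m12 w = 0" "m21 w = 0" "~ root_of_unity (m22 w)" and f: "set f <= I"
 shows "m12 f = 0 | m22 f = 0"
proof(rule ccontr)
 assume nonzero: "~ (m12 f = 0 | m22 f = 0)"
 define L where "L = (\<Union>g\<in>I. {m11 [g], m12 [g], m21 [g], m22 [g]}) Un {inverse (m12 f), inverse (m22 f)}"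
 have "(m22 w^2)^k ~= 1" if "k > 0" for k
  using w(4) that unfolding root_of_unity_def by(metis nat_0_less_mult_iff power_mult zero_less_numeral)
 moreover have "finite L" using finite_I by(simp add: L_def)
 ultimately obtain K A phi where A: "insert (m22 w^2) L <= A" and spec: "fps_specialization K A phi"
  and nonroot: "!!k. k > 0 ==> (phi (m22 w^2) $ 0)^k ~= 1"
  using fps_specialization_exists_nonroot_of_unity[of L "m22 w^2"] by metis
 note spec_simps = fps_specializationD[OF spec]
 define psi where "psi c = phi c $ 0" for c
 have hom: "ring_hom_on A psi" using spec_simps(7) by(simp add: psi_def[abs_def])
 note hom_simps = ring_hom_on_simps[OF hom spec_simps(2)] and closed = subring_closed[OF spec_simps(2)]
 have in_A: "{m11 v, m12 v, m21 v, m22 v} <= A" if "set v <= I" for v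
  using entries_in_subring[OF spec_simps(2) _ that] A by(simp add: L_def UN_subset_iff)
 define x y z u q where "x = psi (m11 f)" and "y = psi (m12 f)" and "z = psi (m21 f)" and "u = psi (m22 f)" and "q = psi (m22 w^2)"
 have y: "psi (inverse (m12 f)) * y = 1" and u: "psi (inverse (m22 f)) * u = 1"
  using hom_simps(1) hom_simps(4)[of "inverse (m12 f)" "m12 f"] hom_simps(4)[of "inverse (m22 f)" "m22 f"] in_A[OF f] A nonzero
  by(auto simp: y_def u_def L_def)
 hence inverse: "inverse y = psi (inverse (m12 f))" "inverse u = psi (inverse (m22 f))"
  by(metis inverse_unique mult.commute)+
 have in_K: "{x, y, z, u, inverse y, inverse u} <= K" "q:K"
  using spec_simps(6) in_A[OF f] A unfolding inverse by(auto simp: x_def y_def z_def u_def q_def psi_def L_def)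
 have "q ~= 0" using nonroot[of 1] hom_simps(4)[of "m11 w^2" "m22 w^2"] hom_simps(1) det[OF w(1)] w(2) in_A[OF w(1)] closed(7)
  by(auto simp: q_def simp flip: power_mult_distrib)
 obtain m le n where pl: "place K le n" and bounds: "!!e. e:{x, y, z, u, inverse y, inverse u} ==> le e n"
  and large: "~ le (q^Suc m) (n^8)"
  by(rule power_exceeds_at_some_place[OF spec_simps(1) _ in_K `q ~= 0`, where N = 8]) (use nonroot in \<open>auto simp: q_def psi_def\<close>)
 have power_q: "q^Suc m : K" using in_K(2) subring_power[OF number_field_subring[OF spec_simps(1)]] by blast
 define W where "W = concat (replicate (Suc m) w)"
 have W: "set W <= I" "m11 W = m11 w^Suc m" "m12 W = 0" "m21 W = 0" "m22 W = m11 W * (m22 w^2)^Suc m"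
  unfolding W_def using diagonal_word_power[OF w(1-3), of "Suc m"] by simp_all
 have fW: "set (f @ W) <= I" using f W(1) by simp
 obtain v v' where v: "length v = length v'" "v ~= v'" "proj_eq D a b (word_subst W (f @ W) v) (word_subst W (f @ W) v')"
  using relation_equal_length[OF W(1) fW] by metis
 note words = set_word_subst[OF W(1) fW]
 define V where "V s = (psi (m12 (word_subst W (f @ W) s)), psi (m22 (word_subst W (f @ W) s)))" for s
 have "wedge (V v) (V v') ~= 0"
 proof(rule place.ping_pong[OF pl, where x = x and y = y and z = z and u = u and t = "q^Suc m" and xi = "psi (m11 W)"])
  have "psi (m22 W) = psi (m11 W) * q^Suc m"
   unfolding W(5) q_def using in_A[OF W(1)] A closed(7) by(simp only: hom_simps(4,7) insert_subset)
  thus "V (True # s) = (psi (m11 W) * fst (V s), psi (m11 W) * q^Suc m * snd (V s))" for s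
   using entries_append[OF W(1) words] in_A[OF W(1)] in_A[OF words] W(3,4) by(simp add: V_def hom_simps(4))
  have WS: "set (W @ word_subst W (f @ W) s) <= I" for s using W(1) words by simp
  show "V (False # s) = lin x y z u (V (True # s))" for s
   using entries_append(2,4)[OF f WS] in_A[OF f] in_A[OF WS, of s] closed(6)
   by(simp add: V_def lin_def hom_simps(3,4) x_def y_def z_def u_def)
  show "x * u - y * z = 1"
   using arg_cong[OF det[OF f], of psi] in_A[OF f] closed(6) by(simp add: hom_simps(1,4,6) x_def y_def z_def u_def)
  show "psi (m11 W) ~= 0" using arg_cong[OF det[OF W(1)], of psi] W(3) in_A[OF W(1)] hom_simps(1,2,4) by auto
  show "psi (m11 W) : K" using in_A[OF W(1)] spec_simps(6) by(simp add: psi_def)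
 qed(use in_K bounds y u power_q large v hom_simps in \<open>auto simp: V_def\<close>)
 moreover have "wedge (V v) (V v') = 0"
  using arg_cong[OF column_eq_if_proj_eq[OF words words v(3)], of psi] in_A[OF words] by(simp add: wedge_def V_def hom_simps(4))
 ultimately show False by simp
qed

context moebius_system
begin

lemma moebius_basisI: "wedge v1 v2 = 1 ==> moebius_basis D a b I v1 v2" by unfold_locales

lemma poly_growth_if_nonroot:
 assumes w: "set w <= I" and zeta: "zeta ~= 0" "trace w = zeta + 1 / zeta" "~ root_of_unity zeta"
 shows "poly_growth (proj_eq D a b) I"
proof -
 have "zeta^2 ~= 1" using zeta(3) unfolding root_of_unity_def by(metis zero_less_numeral)
 then obtain v1 v2 where v: "wedge v1 v2 = 1" "act D a b w v1 = scale zeta v1" "act D a b w v2 = scale (1 / zeta) v2"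
  using diagonalise[OF w zeta(1,2)] by metis
 have v21: "wedge v2 v1 = - 1" using v(1) wedge_commute[of v2 v1] by simp
 interpret B: moebius_basis D a b I v1 v2 by(rule moebius_basisI[OF v(1)])
 interpret C: moebius_basis D a b I v2 "scale (-1) v1" by(rule moebius_basisI) (simp add: v21)
 have swap: "C.m12 f = - B.m21 f" "C.m22 f = B.m11 f" if "set f <= I" for f
  using wedge_commute[of v1 "act D a b f v1"] wedge_commute[of v2 "act D a b f v1"] wdeg_1[OF that]
  by(simp_all add: C.entries_def B.entries_def act_scale)
 have "~ root_of_unity (1 / zeta)" using zeta(3) root_of_unity_inverse[of "1 / zeta"] by auto
 hence "B.m12 f = 0 | B.m22 f = 0" if "set f <= I" for f
  using B.antidiagonal_if_nonroot[OF w _ _ _ that] v by(simp add: B.entries_def)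
 moreover have "B.m21 f = 0 | B.m11 f = 0" if "set f <= I" for f
  using C.antidiagonal_if_nonroot[OF w _ _ _ that] zeta(3) swap[OF that] swap[OF w] v v21 by(simp add: C.entries_def B.entries_def)
 ultimately show ?thesis using B.det B.poly_growth_if_monomial by(metis empty_set empty_subsetI insert_subset list.simps(15) mult_zero_left mult_zero_right diff_self zero_neq_one)
qed

lemma poly_growth_if_elliptic:
 assumes unity: quasiunipotent and w: "set w <= I" and zeta: "zeta ~= 0" "trace w = zeta + 1 / zeta" "zeta^2 ~= 1"
 shows "poly_growth (proj_eq D a b) I"
proof -
 obtain v1 v2 where v: "wedge v1 v2 = 1" "act D a b w v1 = scale zeta v1" "act D a b w v2 = scale (1 / zeta) v2"
  using diagonalise[OF w zeta] by metis
 have v21: "wedge v2 v1 = - 1" using v(1) wedge_commute[of v2 v1] by simp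
 interpret B: moebius_basis D a b I v1 v2 by(rule moebius_basisI[OF v(1)])
 interpret C: moebius_basis D a b I v2 "scale (-1) v1" by(rule moebius_basisI) (simp add: v21)
 have swap: "C.m21 f = - B.m12 f" for f using wedge_commute[of v2 "act D a b f v2"] by(simp add: C.entries_def B.entries_def)
 have "zeta ~= 1 / zeta" using zeta(1,3) by(auto simp: power2_eq_square eq_divide_eq)
 hence w': "B.m12 w = 0" "B.m21 w = 0" "B.m11 w ~= B.m22 w" using v by(simp_all add: B.entries_def)
 consider "ALL g:I. B.m21 [g] = 0" | "ALL g:I. B.m12 [g] = 0" | f f' where "f:I" "B.m21 [f] ~= 0" "f':I" "B.m12 [f'] ~= 0" by blast
 thus ?thesis
 proof cases
  case 1
  thus ?thesis using B.poly_growth_if_triangular unity by blast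
 next
  case 2
  thus ?thesis using C.poly_growth_if_triangular unity swap by simp
 next
  case 3
  thus ?thesis using B.poly_growth_if_irreducible[OF B.finite_traces[OF unity] w w', of "[f]" "[f']"] by simp
 qed
qed

lemma poly_growth_if_parabolic:
 assumes unity: quasiunipotent and parabolic: "!!w. set w <= I ==> trace w^2 = 4"
 shows "poly_growth (proj_eq D a b) I"
proof -
 interpret E: moebius_basis D a b I "(1,0)" "(0,1)" by(rule moebius_basisI) (simp add: wedge_def)
 show ?thesis
 proof(cases "ALL g:I. E.m21 [g] = 0")
  case False
  then obtain h where h: "set [h] <= I" "E.m21 [h] ~= 0" by auto
  define e where "e = trace [h] / 2"
  have e: "e * e = 1" "trace [h] = 2 * e" using parabolic[OF h(1)] by(simp_all add: e_def power2_eq_square)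
  have "1 / e = e" "e ~= 0" using e(1) by(auto simp: divide_eq_eq)
  then obtain v1 where v1: "v1 ~= (0,0)" "act D a b [h] v1 = scale e v1" using eigenvector[OF h(1), of e] e(2) by auto
  obtain v2 where v2: "wedge v1 v2 = 1" using wedge_one_exists[OF v1(1)] .
  interpret B: moebius_basis D a b I v1 v2 by(rule moebius_basisI[OF v2])
  have "B.m11 [h] = e" "B.m21 [h] = 0" unfolding B.entries_def v1(2) using v2 by simp_all
  moreover from this have "B.m22 [h] = e" using B.trace_eq[OF h(1)] e(2) by simp
  ultimately have m: "B.m11 [h] = e" "B.m21 [h] = 0" "B.m22 [h] = e" by auto
  have "B.m12 [h] ~= 0"
  proof
   assume "B.m12 [h] = 0"
   hence "act D a b [h] (1,0) = scale e (scale (wedge (1,0) v2) v1 + scale (wedge v1 (1,0)) v2)"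
    unfolding B.act_coordinates[OF h(1)] m by(simp add: scale_def algebra_simps)
   hence "act D a b [h] (1,0) = scale e (1,0)" using B.coordinates[of "(1,0)"] by metis
   thus False using h(2) by(simp add: E.entries_def)
  qed
  moreover have "B.m12 [h] * B.m21 [g] = 0" if g: "g:I" for g
  proof -
   define tau k where "tau = trace [g]" and "k = e * B.m12 [h] * B.m21 [g]"
   have g': "set [g] <= I" "set ([h] @ [g]) <= I" "set ([h] @ [h] @ [g]) <= I" using g h(1) by auto
   have ee: "e * (e * x) = x" for x using e(1) by(simp flip: mult.assoc)
   note traces = B.trace_eq[OF g'(1), symmetric] B.trace_eq[OF g'(2), symmetric] B.trace_eq[OF g'(3), symmetric]
   note entries = B.entries_append[OF h(1) g'(1)] B.entries_append[OF h(1) g'(2)]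
   have "trace ([h] @ [g]) = e * (tau + k)" "trace ([h] @ [h] @ [g]) = tau + 2 * k"
    unfolding traces tau_def k_def entries m by(simp_all add: algebra_simps ee)
   hence "tau^2 = 4" "(tau + k)^2 = 4" "(tau + 2 * k)^2 = 4"
    using parabolic[OF g'(1)] parabolic[OF g'(2)] parabolic[OF g'(3)] e(1) by(simp_all add: tau_def power_mult_distrib power2_eq_square[of e])
   moreover have "2 * k^2 = (tau + 2 * k)^2 - 2 * (tau + k)^2 + tau^2" by(simp add: power2_eq_square algebra_simps)
   ultimately have "k = 0" by simp
   thus ?thesis using `e ~= 0` by(simp add: k_def)
  qed
  ultimately show ?thesis using B.poly_growth_if_triangular unity by simp
 qed(use E.poly_growth_if_triangular unity in blast)
qed

lemma poly_growth_proj_eq: "poly_growth (proj_eq D a b) I"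
proof(cases quasiunipotent)
 case False
 then obtain w where w: "set w <= I" "!!zeta. trace w = zeta + 1 / zeta ==> ~ root_of_unity zeta" unfolding quasiunipotent_def by blast
 obtain zeta where "zeta ~= 0" "trace w = zeta + 1 / zeta" using inverse_sum_exists by metis
 thus ?thesis using poly_growth_if_nonroot w by blast
next
 case True
 show ?thesis
 proof(cases "ALL w. set w <= I --> trace w^2 = 4")
  case False
  then obtain w zeta where w: "set w <= I" "trace w^2 ~= 4" "root_of_unity zeta" "trace w = zeta + 1 / zeta"
   using True unfolding quasiunipotent_def by blast
  have "trace w^2 = 4" if unit: "zeta^2 = 1"
  proof -
   have "1 / zeta = zeta" using unit root_of_unity_nonzero[OF w(3)] by(simp add: divide_eq_eq power2_eq_square)
   hence "trace w = 2 * zeta" using w(4) by simp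
   thus ?thesis using unit by(simp add: power_mult_distrib)
  qed
  hence "zeta^2 ~= 1" using w(2) by blast
  thus ?thesis using poly_growth_if_elliptic[OF True w(1) root_of_unity_nonzero[OF w(3)] w(4)] by simp
 qed(use True poly_growth_if_parabolic in blast)
qed

end

theorem poly_growth_degree_1:
 fixes D :: "'g => nat" and a b :: "'g => nat => complex"
 assumes sys: "hmap_system D a b I" and fin: "finite I" and degree: "!!g. g:I ==> D g = 1"
  and rel: "!!x y. set x <= I ==> set y <= I
   ==> EX u v. proj_eq D a b (word_subst x y (u @ [True])) (word_subst x y (v @ [False]))"
 shows "poly_growth (proj_eq D a b) I"
proof -
 interpret S: hmap_system D a b I by(rule sys)
 define delta where "delta g = wedge (hmap (D g) (a g) (b g) (1,0)) (hmap (D g) (a g) (b g) (0,1))" for g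
 have delta: "delta g ~= 0" if g: "g:I" for g
 proof
  assume "delta g = 0"
  moreover have "hmap (D g) (a g) (b g) X = (a g 0 * snd X + a g 1 * fst X, b g 0 * snd X + b g 1 * fst X)" for X
   using degree[OF g] by(simp add: hmap_def hform_def)
  ultimately have "hmap (D g) (a g) (b g) (a g 0, - a g 1) = (0,0)" "hmap (D g) (a g) (b g) (b g 0, - b g 1) = (0,0)"
   by(simp_all add: delta_def wedge_def algebra_simps)
  hence "a g 0 = 0" "a g 1 = 0" using S.nondegenerate[OF g] unfolding nondegenerate_def by auto
  thus False using `hmap (D g) (a g) (b g) (b g 0, - b g 1) = (0,0)` S.nondegenerate[OF g] degree[OF g]
    nondegenerate_nonzero[OF S.nondegenerate[OF g], of "(1,0)"] nondegenerate_nonzero[OF S.nondegenerate[OF g], of "(b g 0, - b g 1)"]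
   by(auto simp: hmap_def hform_def)
 qed
 define c where "c g = csqrt (1 / delta g)" for g
 have c: "c g * c g * delta g = 1" "c g ~= 0" if "g:I" for g
  using delta[OF that] by(simp_all add: c_def flip: power2_eq_square)
 have eq: "proj_eq D (%g i. c g * a g i) (%g i. c g * b g i) w w' \<longleftrightarrow> proj_eq D a b w w'" if "set w <= I" "set w' <= I" for w w'
  using proj_eq_rescale[of w w' c D a b] c(2) that by auto
 have "moebius_system D (%g i. c g * a g i) (%g i. c g * b g i) I"
 proof
  show "nondegenerate (D g) (%i. c g * a g i) (%i. c g * b g i)" if "g:I" for g
   using S.nondegenerate[OF that] c(2)[OF that] by(auto simp: nondegenerate_def scale_hmap scale_eq_0_iff)
  show "wedge (hmap (D g) (%i. c g * a g i) (%i. c g * b g i) (1,0)) (hmap (D g) (%i. c g * a g i) (%i. c g * b g i) (0,1)) = 1"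
   if "g:I" for g
   using c(1)[OF that] by(simp add: scale_hmap delta_def mult.assoc)
  show "EX u v. proj_eq D (%g i. c g * a g i) (%g i. c g * b g i) (word_subst x y (u @ [True])) (word_subst x y (v @ [False]))"
   if xy: "set x <= I" "set y <= I" for x y
   using rel[OF xy] eq[OF set_word_subst[OF xy] set_word_subst[OF xy]] by blast
 qed(use S.degree_pos degree fin in auto)
 from moebius_system.poly_growth_proj_eq[OF this] show ?thesis by(rule poly_growth_mono) (use eq in blast)
qed

section \<open>Semigroups of rational functions\<close>

lemma (in hmap_system) relation_if_words_distinct:
 assumes xy: "set x <= I" "set y <= I" and "p ~= p'" and eq: "proj_eq D a b (word_subst x y p) (word_subst x y p')"
 shows "EX u v. proj_eq D a b (word_subst x y (u @ [True])) (word_subst x y (v @ [False]))"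
proof -
 note I = set_word_subst[OF xy]
 obtain s q q' where "rev p = s @ q" "rev p' = s @ q'" and last: "q = [] | q' = [] | hd q ~= hd q'"
  using longest_common_prefix[of "rev p" "rev p'"] by blast
 hence p: "p = rev q @ rev s" "p' = rev q' @ rev s" by(simp_all add: rev_swap)
 define c where "c \<longleftrightarrow> (if q = [] then ~ hd q' else ~ hd q)"
 define r r' where "r = c # rev q" and "r' = c # rev q'"
 have "proj_eq D a b (word_subst x y (rev q)) (word_subst x y (rev q'))"
  using proj_eq_cancel[OF I[of "rev s"]] eq by(simp add: p)
 hence "proj_eq D a b (word_subst x y [c] @ word_subst x y (rev q) @ []) (word_subst x y [c] @ word_subst x y (rev q') @ [])"
  using proj_eq_append[OF I I I[of "[c]"], of "[]"] by simp
 hence r: "proj_eq D a b (word_subst x y r) (word_subst x y r')" by(simp add: r_def r'_def)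
 have "last r ~= last r'" using last `p ~= p'` unfolding p by(cases q; cases q') (auto simp: r_def r'_def c_def last_rev)
 moreover have "r ~= []" "r' ~= []" by(simp_all add: r_def r'_def)
 hence "r = butlast r @ [last r]" "r' = butlast r' @ [last r']" by simp_all
 ultimately show ?thesis using r proj_eq_sym[OF r] by(cases "last r") metis+
qed

definition numerator :: "ratfun => complex poly" where
 "numerator f = fst (quot_of_fract f)"

definition denominator :: "ratfun => complex poly" where
 "denominator f = snd (quot_of_fract f)"

definition ratfun_degree :: "ratfun => nat" where
 "ratfun_degree f = max (degree (numerator f)) (degree (denominator f))"

abbreviation ratfun_proj_eq :: "ratfun list => ratfun list => bool" where
 "ratfun_proj_eq \<equiv> proj_eq ratfun_degree (%f. coeff (numerator f)) (%f. coeff (denominator f))"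

abbreviation ratfun_act_poly :: "ratfun list => complex poly * complex poly" where
 "ratfun_act_poly \<equiv> act_poly ratfun_degree (%f. coeff (numerator f)) (%f. coeff (denominator f))"

definition word_value :: "ratfun list => ratfun" where
 "word_value w = to_fract (fst (ratfun_act_poly w)) / to_fract (snd (ratfun_act_poly w))"

lemma ratfun_quotient: "f = to_fract (numerator f) / to_fract (denominator f)" "denominator f ~= 0"
 "coprime (numerator f) (denominator f)"
 unfolding numerator_def denominator_def by(rule ratfun_eq_div, simp, rule coprime_quot_of_fract)

lemma degree_le_ratfun_degree: "degree (numerator f) <= ratfun_degree f" "degree (denominator f) <= ratfun_degree f"
 by(simp_all add: ratfun_degree_def)

lemma dehom_coeff: "degree p <= d ==> dehom d (coeff p) = p" by(intro poly_eqI) (simp add: coeff_dehom coeff_eq_0)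

lemma nondegenerate_ratfun:
 assumes "ratfun_degree f >= 1"
 shows "nondegenerate (ratfun_degree f) (coeff (numerator f)) (coeff (denominator f))"
proof -
 obtain u v where "u * numerator f + v * denominator f = 1"
  using bezout_coefficients_fst_snd[of "numerator f" "denominator f"] ratfun_quotient(3) by(metis coprime_imp_gcd_eq_1)
 moreover have "coeff (numerator f) (ratfun_degree f) ~= 0 | coeff (denominator f) (ratfun_degree f) ~= 0"
 proof(cases "degree (denominator f) = ratfun_degree f")
  case False
  hence "degree (numerator f) = ratfun_degree f" "numerator f ~= 0"
   using assms by(auto simp: ratfun_degree_def max_def split: if_splits)
  thus ?thesis by(metis leading_coeff_0_iff)
 qed(metis leading_coeff_0_iff ratfun_quotient(2))
 ultimately show ?thesis by(intro nondegenerateI) (simp_all add: dehom_coeff degree_le_ratfun_degree)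
qed

lemma poly_at_homogenise:
 assumes "degree p <= d" "M ~= 0"
 shows "poly_at p (to_fract N / to_fract M) * to_fract M^d = to_fract (hform d (%i. [:coeff p i:]) N M)"
proof -
 have "ring_hom_on UNIV (to_fract :: complex poly => ratfun)" by(simp add: ring_hom_on_def)
 hence "to_fract (hform d (%i. [:coeff p i:]) N M) = hform d (%i. to_fract [:coeff p i:]) (to_fract N) (to_fract M)"
  using ring_hom_on_hform(1)[OF _ subring_UNIV] by blast
 also have "... = to_fract M^d * poly (dehom d (%i. to_fract [:coeff p i:])) (to_fract N / to_fract M)"
  using assms(2) by(intro hform_divide) simp
 also have "dehom d (%i. to_fract [:coeff p i:]) = map_poly (%c. to_fract [:c:]) p"
  using assms(1) by(intro poly_eqI) (simp add: coeff_dehom coeff_map_poly coeff_eq_0)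
 finally show ?thesis by(simp add: poly_at_def mult.commute)
qed

lemma hform_const_X: "degree p <= d ==> hform d (%i. [:coeff p i:]) [:0, 1:] 1 = (p :: complex poly)"
 by(intro iffD1[OF poly_eq_poly_eq_iff] ext) (simp add: hform_def poly_sum poly_altdef_le)

lemma constant_comp:
 assumes "ratfun_degree c = 0"
 shows "ratfun_comp c h = c"
proof -
 obtain p q where "numerator c = [:p:]" "denominator c = [:q:]"
  using assms by(auto simp: ratfun_degree_def elim!: degree_eq_zeroE)
 thus ?thesis using ratfun_quotient(1)[of c] by(simp add: ratfun_comp_def numerator_def denominator_def)
qed

locale ratfun_generators =
 fixes G S :: "ratfun set"
 assumes semigroup: "ratfun_semigroup G" and finite_S: "finite S" and G: "G = semigroup_generated ratfun_comp S"
begin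

definition I :: "ratfun set" where
 "I = {f:S. ratfun_degree f >= 1}"

lemma S_subset_G: "S <= G" unfolding G by(auto intro: semigroup_generated.generator)

lemma I_subset_G: "I <= G" using S_subset_G by(auto simp: I_def)

lemma comp_in_G: "f:G ==> g:G ==> ratfun_composable f g & ratfun_comp f g : G"
 using semigroup by(auto simp: ratfun_semigroup_def)

lemma word_prod_in_G: "set w <= G ==> w ~= [] ==> word_prod ratfun_comp w : G"
 by(induction ratfun_comp w rule: word_prod.induct) (auto dest: comp_in_G)

lemma word_prod_append:
 assumes "set u <= G" "u ~= []" "set v <= G" "v ~= []"
 shows "word_prod ratfun_comp (u @ v) = ratfun_comp (word_prod ratfun_comp u) (word_prod ratfun_comp v)"
 using assms(1,2)
proof(induction u rule: induct_list012)
 case (2 f)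
 thus ?case using assms(4) by(cases v) auto
next
 case (3 f g u)
 define A B where "A = word_prod ratfun_comp (g # u)" and "B = word_prod ratfun_comp v"
 have "f:G" "A:G" "B:G" using 3 assms word_prod_in_G[of "g # u"] word_prod_in_G[of v] by(auto simp: A_def B_def)
 hence "ratfun_comp f (ratfun_comp A B) = ratfun_comp (ratfun_comp f A) B"
  by(intro ratfun_comp_assoc[symmetric]) (simp_all add: comp_in_G)
 thus ?case using 3 by(simp add: A_def B_def)
qed simp

sublocale hmap_system ratfun_degree "%f. coeff (numerator f)" "%f. coeff (denominator f)" I
 by unfold_locales (auto simp: I_def intro: nondegenerate_ratfun)

lemma word_prod_eq_word_value:
 assumes "set w <= I"
 shows "snd (ratfun_act_poly w) ~= 0" "w ~= [] ==> word_prod ratfun_comp w = word_value w"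
proof -
 have "snd (ratfun_act_poly w) ~= 0 & (w ~= [] --> word_prod ratfun_comp w = word_value w)" using assms
 proof(induction w rule: induct_list012)
  case 1
  show ?case by(simp add: act_poly_def)
 next
  case (2 f)
  have "ratfun_act_poly [f] = (numerator f, denominator f)"
   by(simp add: act_poly_def hmap_def hform_const_X degree_le_ratfun_degree)
  thus ?case using ratfun_quotient(1,2)[of f] by(simp add: word_value_def)
 next
  case (3 f g w)
  define N M h where "N = fst (ratfun_act_poly (g # w))" and "M = snd (ratfun_act_poly (g # w))"
   and "h = word_prod ratfun_comp (g # w)"
  have IH: "M ~= 0" "h = to_fract N / to_fract M" using 3 by(auto simp: M_def N_def h_def word_value_def)
  have "f:G" "h:G" using 3 I_subset_G word_prod_in_G[of "g # w"] by(auto simp: h_def)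
  hence composable: "poly_at (denominator f) h ~= 0" using comp_in_G by(auto simp: ratfun_composable_def denominator_def)
  define U V where "U = hform (ratfun_degree f) (%i. [:coeff (numerator f) i:]) N M"
   and "V = hform (ratfun_degree f) (%i. [:coeff (denominator f) i:]) N M"
  have M: "to_fract M^ratfun_degree f ~= 0" using IH(1) by simp
  have UV: "poly_at (numerator f) h * to_fract M^ratfun_degree f = to_fract U"
   "poly_at (denominator f) h * to_fract M^ratfun_degree f = to_fract V"
   unfolding IH(2) U_def V_def by(rule poly_at_homogenise[OF degree_le_ratfun_degree(1) IH(1)], rule poly_at_homogenise[OF degree_le_ratfun_degree(2) IH(1)])
  have "word_prod ratfun_comp (f # g # w) = poly_at (numerator f) h / poly_at (denominator f) h"
   by(simp add: h_def ratfun_comp_def numerator_def denominator_def)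
  also have "... = to_fract U / to_fract V" unfolding UV[symmetric] using M by simp
  moreover have "V ~= 0" using UV(2) composable M by auto
  moreover have "ratfun_act_poly (f # g # w) = (U, V)" by(simp add: act_poly_def hmap_def U_def V_def N_def M_def)
  ultimately show ?case by(simp add: word_value_def)
 qed
 thus "snd (ratfun_act_poly w) ~= 0" "w ~= [] ==> word_prod ratfun_comp w = word_value w" by auto
qed

lemma word_value_eq_iff:
 assumes "set w <= I" "set w' <= I"
 shows "word_value w = word_value w' \<longleftrightarrow> ratfun_proj_eq w w'"
proof -
 have "word_value w = word_value w' \<longleftrightarrow>
   to_fract (fst (ratfun_act_poly w) * snd (ratfun_act_poly w')) = to_fract (fst (ratfun_act_poly w') * snd (ratfun_act_poly w))"
  using word_prod_eq_word_value(1)[OF assms(1)] word_prod_eq_word_value(1)[OF assms(2)] by(simp add: word_value_def frac_eq_eq)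
 thus ?thesis unfolding to_fract_eq_iff by(auto simp: proj_eq_def wedge_def mult.commute)
qed

lemma proj_eq_if_word_prod_eq:
 assumes "set w <= I" "set w' <= I" "w ~= []" "w' ~= []" "word_prod ratfun_comp w = word_prod ratfun_comp w'"
 shows "ratfun_proj_eq w w'"
 using word_prod_eq_word_value(2)[OF assms(1)] word_prod_eq_word_value(2)[OF assms(2)] word_value_eq_iff[OF assms(1,2)] assms(3-) by simp

lemma word_prod_word_subst:
 assumes x: "set x <= I" "x ~= []" and y: "set y <= I" "y ~= []" and "p ~= []"
 shows "word_subst x y p ~= []"
  "word_prod ratfun_comp (map (%s. word_prod ratfun_comp (if s then x else y)) p) = word_prod ratfun_comp (word_subst x y p)"
proof -
 have nonempty: "word_subst x y q ~= []" if "q ~= []" for q using that x y by(cases q) auto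
 thus "word_subst x y p ~= []" using `p ~= []` .
 show "word_prod ratfun_comp (map (%s. word_prod ratfun_comp (if s then x else y)) p) = word_prod ratfun_comp (word_subst x y p)"
  using `p ~= []`
 proof(induction p rule: induct_list012)
  case (3 s t q)
  have "set (word_subst x y (t # q)) <= G" using set_word_subst[OF x(1) y(1)] I_subset_G by blast
  hence "word_prod ratfun_comp ((if s then x else y) @ word_subst x y (t # q))
    = ratfun_comp (word_prod ratfun_comp (if s then x else y)) (word_prod ratfun_comp (word_subst x y (t # q)))"
   using x y I_subset_G nonempty[of "t # q"] by(intro word_prod_append) auto
  thus ?case using 3 by simp
 qed simp_all
qed

lemma distinct_words_if_not_free:
 assumes not_free: "~ contains_nonabelian_free_semigroup ratfun_comp G" and XY: "X:G" "Y:G" "X ~= Y"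
 obtains l l' where "l:words {X, Y}" "l':words {X, Y}" "l ~= l'" "word_prod ratfun_comp l = word_prod ratfun_comp l'"
proof -
 define T where "T = word_prod ratfun_comp ` words {X, Y}"
 have words_G: "set w <= G" "w ~= []" if "w:words {X, Y}" for w using that XY by(auto simp: words_def)
 have "T <= G" using words_G word_prod_in_G by(auto simp: T_def)
 moreover have "ratfun_comp p q : T" if "p:T" "q:T" for p q
 proof -
  obtain w w' where w: "w:words {X, Y}" "p = word_prod ratfun_comp w" "w':words {X, Y}" "q = word_prod ratfun_comp w'"
   using `p : T` `q : T` by(auto simp: T_def)
  have "w @ w' : words {X, Y}" using w by(auto simp: words_def)
  thus ?thesis unfolding T_def w(2,4) word_prod_append[OF words_G[OF w(1)] words_G[OF w(3)], symmetric] by(rule imageI)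
 qed
 ultimately have "~ free_semigroup_on ratfun_comp {X, Y} T"
  using not_free XY(3) unfolding contains_nonabelian_free_semigroup_def by blast
 hence "~ inj_on (word_prod ratfun_comp) (words {X, Y})" unfolding free_semigroup_on_def bij_betw_def T_def by blast
 thus thesis using that by(auto simp: inj_on_def)
qed

lemma relation:
 assumes not_free: "~ contains_nonabelian_free_semigroup ratfun_comp G" and x: "set x <= I" and y: "set y <= I"
 shows "EX u v. ratfun_proj_eq (word_subst x y (u @ [True])) (word_subst x y (v @ [False]))"
proof(cases "x = [] | y = []")
 case True
 thus ?thesis
  by(intro exI[of _ "if x = [] then [False] else []"] exI[of _ "if x = [] then [] else [True]"]) (auto simp: proj_eq_iff)
next
 case False
 define X Y where "X = word_prod ratfun_comp x" and "Y = word_prod ratfun_comp y"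
 have XY: "X:G" "Y:G" using word_prod_in_G x y False I_subset_G by(auto simp: X_def Y_def)
 show ?thesis
 proof(cases "X = Y")
  case True
  hence "ratfun_proj_eq x y" using proj_eq_if_word_prod_eq[OF x y] False by(simp add: X_def Y_def)
  thus ?thesis by(intro exI[of _ "[]"]) simp
 next
  case neq: False
  obtain l l' where l: "l:words {X, Y}" "l':words {X, Y}" "l ~= l'" "word_prod ratfun_comp l = word_prod ratfun_comp l'"
   using distinct_words_if_not_free[OF not_free XY neq] by metis
  define code where "code = map (%z. z = X)"
  have decode: "map (%s. word_prod ratfun_comp (if s then x else y)) (code k) = k" "code k ~= []" if "k:words {X, Y}" for k
   using that by(auto simp: words_def code_def X_def Y_def comp_def intro!: map_idI)
  note prod = word_prod_word_subst[OF x _ y _ decode(2)] decode(1)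
  have "ratfun_proj_eq (word_subst x y (code l)) (word_subst x y (code l'))"
   using prod(1)[of l] prod(1)[of l'] prod(2)[of l] prod(2)[of l'] prod(3)[of l] prod(3)[of l'] l False
   by(intro proj_eq_if_word_prod_eq set_word_subst[OF x y]) auto
  moreover have "code l ~= code l'" using decode(1)[OF l(1)] decode(1)[OF l(2)] l(3) by metis
  ultimately show ?thesis using relation_if_words_distinct[OF x y] by blast
 qed
qed

lemma word_prod_cases:
 assumes "w:words S"
 obtains "set w <= I" | "word_prod ratfun_comp w : S"
  | u c where "set u <= I" "u ~= []" "length u <= length w" "c:S" "word_prod ratfun_comp w = ratfun_comp (word_prod ratfun_comp u) c"
proof(cases "set w <= I")
 case False
 hence "EX f:set w. f ~: I" by blast
 from split_list_first_prop[OF this] obtain u c v where w: "w = u @ c # v" "c ~: I" "ALL f:set u. ~ f ~: I" by blast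
 have w_S: "set w <= S" using assms by(simp add: words_def)
 hence "ratfun_degree c = 0" using w by(auto simp: I_def)
 hence tail: "word_prod ratfun_comp (c # v) = c" using constant_comp by(cases v) auto
 show thesis
 proof(cases "u = []")
  case True
  thus thesis using that(2) w tail w_S by simp
 next
  case nonempty: False
  have "word_prod ratfun_comp w = ratfun_comp (word_prod ratfun_comp u) (word_prod ratfun_comp (c # v))"
   unfolding w(1) using w w_S S_subset_G nonempty by(intro word_prod_append) auto
  thus thesis using that(3)[of u c] tail w nonempty w_S by auto
 qed
qed(rule that(1))

lemma growth_le:
 assumes X: "finite X" "!!w. set w <= I ==> length w <= n ==> EX w':X. set w' <= I & ratfun_proj_eq w w'"
 shows "growth ratfun_comp S n <= card X + card S + card X * card S"
proof -
 define P where "P = (%(f, c). ratfun_comp f c) ` (word_value ` X \<times> S)"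
 have rep: "word_prod ratfun_comp w : word_value ` X" if w: "set w <= I" "w ~= []" "length w <= n" for w
  using X(2)[OF w(1,3)] word_prod_eq_word_value(2)[OF w(1,2)] word_value_eq_iff[OF w(1)] by force
 have "word_prod ratfun_comp w : word_value ` X Un S Un P" if w: "w:words S" "length w <= n" for w using w(1)
 proof(cases rule: word_prod_cases)
  case 1
  thus ?thesis using rep w by(auto simp: words_def)
 next
  case (3 u c)
  thus ?thesis using rep[of u] w(2) by(force simp: P_def)
 qed simp
 hence "word_prod ratfun_comp ` {w:words S. length w <= n} <= word_value ` X Un S Un P" by blast
 moreover have "finite (word_value ` X Un S Un P)" using X(1) finite_S by(simp add: P_def)
 ultimately have "growth ratfun_comp S n <= card (word_value ` X Un S Un P)" unfolding growth_def by(rule card_mono[rotated])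
 also have "... <= card (word_value ` X) + card S + card P"
  using card_Un_le[of "word_value ` X Un S" P] card_Un_le[of "word_value ` X" S] by linarith
 also have "card P <= card (word_value ` X) * card S"
  unfolding P_def using card_image_le[of "word_value ` X \<times> S"] X(1) finite_S by(simp add: card_cartesian_product)
 finally show ?thesis using card_image_le[OF X(1), of word_value] mult_le_mono1[of "card (word_value ` X)" "card X" "card S"] by linarith
qed

lemma growth_bound:
 assumes "poly_growth ratfun_proj_eq I"
 obtains C k where "!!n. growth ratfun_comp S n <= C * (n + 1)^k"
proof -
 obtain C k where Ck: "!!n. EX X. finite X & card X <= C * (n + 1)^k &
   (ALL w. set w <= I --> length w <= n --> (EX w':X. set w' <= I & ratfun_proj_eq w w'))"
  using assms unfolding poly_growth_def by blast
 have "growth ratfun_comp S n <= (C + card S + C * card S) * (n + 1)^k" for n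
 proof -
  obtain X where X: "finite X" "card X <= C * (n + 1)^k"
   "!!w. set w <= I ==> length w <= n ==> EX w':X. set w' <= I & ratfun_proj_eq w w'" using Ck by metis
  have "growth ratfun_comp S n <= card X + card S * 1 + card X * card S" using growth_le[OF X(1,3)] by simp
  also have "... <= C * (n + 1)^k + card S * (n + 1)^k + C * (n + 1)^k * card S"
   using X(2) by(intro add_mono mult_le_mono) auto
  finally show ?thesis by(simp add: algebra_simps)
 qed
 thus thesis using that by blast
qed

end

lemma polynomially_bounded_growthI:
 assumes "!!n. growth m S n <= C * (n + 1)^k"
 shows "polynomially_bounded_growth m S"
 unfolding polynomially_bounded_growth_def
proof(intro exI[of _ "real k + 1"] conjI)
 show "(%n. real (growth m S n)) : O(%n. real n powr (real k + 1))"
 proof(rule bigoI[where c = "real C * 2^k"], rule eventually_sequentiallyI[of 1])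
  fix n :: nat assume n: "n >= 1"
  have "real (growth m S n) <= real (C * (n + 1)^k)" using assms[of n] by(simp only: of_nat_le_iff)
  also have "... = real C * (real n + 1)^k" by(simp add: add.commute)
  also have "... <= real C * (2 * real n)^k" using n by(intro mult_left_mono power_mono) auto
  also have "... = real C * 2^k * real n powr real k" using n by(simp add: power_mult_distrib powr_realpow)
  also have "... <= real C * 2^k * real n powr (real k + 1)" using n by(intro mult_left_mono powr_mono) auto
  finally show "norm (real (growth m S n)) <= real C * 2^k * norm (real n powr (real k + 1))" by simp
 qed
qed simp

theorem theorem1p1:
 fixes G S :: "ratfun set"
 assumes "ratfun_semigroup G"
  and "finite S"
  and "G = semigroup_generated ratfun_comp S"
 shows "polynomially_bounded_growth ratfun_comp S
   \<or> contains_nonabelian_free_semigroup ratfun_comp G"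
proof(rule disjCI)
 assume not_free: "~ contains_nonabelian_free_semigroup ratfun_comp G"
 interpret ratfun_generators G S by unfold_locales (fact assms)+
 have finite_I: "finite I" using finite_S by(simp add: I_def)
 have "poly_growth ratfun_proj_eq I"
 proof(cases "EX g:I. ratfun_degree g >= 2")
  case True
  then obtain g where g: "g:I" "ratfun_degree g >= 2" by blast
  have "coeff (numerator f) i = 0 & coeff (denominator f) i = 0" if "i > ratfun_degree f" for f i
   using that degree_le_ratfun_degree[of f] by(simp add: coeff_eq_0)
  thus ?thesis by(intro poly_growth_degree_ge_2[OF hmap_system_axioms finite_I _ g relation[OF not_free]])
 next
  case False
  hence "ratfun_degree g = 1" if "g:I" for g using that by(force simp: I_def)
  thus ?thesis by(intro poly_growth_degree_1[OF hmap_system_axioms finite_I _ relation[OF not_free]])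
 qed
 then obtain C k where "!!n. growth ratfun_comp S n <= C * (n + 1)^k" using growth_bound by metis
 thus "polynomially_bounded_growth ratfun_comp S" by(rule polynomially_bounded_growthI)
qed

end
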